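(* There does not exist an $\mathrm{Out}^0(W_4)$-equivariant piecewise Euclidean $\mathrm{CAT}(0)$ metric on McCullough–Miller space $K_4$, nor an $\mathrm{Out}^0(W_4)$-equivariant piecewise hyperbolic $\mathrm{CAT}(-1)$ metric on $K_4$.
   Context: $W_n=\langle a_1,\dots,a_n\mid a_i^2=1\rangle$, $[n]=\{1,\dots,n\}$. For $i\in[n]$ and nonempty $D\subseteq[n]\setminus\{i\}$, the partial conjugation $x_{i,D}$ sends $a_j\mapsto a_ia_ja_i$ for $j\in D$ and fixes the other generators. $\mathrm{Out}^0(W_n)=\mathrm{Aut}^0(W_n)/\mathrm{Inn}(W_n)$ where $\mathrm{Aut}^0(W_n)$ consists of automorphisms sending each $a_j$ to a conjugate of itself. Hypertrees: a hypertree on $[n]$ is a set of subsets (hyperedges) of $[n]$ of size $\ge2$ such that any two vertices are joined by a unique simple walk (alternating sequence of distinct vertices and distinct hyperedges, consecutive vertices in the intervening hyperedge); $\mathcal{HT}_n$ is the set of them. $\Theta\le\Lambda$ if $\Theta$ is obtained from $\Lambda$ by finitely many folds (a fold replaces two intersecting distinct hyperedges by their union). $\Theta$ carries $x_{i,D}$ if for every $d\in D$, $j\in[n]\setminus(D\cup\{i\})$ the simple walk from $d$ to $j$ visits $i$; $\alpha\in\mathrm{Out}^0(W_n)$ is carried by $\Theta$ if it is a product of partial conjugations carried by $\Theta$. McCullough–Miller space: on $\mathrm{Out}^0(W_n)\times\mathcal{HT}_n$ set $(\alpha,\Theta)\sim(\beta,\Lambda)$ iff $\Theta=\Lambda$ and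 $\alpha^{-1}\beta$ is carried by $\Theta$; write $[\alpha,\Theta]$ for classes. Order: $[\alpha,\Theta]\le[\beta,\Lambda]$ iff $\Theta\le\Lambda$ and $\alpha^{-1}\beta$ is carried by $\Lambda$. $K_n$ is the simplicial realization (order complex) of this poset. $\mathrm{Out}^0(W_n)$ acts by simplicial automorphisms via $\varphi\cdot[\alpha,\Theta]=[\varphi\alpha,\Theta]$. A piecewise Euclidean (resp. hyperbolic) metric on $K_n$ means: each simplex is metrized as a geodesic simplex in Euclidean space (resp. hyperbolic space), face inclusions are isometries, and $K_n$ carries the induced length metric. It is $G$-equivariant if $G$ acts by isometries. *)

theory Defs
  imports "HOL-Analysis.Analysis"
begin

type_synonym word = "nat list"

text \<open>Generators are a_1,...,a_n, encoded by 1..n; a word is a list of generator indices.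
  Elements of W_n are the reduced words (no two adjacent letters equal).\<close>

definition Wn :: "nat \<Rightarrow> word set" where
  "Wn n = {w. set w \<subseteq> {1..n} \<and> successively (\<noteq>) w}"

fun push :: "nat \<Rightarrow> word \<Rightarrow> word" where
  "push a [] = [a]"
| "push a (b # w) = (if a = b then w else a # b # w)"

text \<open>Group multiplication of reduced words (concatenate and freely reduce using a_i^2 = 1).\<close>
definition wmult :: "word \<Rightarrow> word \<Rightarrow> word" where
  "wmult u v = foldr push u v"

definition hom_of :: "(nat \<Rightarrow> word) \<Rightarrow> word \<Rightarrow> word" where
  "hom_of f w = foldr (\<lambda>a acc. wmult (f a) acc) w []"

text \<open>conjw c w = c w c^{-1} (the inverse of a reduced word is its reverse).\<close>
definition conjw :: "word \<Rightarrow> word \<Rightarrow> word" where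
  "conjw c w = wmult c (wmult w (rev c))"

type_synonym autom = "word \<Rightarrow> word"
type_synonym outel = "autom set"

text \<open>Automorphisms are represented as maps on W_n (extensional, i.e. restricted to W_n).\<close>
definition Aut0 :: "nat \<Rightarrow> autom set" where
  "Aut0 n = {restrict (hom_of f) (Wn n) | f.
      (\<forall>j\<in>{1..n}. \<exists>c\<in>Wn n. f j = conjw c [j]) \<and> bij_betw (hom_of f) (Wn n) (Wn n)}"

definition Inn :: "nat \<Rightarrow> autom set" where
  "Inn n = {restrict (conjw c) (Wn n) | c. c \<in> Wn n}"

definition out_class :: "nat \<Rightarrow> autom \<Rightarrow> outel" where
  "out_class n h = {compose (Wn n) h i | i. i \<in> Inn n}"

definition Out0 :: "nat \<Rightarrow> outel set" where
  "Out0 n = out_class n ` Aut0 n"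

definition out_mult :: "nat \<Rightarrow> outel \<Rightarrow> outel \<Rightarrow> outel" where
  "out_mult n \<alpha> \<beta> = out_class n (compose (Wn n) (SOME h. h \<in> \<alpha>) (SOME g. g \<in> \<beta>))"

definition pc :: "nat \<Rightarrow> nat \<Rightarrow> nat set \<Rightarrow> autom" where
  "pc n i D = restrict (hom_of (\<lambda>j. if j \<in> D then [i, j, i] else [j])) (Wn n)"

definition is_pc :: "nat \<Rightarrow> nat \<Rightarrow> nat set \<Rightarrow> bool" where
  "is_pc n i D \<longleftrightarrow> i \<in> {1..n} \<and> D \<noteq> {} \<and> D \<subseteq> {1..n} - {i}"

type_synonym hyp = "nat set set"

definition walk :: "hyp \<Rightarrow> nat list \<Rightarrow> nat set list \<Rightarrow> bool" where
  "walk \<Theta> vs es \<longleftrightarrow> vs \<noteq> [] \<and> length es = length vs - 1 \<and> distinct vs \<and> distinct es \<and>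
     set es \<subseteq> \<Theta> \<and> (\<forall>k < length es. vs ! k \<in> es ! k \<and> vs ! (Suc k) \<in> es ! k)"

definition HT :: "nat \<Rightarrow> hyp set" where
  "HT n = {\<Theta>. (\<forall>E\<in>\<Theta>. E \<subseteq> {1..n} \<and> card E \<ge> 2) \<and>
      (\<forall>u\<in>{1..n}. \<forall>v\<in>{1..n}. \<exists>!w. walk \<Theta> (fst w) (snd w) \<and> hd (fst w) = u \<and> last (fst w) = v)}"

definition fold_step :: "hyp \<Rightarrow> hyp \<Rightarrow> bool" where
  "fold_step \<Lambda> \<Theta> \<longleftrightarrow> (\<exists>E F. E \<in> \<Lambda> \<and> F \<in> \<Lambda> \<and> E \<noteq> F \<and> E \<inter> F \<noteq> {} \<and>
       \<Theta> = (\<Lambda> - {E, F}) \<union> {E \<union> F})"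

definition ht_le :: "hyp \<Rightarrow> hyp \<Rightarrow> bool" where
  "ht_le \<Theta> \<Lambda> \<longleftrightarrow> fold_step\<^sup>*\<^sup>* \<Lambda> \<Theta>"

definition carries :: "nat \<Rightarrow> hyp \<Rightarrow> nat \<Rightarrow> nat set \<Rightarrow> bool" where
  "carries n \<Theta> i D \<longleftrightarrow> (\<forall>d\<in>D. \<forall>j\<in>{1..n} - (D \<union> {i}). \<forall>vs es.
      walk \<Theta> vs es \<and> hd vs = d \<and> last vs = j \<longrightarrow> i \<in> set vs)"

definition carried_out :: "nat \<Rightarrow> hyp \<Rightarrow> outel set" where
  "carried_out n \<Theta> = {out_class n (foldr (\<lambda>g acc. compose (Wn n) g acc) gs (restrict id (Wn n))) | gs.
      \<forall>g\<in>set gs. \<exists>i D. is_pc n i D \<and> carries n \<Theta> i D \<and> g = pc n i D}"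

text \<open>carried_by n \<Theta> \<alpha> \<beta>: \<alpha>^{-1}\<beta> is carried by \<Theta> (i.e. \<beta> = \<alpha>\<gamma> with \<gamma> carried).\<close>
definition carried_by :: "nat \<Rightarrow> hyp \<Rightarrow> outel \<Rightarrow> outel \<Rightarrow> bool" where
  "carried_by n \<Theta> \<alpha> \<beta> \<longleftrightarrow> (\<exists>\<gamma>\<in>carried_out n \<Theta>. \<beta> = out_mult n \<alpha> \<gamma>)"

type_synonym mmv = "(outel \<times> hyp) set"

definition mm_class :: "nat \<Rightarrow> outel \<Rightarrow> hyp \<Rightarrow> mmv" where
  "mm_class n \<alpha> \<Theta> = {(\<beta>, \<Theta>) | \<beta>. \<beta> \<in> Out0 n \<and> carried_by n \<Theta> \<alpha> \<beta>}"

definition MMV :: "nat \<Rightarrow> mmv set" where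
  "MMV n = {mm_class n \<alpha> \<Theta> | \<alpha> \<Theta>. \<alpha> \<in> Out0 n \<and> \<Theta> \<in> HT n}"

definition MMle :: "nat \<Rightarrow> mmv \<Rightarrow> mmv \<Rightarrow> bool" where
  "MMle n u v \<longleftrightarrow> u \<in> MMV n \<and> v \<in> MMV n \<and>
     (\<exists>\<alpha> \<Theta> \<beta> \<Lambda>. (\<alpha>, \<Theta>) \<in> u \<and> (\<beta>, \<Lambda>) \<in> v \<and> ht_le \<Theta> \<Lambda> \<and> carried_by n \<Lambda> \<alpha> \<beta>)"

definition mm_act :: "nat \<Rightarrow> outel \<Rightarrow> mmv \<Rightarrow> mmv" where
  "mm_act n \<phi> u = {(out_mult n \<phi> \<alpha>, \<Theta>) | \<alpha> \<Theta>. (\<alpha>, \<Theta>) \<in> u}"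

definition is_chain :: "'v set \<Rightarrow> ('v \<Rightarrow> 'v \<Rightarrow> bool) \<Rightarrow> 'v set \<Rightarrow> bool" where
  "is_chain V le \<sigma> \<longleftrightarrow> finite \<sigma> \<and> \<sigma> \<noteq> {} \<and> \<sigma> \<subseteq> V \<and> (\<forall>u\<in>\<sigma>. \<forall>v\<in>\<sigma>. le u v \<or> le v u)"

definition supp :: "('v \<Rightarrow> real) \<Rightarrow> 'v set" where
  "supp x = {v. x v \<noteq> 0}"

text \<open>Points of the realization, in barycentric coordinates.\<close>
definition real_pts :: "'v set \<Rightarrow> ('v \<Rightarrow> 'v \<Rightarrow> bool) \<Rightarrow> ('v \<Rightarrow> real) set" where
  "real_pts V le = {x. (\<forall>v. 0 \<le> x v) \<and> is_chain V le (supp x) \<and> sum x (supp x) = 1}"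

definition push_pt :: "('v \<Rightarrow> 'v) \<Rightarrow> ('v \<Rightarrow> real) \<Rightarrow> ('v \<Rightarrow> real)" where
  "push_pt f x = (\<lambda>v. \<Sum>u\<in>{u \<in> supp x. f u = v}. x u)"

text \<open>Euclidean: simplex \<sigma> has vertices p \<sigma> v in R^(N \<sigma>) (coordinates i < N \<sigma>), affinely independent;
  the simplex metric is the Euclidean distance of the affine images.\<close>
definition eucl_ok :: "'v set \<Rightarrow> ('v \<Rightarrow> 'v \<Rightarrow> bool) \<Rightarrow> ('v set \<Rightarrow> nat) \<Rightarrow> ('v set \<Rightarrow> 'v \<Rightarrow> nat \<Rightarrow> real) \<Rightarrow> bool" where
  "eucl_ok V le N p \<longleftrightarrow> (\<forall>\<sigma>. is_chain V le \<sigma> \<longrightarrow>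
     (\<forall>c. (\<Sum>v\<in>\<sigma>. c v) = 0 \<and> (\<forall>i < N \<sigma>. (\<Sum>v\<in>\<sigma>. c v * p \<sigma> v i) = 0) \<longrightarrow> (\<forall>v\<in>\<sigma>. c v = 0)))"

definition eucl_sd :: "('v set \<Rightarrow> nat) \<Rightarrow> ('v set \<Rightarrow> 'v \<Rightarrow> nat \<Rightarrow> real) \<Rightarrow> 'v set \<Rightarrow> ('v \<Rightarrow> real) \<Rightarrow> ('v \<Rightarrow> real) \<Rightarrow> real" where
  "eucl_sd N p \<sigma> x y = sqrt (\<Sum>i < N \<sigma>. (\<Sum>v\<in>\<sigma>. (x v - y v) * p \<sigma> v i)\<^sup>2)"

definition mink :: "nat \<Rightarrow> (nat \<Rightarrow> real) \<Rightarrow> (nat \<Rightarrow> real) \<Rightarrow> real" where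
  "mink N u w = (\<Sum>i < N. u i * w i) - u N * w N"

text \<open>Hyperbolic: simplex \<sigma> has vertices p \<sigma> v on the hyperboloid model of H^(N \<sigma>), in general position;
  the point with barycentric coordinates x is the normalization of \<Sum> x v p \<sigma> v (radial projection
  of the affine simplex onto the geodesic simplex).\<close>
definition hyp_ok :: "'v set \<Rightarrow> ('v \<Rightarrow> 'v \<Rightarrow> bool) \<Rightarrow> ('v set \<Rightarrow> nat) \<Rightarrow> ('v set \<Rightarrow> 'v \<Rightarrow> nat \<Rightarrow> real) \<Rightarrow> bool" where
  "hyp_ok V le N p \<longleftrightarrow> (\<forall>\<sigma>. is_chain V le \<sigma> \<longrightarrow>
     (\<forall>v\<in>\<sigma>. mink (N \<sigma>) (p \<sigma> v) (p \<sigma> v) = -1 \<and> p \<sigma> v (N \<sigma>) > 0) \<and>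
     (\<forall>c. (\<forall>i \<le> N \<sigma>. (\<Sum>v\<in>\<sigma>. c v * p \<sigma> v i) = 0) \<longrightarrow> (\<forall>v\<in>\<sigma>. c v = 0)))"

definition hyp_sd :: "('v set \<Rightarrow> nat) \<Rightarrow> ('v set \<Rightarrow> 'v \<Rightarrow> nat \<Rightarrow> real) \<Rightarrow> 'v set \<Rightarrow> ('v \<Rightarrow> real) \<Rightarrow> ('v \<Rightarrow> real) \<Rightarrow> real" where
  "hyp_sd N p \<sigma> x y =
     (let zx = (\<lambda>i. \<Sum>v\<in>\<sigma>. x v * p \<sigma> v i); zy = (\<lambda>i. \<Sum>v\<in>\<sigma>. y v * p \<sigma> v i)
      in arcosh (- mink (N \<sigma>) zx zy / sqrt (mink (N \<sigma>) zx zx * mink (N \<sigma>) zy zy)))"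

definition face_iso :: "'v set \<Rightarrow> ('v \<Rightarrow> 'v \<Rightarrow> bool) \<Rightarrow> ('v set \<Rightarrow> ('v \<Rightarrow> real) \<Rightarrow> ('v \<Rightarrow> real) \<Rightarrow> real) \<Rightarrow> bool" where
  "face_iso V le sd \<longleftrightarrow> (\<forall>\<sigma> \<tau>. is_chain V le \<sigma> \<and> is_chain V le \<tau> \<and> \<tau> \<subseteq> \<sigma> \<longrightarrow>
     (\<forall>x\<in>real_pts V le. \<forall>y\<in>real_pts V le. supp x \<subseteq> \<tau> \<and> supp y \<subseteq> \<tau> \<longrightarrow> sd \<tau> x y = sd \<sigma> x y))"

text \<open>Induced length (intrinsic) metric: infimum of lengths of strings of points, consecutive
  points lying in a common simplex (Bridson--Haefliger I.7.4).\<close>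
definition strings :: "'v set \<Rightarrow> ('v \<Rightarrow> 'v \<Rightarrow> bool) \<Rightarrow> ('v \<Rightarrow> real) \<Rightarrow> ('v \<Rightarrow> real) \<Rightarrow> ('v \<Rightarrow> real) list set" where
  "strings V le x y = {xs. xs \<noteq> [] \<and> hd xs = x \<and> last xs = y \<and> set xs \<subseteq> real_pts V le \<and>
      (\<forall>k < length xs - 1. is_chain V le (supp (xs ! k) \<union> supp (xs ! Suc k)))}"

definition len_metric :: "'v set \<Rightarrow> ('v \<Rightarrow> 'v \<Rightarrow> bool) \<Rightarrow> ('v set \<Rightarrow> ('v \<Rightarrow> real) \<Rightarrow> ('v \<Rightarrow> real) \<Rightarrow> real)
     \<Rightarrow> ('v \<Rightarrow> real) \<Rightarrow> ('v \<Rightarrow> real) \<Rightarrow> real" where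
  "len_metric V le sd x y = Inf {(\<Sum>k < length xs - 1. sd (supp (xs ! k) \<union> supp (xs ! Suc k)) (xs ! k) (xs ! Suc k))
      | xs. xs \<in> strings V le x y}"

definition is_geodesic :: "'a set \<Rightarrow> ('a \<Rightarrow> 'a \<Rightarrow> real) \<Rightarrow> (real \<Rightarrow> 'a) \<Rightarrow> 'a \<Rightarrow> 'a \<Rightarrow> bool" where
  "is_geodesic X d \<gamma> x y \<longleftrightarrow> \<gamma> 0 = x \<and> \<gamma> (d x y) = y \<and> (\<forall>s\<in>{0..d x y}. \<gamma> s \<in> X) \<and>
     (\<forall>s\<in>{0..d x y}. \<forall>t\<in>{0..d x y}. d (\<gamma> s) (\<gamma> t) = \<bar>s - t\<bar>)"

definition geodesic_space :: "'a set \<Rightarrow> ('a \<Rightarrow> 'a \<Rightarrow> real) \<Rightarrow> bool" where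
  "geodesic_space X d \<longleftrightarrow> Metric_space X d \<and> (\<forall>x\<in>X. \<forall>y\<in>X. \<exists>\<gamma>. is_geodesic X d \<gamma> x y)"

text \<open>Euclidean plane = complex numbers. Pairs (point on a side, comparison point).\<close>
definition side_pts_E :: "(real \<Rightarrow> 'a) \<Rightarrow> real \<Rightarrow> complex \<Rightarrow> complex \<Rightarrow> ('a \<times> complex) set" where
  "side_pts_E \<gamma> L A B = {(\<gamma> s, A + of_real (s / L) * (B - A)) | s. 0 \<le> s \<and> s \<le> L}"

definition CAT0 :: "'a set \<Rightarrow> ('a \<Rightarrow> 'a \<Rightarrow> real) \<Rightarrow> bool" where
  "CAT0 X d \<longleftrightarrow> geodesic_space X d \<and>
    (\<forall>p q r \<gamma>1 \<gamma>2 \<gamma>3 P Q R. p \<in> X \<and> q \<in> X \<and> r \<in> X \<and>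
       is_geodesic X d \<gamma>1 p q \<and> is_geodesic X d \<gamma>2 q r \<and> is_geodesic X d \<gamma>3 r p \<and>
       cmod (P - Q) = d p q \<and> cmod (Q - R) = d q r \<and> cmod (R - P) = d r p \<longrightarrow>
       (let C = side_pts_E \<gamma>1 (d p q) P Q \<union> side_pts_E \<gamma>2 (d q r) Q R \<union> side_pts_E \<gamma>3 (d r p) R P
        in \<forall>(x, xb)\<in>C. \<forall>(y, yb)\<in>C. d x y \<le> cmod (xb - yb)))"

text \<open>Hyperbolic plane: hyperboloid model in R^(2,1).\<close>
definition mink3 :: "real \<times> real \<times> real \<Rightarrow> real \<times> real \<times> real \<Rightarrow> real" where
  "mink3 u w = (case u of (a, b, c) \<Rightarrow> case w of (a', b', c') \<Rightarrow> a * a' + b * b' - c * c')"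

definition H2 :: "(real \<times> real \<times> real) set" where
  "H2 = {u. mink3 u u = -1 \<and> snd (snd u) > 0}"

definition hdist :: "real \<times> real \<times> real \<Rightarrow> real \<times> real \<times> real \<Rightarrow> real" where
  "hdist u w = arcosh (- mink3 u w)"

text \<open>Point at distance s from A on the geodesic from A to B, where L = hdist A B.\<close>
definition hgeo :: "real \<times> real \<times> real \<Rightarrow> real \<times> real \<times> real \<Rightarrow> real \<Rightarrow> real \<Rightarrow> real \<times> real \<times> real" where
  "hgeo A B L s = (if L = 0 then A else (sinh (L - s) / sinh L) *\<^sub>R A + (sinh s / sinh L) *\<^sub>R B)"

definition side_pts_H :: "(real \<Rightarrow> 'a) \<Rightarrow> real \<Rightarrow> real \<times> real \<times> real \<Rightarrow> real \<times> real \<times> real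
     \<Rightarrow> ('a \<times> (real \<times> real \<times> real)) set" where
  "side_pts_H \<gamma> L A B = {(\<gamma> s, hgeo A B L s) | s. 0 \<le> s \<and> s \<le> L}"

definition CATm1 :: "'a set \<Rightarrow> ('a \<Rightarrow> 'a \<Rightarrow> real) \<Rightarrow> bool" where
  "CATm1 X d \<longleftrightarrow> geodesic_space X d \<and>
    (\<forall>p q r \<gamma>1 \<gamma>2 \<gamma>3 P Q R. p \<in> X \<and> q \<in> X \<and> r \<in> X \<and>
       is_geodesic X d \<gamma>1 p q \<and> is_geodesic X d \<gamma>2 q r \<and> is_geodesic X d \<gamma>3 r p \<and>
       P \<in> H2 \<and> Q \<in> H2 \<and> R \<in> H2 \<and>
       hdist P Q = d p q \<and> hdist Q R = d q r \<and> hdist R P = d r p \<longrightarrow>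
       (let C = side_pts_H \<gamma>1 (d p q) P Q \<union> side_pts_H \<gamma>2 (d q r) Q R \<union> side_pts_H \<gamma>3 (d r p) R P
        in \<forall>(x, xb)\<in>C. \<forall>(y, yb)\<in>C. d x y \<le> hdist xb yb))"

definition mm_equivariant :: "nat \<Rightarrow> ((mmv \<Rightarrow> real) \<Rightarrow> (mmv \<Rightarrow> real) \<Rightarrow> real) \<Rightarrow> bool" where
  "mm_equivariant n d \<longleftrightarrow> (\<forall>\<phi>\<in>Out0 n. \<forall>x\<in>real_pts (MMV n) (MMle n). \<forall>y\<in>real_pts (MMV n) (MMle n).
      d (push_pt (mm_act n \<phi>) x) (push_pt (mm_act n \<phi>) y) = d x y)"

definition PE_metric :: "nat \<Rightarrow> (mmv set \<Rightarrow> nat) \<Rightarrow> (mmv set \<Rightarrow> mmv \<Rightarrow> nat \<Rightarrow> real) \<Rightarrow> bool" where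
  "PE_metric n N p \<longleftrightarrow> eucl_ok (MMV n) (MMle n) N p \<and> face_iso (MMV n) (MMle n) (eucl_sd N p)"

definition PH_metric :: "nat \<Rightarrow> (mmv set \<Rightarrow> nat) \<Rightarrow> (mmv set \<Rightarrow> mmv \<Rightarrow> nat \<Rightarrow> real) \<Rightarrow> bool" where
  "PH_metric n N p \<longleftrightarrow> hyp_ok (MMV n) (MMle n) N p \<and> face_iso (MMV n) (MMle n) (hyp_sd N p)"

end

theory Submission
  imports Defs
begin

text \<open>Suppose an equivariant metric of non-positive curvature exists. By equivariance the edge lengths, hence
  the angles, of a triangle of \<open>K\<^sub>4\<close> depend only on its three hypertrees, so there are 36 triangles up to the action:
  12 end in a star and 24 in a path. The angles of each triangle sum to at most \<open>\<pi>\<close>, so the total is at most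
  \<open>36\<pi>\<close>. On the other hand every closed cycle in the link of a vertex has length at least \<open>2\<pi>\<close>: otherwise
  developing the sectors along it produces a small loop around the vertex that can be coned off by geodesics
  missing the vertex, although the loop has winding number one. The links of the vertices with two hyperedges
  force a total angle of at least \<open>18\<pi>\<close> there, those of the paths \<open>6\<pi>\<close>, those of the stars \<open>4\<pi>\<close>, and the
  octagons in the links of the vertices with one hyperedge \<open>9\<pi>\<close>. Since \<open>18 + 6 + 4 + 9 = 37 > 36\<close>, this is absurd.
  Only the cone construction and the law of cosines depend on the curvature, so the Euclidean and the
  hyperbolic case are instances of one axiomatic notion of a metric with angles.\<close>

section \<open>Reduced words and outer automorphisms\<close>

text \<open>The margin is a single \<open>pi\<close>, so links of every kind have to contribute, and
  at the one-hyperedge vertex two kinds of octagons are combined: octagons of paths only, and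
  octagons running through two stars.

  The bound for closed cycles in a link is proved directly. The obstacle is that a neighbourhood of
  a vertex is not a disc, so the winding number of a loop has no immediate meaning. It is read off
  from one triangle: that triangle is a maximal simplex, so a complex-valued function of the
  barycentric coordinates can be positive wherever the triangle is left and still turn once around 0
  across it. For this reason a cycle must run through its first triangle only once, and recurring
  hypertrees have to be told apart by their group elements.

  A second obstacle is that equivariance is a statement about the length metric, whereas angles are
  computed from edge lengths inside single simplices. Near a vertex the length metric agrees with
  the simplex metric along each edge. This comparison rests on local finiteness, and hence on the
  finiteness of the groups carried by the hypertrees that occur.\<close>

abbreviation red :: "word \<Rightarrow> bool" where "red \<equiv> successively (\<noteq>)"

lemma red_push: "red w \<Longrightarrow> red (push a w)"
  by (cases w; cases "tl w") (auto simp: successively_Cons)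

lemma push_push: "red w \<Longrightarrow> push a (push a w) = w"
  by (cases w; cases "tl w") (auto simp: successively_Cons)

lemma set_push: "set (push a w) \<subseteq> insert a (set w)"
  by (cases w) auto

lemma wmult_simps [simp]: "wmult [] v = v" "wmult (a # u) v = push a (wmult u v)"
  by (auto simp: wmult_def)

lemma wmult_append: "wmult (u @ v) w = wmult u (wmult v w)"
  by (simp add: wmult_def)

lemma red_wmult: "red v \<Longrightarrow> red (wmult u v)"
  by (induction u) (auto simp: red_push)

lemma set_wmult: "set (wmult u v) \<subseteq> set u \<union> set v"
  by (induction u) (use set_push in fastforce)+

lemma wmult_Nil [simp]: "red u \<Longrightarrow> wmult u [] = u"
proof (induction u)
  case (Cons a u)
  then show ?case by (cases u) (auto simp: successively_Cons)
qed auto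

text \<open>The critical case is a cancellation: if \<open>u\<close> starts with \<open>a\<close>,
  the right-hand side pushes \<open>a\<close> twice onto a reduced word and \<open>push_push\<close>
  removes both. Associativity is then an induction on the first factor.\<close>

lemma wmult_push: "red u \<Longrightarrow> red v \<Longrightarrow> wmult (push a u) v = push a (wmult u v)"
  by (cases u) (auto simp: push_push red_wmult successively_Cons)

lemma wmult_assoc: "red v \<Longrightarrow> red w \<Longrightarrow> wmult (wmult u v) w = wmult u (wmult v w)"
  by (induction u) (auto simp: wmult_push red_wmult)

lemma red_rev [simp]: "red (rev u) \<longleftrightarrow> red u"
  by (simp add: eq_commute)

declare successively_rev [simp del]

lemma wmult_rev: "red u \<Longrightarrow> wmult u (rev u) = []"
proof (induction u)
  case (Cons a u)
  have r: "red u" using Cons.prems by (cases u) auto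
  have "red (rev (a # u))" using Cons.prems by (simp only: red_rev)
  then have "wmult (rev u) [a] = rev u @ [a]" using wmult_Nil[of "rev (a # u)"] by (simp add: wmult_append)
  then have "wmult u (rev u @ [a]) = wmult u (wmult (rev u) [a])" by simp
  also have "\<dots> = [a]" using Cons.IH r wmult_assoc[of "rev u" "[a]" u] by (simp del: wmult_simps(2))
  finally show ?case by simp
qed auto

text \<open>Extensionality is included so that agreement on generators yields equality of functions;
  automorphisms are stored as maps restricted to \<open>Wn n\<close>.\<close>

definition hom_Wn :: "nat \<Rightarrow> autom \<Rightarrow> bool" where
  "hom_Wn n h \<longleftrightarrow> h \<in> extensional (Wn n) \<and> h ` Wn n \<subseteq> Wn n \<and>
     (\<forall>u\<in>Wn n. \<forall>v\<in>Wn n. h (wmult u v) = wmult (h u) (h v))"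

abbreviation inn :: "nat \<Rightarrow> word \<Rightarrow> autom" where "inn n c \<equiv> restrict (conjw c) (Wn n)"
definition ident :: "nat \<Rightarrow> autom" where "ident n = restrict id (Wn n)"
abbreviation out_one :: "nat \<Rightarrow> outel" where "out_one n \<equiv> out_class n (ident n)"

context fixes n :: nat begin

section \<open>Group laws and conjugation in W_n\<close>

lemma WnD: "w \<in> Wn n \<Longrightarrow> red w" by (simp add: Wn_def)
lemma Nil_Wn [simp, intro]: "[] \<in> Wn n" by (simp add: Wn_def)
lemma single_Wn [simp]: "[a] \<in> Wn n \<longleftrightarrow> a \<in> {1..n}" by (simp add: Wn_def)
lemma wmult_Wn [simp]: "u \<in> Wn n \<Longrightarrow> v \<in> Wn n \<Longrightarrow> wmult u v \<in> Wn n"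
  using set_wmult[of u v] by (auto simp: Wn_def red_wmult)
lemma rev_Wn [simp]: "u \<in> Wn n \<Longrightarrow> rev u \<in> Wn n"
  by (simp add: Wn_def)
lemma assoc_Wn: "u \<in> Wn n \<Longrightarrow> v \<in> Wn n \<Longrightarrow> w \<in> Wn n \<Longrightarrow> wmult (wmult u v) w = wmult u (wmult v w)"
  by (simp add: wmult_assoc WnD)
lemma unit_Wn [simp]: "u \<in> Wn n \<Longrightarrow> wmult u [] = u" by (simp add: WnD)
lemma rinv_Wn [simp]: "u \<in> Wn n \<Longrightarrow> wmult u (rev u) = []" by (simp add: WnD wmult_rev)
lemma linv_Wn [simp]: "u \<in> Wn n \<Longrightarrow> wmult (rev u) u = []" using rinv_Wn[of "rev u"] by simp
lemma rinv_assoc_Wn [simp]: "u \<in> Wn n \<Longrightarrow> v \<in> Wn n \<Longrightarrow> wmult u (wmult (rev u) v) = v"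
  using assoc_Wn[of u "rev u" v] by simp
lemma linv_assoc_Wn [simp]: "u \<in> Wn n \<Longrightarrow> v \<in> Wn n \<Longrightarrow> wmult (rev u) (wmult u v) = v"
  using rinv_assoc_Wn[of "rev u" v] by simp

lemma inverse_unique_Wn:
  assumes "u \<in> Wn n" "v \<in> Wn n" "wmult u v = []" shows "v = rev u"
  using linv_assoc_Wn[OF assms(1,2)] assms by simp

lemma rev_wmult: "u \<in> Wn n \<Longrightarrow> v \<in> Wn n \<Longrightarrow> rev (wmult u v) = wmult (rev v) (rev u)"
  by (rule inverse_unique_Wn[symmetric]) (auto simp: assoc_Wn)

lemma conjw_Wn [simp]: "c \<in> Wn n \<Longrightarrow> w \<in> Wn n \<Longrightarrow> conjw c w \<in> Wn n"
  by (auto simp: conjw_def)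

lemma conjw_conjw: "c \<in> Wn n \<Longrightarrow> d \<in> Wn n \<Longrightarrow> w \<in> Wn n \<Longrightarrow> conjw c (conjw d w) = conjw (wmult c d) w"
  by (auto simp: conjw_def rev_wmult assoc_Wn)

lemma conjw_wmult: "c \<in> Wn n \<Longrightarrow> u \<in> Wn n \<Longrightarrow> v \<in> Wn n \<Longrightarrow> conjw c (wmult u v) = wmult (conjw c u) (conjw c v)"
  by (auto simp: conjw_def assoc_Wn linv_assoc_Wn)

lemma conjw_Nil [simp]: "w \<in> Wn n \<Longrightarrow> conjw [] w = w"
  by (auto simp: conjw_def)

lemma conjw_rev [simp]: "c \<in> Wn n \<Longrightarrow> w \<in> Wn n \<Longrightarrow> conjw c (conjw (rev c) w) = w"
   "c \<in> Wn n \<Longrightarrow> w \<in> Wn n \<Longrightarrow> conjw (rev c) (conjw c w) = w"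
  by (auto simp: conjw_conjw)

section \<open>Homomorphisms determined by the generators\<close>

lemma hom_WnD: assumes "hom_Wn n h" shows "h \<in> extensional (Wn n)"
   "\<And>u. u \<in> Wn n \<Longrightarrow> h u \<in> Wn n" "\<And>u v. u \<in> Wn n \<Longrightarrow> v \<in> Wn n \<Longrightarrow> h (wmult u v) = wmult (h u) (h v)"
  using assms by (auto simp: hom_Wn_def)

lemma hom_Wn_Nil: assumes "hom_Wn n h" shows "h [] = []"
proof -
  have "h [] = wmult (h []) (h [])" using hom_WnD(3)[OF assms, of "[]" "[]"] by simp
  then have "wmult (rev (h [])) (h []) = wmult (rev (h [])) (wmult (h []) (h []))" by simp
  then show ?thesis using hom_WnD(2)[OF assms, of "[]"] by (simp add: linv_assoc_Wn)
qed

lemma Wn_ConsD: "a # w \<in> Wn n \<Longrightarrow> a \<in> {1..n} \<and> w \<in> Wn n \<and> a # w = wmult [a] w"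
  by (cases w) (auto simp: Wn_def)

lemma hom_Wn_eqI:
  assumes "hom_Wn n h" "hom_Wn n g" "\<And>j. j \<in> {1..n} \<Longrightarrow> h [j] = g [j]" shows "h = g"
proof
  have "h w = g w" if "w \<in> Wn n" for w using that
  proof (induction w)
    case Nil then show ?case using assms by (simp add: hom_Wn_Nil)
  next
    case (Cons a w)
    from Wn_ConsD[OF Cons.prems] have a: "a \<in> {1..n}" "w \<in> Wn n" "a # w = wmult [a] w" by auto
    have "h (a # w) = wmult (h [a]) (h w)" using a hom_WnD(3)[OF assms(1), of "[a]" w] by simp
    moreover have "g (a # w) = wmult (g [a]) (g w)" using a hom_WnD(3)[OF assms(2), of "[a]" w] by simp
    ultimately show ?case using Cons.IH a assms(3) by simp
  qed
  then show "h w = g w" for w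
    using hom_WnD(1)[OF assms(1)] hom_WnD(1)[OF assms(2)] by (cases "w \<in> Wn n") (auto simp: extensional_def)
qed

lemma hom_Wn_compose: assumes "hom_Wn n h" "hom_Wn n g" shows "hom_Wn n (compose (Wn n) h g)"
  unfolding hom_Wn_def using hom_WnD[OF assms(1)] hom_WnD[OF assms(2)]
  by (auto simp: compose_def)

lemma hom_Wn_inn: "c \<in> Wn n \<Longrightarrow> hom_Wn n (restrict (conjw c) (Wn n))"
  by (auto simp: hom_Wn_def conjw_wmult)

lemma hom_Wn_id: "hom_Wn n (ident n)"
  by (auto simp: hom_Wn_def ident_def)

lemma hom_of_Wn: assumes "\<And>j. j \<in> {1..n} \<Longrightarrow> f j \<in> Wn n" "w \<in> Wn n" shows "hom_of f w \<in> Wn n"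
  using assms(2)
proof (induction w)
  case (Cons a w)
  have "a \<in> {1..n}" "w \<in> Wn n" using Wn_ConsD[OF Cons.prems] by auto
  then show ?case using Cons.IH assms(1) by (simp add: hom_of_def)
qed (auto simp: hom_of_def)

text \<open>This is the universal property of a free product of groups of order two: the cancelling
  branch of \<open>push\<close> is matched by the hypothesis that the images square to 1.\<close>

lemma hom_of_hom: 
  assumes f: "\<And>j. j \<in> {1..n} \<Longrightarrow> f j \<in> Wn n" "\<And>j. j \<in> {1..n} \<Longrightarrow> wmult (f j) (f j) = []"
  shows "hom_Wn n (restrict (hom_of f) (Wn n))"
proof -
  have simps: "hom_of f [] = []" "hom_of f (a # w) = wmult (f a) (hom_of f w)" for a w
    by (auto simp: hom_of_def)
  have W: "hom_of f w \<in> Wn n" if "w \<in> Wn n" for w using hom_of_Wn f(1) that by blast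
  have p: "hom_of f (push a w) = wmult (f a) (hom_of f w)" if "a \<in> {1..n}" "w \<in> Wn n" for a w
  proof (cases w)
    case (Cons b v)
    have v: "v \<in> Wn n" using Wn_ConsD that Cons by blast
    have "wmult (f a) (wmult (f a) (hom_of f v)) = hom_of f v"
      using assoc_Wn[of "f a" "f a" "hom_of f v"] f that v W by simp
    then show ?thesis using Cons by (auto simp: simps)
  qed (auto simp: simps)
  have "hom_of f (wmult u v) = wmult (hom_of f u) (hom_of f v)" if "u \<in> Wn n" "v \<in> Wn n" for u v
    using that
  proof (induction u)
    case (Cons a u)
    have a: "a \<in> {1..n}" "u \<in> Wn n" using Wn_ConsD[OF Cons.prems(1)] by auto
    show ?case using a Cons W f p[of a "wmult u v"] by (simp add: simps assoc_Wn)
  qed (auto simp: simps)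
  then show ?thesis using W by (auto simp: hom_Wn_def)
qed

section \<open>Automorphisms sending each generator to a conjugate\<close>

lemma conjw_square: assumes "c \<in> Wn n" "j \<in> {1..n}" shows "wmult (conjw c [j]) (conjw c [j]) = []"
  using assms conjw_wmult[of c "[j]" "[j]"] by (simp add: conjw_def)

lemma hom_of_single: "f j \<in> Wn n \<Longrightarrow> hom_of f [j] = f j" by (simp add: hom_of_def)

text \<open>Trades the existential generator map of the definition for conditions on
  \<open>h\<close> itself; from right to left that map is recovered as
  \<open>f j = h [j]\<close>.\<close>

lemma Aut0_iff: "h \<in> Aut0 n \<longleftrightarrow> hom_Wn n h \<and> bij_betw h (Wn n) (Wn n) \<and> (\<forall>j\<in>{1..n}. \<exists>c\<in>Wn n. h [j] = conjw c [j])"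
proof
  assume "h \<in> Aut0 n"
  then obtain f where h: "h = restrict (hom_of f) (Wn n)" "\<forall>j\<in>{1..n}. \<exists>c\<in>Wn n. f j = conjw c [j]"
     "bij_betw (hom_of f) (Wn n) (Wn n)" by (auto simp: Aut0_def)
  have fW: "f j \<in> Wn n" "wmult (f j) (f j) = []" if "j \<in> {1..n}" for j
    using h(2) that conjw_square by (metis conjw_Wn single_Wn)+
  then have "hom_Wn n h" using hom_of_hom[of f] h by blast
  moreover have "h [j] = f j" if "j \<in> {1..n}" for j using that fW h hom_of_single by simp
  ultimately show "hom_Wn n h \<and> bij_betw h (Wn n) (Wn n) \<and> (\<forall>j\<in>{1..n}. \<exists>c\<in>Wn n. h [j] = conjw c [j])"
    using h by (simp add: bij_betw_restrict_eq)
next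
  assume h: "hom_Wn n h \<and> bij_betw h (Wn n) (Wn n) \<and> (\<forall>j\<in>{1..n}. \<exists>c\<in>Wn n. h [j] = conjw c [j])"
  define f where "f j = h [j]" for j
  have fW: "f j \<in> Wn n" "wmult (f j) (f j) = []" if "j \<in> {1..n}" for j
    using h that conjw_square unfolding f_def by (metis conjw_Wn single_Wn)+
  have "hom_Wn n (restrict (hom_of f) (Wn n))" using hom_of_hom[of f] fW by blast
  then have "h = restrict (hom_of f) (Wn n)"
    using h fW by (intro hom_Wn_eqI) (auto simp: hom_of_single f_def)
  then show "h \<in> Aut0 n" using h by (auto simp: Aut0_def f_def bij_betw_restrict_eq intro!: exI[of _ f])
qed

lemma Aut0_hom: "h \<in> Aut0 n \<Longrightarrow> hom_Wn n h" by (simp add: Aut0_iff)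

lemma Aut0_rev: assumes "h \<in> Aut0 n" "c \<in> Wn n" shows "h (rev c) = rev (h c)"
proof (rule inverse_unique_Wn)
  show "h c \<in> Wn n" "h (rev c) \<in> Wn n" using assms hom_WnD[OF Aut0_hom] by auto
  have "wmult (h c) (h (rev c)) = h (wmult c (rev c))" using assms hom_WnD[OF Aut0_hom] by auto
  then show "wmult (h c) (h (rev c)) = []" using assms hom_Wn_Nil[OF Aut0_hom] by simp
qed

lemma Aut0_conjw: assumes "h \<in> Aut0 n" "c \<in> Wn n" "w \<in> Wn n" shows "h (conjw c w) = conjw (h c) (h w)"
  using assms hom_WnD[OF Aut0_hom[OF assms(1)]] Aut0_rev[OF assms(1)] by (simp add: conjw_def rev_Wn wmult_Wn)

lemma Aut0_compose: assumes "h \<in> Aut0 n" "g \<in> Aut0 n" shows "compose (Wn n) h g \<in> Aut0 n"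
  unfolding Aut0_iff
proof (intro conjI ballI)
  note H = hom_WnD[OF Aut0_hom[OF assms(1)]] and G = hom_WnD[OF Aut0_hom[OF assms(2)]]
  show "hom_Wn n (compose (Wn n) h g)" using assms by (simp add: hom_Wn_compose Aut0_hom)
  show "bij_betw (compose (Wn n) h g) (Wn n) (Wn n)"
    using assms bij_betw_compose by (auto simp: Aut0_iff)
  fix j assume j: "j \<in> {1..n}"
  obtain c d where "c \<in> Wn n" "g [j] = conjw c [j]" "d \<in> Wn n" "h [j] = conjw d [j]"
    using assms j unfolding Aut0_iff by blast
  then have "compose (Wn n) h g [j] = conjw (wmult (h c) d) [j]"
    using j H G by (simp add: compose_def Aut0_conjw[OF assms(1)] conjw_conjw)
  then show "\<exists>c\<in>Wn n. compose (Wn n) h g [j] = conjw c [j]"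
    using \<open>c \<in> _\<close> \<open>d \<in> _\<close> by (intro bexI[of _ "wmult (h c) d"] wmult_Wn H(2))
qed

lemma ident_eq: "ident n = inn n []" unfolding ident_def by (rule restrict_ext) simp

lemma inn_Aut0: assumes "c \<in> Wn n" shows "inn n c \<in> Aut0 n"
  unfolding Aut0_iff
proof (intro conjI ballI)
  show "hom_Wn n (inn n c)" using assms by (rule hom_Wn_inn)
  show "bij_betw (inn n c) (Wn n) (Wn n)" 
    by (rule bij_betw_byWitness[of _ "conjw (rev c)"]) (use assms in auto)
  show "\<exists>d\<in>Wn n. inn n c [j] = conjw d [j]" if "j \<in> {1..n}" for j using assms that by auto
qed

lemma ident_Aut0 [simp]: "ident n \<in> Aut0 n" unfolding ident_eq by (rule inn_Aut0) simp

lemma compose_Wn_assoc: assumes "h \<in> Aut0 n" "g \<in> Aut0 n" "f \<in> Aut0 n"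
  shows "compose (Wn n) h (compose (Wn n) g f) = compose (Wn n) (compose (Wn n) h g) f"
  using hom_WnD(2)[OF Aut0_hom[OF assms(3)]] by (auto simp: compose_def)

lemma compose_ident [simp]: assumes "h \<in> Aut0 n" 
  shows "compose (Wn n) h (ident n) = h" "compose (Wn n) (ident n) h = h"
  using hom_WnD[OF Aut0_hom[OF assms]] by (auto simp: compose_def restrict_def extensional_def ident_def)

lemma inn_compose: "c \<in> Wn n \<Longrightarrow> d \<in> Wn n \<Longrightarrow> compose (Wn n) (inn n c) (inn n d) = inn n (wmult c d)"
  by (auto simp: compose_def restrict_def conjw_conjw)

section \<open>Outer classes and their product\<close>

lemma out_class_self: "h \<in> Aut0 n \<Longrightarrow> h \<in> out_class n h"
  unfolding out_class_def Inn_def using compose_ident(1)[of h] ident_eq Nil_Wn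
  by (smt (verit, best) mem_Collect_eq)

lemma out_class_memD: "g \<in> out_class n h \<Longrightarrow> \<exists>c\<in>Wn n. g = compose (Wn n) h (inn n c)"
  by (auto simp: out_class_def Inn_def)

lemma out_class_memI: "d \<in> Wn n \<Longrightarrow> compose (Wn n) h (inn n d) \<in> out_class n h"
  by (auto simp: out_class_def Inn_def)

lemma out_class_eq:
  assumes "h \<in> Aut0 n" "c \<in> Wn n" shows "out_class n (compose (Wn n) h (inn n c)) = out_class n h"
proof -
  have "compose (Wn n) (compose (Wn n) h (inn n c)) (inn n d) = compose (Wn n) h (inn n (wmult c d))" if "d \<in> Wn n" for d
    using assms that by (simp add: compose_Wn_assoc[symmetric] inn_Aut0 inn_compose)
  moreover have "compose (Wn n) h (inn n d) \<in> out_class n (compose (Wn n) h (inn n c))" if "d \<in> Wn n" for d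
    using out_class_memI[of "wmult (rev c) d" "compose (Wn n) h (inn n c)"]
    using assms that by (simp add: compose_Wn_assoc[symmetric] inn_Aut0 inn_compose wmult_Wn rev_Wn rinv_assoc_Wn)
  ultimately show ?thesis using assms
    by (intro equalityI subsetI) (auto dest!: out_class_memD intro!: out_class_memI)
qed

text \<open>The product uses representatives chosen by \<open>SOME\<close>. The choice is harmless
  because inner automorphisms are normal: conjugation by \<open>c\<close> after \<open>g\<close>
  equals \<open>g\<close> after conjugation by \<open>c'\<close>, where \<open>c = g c'\<close>
  exists by surjectivity of \<open>g\<close>. The inner factors therefore collect on the
  right.\<close>

lemma out_mult_class:
  assumes h: "h \<in> Aut0 n" and g: "g \<in> Aut0 n"
  shows "out_mult n (out_class n h) (out_class n g) = out_class n (compose (Wn n) h g)"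
proof -
  define h' where "h' = (SOME x. x \<in> out_class n h)"
  define g' where "g' = (SOME x. x \<in> out_class n g)"
  have "h' \<in> out_class n h" unfolding h'_def by (rule someI[of _ h]) (rule out_class_self[OF h])
  moreover have "g' \<in> out_class n g" unfolding g'_def by (rule someI[of _ g]) (rule out_class_self[OF g])
  ultimately obtain c d where c: "c \<in> Wn n" "h' = compose (Wn n) h (inn n c)" and d: "d \<in> Wn n" "g' = compose (Wn n) g (inn n d)"
    using out_class_memD by metis
  obtain c' where c': "c' \<in> Wn n" "c = g c'" using g c by (auto simp: Aut0_iff bij_betw_def)
  have "compose (Wn n) (inn n c) g = compose (Wn n) g (inn n c')"
    using c' hom_WnD(2)[OF Aut0_hom[OF g]] by (auto simp: compose_def restrict_def Aut0_conjw[OF g])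
  then have "compose (Wn n) h' g' = compose (Wn n) (compose (Wn n) (compose (Wn n) h g) (inn n c')) (inn n d)"
    using c d c' h g by (metis Aut0_compose compose_Wn_assoc inn_Aut0)
  then show ?thesis unfolding out_mult_def h'_def[symmetric] g'_def[symmetric]
    using c c' d h g by (simp add: out_class_eq Aut0_compose inn_Aut0)
qed

lemma out_class_Out0 [simp, intro]: "h \<in> Aut0 n \<Longrightarrow> out_class n h \<in> Out0 n" by (auto simp: Out0_def)

lemma out_mult_Out0 [simp]: "\<alpha> \<in> Out0 n \<Longrightarrow> \<beta> \<in> Out0 n \<Longrightarrow> out_mult n \<alpha> \<beta> \<in> Out0 n"
  by (auto simp: Out0_def out_mult_class Aut0_compose)
lemma out_one_Out0 [simp, intro]: "out_one n \<in> Out0 n" by auto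
lemma out_mult_one [simp]: "\<alpha> \<in> Out0 n \<Longrightarrow> out_mult n \<alpha> (out_one n) = \<alpha>" "\<alpha> \<in> Out0 n \<Longrightarrow> out_mult n (out_one n) \<alpha> = \<alpha>"
  by (auto simp: Out0_def out_mult_class)
lemma out_mult_assoc: "\<alpha> \<in> Out0 n \<Longrightarrow> \<beta> \<in> Out0 n \<Longrightarrow> \<gamma> \<in> Out0 n \<Longrightarrow>
   out_mult n (out_mult n \<alpha> \<beta>) \<gamma> = out_mult n \<alpha> (out_mult n \<beta> \<gamma>)"
  by (auto simp: Out0_def out_mult_class Aut0_compose compose_Wn_assoc)

end

section \<open>Partial conjugations and McCullough--Miller vertices\<close>

context fixes n :: nat begin

lemma triple_Wn: "a \<in> {1..n} \<Longrightarrow> b \<in> {1..n} \<Longrightarrow> a \<noteq> b \<Longrightarrow> [a, b, a] \<in> Wn n"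
  by (simp add: Wn_def)

lemma hom_Wn_triple:
  assumes "hom_Wn n h" "a \<in> {1..n}" "b \<in> {1..n}" "a \<noteq> b"
  shows "h [a, b, a] = wmult (h [a]) (wmult (h [b]) (h [a]))"
proof -
  have 1: "[a, b, a] = wmult [a] (wmult [b] [a])" using assms by simp
  have 2: "wmult [b] [a] \<in> Wn n" "[a] \<in> Wn n" "[b] \<in> Wn n" using assms by (auto simp: Wn_def)
  show ?thesis unfolding 1 using hom_WnD(3)[OF assms(1) 2(2) 2(1)] hom_WnD(3)[OF assms(1) 2(3) 2(2)] by simp
qed

lemma pc_hom_single: assumes "i \<in> {1..n}" "i \<notin> D"
  shows "hom_Wn n (pc n i D) \<and> (\<forall>j\<in>{1..n}. pc n i D [j] = (if j \<in> D then [i, j, i] else [j]))"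
proof -
  have "hom_Wn n (pc n i D)" unfolding pc_def
    by (rule hom_of_hom) (use assms in \<open>auto intro!: triple_Wn\<close>)
  then show ?thesis using assms by (auto simp: pc_def hom_of_def triple_Wn)
qed

lemmas pc_hom = pc_hom_single[THEN conjunct1]
lemmas pc_single = pc_hom_single[THEN conjunct2, rule_format]

text \<open>The acting letter is fixed and is an involution, so a letter conjugated by both factors
  returns to itself; what survives is the symmetric difference.\<close>

lemma pc_pc: assumes "i \<in> {1..n}" "i \<notin> D" "i \<notin> D'"
  shows "compose (Wn n) (pc n i D) (pc n i D') = pc n i ((D - D') \<union> (D' - D))"
proof (rule hom_Wn_eqI)
  show "hom_Wn n (compose (Wn n) (pc n i D) (pc n i D'))" using assms by (simp add: hom_Wn_compose pc_hom)
  show "hom_Wn n (pc n i ((D - D') \<union> (D' - D)))" using assms by (simp add: pc_hom)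
  fix j assume "j \<in> {1..n}"
  then show "compose (Wn n) (pc n i D) (pc n i D') [j] = pc n i ((D - D') \<union> (D' - D)) [j]"
    using assms hom_Wn_triple[OF pc_hom[of i D], of i j] by (cases "i = j") (auto simp: compose_def pc_single)
qed

lemma pc_empty: assumes "i \<in> {1..n}" shows "pc n i {} = ident n"
proof (rule hom_Wn_eqI)
  show "hom_Wn n (pc n i {})" "hom_Wn n (ident n)" using assms by (simp_all add: pc_hom hom_Wn_id)
qed (use assms in \<open>auto simp: pc_single ident_def\<close>)

lemma pc_commute: assumes "i \<in> {1..n}" "i \<notin> D" "k \<in> {1..n}" "k \<notin> D'" "i \<noteq> k" "i \<notin> D'" "k \<notin> D" "D \<inter> D' = {}"
  shows "compose (Wn n) (pc n i D) (pc n k D') = compose (Wn n) (pc n k D') (pc n i D)"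
proof (rule hom_Wn_eqI)
  show "hom_Wn n (compose (Wn n) (pc n i D) (pc n k D'))" "hom_Wn n (compose (Wn n) (pc n k D') (pc n i D))"
    using assms by (simp_all add: hom_Wn_compose pc_hom)
  fix j assume "j \<in> {1..n}"
  then show "compose (Wn n) (pc n i D) (pc n k D') [j] = compose (Wn n) (pc n k D') (pc n i D) [j]"
    using assms hom_Wn_triple[OF pc_hom[of i D], of k j] hom_Wn_triple[OF pc_hom[of k D'], of i j]
    by (cases "i = j"; cases "k = j") (auto simp: compose_def pc_single)
qed

text \<open>Conjugation by the letter \<open>k\<close> toggles every other letter between conjugated
  and not conjugated. Modulo inner automorphisms a set and its complement therefore define the same
  element.\<close>

lemma pc_compl: assumes "k \<in> {1..n}" "k \<notin> D"
  shows "compose (Wn n) (pc n k D) (inn n [k]) = pc n k ({1..n} - {k} - D)"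
proof (rule hom_Wn_eqI)
  show "hom_Wn n (compose (Wn n) (pc n k D) (inn n [k]))" using assms by (intro hom_Wn_compose pc_hom hom_Wn_inn) auto
  show "hom_Wn n (pc n k ({1..n} - {k} - D))" using assms by (simp add: pc_hom)
  fix j assume j: "j \<in> {1..n}"
  have "inn n [k] [j] = (if j = k then [k] else [k, j, k])" using j by (auto simp: conjw_def)
  then show "compose (Wn n) (pc n k D) (inn n [k]) [j] = pc n k ({1..n} - {k} - D) [j]"
    using j assms hom_Wn_triple[OF pc_hom[of k D], of k j] by (auto simp: compose_def pc_single)
qed

lemma pc_Aut0: assumes "i \<in> {1..n}" "i \<notin> D" shows "pc n i D \<in> Aut0 n"
  unfolding Aut0_iff
proof (intro conjI ballI)
  show h: "hom_Wn n (pc n i D)" using assms by (rule pc_hom)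
  have "compose (Wn n) (pc n i D) (pc n i D) = ident n" using pc_pc[of i D D] assms pc_empty by simp
  then have "compose (Wn n) (pc n i D) (pc n i D) w = ident n w" for w by simp
  then have "pc n i D (pc n i D w) = w" if "w \<in> Wn n" for w using that
    by (metis compose_eq ident_def id_apply restrict_apply')
  then show "bij_betw (pc n i D) (Wn n) (Wn n)" using hom_WnD(2)[OF h]
    by (intro bij_betw_byWitness[of _ "pc n i D"]) auto
  fix j assume j: "j \<in> {1..n}"
  have "conjw [i] [j] = (if i = j then [j] else [i, j, i])" by (auto simp: conjw_def)
  then have "pc n i D [j] = conjw (if j \<in> D then [i] else []) [j]" using j assms by (auto simp: pc_single)
  then show "\<exists>c\<in>Wn n. pc n i D [j] = conjw c [j]" using assms by (intro bexI[of _ "if j \<in> D then [i] else []"]) auto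
qed

abbreviation xo :: "nat \<Rightarrow> nat set \<Rightarrow> outel" where "xo i D \<equiv> out_class n (pc n i D)"

lemma xo_Out0: "i \<in> {1..n} \<Longrightarrow> i \<notin> D \<Longrightarrow> xo i D \<in> Out0 n" by (simp add: pc_Aut0 out_class_Out0)
lemma xo_xo: "i \<in> {1..n} \<Longrightarrow> i \<notin> D \<Longrightarrow> i \<notin> D' \<Longrightarrow> out_mult n (xo i D) (xo i D') = xo i ((D - D') \<union> (D' - D))"
  by (simp add: out_mult_class pc_Aut0 pc_pc)
lemma xo_commute: "i \<in> {1..n} \<Longrightarrow> i \<notin> D \<Longrightarrow> k \<in> {1..n} \<Longrightarrow> k \<notin> D' \<Longrightarrow> i \<noteq> k \<Longrightarrow> i \<notin> D' \<Longrightarrow> k \<notin> D \<Longrightarrow> D \<inter> D' = {} \<Longrightarrow>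
  out_mult n (xo i D) (xo k D') = out_mult n (xo k D') (xo i D)"
  using pc_commute[of i D k D'] by (simp add: out_mult_class pc_Aut0)
lemma xo_empty: "i \<in> {1..n} \<Longrightarrow> xo i {} = out_one n" by (simp add: pc_empty)
lemma xo_compl: assumes "k \<in> {1..n}" "k \<notin> D" shows "xo k ({1..n} - {k} - D) = xo k D"
  using out_class_eq[OF pc_Aut0[OF assms], of "[k]"] pc_compl[OF assms] assms by simp

section \<open>Centralizers of generators and nontrivial outer classes\<close>

text \<open>Compare left and right multiplication by \<open>a\<close> as reduced words. Without
  cancellation they give \<open>c @ [a] = a # c\<close>, so \<open>c\<close> would have to begin
  with \<open>a\<close>. With cancellation \<open>c\<close> both begins and ends with
  \<open>a\<close>, and a longer \<open>c\<close> would contain \<open>a\<close> twice in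
  succession.\<close>

lemma commutes_single:
  assumes "c \<in> Wn n" "a \<in> {1..n}" "conjw c [a] = [a]" shows "c = [] \<or> c = [a]"
proof -
  have W: "[a] \<in> Wn n" using assms by simp
  have "wmult (conjw c [a]) c = wmult c [a]" by (simp only: conjw_def assoc_Wn[where n=n] W assms(1) rev_Wn wmult_Wn linv_Wn[where n=n] unit_Wn[where n=n])
  then have "wmult c [a] = push a c" using assms(3) by simp
  moreover have "wmult c [a] = rev (push a (rev c))"
    using rev_wmult[of "[a]" n "rev c"] assms(1) W by (simp add: rev_swap)
  ultimately have e: "rev (push a (rev c)) = push a c" by simp
  show ?thesis
  proof (cases c)
    case (Cons b w)
    show ?thesis
    proof (cases "b = a")
      case False
      then have p: "push a c = a # c" using Cons by simp
      then have "length (push a (rev c)) = Suc (length c)" using e by (metis length_rev length_Cons)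
      then have "push a (rev c) = a # rev c" by (cases "rev c") (auto split: if_splits)
      then have "c @ [a] = a # c" using e p by simp
      then show ?thesis using Cons False by simp
    next
      case True
      then have p: "push a c = w" using Cons by simp
      then have l: "Suc (length (push a (rev c))) = length c" using e Cons by (metis length_rev length_Cons)
      obtain v where v: "rev c = a # v"
      proof (cases "rev c")
        case (Cons b' v)
        then have "length (b' # v) = length c" by (metis length_rev)
        then have "b' = a" using l Cons by (auto split: if_splits)
        then show ?thesis using that Cons by simp
      qed (use l in simp)
      then have "c = w @ [a]" using e p by (simp add: rev_swap)
      then have "w @ [a] = a # w" using Cons True by simp
      then have "w = [] \<or> hd w = a" by (cases w) auto
      then show ?thesis using Cons True assms(1) by (cases w) (auto simp: Wn_def)
    qed
  qed simp
qed

text \<open>An inner automorphism fixing two distinct generators is conjugation by an element of the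
  intersection of their centralizers, which is trivial. Thus non-triviality of an outer class can be
  tested on a representative with two fixed generators.\<close>

lemma out_class_trivial:
  assumes "h \<in> Aut0 n" "out_class n h = out_one n" "a \<in> {1..n}" "b \<in> {1..n}" "a \<noteq> b" "h [a] = [a]" "h [b] = [b]"
  shows "h = ident n"
proof -
  have "h \<in> out_one n" using out_class_self[OF assms(1)] assms(2) by simp
  then obtain c where c: "c \<in> Wn n" "h = compose (Wn n) (ident n) (inn n c)" using out_class_memD by blast
  then have h: "h = inn n c" using compose_ident(2)[OF inn_Aut0] by simp
  then have "conjw c [a] = [a]" "conjw c [b] = [b]" using assms by auto
  then have "c = []" using commutes_single[OF c(1), of a] commutes_single[OF c(1), of b] assms by auto
  then show ?thesis using h ident_eq by simp
qed

section \<open>The group carried by a hypertree\<close>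

lemma carried_out_alt: "carried_out n \<Theta> = {out_class n (foldr (\<lambda>g acc. compose (Wn n) g acc) gs (ident n)) | gs.
      \<forall>g\<in>set gs. \<exists>i D. is_pc n i D \<and> carries n \<Theta> i D \<and> g = pc n i D}"
  by (simp only: carried_out_def ident_def)

lemma foldr_compose_Aut0: "\<forall>g\<in>set gs. g \<in> Aut0 n \<Longrightarrow> foldr (\<lambda>g acc. compose (Wn n) g acc) gs (ident n) \<in> Aut0 n"
  by (induction gs) (auto simp: Aut0_compose)

lemma is_pc_Aut0: "is_pc n i D \<Longrightarrow> pc n i D \<in> Aut0 n"
  unfolding is_pc_def by (intro pc_Aut0) auto

lemma carried_one: "out_one n \<in> carried_out n \<Theta>"
  unfolding carried_out_alt by (rule CollectI, rule exI[of _ "[]"]) simp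

lemma carried_step: assumes "is_pc n i D" "carries n \<Theta> i D" "\<gamma> \<in> carried_out n \<Theta>"
  shows "out_mult n (xo i D) \<gamma> \<in> carried_out n \<Theta>"
proof -
  obtain gs where gs: "\<gamma> = out_class n (foldr (\<lambda>g acc. compose (Wn n) g acc) gs (ident n))"
      "\<forall>g\<in>set gs. \<exists>i D. is_pc n i D \<and> carries n \<Theta> i D \<and> g = pc n i D"
    using assms(3) by (auto simp: carried_out_alt)
  have "out_mult n (xo i D) \<gamma> = out_class n (foldr (\<lambda>g acc. compose (Wn n) g acc) (pc n i D # gs) (ident n))"
    unfolding gs(1) using gs(2) assms(1) is_pc_Aut0 by (subst out_mult_class) (auto intro!: foldr_compose_Aut0)
  moreover have "\<forall>g\<in>set (pc n i D # gs). \<exists>i D. is_pc n i D \<and> carries n \<Theta> i D \<and> g = pc n i D" using gs(2) assms by auto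
  ultimately show ?thesis unfolding carried_out_alt by blast
qed

text \<open>Replaces lists of generators by closure under left multiplication with one carried
  generator; the group properties and the later size bounds are inductions of this form.\<close>

lemma carried_induct [consumes 1, case_names one step]:
  assumes "\<gamma> \<in> carried_out n \<Theta>" "P (out_one n)"
    "\<And>i D \<gamma>. is_pc n i D \<Longrightarrow> carries n \<Theta> i D \<Longrightarrow> \<gamma> \<in> carried_out n \<Theta> \<Longrightarrow> P \<gamma> \<Longrightarrow> P (out_mult n (xo i D) \<gamma>)"
  shows "P \<gamma>"
proof -
  obtain gs where gs: "\<gamma> = out_class n (foldr (\<lambda>g acc. compose (Wn n) g acc) gs (ident n))"
      "\<forall>g\<in>set gs. \<exists>i D. is_pc n i D \<and> carries n \<Theta> i D \<and> g = pc n i D"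
    using assms(1) by (auto simp: carried_out_alt)
  have "P (out_class n (foldr (\<lambda>g acc. compose (Wn n) g acc) gs (ident n))) \<and>
     out_class n (foldr (\<lambda>g acc. compose (Wn n) g acc) gs (ident n)) \<in> carried_out n \<Theta>" using gs(2)
  proof (induction gs)
    case Nil then show ?case using assms(2) carried_one by simp
  next
    case (Cons g gs)
    then obtain i D where g: "is_pc n i D" "carries n \<Theta> i D" "g = pc n i D" by auto
    have "\<forall>g\<in>set gs. g \<in> Aut0 n" using Cons.prems is_pc_Aut0 by auto
    then have "out_class n (foldr (\<lambda>g acc. compose (Wn n) g acc) (g # gs) (ident n)) =
       out_mult n (xo i D) (out_class n (foldr (\<lambda>g acc. compose (Wn n) g acc) gs (ident n)))"
      using g is_pc_Aut0 by (subst out_mult_class) (auto intro!: foldr_compose_Aut0)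
    then show ?case using assms(3) g carried_step Cons by simp
  qed
  then show ?thesis using gs by simp
qed

lemma is_pc_xo: "is_pc n i D \<Longrightarrow> xo i D \<in> Out0 n \<and> out_mult n (xo i D) (xo i D) = out_one n"
  unfolding is_pc_def by (subst xo_xo) (auto intro!: xo_Out0 simp: xo_empty)

lemma carried_Out0: "\<gamma> \<in> carried_out n \<Theta> \<Longrightarrow> \<gamma> \<in> Out0 n"
  by (induction rule: carried_induct) (use is_pc_xo out_mult_Out0 out_one_Out0 in blast)+

lemma carried_gen: assumes "is_pc n i D" "carries n \<Theta> i D" shows "xo i D \<in> carried_out n \<Theta>"
  using carried_step[OF assms carried_one] is_pc_xo[OF assms(1)] by simp

lemma carried_mult: "\<gamma> \<in> carried_out n \<Theta> \<Longrightarrow> \<delta> \<in> carried_out n \<Theta> \<Longrightarrow> out_mult n \<gamma> \<delta> \<in> carried_out n \<Theta>"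
proof (induction rule: carried_induct)
  case one then show ?case using carried_Out0 by simp
next
  case (step i D \<gamma>)
  then show ?case using is_pc_xo carried_Out0 by (subst out_mult_assoc) (auto intro: carried_step)
qed

text \<open>Generators are involutions, so the reversed product inverts. This is what makes the
  relation defining the vertices symmetric.\<close>

lemma carried_inverse: "\<gamma> \<in> carried_out n \<Theta> \<Longrightarrow> \<exists>\<delta>\<in>carried_out n \<Theta>. out_mult n \<gamma> \<delta> = out_one n"
proof (induction rule: carried_induct)
  case one then show ?case using carried_one by (intro bexI[of _ "out_one n"]) auto
next
  case (step i D \<gamma>)
  then obtain \<delta> where \<delta>: "\<delta> \<in> carried_out n \<Theta>" "out_mult n \<gamma> \<delta> = out_one n" by auto
  let ?x = "xo i D"
  have O: "?x \<in> Out0 n" "\<gamma> \<in> Out0 n" "\<delta> \<in> Out0 n" using is_pc_xo step \<delta> carried_Out0 by auto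
  have "out_mult n (out_mult n ?x \<gamma>) (out_mult n \<delta> ?x) = out_mult n ?x (out_mult n (out_mult n \<gamma> \<delta>) ?x)"
    using O by (simp add: out_mult_assoc)
  also have "\<dots> = out_one n" using \<delta> O is_pc_xo step by simp
  finally show ?case using carried_mult[OF \<delta>(1) carried_gen[of i D \<Theta>]] step by blast
qed

section \<open>Classes and the order of the poset\<close>

lemma carried_by_refl: "\<alpha> \<in> Out0 n \<Longrightarrow> carried_by n \<Theta> \<alpha> \<alpha>"
  unfolding carried_by_def using carried_one by (intro bexI[of _ "out_one n"]) auto

lemma carried_by_trans: assumes "\<alpha> \<in> Out0 n" "carried_by n \<Theta> \<alpha> \<beta>" "carried_by n \<Theta> \<beta> \<gamma>" shows "carried_by n \<Theta> \<alpha> \<gamma>"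
proof -
  obtain d e where "d \<in> carried_out n \<Theta>" "\<beta> = out_mult n \<alpha> d" "e \<in> carried_out n \<Theta>" "\<gamma> = out_mult n \<beta> e"
    using assms by (auto simp: carried_by_def)
  then have "\<gamma> = out_mult n \<alpha> (out_mult n d e)" "out_mult n d e \<in> carried_out n \<Theta>"
    using assms(1) carried_Out0 carried_mult by (auto simp: out_mult_assoc)
  then show ?thesis unfolding carried_by_def by blast
qed

lemma carried_by_sym: assumes "\<alpha> \<in> Out0 n" "carried_by n \<Theta> \<alpha> \<beta>" shows "carried_by n \<Theta> \<beta> \<alpha>"
proof -
  obtain d where d: "d \<in> carried_out n \<Theta>" "\<beta> = out_mult n \<alpha> d" using assms by (auto simp: carried_by_def)
  obtain e where e: "e \<in> carried_out n \<Theta>" "out_mult n d e = out_one n" using carried_inverse d by blast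
  have "out_mult n \<beta> e = \<alpha>" using d e assms(1) carried_Out0 by (simp add: out_mult_assoc)
  then show ?thesis unfolding carried_by_def using e by metis
qed

lemma mm_class_eqI: assumes "\<alpha> \<in> Out0 n" "carried_by n \<Theta> \<alpha> \<beta>" "\<beta> \<in> Out0 n" shows "mm_class n \<alpha> \<Theta> = mm_class n \<beta> \<Theta>"
proof -
  have "carried_by n \<Theta> \<alpha> \<gamma> \<longleftrightarrow> carried_by n \<Theta> \<beta> \<gamma>" for \<gamma>
    using assms carried_by_trans carried_by_sym by metis
  then show ?thesis by (simp add: mm_class_def)
qed

lemma mem_mm_class: "(\<beta>, \<Lambda>) \<in> mm_class n \<alpha> \<Theta> \<longleftrightarrow> \<Lambda> = \<Theta> \<and> \<beta> \<in> Out0 n \<and> carried_by n \<Theta> \<alpha> \<beta>"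
  by (auto simp: mm_class_def)

lemma mm_class_mem: "u \<in> MMV n \<Longrightarrow> (\<alpha>, \<Theta>) \<in> u \<Longrightarrow> \<alpha> \<in> Out0 n \<and> \<Theta> \<in> HT n \<and> u = mm_class n \<alpha> \<Theta>"
proof -
  assume "u \<in> MMV n" "(\<alpha>, \<Theta>) \<in> u"
  then obtain \<beta> where "\<beta> \<in> Out0 n" "\<Theta> \<in> HT n" "u = mm_class n \<beta> \<Theta>" "\<alpha> \<in> Out0 n" "carried_by n \<Theta> \<beta> \<alpha>"
    by (auto simp: MMV_def mem_mm_class)
  then show ?thesis using mm_class_eqI by blast
qed

lemma mm_class_MMV: "\<alpha> \<in> Out0 n \<Longrightarrow> \<Theta> \<in> HT n \<Longrightarrow> mm_class n \<alpha> \<Theta> \<in> MMV n"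
  by (auto simp: MMV_def)

lemma mm_class_self: "\<alpha> \<in> Out0 n \<Longrightarrow> (\<alpha>, \<Theta>) \<in> mm_class n \<alpha> \<Theta>"
  by (simp add: mem_mm_class carried_by_refl)

lemma MMle_I: assumes "\<alpha> \<in> Out0 n" "\<Theta> \<in> HT n" "\<Lambda> \<in> HT n" "ht_le \<Theta> \<Lambda>"
  shows "MMle n (mm_class n \<alpha> \<Theta>) (mm_class n \<alpha> \<Lambda>)"
  unfolding MMle_def using assms mm_class_MMV mm_class_self carried_by_refl by blast

text \<open>The representative of the larger class may be changed by an element carried by its own
  hypertree, so both classes can be written with one group element. Later incidence arguments rely
  on this normal form.\<close>

lemma MMle_D: assumes "MMle n u v"
  shows "\<exists>\<alpha> \<Theta> \<Lambda>. \<alpha> \<in> Out0 n \<and> \<Theta> \<in> HT n \<and> \<Lambda> \<in> HT n \<and> ht_le \<Theta> \<Lambda> \<and> u = mm_class n \<alpha> \<Theta> \<and> v = mm_class n \<alpha> \<Lambda>"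
proof -
  obtain \<alpha> \<Theta> \<beta> \<Lambda> where h: "u \<in> MMV n" "v \<in> MMV n" "(\<alpha>, \<Theta>) \<in> u" "(\<beta>, \<Lambda>) \<in> v" "ht_le \<Theta> \<Lambda>" "carried_by n \<Lambda> \<alpha> \<beta>"
    using assms by (auto simp: MMle_def)
  have u: "\<alpha> \<in> Out0 n" "\<Theta> \<in> HT n" "u = mm_class n \<alpha> \<Theta>" using mm_class_mem h by blast+
  have v: "\<beta> \<in> Out0 n" "\<Lambda> \<in> HT n" "v = mm_class n \<beta> \<Lambda>" using mm_class_mem h by blast+
  have "v = mm_class n \<alpha> \<Lambda>" using mm_class_eqI[OF u(1) h(6) v(1)] v(3) by simp
  then show ?thesis using u v h by blast
qed

lemma carried_out_mult_left:
  assumes "\<phi> \<in> Out0 n" "\<alpha> \<in> Out0 n" "carried_by n \<Theta> \<alpha> \<beta>" shows "carried_by n \<Theta> (out_mult n \<phi> \<alpha>) (out_mult n \<phi> \<beta>)"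
  using assms carried_Out0 unfolding carried_by_def by (metis out_mult_assoc)

end

section \<open>Hypertrees\<close>

text \<open>The vertex set is a parameter so that hypertrees can be grown by attaching leaves,
  starting from fewer than \<open>n\<close> vertices.\<close>

definition hypertree_on :: "nat set \<Rightarrow> hyp \<Rightarrow> bool" where
  "hypertree_on V \<Theta> \<longleftrightarrow> (\<forall>E\<in>\<Theta>. E \<subseteq> V \<and> card E \<ge> 2) \<and>
     (\<forall>u\<in>V. \<forall>v\<in>V. \<exists>!w. walk \<Theta> (fst w) (snd w) \<and> hd (fst w) = u \<and> last (fst w) = v)"

lemma HT_iff: "\<Theta> \<in> HT n \<longleftrightarrow> hypertree_on {1..n} \<Theta>"
  by (simp add: HT_def hypertree_on_def)

section \<open>Simple walks in hypergraphs\<close>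

lemma walk_single [simp]: "walk \<Theta> [a] es \<longleftrightarrow> es = []"
  by (auto simp: walk_def)

lemma walk_Cons2: "walk \<Theta> (a # b # vs) es \<longleftrightarrow> (\<exists>e es'. es = e # es' \<and> e \<in> \<Theta> \<and> e \<notin> set es' \<and> a \<in> e \<and> b \<in> e \<and>
   a \<noteq> b \<and> a \<notin> set vs \<and> walk \<Theta> (b # vs) es')"
proof (cases es)
  case (Cons e es')
  have "(\<forall>k < length es. (a # b # vs) ! k \<in> es ! k \<and> (a # b # vs) ! (Suc k) \<in> es ! k) \<longleftrightarrow>
     a \<in> e \<and> b \<in> e \<and> (\<forall>k < length es'. (b # vs) ! k \<in> es' ! k \<and> (b # vs) ! (Suc k) \<in> es' ! k)"
    unfolding Cons by (simp add: All_less_Suc2)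
  then show ?thesis unfolding walk_def Cons by auto
qed (auto simp: walk_def)

lemma walk_rev: assumes "walk \<Theta> vs es" shows "walk \<Theta> (rev vs) (rev es)"
proof -
  have l: "length es = length vs - 1" "vs \<noteq> []" using assms by (auto simp: walk_def)
  have "rev vs ! k \<in> rev es ! k \<and> rev vs ! Suc k \<in> rev es ! k" if k: "k < length es" for k
  proof -
    let ?m = "length es - Suc k"
    have "vs ! ?m \<in> es ! ?m \<and> vs ! Suc ?m \<in> es ! ?m" using assms k by (auto simp: walk_def)
    moreover have "rev es ! k = es ! ?m" "rev vs ! k = vs ! Suc ?m" "rev vs ! Suc k = vs ! ?m"
      using k l by (auto simp: rev_nth intro!: arg_cong[of _ _ "(!) vs"])
    ultimately show ?thesis by simp
  qed
  then show ?thesis using assms by (auto simp: walk_def)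
qed

lemma walk_take: "walk \<Theta> vs es \<Longrightarrow> m \<le> length es \<Longrightarrow> walk \<Theta> (take (Suc m) vs) (take m es)"
  unfolding walk_def by (auto dest: in_set_takeD)

lemma walk_drop: "walk \<Theta> vs es \<Longrightarrow> m \<le> length es \<Longrightarrow> walk \<Theta> (drop m vs) (drop m es)"
  unfolding walk_def by (cases vs) (auto dest: in_set_dropD)

lemma walk_snoc: assumes w: "walk \<Theta> vs es" and E: "E \<in> \<Theta>" "E \<notin> set es" and v: "v \<notin> set vs" "last vs \<in> E" "v \<in> E"
  shows "walk \<Theta> (vs @ [v]) (es @ [E])"
proof -
  have l: "length es = length vs - 1" "vs \<noteq> []" and A: "\<forall>k<length es. vs ! k \<in> es ! k \<and> vs ! Suc k \<in> es ! k"
    using w by (auto simp: walk_def)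
  have "(vs @ [v]) ! k \<in> (es @ [E]) ! k \<and> (vs @ [v]) ! Suc k \<in> (es @ [E]) ! k" if k: "k < length (es @ [E])" for k
  proof (cases "k < length es")
    case True
    then have "Suc k < length vs" using l by simp
    then show ?thesis using A[rule_format, OF True] True by (simp add: nth_append)
  next
    case False
    then have k': "k = length es" "length vs = Suc k" using k l by (cases vs; simp)+
    moreover have "vs ! k = last vs" using l(2) k' by (simp add: last_conv_nth)
    ultimately show ?thesis using v by (simp add: nth_append)
  qed
  moreover have "length (es @ [E]) = length (vs @ [v]) - 1" using l by (cases vs) auto
  ultimately show ?thesis using w E v by (simp add: walk_def)
qed

lemma walk_closed_single: assumes "walk \<Theta> vs es" "hd vs = last vs" shows "vs = [hd vs] \<and> es = []"
proof (cases vs)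
  case (Cons a w)
  then show ?thesis using assms by (cases w) (auto simp: walk_def split: if_splits)
qed (use assms in \<open>auto simp: walk_def\<close>)

section \<open>Hypertrees built by attaching leaves\<close>

lemma hypertree_on_single_edge: assumes "finite V" "card V \<ge> 2" shows "hypertree_on V {V}"
  unfolding hypertree_on_def
proof (intro conjI ballI)
  fix u v assume uv: "u \<in> V" "v \<in> V"
  show "\<exists>!w. walk {V} (fst w) (snd w) \<and> hd (fst w) = u \<and> last (fst w) = v"
  proof (rule ex1I[of _ "if u = v then ([u], []) else ([u, v], [V])"])
    fix w assume w: "walk {V} (fst w) (snd w) \<and> hd (fst w) = u \<and> last (fst w) = v"
    obtain vs es where we: "w = (vs, es)" by force
    show "w = (if u = v then ([u], []) else ([u, v], [V]))"
    proof (cases "u = v")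
      case True then show ?thesis using walk_closed_single[of "{V}" vs es] w we by auto
    next
      case False
      then obtain b vs' where vs: "vs = u # b # vs'" using w we by (cases vs; cases "tl vs") (auto simp: walk_def)
      then have "walk {V} (b # vs') (tl es)" "V \<notin> set (tl es)" "es = V # tl es" using w we by (auto simp: walk_Cons2)
      then have "vs' = []" "es = [V]" by (cases vs'; auto simp: walk_Cons2)+
      then show ?thesis using w we vs False by auto
    qed
  qed (use uv in \<open>auto simp: walk_Cons2\<close>)
qed (use assms in auto)

text \<open>The new vertex lies in a single hyperedge, so a walk through it in its interior would
  use that hyperedge twice. Walks between old vertices are therefore the old ones, and a walk
  leaving \<open>l\<close> must first step to \<open>k\<close> and then continue as an old
  walk.\<close>

lemma hypertree_on_leaf:
  assumes T: "hypertree_on V \<Theta>" and k: "k \<in> V" "l \<notin> V"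
  shows "hypertree_on (insert l V) (insert {k, l} \<Theta>)"
proof -
  let ?T = "insert {k, l} \<Theta>"
  have EV: "E \<subseteq> V" if "E \<in> \<Theta>" for E using T that by (auto simp: hypertree_on_def)
  have lE: "E = {k, l}" if "E \<in> ?T" "l \<in> E" for E using that EV k by auto
  have no_l: "l \<notin> set vs" if w: "walk ?T vs es" "hd vs \<noteq> l" "last vs \<noteq> l" for vs es
  proof
    assume "l \<in> set vs"
    then obtain m where m: "m < length vs" "vs ! m = l" by (auto simp: in_set_conv_nth)
    have len: "length es = length vs - 1" "vs \<noteq> []" using w by (auto simp: walk_def)
    have "m \<noteq> 0" using m w len by (metis hd_conv_nth)
    moreover have "m \<noteq> length vs - 1" using m w len by (metis last_conv_nth)
    ultimately have mm: "m - 1 < length es" "m < length es" "Suc (m - 1) = m" using m len by auto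
    have A: "\<forall>k<length es. vs ! k \<in> es ! k \<and> vs ! Suc k \<in> es ! k" using w by (auto simp: walk_def)
    have "l \<in> es ! (m - 1)" "l \<in> es ! m" using A[rule_format, OF mm(1)] A[rule_format, OF mm(2)] m mm(3) by auto
    moreover have "es ! (m - 1) \<in> ?T" "es ! m \<in> ?T" using w mm by (auto simp: walk_def subset_iff)
    ultimately have "es ! (m - 1) = es ! m" using lE by metis
    moreover have "distinct es" using w by (simp add: walk_def)
    ultimately show False using mm by (metis nth_eq_iff_index_eq n_not_Suc_n)
  qed
  \<comment> \<open>The new hyperedge has only the endpoints \<open>k\<close> and \<open>l\<close>;
    two distinct consecutive vertices in it would include \<open>l\<close>.\<close>
  have restr: "walk \<Theta> vs es" if w: "walk ?T vs es" "l \<notin> set vs" for vs es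
  proof -
    have "{k, l} \<notin> set es"
    proof
      assume "{k, l} \<in> set es"
      then obtain m where m: "m < length es" "es ! m = {k, l}" by (auto simp: in_set_conv_nth)
      then have "vs ! m \<in> {k, l}" "vs ! Suc m \<in> {k, l}" using w by (auto simp: walk_def)
      moreover have "Suc m < length vs" "distinct vs" using w m by (auto simp: walk_def)
      ultimately show False using w(2) by (metis Suc_lessD empty_iff insert_iff n_not_Suc_n nth_eq_iff_index_eq nth_mem)
    qed
    then show ?thesis using w by (auto simp: walk_def)
  qed
  have ext: "walk ?T vs es" if "walk \<Theta> vs es" for vs es using that by (auto simp: walk_def)
  have uniq: "\<exists>!w. walk \<Theta> (fst w) (snd w) \<and> hd (fst w) = u \<and> last (fst w) = v" if "u \<in> V" "v \<in> V" for u v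
    using T that by (auto simp: hypertree_on_def)
  have l_not: "l \<notin> set vs" if w: "walk \<Theta> vs es" "hd vs \<in> V" for vs es using that
  proof (induction vs arbitrary: es)
    case (Cons a vs)
    show ?case
    proof (cases vs)
      case Nil then show ?thesis using Cons k by auto
    next
      case (Cons b us)
      then obtain e es' where "walk \<Theta> (b # us) es'" "e \<in> \<Theta>" "b \<in> e" using Cons.prems by (auto simp: walk_Cons2)
      then show ?thesis using Cons.IH[of es'] Cons EV Cons.prems k by auto
    qed
  qed auto
  have inV: "\<exists>!w. walk ?T (fst w) (snd w) \<and> hd (fst w) = u \<and> last (fst w) = v" if "u \<in> V" "v \<in> V" for u v
  proof -
    have "walk ?T vs es \<and> hd vs = u \<and> last vs = v \<longleftrightarrow> walk \<Theta> vs es \<and> hd vs = u \<and> last vs = v" for vs es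
      using no_l[of vs es] restr[of vs es] ext[of vs es] that k by blast
    then show ?thesis using uniq[OF that] by simp
  qed
  have fromL: "\<exists>!w. walk ?T (fst w) (snd w) \<and> hd (fst w) = l \<and> last (fst w) = v" if v: "v \<in> V" for v
  proof -
    obtain w where w: "walk \<Theta> (fst w) (snd w)" "hd (fst w) = k" "last (fst w) = v"
       and wu: "\<And>w'. walk \<Theta> (fst w') (snd w') \<and> hd (fst w') = k \<and> last (fst w') = v \<Longrightarrow> w' = w"
      using uniq[OF k(1) v] by auto
    have wn: "fst w \<noteq> []" using w by (auto simp: walk_def)
    have vl: "v \<noteq> l" "k \<noteq> l" using v k by auto
    show ?thesis
    proof (rule ex1I[of _ "(l # fst w, {k, l} # snd w)"])
      obtain us where us: "fst w = k # us" using w wn by (cases "fst w") auto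
      have "l \<notin> set (fst w)" using l_not[OF w(1)] w k by simp
      moreover have "{k, l} \<notin> set (snd w)" using w EV k by (auto simp: walk_def)
      ultimately show "walk ?T (fst (l # fst w, {k, l} # snd w)) (snd (l # fst w, {k, l} # snd w)) \<and>
          hd (fst (l # fst w, {k, l} # snd w)) = l \<and> last (fst (l # fst w, {k, l} # snd w)) = v"
        using w ext us by (auto simp: walk_Cons2)
      fix w' assume w': "walk ?T (fst w') (snd w') \<and> hd (fst w') = l \<and> last (fst w') = v"
      obtain vs es where we: "w' = (vs, es)" by force
      obtain b us' where vs: "vs = l # b # us'" using w' we vl by (cases vs; cases "tl vs") (auto simp: walk_def)
      then obtain e es' where e: "es = e # es'" "e \<in> ?T" "l \<in> e" "b \<in> e" "l \<noteq> b" "l \<notin> set us'" "walk ?T (b # us') es'"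
        using w' we by (auto simp: walk_Cons2)
      have b: "e = {k, l}" "b = k" using lE e by auto
      have "walk \<Theta> (k # us') es'" using restr[of "k # us'" es'] e b by auto
      then have "(k # us', es') = w" using wu[of "(k # us', es')"] w' we vs b by auto
      then show "w' = (l # fst w, {k, l} # snd w)" using we vs b e by auto
    qed
  qed
  have toL: "\<exists>!w. walk ?T (fst w) (snd w) \<and> hd (fst w) = v \<and> last (fst w) = l" if v: "v \<in> V" for v
  proof -
    obtain w where w: "walk ?T (fst w) (snd w)" "hd (fst w) = l" "last (fst w) = v"
       and wu: "\<And>w'. walk ?T (fst w') (snd w') \<and> hd (fst w') = l \<and> last (fst w') = v \<Longrightarrow> w' = w"
      using fromL[OF v] by auto
    have ne: "vs \<noteq> []" if "walk ?T vs es" for vs es using that by (simp add: walk_def)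
    show ?thesis
    proof (rule ex1I[of _ "(rev (fst w), rev (snd w))"])
      show "walk ?T (fst (rev (fst w), rev (snd w))) (snd (rev (fst w), rev (snd w))) \<and>
        hd (fst (rev (fst w), rev (snd w))) = v \<and> last (fst (rev (fst w), rev (snd w))) = l"
        using w walk_rev ne[OF w(1)] by (auto simp: hd_rev last_rev)
      fix w' assume w': "walk ?T (fst w') (snd w') \<and> hd (fst w') = v \<and> last (fst w') = l"
      have "(rev (fst w'), rev (snd w')) = w"
        using wu[of "(rev (fst w'), rev (snd w'))"] w' walk_rev[of ?T "fst w'" "snd w'"] ne by (auto simp: hd_rev last_rev)
      then show "w' = (rev (fst w), rev (snd w))" by auto
    qed
  qed
  have LL: "\<exists>!w. walk ?T (fst w) (snd w) \<and> hd (fst w) = l \<and> last (fst w) = l"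
  proof (rule ex1I[of _ "([l], [])"])
    fix w' assume w': "walk ?T (fst w') (snd w') \<and> hd (fst w') = l \<and> last (fst w') = l"
    then show "w' = ([l], [])" using walk_closed_single[of ?T "fst w'" "snd w'"] by (auto simp: prod_eq_iff)
  qed auto
  have c2: "card {k, l} = 2" using k by (cases "k = l") auto
  have T1: "\<forall>E\<in>\<Theta>. E \<subseteq> V \<and> 2 \<le> card E" using T unfolding hypertree_on_def by (rule conjunct1)
  have A: "\<forall>E\<in>?T. E \<subseteq> insert l V \<and> 2 \<le> card E"
  proof
    fix E assume "E \<in> ?T"
    then consider "E = {k, l}" | "E \<in> \<Theta>" by (elim insertE)
    then show "E \<subseteq> insert l V \<and> 2 \<le> card E"
    proof cases
      case 1 show ?thesis unfolding 1 using c2 k(1) by simp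
    next
      case 2 show ?thesis using bspec[OF T1 2] by (simp add: subset_insertI2)
    qed
  qed
  have B: "\<exists>!w. walk ?T (fst w) (snd w) \<and> hd (fst w) = u \<and> last (fst w) = v"
    if u: "u \<in> insert l V" and v: "v \<in> insert l V" for u v
  proof (cases "u = l"; cases "v = l")
    assume "u = l" "v = l" then show ?thesis using LL by (simp only:)
  next
    assume "u = l" "v \<noteq> l" then show ?thesis using fromL v by (simp only: insert_iff simp_thms)
  next
    assume "u \<noteq> l" "v = l" then show ?thesis using toL u by (simp only: insert_iff simp_thms)
  next
    assume "u \<noteq> l" "v \<noteq> l" then show ?thesis using inV u v by (simp only: insert_iff simp_thms)
  qed
  show ?thesis unfolding hypertree_on_def by (rule conjI[OF A], intro ballI, rule B)
qed

text \<open>Rooting the hypertree at the vertex 1, every hyperedge is the last one of the walk from 1 to some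
  other vertex.\<close>

lemma card_HT_less:
  assumes "\<Theta> \<in> HT n" "n \<ge> 1" shows "card \<Theta> < n"
proof -
  note H = assms(1)[unfolded HT_def mem_Collect_eq]
  have E2: "E \<subseteq> {1..n}" "card E \<ge> 2" if "E \<in> \<Theta>" for E using bspec[OF conjunct1[OF H] that] by blast+
  have ex: "\<exists>!w. walk \<Theta> (fst w) (snd w) \<and> hd (fst w) = u \<and> last (fst w) = v" if "u \<in> {1..n}" "v \<in> {1..n}" for u v
    by (rule bspec[OF bspec[OF conjunct2[OF H] that(1)] that(2)])
  \<comment> \<open>The unique walk from the root 1 to \<open>v\<close>; uniqueness makes its last
    hyperedge a function of \<open>v\<close>.\<close>
  define W where "W v = (THE w. walk \<Theta> (fst w) (snd w) \<and> hd (fst w) = 1 \<and> last (fst w) = v)" for v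
  have Wv: "W v = (vs, es)" if "v \<in> {1..n}" "walk \<Theta> vs es" "hd vs = 1" "last vs = v" for v vs es
    unfolding W_def by (rule the1_equality[OF ex]) (use that assms in auto)
  have last_in: "last vs \<in> {1..n} - {1}" if "walk \<Theta> vs es" "hd vs = 1" "es \<noteq> []" for vs es
  proof -
    have l: "length es = length vs - 1" "vs \<noteq> []" using that by (auto simp: walk_def)
    define m where "m = length es - 1"
    have m: "m < length es" "Suc m = length vs - 1" using l that(3) by (cases vs; cases es; auto simp: m_def)+
    have "\<forall>k<length es. vs ! k \<in> es ! k \<and> vs ! Suc k \<in> es ! k" "set es \<subseteq> \<Theta>" using that by (auto simp: walk_def)
    then have "vs ! Suc m \<in> es ! m" "es ! m \<in> \<Theta>" using m(1) nth_mem by blast+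
    moreover have "last vs = vs ! Suc m" using l m by (simp add: last_conv_nth)
    moreover have "last vs \<noteq> 1" using walk_closed_single[OF that(1)] that by auto
    moreover have "vs ! Suc m \<in> {1..n}" using calculation E2(1) by blast
    ultimately show ?thesis by simp
  qed
  have uniq: "es = es'" if h: "walk \<Theta> vs es" "walk \<Theta> vs' es'" "hd vs = u" "hd vs' = u" "last vs = v" "last vs' = v"
      "u \<in> {1..n}" "v \<in> {1..n}" for vs vs' es es' u v
  proof -
    obtain z where z: "\<And>w. walk \<Theta> (fst w) (snd w) \<and> hd (fst w) = u \<and> last (fst w) = v \<Longrightarrow> w = z"
      using ex[OF h(7,8)] by blast
    show ?thesis using z[of "(vs, es)"] z[of "(vs', es')"] h by simp
  qed
  have last_edge: "\<exists>vs es. walk \<Theta> vs es \<and> hd vs = 1 \<and> es \<noteq> [] \<and> last es = E" if E: "E \<in> \<Theta>" for E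
  proof -
    have "\<not> card E \<le> Suc 0" "finite E" using E2[OF E] finite_subset by auto
    then obtain u v where uv: "u \<in> E" "v \<in> E" "u \<noteq> v" using card_le_Suc0_iff_eq[of E] by auto
    have "u \<in> {1..n}" "1 \<in> {1..n}" using uv E2(1)[OF E] assms(2) by auto
    then obtain w' where "walk \<Theta> (fst w') (snd w')" "hd (fst w') = 1" "last (fst w') = u" using ex[of 1 u] by blast
    then obtain vs es where w: "walk \<Theta> vs es" "hd vs = 1" "last vs = u" by blast
    have l: "length es = length vs - 1" "vs \<noteq> []" using w by (auto simp: walk_def)
    show ?thesis
    \<comment> \<open>A walk to \<open>u\<close> containing \<open>E\<close> is cut off right after
      \<open>E\<close>; otherwise it is prolonged through \<open>E\<close> to
      \<open>v\<close>.\<close>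
    proof (cases "E \<in> set es")
      case True
      then obtain m where m: "m < length es" "es ! m = E" by (auto simp: in_set_conv_nth)
      have "walk \<Theta> (take (Suc (Suc m)) vs) (take (Suc m) es)" using walk_take[OF w(1), of "Suc m"] m by simp
      moreover have "last (take (Suc m) es) = E" using m by (simp add: take_Suc_conv_app_nth)
      moreover have "hd (take (Suc (Suc m)) vs) = 1" using w l by (simp add: hd_take)
      moreover have "take (Suc m) es \<noteq> []" using m by auto
      ultimately show ?thesis by blast
    next
      case False
      show ?thesis
      proof (cases "v \<in> set vs")
        case False
        have "walk \<Theta> (vs @ [v]) (es @ [E])" using walk_snoc[OF w(1) E \<open>E \<notin> set es\<close> False] w uv by simp
        moreover have "hd (vs @ [v]) = 1" "last (es @ [E]) = E" "es @ [E] \<noteq> []" using w l by auto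
        ultimately show ?thesis by blast
      next
        case True
        then obtain m where m: "m < length vs" "vs ! m = v" by (auto simp: in_set_conv_nth)
        have vn: "v \<in> {1..n}" using uv E2(1)[OF E] by auto
        have "walk \<Theta> (drop m vs) (drop m es)" using walk_drop[OF w(1)] m l by simp
        moreover have "hd (drop m vs) = v" "last (drop m vs) = u" using m w by (auto simp: hd_drop_conv_nth)
        moreover have "walk \<Theta> [v, u] [E]" using uv E by (auto simp: walk_Cons2)
        \<comment> \<open>If \<open>v\<close> was visited already, the rest of the walk and the
          one-step walk inside \<open>E\<close> both lead from \<open>v\<close> to \<open>u\<close>.
          Uniqueness then puts \<open>E\<close> into the walk, contrary to the case
          assumption.\<close>
        ultimately have "drop m es = [E]" using uniq[of "drop m vs" "drop m es" "[v, u]" "[E]" v u] \<open>u \<in> {1..n}\<close> vn by simp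
        then have "E \<in> set (drop m es)" by simp
        then show ?thesis using \<open>E \<notin> set es\<close> in_set_dropD[of E m es] by blast
      qed
    qed
  qed
  \<comment> \<open>The root is left out because a walk whose last hyperedge exists cannot end where
    it started. This is the source of the strict inequality.\<close>
  have "\<Theta> \<subseteq> (\<lambda>v. last (snd (W v))) ` ({1..n} - {1})"
  proof (intro subsetI)
    fix E assume "E \<in> \<Theta>"
    obtain vs es where w: "walk \<Theta> vs es" "hd vs = 1" "es \<noteq> []" "last es = E" using last_edge[OF \<open>E \<in> \<Theta>\<close>] by blast
    have "last vs \<in> {1..n} - {1}" using last_in w by blast
    moreover have "last (snd (W (last vs))) = E" using Wv[of "last vs" vs es] w calculation by auto
    ultimately show "E \<in> (\<lambda>v. last (snd (W v))) ` ({1..n} - {1})" by blast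
  qed
  then have "card \<Theta> \<le> card ((\<lambda>v. last (snd (W v))) ` ({1..n} - {1}))" by (intro card_mono) auto
  also have "\<dots> \<le> card ({1..n} - {1})" by (intro card_image_le) auto
  finally have "card \<Theta> \<le> card ({1..n} - {1})" .
  then show ?thesis using assms by simp
qed

section \<open>Folds and the number of hyperedges\<close>

text \<open>Two hyperedges disappear and at most one is new: for an arbitrary set of hyperedges the
  union may already be present, hence an inequality and not an exact count.\<close>

lemma fold_step_card: "fold_step \<Lambda> \<Theta> \<Longrightarrow> finite \<Lambda> \<Longrightarrow> finite \<Theta> \<and> card \<Theta> < card \<Lambda>"
proof -
  assume "fold_step \<Lambda> \<Theta>" "finite \<Lambda>"
  then obtain E F where EF: "E \<in> \<Lambda>" "F \<in> \<Lambda>" "E \<noteq> F" "\<Theta> = (\<Lambda> - {E, F}) \<union> {E \<union> F}" by (auto simp: fold_step_def)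
  have "card (\<Lambda> - {E, F}) = card \<Lambda> - 2" using EF by (subst card_Diff_subset) auto
  moreover have "card {E, F} \<le> card \<Lambda>" using EF \<open>finite \<Lambda>\<close> by (intro card_mono) auto
  moreover have "card \<Theta> \<le> card (\<Lambda> - {E, F}) + 1" using card_Un_le[of "\<Lambda> - {E, F}" "{E \<union> F}"] EF by simp
  ultimately show ?thesis using EF \<open>finite \<Lambda>\<close> by auto
qed

lemma ht_le_card: "ht_le \<Theta> \<Lambda> \<Longrightarrow> finite \<Lambda> \<Longrightarrow> \<Theta> = \<Lambda> \<or> card \<Theta> < card \<Lambda>"
proof -
  assume "ht_le \<Theta> \<Lambda>" "finite \<Lambda>"
  then have "fold_step\<^sup>*\<^sup>* \<Lambda> \<Theta>" by (simp add: ht_le_def)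
  then have "finite \<Theta> \<and> (\<Theta> = \<Lambda> \<or> card \<Theta> < card \<Lambda>)"
  proof (induction)
    case (step y z) then show ?case using fold_step_card[of y z] by auto
  qed (use \<open>finite \<Lambda>\<close> in auto)
  then show ?thesis by simp
qed

lemma finite_HT_mem: "\<Theta> \<in> HT n \<Longrightarrow> finite \<Theta>"
  by (rule finite_subset[of _ "Pow {1..n}"]) (auto simp: HT_def)

lemma finite_HT: "finite (HT n)"
  by (rule finite_subset[of _ "Pow (Pow {1..n})"]) (auto simp: HT_def)

section \<open>Hypertrees on four vertices\<close>

text \<open>A labelling of the four vertices. Statements are proved for one labelling and carried
  over by permuting the labels, and the final count is a sum over labellings.\<close>

definition quad :: "nat \<Rightarrow> nat \<Rightarrow> nat \<Rightarrow> nat \<Rightarrow> bool" where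
  "quad i j k l \<longleftrightarrow> distinct [i, j, k, l] \<and> {1..4} = {i, j, k, l}"

lemma quad_perm:
  assumes "quad i j k l" shows "quad j i k l" "quad l k j i" "quad i j l k" "quad i k j l" "quad k j i l" "quad l j k i"
  using assms unfolding quad_def by (simp_all only:) (auto)

lemma quad_rearrange:
  assumes q: "quad i j k l" and e: "{a, b, c, d} = {i, j, k, l}" shows "quad a b c d"
proof -
  have "card {i, j, k, l} = 4" using q by (auto simp: quad_def card_insert_if)
  then have "card (set [a, b, c, d]) = length [a, b, c, d]" using e by simp
  then have "distinct [a, b, c, d]" by (rule card_distinct)
  then show ?thesis using q e by (simp only: quad_def)
qed

text \<open>\<open>RT k l\<close>: the leaf \<open>l\<close> attached at \<open>k\<close>; \<open>ST k\<close>: the star with centre \<open>k\<close>; \<open>PT i j k l\<close>: the path.\<close>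

definition T0 :: hyp where "T0 = {{1..4}}"
definition RT :: "nat \<Rightarrow> nat \<Rightarrow> hyp" where "RT k l = {{1..4} - {l}, {k, l}}"
definition ST :: "nat \<Rightarrow> hyp" where "ST k = (\<lambda>m. {k, m}) ` ({1..4} - {k})"
definition PT :: "nat \<Rightarrow> nat \<Rightarrow> nat \<Rightarrow> nat \<Rightarrow> hyp" where "PT i j k l = {{i, j}, {j, k}, {k, l}}"

text \<open>Since complementary sets give the same outer class, singletons represent every partial
  conjugation on four letters that is not inner.\<close>

abbreviation xx :: "nat \<Rightarrow> nat \<Rightarrow> outel" where "xx k l \<equiv> xo 4 k {l}"

lemma PT_rev: "PT i j k l = PT l k j i"
  by (auto simp: PT_def insert_commute)

lemma RT_quad: "quad i j k l \<Longrightarrow> RT k l = {{i, j, k}, {k, l}}"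
  by (auto simp: RT_def quad_def)
lemma ST_quad: "quad i j k l \<Longrightarrow> ST k = {{k, i}, {k, j}, {k, l}}"
  by (auto simp: ST_def quad_def)

lemma T0_HT: "T0 \<in> HT 4"
  unfolding HT_iff T0_def by (rule hypertree_on_single_edge) auto

lemma RT_HT: assumes q: "quad i j k l" shows "RT k l \<in> HT 4"
proof -
  have "hypertree_on {i, j, k} {{i, j, k}}" using q by (intro hypertree_on_single_edge) (auto simp: quad_def)
  then have "hypertree_on (insert l {i, j, k}) (insert {k, l} {{i, j, k}})"
    by (rule hypertree_on_leaf) (use q in \<open>auto simp: quad_def\<close>)
  moreover have "insert l {i, j, k} = {1..4}" "insert {k, l} {{i, j, k}} = RT k l"
    using q unfolding RT_quad[OF q] unfolding quad_def by (simp_all only:) auto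
  ultimately show ?thesis by (simp add: HT_iff)
qed

lemma ST_HT: assumes q: "quad i j k l" shows "ST k \<in> HT 4"
proof -
  have d: "i \<noteq> j" "i \<noteq> k" "i \<noteq> l" "j \<noteq> k" "j \<noteq> l" "k \<noteq> l" using q by (auto simp: quad_def)
  have "hypertree_on {k, i} {{k, i}}" using d by (intro hypertree_on_single_edge) auto
  then have "hypertree_on (insert j {k, i}) (insert {k, j} {{k, i}})" by (rule hypertree_on_leaf) (use d in auto)
  then have "hypertree_on (insert l (insert j {k, i})) (insert {k, l} (insert {k, j} {{k, i}}))"
    by (rule hypertree_on_leaf) (use d in auto)
  moreover have "insert l (insert j {k, i}) = {1..4}" "(insert {k, l} (insert {k, j} {{k, i}})) = ST k"
    using q unfolding ST_quad[OF q] unfolding quad_def by (simp_all only:) auto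
  ultimately show ?thesis by (simp add: HT_iff)
qed

lemma PT_HT: assumes q: "quad i j k l" shows "PT i j k l \<in> HT 4"
proof -
  have d: "i \<noteq> j" "i \<noteq> k" "i \<noteq> l" "j \<noteq> k" "j \<noteq> l" "k \<noteq> l" using q by (auto simp: quad_def)
  have "hypertree_on {j, k} {{j, k}}" using d by (intro hypertree_on_single_edge) auto
  then have "hypertree_on (insert i {j, k}) (insert {j, i} {{j, k}})" by (rule hypertree_on_leaf) (use d in auto)
  then have "hypertree_on (insert l (insert i {j, k})) (insert {k, l} (insert {j, i} {{j, k}}))"
    by (rule hypertree_on_leaf) (use d in auto)
  moreover have "insert l (insert i {j, k}) = {1..4}"
    using q unfolding quad_def by (simp_all only:) auto
  moreover have "(insert {k, l} (insert {j, i} {{j, k}})) = PT i j k l" by (auto simp: PT_def insert_commute)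
  ultimately show ?thesis by (simp add: HT_iff)
qed

lemma card_T0: "card T0 = 1" by (simp add: T0_def)
lemma card_RT: assumes q: "quad i j k l" shows "card (RT k l) = 2"
proof -
  have "{i, j, k} \<noteq> {k, l}" using q by (auto simp: quad_def)
  then show ?thesis unfolding RT_quad[OF q] by simp
qed
lemma card_ST: assumes q: "quad i j k l" shows "card (ST k) = 3"
  unfolding ST_quad[OF q] using q by (auto simp: quad_def doubleton_eq_iff card_insert_if)
lemma card_PT: assumes q: "quad i j k l" shows "card (PT i j k l) = 3"
  unfolding PT_def using q by (auto simp: quad_def doubleton_eq_iff card_insert_if)

lemma fold_stepI: "E \<in> \<Lambda> \<Longrightarrow> F \<in> \<Lambda> \<Longrightarrow> E \<noteq> F \<Longrightarrow> E \<inter> F \<noteq> {} \<Longrightarrow> ht_le ((\<Lambda> - {E, F}) \<union> {E \<union> F}) \<Lambda>"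
  unfolding ht_le_def fold_step_def by blast

lemma T0_le_RT: assumes q: "quad i j k l" shows "ht_le T0 (RT k l)"
proof -
  have "ht_le ((RT k l - {{i, j, k}, {k, l}}) \<union> {{i, j, k} \<union> {k, l}}) (RT k l)"
    unfolding RT_quad[OF q] using q by (intro fold_stepI) (auto simp: quad_def)
  moreover have "(RT k l - {{i, j, k}, {k, l}}) \<union> {{i, j, k} \<union> {k, l}} = T0"
  proof -
    have "{i, j, k} \<union> {k, l} = {1..4}" using q unfolding quad_def by (simp only:) auto
    then show ?thesis unfolding RT_quad[OF q] T0_def by simp
  qed
  ultimately show ?thesis by simp
qed

lemma RT_le_ST: assumes q: "quad i j k l" shows "ht_le (RT k l) (ST k)"
proof -
  have d: "{k, i} \<noteq> {k, j}" "{k, l} \<noteq> {k, i}" "{k, l} \<noteq> {k, j}" using q by (auto simp: quad_def doubleton_eq_iff)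
  have "ht_le ((ST k - {{k, i}, {k, j}}) \<union> {{k, i} \<union> {k, j}}) (ST k)"
    unfolding ST_quad[OF q] using d by (intro fold_stepI) auto
  moreover have "(ST k - {{k, i}, {k, j}}) \<union> {{k, i} \<union> {k, j}} = RT k l"
    unfolding ST_quad[OF q] RT_quad[OF q] using d by auto
  ultimately show ?thesis by simp
qed

lemma RT_le_PT: assumes q: "quad i j k l" shows "ht_le (RT k l) (PT i j k l)"
proof -
  have d: "{i, j} \<noteq> {j, k}" "{k, l} \<noteq> {i, j}" "{k, l} \<noteq> {j, k}" using q by (auto simp: quad_def doubleton_eq_iff)
  have "ht_le ((PT i j k l - {{i, j}, {j, k}}) \<union> {{i, j} \<union> {j, k}}) (PT i j k l)"
    unfolding PT_def using d by (intro fold_stepI) auto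
  moreover have "(PT i j k l - {{i, j}, {j, k}}) \<union> {{i, j} \<union> {j, k}} = RT k l"
    unfolding PT_def RT_quad[OF q] using d by auto
  ultimately show ?thesis by simp
qed

lemma ht_le_trans: "ht_le A B \<Longrightarrow> ht_le B C \<Longrightarrow> ht_le A C"
  unfolding ht_le_def by (rule rtranclp_trans)

section \<open>Carried partial conjugations on four vertices\<close>

text \<open>Every walk that leaves \<open>l\<close> has \<open>k\<close> as its second vertex,
  because each hyperedge containing \<open>l\<close> is \<open>{k, l}\<close>.\<close>

lemma carries_leaf: assumes "\<And>E. E \<in> \<Theta> \<Longrightarrow> l \<in> E \<Longrightarrow> E = {k, l}" "k \<noteq> l" shows "carries n \<Theta> k {l}"
  unfolding carries_def
proof (intro ballI allI impI)
  fix d j vs es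
  assume "d \<in> {l}" and j: "j \<in> {1..n} - ({l} \<union> {k})" and w: "walk \<Theta> vs es \<and> hd vs = d \<and> last vs = j"
  then have w': "walk \<Theta> vs es" "hd vs = l" "last vs \<noteq> l" by auto
  then obtain b us where vs: "vs = l # b # us" by (cases vs; cases "tl vs") (auto simp: walk_def)
  then obtain e where "e \<in> \<Theta>" "l \<in> e" "b \<in> e" "l \<noteq> b" using w' by (auto simp: walk_Cons2)
  then have "b = k" using assms(1)[of e] by auto
  then show "k \<in> set vs" using vs by simp
qed

text \<open>Two vertices of one hyperedge form a walk of length one, which avoids \<open>m\<close>
  unless \<open>m\<close> is an endpoint. So a carried set cannot separate such vertices; this is
  the tool for bounding carried groups from above.\<close>

lemma carries_adj: assumes "carries n \<Theta> m D" "E \<in> \<Theta>" "d \<in> E" "e \<in> E" "d \<noteq> m" "e \<noteq> m" "d \<in> D" "e \<in> {1..n}" shows "e \<in> D"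
proof (rule ccontr)
  assume "e \<notin> D"
  then have "walk \<Theta> [d, e] [E]" using assms by (auto simp: walk_Cons2)
  then have "m \<in> set [d, e]" using assms \<open>e \<notin> D\<close> unfolding carries_def by (metis DiffI UnE hd_Cons_tl last.simps list.distinct(1) list.sel(1) singletonD)
  then show False using assms by simp
qed

lemma carries_adj_iff: assumes "carries n \<Theta> m D" "E \<in> \<Theta>" "d \<in> E" "e \<in> E" "d \<in> {1..n}" "e \<in> {1..n}" "d \<noteq> m" "e \<noteq> m"
  shows "d \<in> D \<longleftrightarrow> e \<in> D"
  using carries_adj[OF assms(1-4) assms(7,8)] carries_adj[OF assms(1,2,4,3) assms(8,7)] assms(5,6) by blast

lemma is_pc_single: "quad i j k l \<Longrightarrow> is_pc 4 k {l}"
  by (auto simp: is_pc_def quad_def)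

lemma carries_RT: assumes q: "quad i j k l" shows "carries 4 (RT k l) k {l}"
  by (rule carries_leaf) (use q RT_quad[OF q] in \<open>auto simp: quad_def\<close>)
lemma carries_ST: assumes q: "quad i j k l" shows "carries 4 (ST k) k {l}"
  by (rule carries_leaf) (use q ST_quad[OF q] in \<open>auto simp: quad_def\<close>)
lemma carries_PT: assumes q: "quad i j k l" shows "carries 4 (PT i j k l) k {l}"
  by (rule carries_leaf) (use q in \<open>auto simp: quad_def PT_def\<close>)

lemma xx_carried: assumes q: "quad i j k l"
  shows "xx k l \<in> carried_out 4 (RT k l)" "xx k l \<in> carried_out 4 (ST k)" "xx k l \<in> carried_out 4 (PT i j k l)"
     "xx j i \<in> carried_out 4 (PT i j k l)"
  using carried_gen[OF is_pc_single[OF q]] carries_RT[OF q] carries_ST[OF q] carries_PT[OF q]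
    carried_gen[OF is_pc_single[OF quad_perm(2)[OF q]]] carries_PT[OF quad_perm(2)[OF q]] PT_rev[of l k j i] by simp_all

lemma xx_Out0: "quad i j k l \<Longrightarrow> xx k l \<in> Out0 4"
  using is_pc_xo is_pc_single by blast
lemma xx_square: "quad i j k l \<Longrightarrow> out_mult 4 (xx k l) (xx k l) = out_one 4"
  using is_pc_xo is_pc_single by blast

lemma quad_in: "quad i j k l \<Longrightarrow> i \<in> {1..4} \<and> j \<in> {1..4} \<and> k \<in> {1..4} \<and> l \<in> {1..4}"
  by (auto simp: quad_def)

lemma xo_compl4: assumes q: "quad i j k l" 
  shows "xo 4 k {i, j, l} = out_one 4" "xo 4 k {i, j} = xx k l" "xo 4 k {i, l} = xx k j" "xo 4 k {j, l} = xx k i" "xo 4 k {} = out_one 4"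
proof -
  have V: "{1..4} - {k} = {i, j, l}" using q unfolding quad_def by (simp only:) auto
  have d: "i \<noteq> j" "i \<noteq> k" "i \<noteq> l" "j \<noteq> k" "j \<noteq> l" "k \<noteq> l" using q by (auto simp: quad_def)
  have k: "k \<in> {1..4}" using quad_in q by blast
  note c = xo_compl[of k 4, OF k, unfolded V]
  have s: "{i, j, l} - {l} = {i, j}" "{i, j, l} - {j} = {i, l}" "{i, j, l} - {i} = {j, l}" using d by auto
  show "xo 4 k {i, j, l} = out_one 4" "xo 4 k {i, j} = xx k l" "xo 4 k {i, l} = xx k j" "xo 4 k {j, l} = xx k i" "xo 4 k {} = out_one 4"
    using c[of "{}"] c[of "{l}"] c[of "{j}"] c[of "{i}"] d s xo_empty[OF k] by auto
qed

lemma xx_xx: assumes q: "quad i j k l" shows "out_mult 4 (xx k i) (xx k j) = xx k l"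
proof -
  have "out_mult 4 (xx k i) (xx k j) = xo 4 k (({i} - {j}) \<union> ({j} - {i}))"
    using q quad_in[OF q] by (intro xo_xo) (auto simp: quad_def)
  also have "({i} - {j}) \<union> ({j} - {i}) = {i, j}" using q by (auto simp: quad_def)
  finally show ?thesis using xo_compl4(2)[OF q] by simp
qed

lemma xx_commute: assumes q: "quad i j k l" shows "out_mult 4 (xx j i) (xx k l) = out_mult 4 (xx k l) (xx j i)"
  using q quad_in[OF q] by (intro xo_commute) (auto simp: quad_def)

lemma xx_nontrivial: assumes q: "quad i j k l" shows "xx k l \<noteq> out_one 4"
proof
  assume "xx k l = out_one 4"
  moreover have "pc 4 k {l} \<in> Aut0 4" "pc 4 k {l} [i] = [i]" "pc 4 k {l} [j] = [j]" "pc 4 k {l} [l] = [k, l, k]"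
    using q quad_in[OF q] by (auto simp: quad_def pc_single intro!: pc_Aut0)
  moreover have "i \<noteq> j" using q by (auto simp: quad_def)
  ultimately have "pc 4 k {l} = ident 4" using out_class_trivial[of "pc 4 k {l}" 4 i j] quad_in[OF q] by blast
  then show False using \<open>pc 4 k {l} [l] = _\<close> quad_in[OF q] by (auto simp: ident_def)
qed

lemma xx_xx_nontrivial: assumes q: "quad i j k l" shows "out_mult 4 (xx j i) (xx k l) \<noteq> out_one 4"
proof
  have d: "i \<noteq> j" "i \<noteq> k" "i \<noteq> l" "j \<noteq> k" "j \<noteq> l" "k \<noteq> l" using q by (auto simp: quad_def)
  note I = quad_in[OF q]
  let ?h = "compose (Wn 4) (pc 4 j {i}) (pc 4 k {l})"
  have A: "pc 4 j {i} \<in> Aut0 4" "pc 4 k {l} \<in> Aut0 4" using d I by (auto intro!: pc_Aut0)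
  assume "out_mult 4 (xx j i) (xx k l) = out_one 4"
  then have "out_class 4 ?h = out_one 4" using A by (simp add: out_mult_class)
  moreover have "?h \<in> Aut0 4" using A by (rule Aut0_compose)
  moreover have "?h [j] = [j]" "?h [k] = [k]" "?h [i] = [j, i, j]" using d I by (auto simp: compose_def pc_single)
  ultimately have "?h = ident 4" using out_class_trivial[of ?h 4 j k] d I by auto
  then show False using \<open>?h [i] = _\<close> I by (auto simp: ident_def)
qed

lemma carried_subset:
  assumes "out_one n \<in> A" "\<And>i D. is_pc n i D \<Longrightarrow> carries n \<Theta> i D \<Longrightarrow> xo n i D \<in> B" "\<And>b a. b \<in> B \<Longrightarrow> a \<in> A \<Longrightarrow> out_mult n b a \<in> A"
  shows "carried_out n \<Theta> \<subseteq> A"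
proof
  fix \<gamma> assume "\<gamma> \<in> carried_out n \<Theta>" then show "\<gamma> \<in> A"
    by (induction rule: carried_induct) (use assms in auto)
qed

lemma subset_three_cases:
  assumes "D \<subseteq> {a, b, c}"
  obtains "D = {}" | "D = {a}" | "D = {b}" | "D = {c}" | "D = {a, b}" | "D = {a, c}" | "D = {b, c}" | "D = {a, b, c}"
proof -
  have D: "D = (if a \<in> D then {a} else {}) \<union> (if b \<in> D then {b} else {}) \<union> (if c \<in> D then {c} else {})"
    using assms by auto
  show ?thesis
    by (cases "a \<in> D"; cases "b \<in> D"; cases "c \<in> D"; insert D; simp only: if_True if_False Un_empty_left Un_empty_right)
       (use that in \<open>simp_all only: Un_insert_left Un_empty_left\<close>)
qed

text \<open>Each possible class is listed together with the pattern of memberships in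
  \<open>D\<close> producing it. Adjacency facts from \<open>carries_adj_iff\<close> then eliminate
  cases by propositional reasoning alone.\<close>

lemma xo_cases: assumes q: "quad i j m l" "is_pc 4 m D"
  shows "(xo 4 m D = out_one 4 \<or> xo 4 m D = xx m i \<and> (j \<in> D \<longleftrightarrow> l \<in> D) \<and> (i \<in> D \<longleftrightarrow> j \<notin> D)
     \<or> xo 4 m D = xx m j \<and> (i \<in> D \<longleftrightarrow> l \<in> D) \<and> (i \<in> D \<longleftrightarrow> j \<notin> D) \<or> xo 4 m D = xx m l \<and> (i \<in> D \<longleftrightarrow> j \<in> D) \<and> (l \<in> D \<longleftrightarrow> j \<notin> D))"
proof -
  have V: "{1..4} - {m} = {i, j, l}" using q(1) unfolding quad_def by (simp only:) auto
  then have "D \<subseteq> {i, j, l}" using q(2) by (auto simp: is_pc_def)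
  then show ?thesis
    by (rule subset_three_cases) (use xo_compl4[OF q(1)] q(1) in \<open>simp_all add: quad_def\<close>)
qed

lemma gens_T0: assumes "is_pc 4 m D" "carries 4 T0 m D" shows "xo 4 m D = out_one 4"
proof -
  obtain i j l where q: "quad i j m l"
  proof -
    have "m \<in> {1..4}" using assms by (auto simp: is_pc_def)
    then have "m = 1 \<or> m = 2 \<or> m = 3 \<or> m = 4" by auto
    then have "quad 2 3 m 4 \<or> quad 1 3 m 4 \<or> quad 1 2 m 4 \<or> quad 1 2 m 3"
      unfolding quad_def by (elim disjE) (auto)
    then show ?thesis using that by blast
  qed
  have adj: "d \<in> D \<longleftrightarrow> e \<in> D" if "d \<in> {1..4}" "e \<in> {1..4}" "d \<noteq> m" "e \<noteq> m" for d e
    by (rule carries_adj_iff[OF assms(2), of "{1..4}"]) (use that in \<open>simp_all add: T0_def\<close>)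
  have I: "i \<in> {1..4}" "j \<in> {1..4}" "l \<in> {1..4}" using quad_in[OF q] by blast+
  have d: "i \<noteq> m" "j \<noteq> m" "l \<noteq> m" using q by (auto simp: quad_def)
  have "i \<in> D \<longleftrightarrow> j \<in> D" "j \<in> D \<longleftrightarrow> l \<in> D" by (rule adj; rule I d)+
  then show ?thesis using xo_cases[OF q assms(1)] by argo
qed

text \<open>Only \<open>k\<close> is a cut vertex. After deletion of any other vertex the remaining
  three stay linked by the hyperedges, so \<open>D\<close> contains all or none of them and the
  class is trivial.\<close>

lemma gens_RT: assumes q: "quad i j k l" and m: "is_pc 4 m D" "carries 4 (RT k l) m D" shows "xo 4 m D \<in> {out_one 4, xx k l}"
proof -
  have d: "i \<noteq> j" "i \<noteq> k" "i \<noteq> l" "j \<noteq> k" "j \<noteq> l" "k \<noteq> l" using q by (auto simp: quad_def)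
  have I: "i \<in> {1..4}" "j \<in> {1..4}" "k \<in> {1..4}" "l \<in> {1..4}" using quad_in[OF q] by auto
  note adj = carries_adj_iff[OF m(2)]
  note R = RT_quad[OF q]
  have "m \<in> {i, j, k, l}" using m(1) q by (auto simp: is_pc_def quad_def)
  then consider "m = i" | "m = j" | "m = k" | "m = l" by blast
  then show ?thesis
  proof cases
    case 1
    have e0: "j \<in> D \<longleftrightarrow> k \<in> D" by (rule adj[of "{i,j,k}"]) (use d I 1 in \<open>simp_all add: R\<close>)
    have e1: "k \<in> D \<longleftrightarrow> l \<in> D" by (rule adj[of "{k,l}"]) (use d I 1 in \<open>simp_all add: R\<close>)
    have Q: "quad j k i l" by (rule quad_rearrange[OF q]) auto
    have P: "is_pc 4 i D" using m 1 by simp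
    show ?thesis using xo_cases[OF Q P] e0 e1 unfolding 1 insert_iff empty_iff by argo
  next
    case 2
    have e0: "i \<in> D \<longleftrightarrow> k \<in> D" by (rule adj[of "{i,j,k}"]) (use d I 2 in \<open>simp_all add: R\<close>)
    have e1: "k \<in> D \<longleftrightarrow> l \<in> D" by (rule adj[of "{k,l}"]) (use d I 2 in \<open>simp_all add: R\<close>)
    have Q: "quad i k j l" by (rule quad_rearrange[OF q]) auto
    have P: "is_pc 4 j D" using m 2 by simp
    show ?thesis using xo_cases[OF Q P] e0 e1 unfolding 2 insert_iff empty_iff by argo
  next
    case 3
    have e0: "i \<in> D \<longleftrightarrow> j \<in> D" by (rule adj[of "{i,j,k}"]) (use d I 3 in \<open>simp_all add: R\<close>)
    have Q: "quad i j k l" by (rule quad_rearrange[OF q]) auto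
    have P: "is_pc 4 k D" using m 3 by simp
    show ?thesis using xo_cases[OF Q P] e0 unfolding 3 insert_iff empty_iff by argo
  next
    case 4
    have e0: "i \<in> D \<longleftrightarrow> j \<in> D" by (rule adj[of "{i,j,k}"]) (use d I 4 in \<open>simp_all add: R\<close>)
    have e1: "j \<in> D \<longleftrightarrow> k \<in> D" by (rule adj[of "{i,j,k}"]) (use d I 4 in \<open>simp_all add: R\<close>)
    have Q: "quad i j l k" by (rule quad_rearrange[OF q]) auto
    have P: "is_pc 4 l D" using m 4 by simp
    show ?thesis using xo_cases[OF Q P] e0 e1 unfolding 4 insert_iff empty_iff by argo
  qed
qed

text \<open>The cut vertices of the path are \<open>j\<close> and \<open>k\<close>. The subpath of
  length one on the far side keeps two vertices together, which leaves the end vertex as the only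
  possible singleton.\<close>

lemma gens_PT: assumes q: "quad i j k l" and m: "is_pc 4 m D" "carries 4 (PT i j k l) m D" shows "xo 4 m D \<in> {out_one 4, xx j i, xx k l}"
proof -
  have d: "i \<noteq> j" "i \<noteq> k" "i \<noteq> l" "j \<noteq> k" "j \<noteq> l" "k \<noteq> l" using q by (auto simp: quad_def)
  have I: "i \<in> {1..4}" "j \<in> {1..4}" "k \<in> {1..4}" "l \<in> {1..4}" using quad_in[OF q] by auto
  note adj = carries_adj_iff[OF m(2)]
  have "m \<in> {i, j, k, l}" using m(1) q by (auto simp: is_pc_def quad_def)
  then consider "m = i" | "m = j" | "m = k" | "m = l" by blast
  then show ?thesis
  proof cases
    case 1
    have e0: "j \<in> D \<longleftrightarrow> k \<in> D" by (rule adj[of "{j,k}"]) (use d I 1 in \<open>simp_all add: PT_def\<close>)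
    have e1: "k \<in> D \<longleftrightarrow> l \<in> D" by (rule adj[of "{k,l}"]) (use d I 1 in \<open>simp_all add: PT_def\<close>)
    have Q: "quad j k i l" by (rule quad_rearrange[OF q]) auto
    have P: "is_pc 4 i D" using m 1 by simp
    show ?thesis using xo_cases[OF Q P] e0 e1 unfolding 1 insert_iff empty_iff by argo
  next
    case 2
    have e0: "k \<in> D \<longleftrightarrow> l \<in> D" by (rule adj[of "{k,l}"]) (use d I 2 in \<open>simp_all add: PT_def\<close>)
    have Q: "quad k l j i" by (rule quad_rearrange[OF q]) auto
    have P: "is_pc 4 j D" using m 2 by simp
    show ?thesis using xo_cases[OF Q P] e0 unfolding 2 insert_iff empty_iff by argo
  next
    case 3
    have e0: "i \<in> D \<longleftrightarrow> j \<in> D" by (rule adj[of "{i,j}"]) (use d I 3 in \<open>simp_all add: PT_def\<close>)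
    have Q: "quad i j k l" by (rule quad_rearrange[OF q]) auto
    have P: "is_pc 4 k D" using m 3 by simp
    show ?thesis using xo_cases[OF Q P] e0 unfolding 3 insert_iff empty_iff by argo
  next
    case 4
    have e0: "i \<in> D \<longleftrightarrow> j \<in> D" by (rule adj[of "{i,j}"]) (use d I 4 in \<open>simp_all add: PT_def\<close>)
    have e1: "j \<in> D \<longleftrightarrow> k \<in> D" by (rule adj[of "{j,k}"]) (use d I 4 in \<open>simp_all add: PT_def\<close>)
    have Q: "quad i j l k" by (rule quad_rearrange[OF q]) auto
    have P: "is_pc 4 l D" using m 4 by simp
    show ?thesis using xo_cases[OF Q P] e0 e1 unfolding 4 insert_iff empty_iff by argo
  qed
qed

lemma gens_ST: assumes q: "quad i j k l" and m: "is_pc 4 m D" "carries 4 (ST k) m D" shows "xo 4 m D \<in> {out_one 4, xx k i, xx k j, xx k l}"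
proof (cases "m = k")
  case True
  then show ?thesis using xo_cases[OF q] m unfolding insert_iff empty_iff by blast
next
  case False
  have d: "i \<noteq> j" "i \<noteq> k" "i \<noteq> l" "j \<noteq> k" "j \<noteq> l" "k \<noteq> l" using q by (auto simp: quad_def)
  have I: "i \<in> {1..4}" "j \<in> {1..4}" "k \<in> {1..4}" "l \<in> {1..4}" using quad_in[OF q] by auto
  note adj = carries_adj_iff[OF m(2)]
  note R = ST_quad[OF q]
  have "m \<in> {i, j, l}" using m(1) q False by (auto simp: is_pc_def quad_def)
  then consider "m = i" | "m = j" | "m = l" by blast
  then show ?thesis
  proof cases
    case 1
    have e0: "k \<in> D \<longleftrightarrow> j \<in> D" by (rule adj[of "{k,j}"]) (use d I 1 in \<open>simp_all add: R\<close>)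
    have e1: "k \<in> D \<longleftrightarrow> l \<in> D" by (rule adj[of "{k,l}"]) (use d I 1 in \<open>simp_all add: R\<close>)
    have Q: "quad j k i l" by (rule quad_rearrange[OF q]) auto
    have P: "is_pc 4 i D" using m 1 by simp
    show ?thesis using xo_cases[OF Q P] e0 e1 unfolding 1 insert_iff empty_iff by argo
  next
    case 2
    have e0: "k \<in> D \<longleftrightarrow> i \<in> D" by (rule adj[of "{k,i}"]) (use d I 2 in \<open>simp_all add: R\<close>)
    have e1: "k \<in> D \<longleftrightarrow> l \<in> D" by (rule adj[of "{k,l}"]) (use d I 2 in \<open>simp_all add: R\<close>)
    have Q: "quad i k j l" by (rule quad_rearrange[OF q]) auto
    have P: "is_pc 4 j D" using m 2 by simp
    show ?thesis using xo_cases[OF Q P] e0 e1 unfolding 2 insert_iff empty_iff by argo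
  next
    case 3
    have e0: "k \<in> D \<longleftrightarrow> i \<in> D" by (rule adj[of "{k,i}"]) (use d I 3 in \<open>simp_all add: R\<close>)
    have e1: "k \<in> D \<longleftrightarrow> j \<in> D" by (rule adj[of "{k,j}"]) (use d I 3 in \<open>simp_all add: R\<close>)
    have Q: "quad i j l k" by (rule quad_rearrange[OF q]) auto
    have P: "is_pc 4 l D" using m 3 by simp
    show ?thesis using xo_cases[OF Q P] e0 e1 unfolding 3 insert_iff empty_iff by argo
  qed
qed

section \<open>Carried groups on four vertices\<close>

text \<open>Consequently a vertex over \<open>T0\<close> determines its group element. This is what
  distinguishes different vertices over \<open>T0\<close> in the cycles around other
  vertices.\<close>

lemma carried_T0: "carried_out 4 T0 = {out_one 4}"
proof -
  have "carried_out 4 T0 \<subseteq> {out_one 4}"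
  proof (rule carried_subset[where B="{out_one 4}"])
    show "xo 4 i' D \<in> {out_one 4}" if "is_pc 4 i' D" "carries 4 T0 i' D" for i' D
      using gens_T0[OF that] by (simp only: singleton_iff)
  qed simp_all
  then show ?thesis using carried_one by blast
qed

lemma finite_carried_RT: assumes q: "quad i j k l" shows "finite (carried_out 4 (RT k l))"
proof -
  have "carried_out 4 (RT k l) \<subseteq> {out_one 4, xx k l}"
  proof (rule carried_subset[where B="{out_one 4, xx k l}"])
    show "xo 4 i' D \<in> {out_one 4, xx k l}" if "is_pc 4 i' D" "carries 4 (RT k l) i' D" for i' D
      using gens_RT[OF q that] .
    show "out_mult 4 b a \<in> {out_one 4, xx k l}" if "b \<in> {out_one 4, xx k l}" "a \<in> {out_one 4, xx k l}" for a b
      using that by (elim insertE emptyE) (simp_all add: xx_Out0[OF q] xx_square[OF q])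
  qed simp
  then show ?thesis using finite_subset by blast
qed

text \<open>The three generators multiply like the nonzero elements of a Klein four-group: the
  product of any two is the third.\<close>

lemma finite_carried_ST: assumes q: "quad i j k l" shows "finite (carried_out 4 (ST k))"
proof -
  have Q: "quad j l k i" "quad i l k j" "quad j i k l" "quad l j k i" "quad l i k j" by (rule quad_rearrange[OF q], blast)+
  define x y z where "x = xx k i" and "y = xx k j" and "z = xx k l"
  have O: "x \<in> Out0 4" "y \<in> Out0 4" "z \<in> Out0 4" unfolding x_def y_def z_def by (rule xx_Out0, fact q Q)+
  have s: "out_mult 4 x x = out_one 4" "out_mult 4 y y = out_one 4" "out_mult 4 z z = out_one 4"
    unfolding x_def y_def z_def by (rule xx_square, fact q Q)+
  have c: "out_mult 4 x y = z" "out_mult 4 y x = z" "out_mult 4 x z = y" "out_mult 4 z x = y" "out_mult 4 y z = x" "out_mult 4 z y = x"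
    unfolding x_def y_def z_def by (rule xx_xx, fact q Q)+
  have "carried_out 4 (ST k) \<subseteq> {out_one 4, x, y, z}"
  proof (rule carried_subset[where B="{out_one 4, x, y, z}"])
    show "xo 4 i D \<in> {out_one 4, x, y, z}" if "is_pc 4 i D" "carries 4 (ST k) i D" for i D
      unfolding x_def y_def z_def using gens_ST[OF q that] .
    show "out_mult 4 b a \<in> {out_one 4, x, y, z}" if "b \<in> {out_one 4, x, y, z}" "a \<in> {out_one 4, x, y, z}" for a b
      using that by (elim insertE emptyE) (simp_all add: O s c)
  qed simp
  then show ?thesis using finite_subset by blast
qed

text \<open>The generators at the two inner vertices are commuting involutions, so the four listed
  products are closed under multiplication.\<close>

lemma finite_carried_PT: assumes q: "quad i j k l" shows "finite (carried_out 4 (PT i j k l))"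
proof -
  have Q: "quad l k j i" using q quad_perm by metis
  define x y where "x = xx j i" and "y = xx k l"
  have O: "x \<in> Out0 4" "y \<in> Out0 4" using xx_Out0 q Q by (auto simp: x_def y_def)
  have s: "out_mult 4 x x = out_one 4" "out_mult 4 y y = out_one 4" using xx_square q Q by (auto simp: x_def y_def)
  have c: "out_mult 4 y x = out_mult 4 x y" using xx_commute[OF q] by (simp add: x_def y_def)
  have a: "out_mult 4 x (out_mult 4 x y) = y" "out_mult 4 y (out_mult 4 x y) = x"
    using O s c out_mult_assoc[of x 4 x y] out_mult_assoc[of y 4 y x] by auto
  have "carried_out 4 (PT i j k l) \<subseteq> {out_one 4, x, y, out_mult 4 x y}"
  proof (rule carried_subset[where B="{out_one 4, x, y}"])
    show "xo 4 i' D \<in> {out_one 4, x, y}" if "is_pc 4 i' D" "carries 4 (PT i j k l) i' D" for i' D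
      unfolding x_def y_def using gens_PT[OF q that] .
    show "out_mult 4 b a \<in> {out_one 4, x, y, out_mult 4 x y}" if "b \<in> {out_one 4, x, y}" "a \<in> {out_one 4, x, y, out_mult 4 x y}" for a b
      using that by (elim insertE emptyE) (simp_all add: O s c a)
  qed simp
  then show ?thesis using finite_subset by blast
qed

section \<open>Length metrics near a vertex\<close>

definition pt :: "'v \<Rightarrow> 'v \<Rightarrow> real" where "pt v = (\<lambda>w. if w = v then 1 else 0)"

lemma supp_pt [simp]: "supp (pt v) = {v}" by (auto simp: supp_def pt_def)

lemma pt_same [simp]: "pt v v = 1" and pt_other: "w \<noteq> v \<Longrightarrow> pt v w = 0" by (auto simp: pt_def)

lemma telescope_bound:
  fixes f :: "'a \<Rightarrow> real"
  shows "xs \<noteq> [] \<Longrightarrow> \<bar>f (hd xs) - f (last xs)\<bar> \<le> (\<Sum>k<length xs - 1. \<bar>f (xs ! k) - f (xs ! Suc k)\<bar>)"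
proof (induction xs)
  case (Cons a xs)
  show ?case
  proof (cases xs)
    case (Cons b ys)
    have "(\<Sum>k<length (a # xs) - 1. \<bar>f ((a # xs) ! k) - f ((a # xs) ! Suc k)\<bar>) =
       \<bar>f a - f b\<bar> + (\<Sum>k<length xs - 1. \<bar>f (xs ! k) - f (xs ! Suc k)\<bar>)"
      using Cons by (simp add: sum.lessThan_Suc_shift del: sum.lessThan_Suc)
    then show ?thesis using Cons.IH Cons by auto
  qed simp
qed simp

section \<open>Lipschitz estimates for length metrics\<close>

text \<open>Collects what both geometries provide inside a simplex. The triangle inequality is
  stated with one corner at a vertex, where the hyperbolic case reduces to Cauchy-Schwarz on the
  orthogonal complement of that vertex. \<open>sd_coord\<close> says that barycentric coordinates
  are Lipschitz, the substitute for comparing the metric with a fixed norm.\<close>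

locale simplex_metric =
  fixes V :: "'v set" and le :: "'v \<Rightarrow> 'v \<Rightarrow> bool"
    and sd :: "'v set \<Rightarrow> ('v \<Rightarrow> real) \<Rightarrow> ('v \<Rightarrow> real) \<Rightarrow> real"
  assumes sd_nonneg: "\<And>\<sigma> x y. is_chain V le \<sigma> \<Longrightarrow> x \<in> real_pts V le \<Longrightarrow> y \<in> real_pts V le \<Longrightarrow> supp x \<subseteq> \<sigma> \<Longrightarrow> supp y \<subseteq> \<sigma> \<Longrightarrow> 0 \<le> sd \<sigma> x y"
    and sd_refl: "\<And>\<sigma> x. is_chain V le \<sigma> \<Longrightarrow> x \<in> real_pts V le \<Longrightarrow> supp x \<subseteq> \<sigma> \<Longrightarrow> sd \<sigma> x x = 0"
    and sd_vertex: "\<And>\<sigma> v x y. is_chain V le \<sigma> \<Longrightarrow> v \<in> \<sigma> \<Longrightarrow> x \<in> real_pts V le \<Longrightarrow> y \<in> real_pts V le \<Longrightarrow> supp x \<subseteq> \<sigma> \<Longrightarrow> supp y \<subseteq> \<sigma> \<Longrightarrow>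
        \<bar>sd \<sigma> (pt v) x - sd \<sigma> (pt v) y\<bar> \<le> sd \<sigma> x y"
    and sd_coord: "\<And>\<sigma> u. is_chain V le \<sigma> \<Longrightarrow> u \<in> \<sigma> \<Longrightarrow> \<exists>C>0. \<forall>x\<in>real_pts V le. \<forall>y\<in>real_pts V le.
        supp x \<subseteq> \<sigma> \<and> supp y \<subseteq> \<sigma> \<longrightarrow> \<bar>x u - y u\<bar> \<le> C * sd \<sigma> x y"
    and face: "face_iso V le sd"
begin

abbreviation "X \<equiv> real_pts V le"
abbreviation "d \<equiv> len_metric V le sd"
definition "fin v \<longleftrightarrow> finite {\<sigma>. is_chain V le \<sigma> \<and> v \<in> \<sigma>}"

lemma chain_subset: "is_chain V le \<sigma> \<Longrightarrow> \<tau> \<subseteq> \<sigma> \<Longrightarrow> \<tau> \<noteq> {} \<Longrightarrow> is_chain V le \<tau>"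
  unfolding is_chain_def by (meson finite_subset subset_iff)

lemma X_D: assumes "x \<in> X" shows "0 \<le> x v" "is_chain V le (supp x)" "sum x (supp x) = 1" "supp x \<noteq> {}" "finite (supp x)"
  using assms by (auto simp: real_pts_def is_chain_def)

lemma pt_X: "is_chain V le {v} \<Longrightarrow> pt v \<in> X"
  by (simp add: real_pts_def) (simp add: pt_def)

lemma face_eq: "is_chain V le \<sigma> \<Longrightarrow> x \<in> X \<Longrightarrow> y \<in> X \<Longrightarrow> supp x \<subseteq> \<sigma> \<Longrightarrow> supp y \<subseteq> \<sigma> \<Longrightarrow> \<tau> \<subseteq> \<sigma> \<Longrightarrow>
   supp x \<subseteq> \<tau> \<Longrightarrow> supp y \<subseteq> \<tau> \<Longrightarrow> sd \<tau> x y = sd \<sigma> x y"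
  using face X_D(4)[of x] chain_subset[of \<sigma> \<tau>] unfolding face_iso_def by blast

definition "slen xs = (\<Sum>k < length xs - 1. sd (supp (xs ! k) \<union> supp (xs ! Suc k)) (xs ! k) (xs ! Suc k))"

lemma d_alt: "d x y = Inf (slen ` strings V le x y)"
  by (simp add: len_metric_def slen_def image_def Bex_def conj_commute)

lemma slen_nonneg: assumes "xs \<in> strings V le x y" shows "0 \<le> slen xs"
  unfolding slen_def
proof (rule sum_nonneg)
  fix k assume k: "k \<in> {..<length xs - 1}"
  then have "xs ! k \<in> X" "xs ! Suc k \<in> X" "is_chain V le (supp (xs ! k) \<union> supp (xs ! Suc k))"
    using assms by (auto simp: strings_def subset_iff)
  then show "0 \<le> sd (supp (xs ! k) \<union> supp (xs ! Suc k)) (xs ! k) (xs ! Suc k)" by (intro sd_nonneg) auto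
qed

lemma d_le_sd: assumes "is_chain V le \<sigma>" "x \<in> X" "y \<in> X" "supp x \<subseteq> \<sigma>" "supp y \<subseteq> \<sigma>" shows "d x y \<le> sd \<sigma> x y"
proof -
  have c: "is_chain V le (supp x \<union> supp y)" by (rule chain_subset[OF assms(1)]) (use assms X_D(4)[OF assms(2)] in auto)
  have s: "[x, y] \<in> strings V le x y" using assms c by (auto simp: strings_def)
  have "d x y \<le> slen [x, y]" unfolding d_alt
    by (rule cInf_lower) (use s slen_nonneg in \<open>auto intro!: bdd_belowI[of _ 0]\<close>)
  also have "slen [x, y] = sd (supp x \<union> supp y) x y" by (simp add: slen_def)
  also have "\<dots> = sd \<sigma> x y" using assms by (intro face_eq) auto
  finally show ?thesis .
qed

text \<open>Along a string the increments of \<open>f\<close> telescope, so a bound within simplices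
  passes to the infimum. All lower bounds on \<open>d\<close> come from suitable test functions. A
  string must exist, since the infimum over the empty set carries no information.\<close>

lemma lipschitz_d:
  assumes "C > 0" and f: "\<And>x y. x \<in> X \<Longrightarrow> y \<in> X \<Longrightarrow> is_chain V le (supp x \<union> supp y) \<Longrightarrow> \<bar>f x - f y\<bar> \<le> C * sd (supp x \<union> supp y) x y"
    and ne: "strings V le x y \<noteq> {}"
  shows "\<bar>f x - f y\<bar> \<le> C * d x y"
proof -
  have "\<bar>f x - f y\<bar> / C \<le> d x y" unfolding d_alt
  proof (rule cInf_greatest)
    fix l assume "l \<in> slen ` strings V le x y"
    then obtain xs where xs: "xs \<in> strings V le x y" "l = slen xs" by auto
    then have h: "xs \<noteq> []" "hd xs = x" "last xs = y" "set xs \<subseteq> X"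
      "\<And>k. k < length xs - 1 \<Longrightarrow> is_chain V le (supp (xs ! k) \<union> supp (xs ! Suc k))" by (auto simp: strings_def)
    have "\<bar>f x - f y\<bar> \<le> (\<Sum>k<length xs - 1. \<bar>f (xs ! k) - f (xs ! Suc k)\<bar>)" using telescope_bound[OF h(1), of f] h by simp
    also have "\<dots> \<le> (\<Sum>k<length xs - 1. C * sd (supp (xs ! k) \<union> supp (xs ! Suc k)) (xs ! k) (xs ! Suc k))"
    proof (rule sum_mono)
      fix k assume k: "k \<in> {..<length xs - 1}"
      then have "xs ! k \<in> X" "xs ! Suc k \<in> X" using h(4) by (auto simp: subset_iff)
      then show "\<bar>f (xs ! k) - f (xs ! Suc k)\<bar> \<le> C * sd (supp (xs ! k) \<union> supp (xs ! Suc k)) (xs ! k) (xs ! Suc k)"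
        using f h(5) k by auto
    qed
    also have "\<dots> = C * l" by (simp add: xs slen_def sum_distrib_left)
    finally show "\<bar>f x - f y\<bar> / C \<le> l" using assms(1) by (simp add: field_simps)
  qed (use ne in simp)
  then show ?thesis using assms(1) by (simp add: field_simps)
qed

lemma strings_append:
  assumes "xs \<in> strings V le x m" "ys \<in> strings V le m y" shows "xs @ ys \<in> strings V le x y"
proof -
  have x: "xs \<noteq> []" "hd xs = x" "last xs = m" "set xs \<subseteq> X"
      "\<And>k. k < length xs - 1 \<Longrightarrow> is_chain V le (supp (xs ! k) \<union> supp (xs ! Suc k))" using assms by (auto simp: strings_def)
  have y: "ys \<noteq> []" "hd ys = m" "last ys = y" "set ys \<subseteq> X"
      "\<And>k. k < length ys - 1 \<Longrightarrow> is_chain V le (supp (ys ! k) \<union> supp (ys ! Suc k))" using assms by (auto simp: strings_def)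
  have "is_chain V le (supp ((xs @ ys) ! k) \<union> supp ((xs @ ys) ! Suc k))" if k: "k < length (xs @ ys) - 1" for k
  proof -
    consider "k < length xs - 1" | "k = length xs - 1" | "k \<ge> length xs" by linarith
    then show ?thesis
    proof cases
      case 1 then show ?thesis using x(5)[of k] by (auto simp: nth_append)
    next
      case 2
      then have "(xs @ ys) ! k = m" "(xs @ ys) ! Suc k = m" using x y by (auto simp: nth_append last_conv_nth hd_conv_nth)
      moreover have "m \<in> X" using x by (metis last_in_set subset_iff)
      ultimately show ?thesis using X_D(2)[of m] by simp
    next
      case 3
      then have "k - length xs < length ys - 1" using k y(1) by auto
      then show ?thesis using y(5)[of "k - length xs"] 3 by (auto simp: nth_append Suc_diff_le)
    qed
  qed
  then show ?thesis using x y by (auto simp: strings_def)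
qed

end

text \<open>\<open>fan\<close> is the form in which curvature enters the cone construction:
  geodesics from a common point, compared at equal arc length, are no further apart than their
  endpoints. Both curvature conditions yield it.\<close>

locale geodesic_simplex_metric = simplex_metric V le sd
  for V :: "'v set" and le :: "'v \<Rightarrow> 'v \<Rightarrow> bool" and sd +
  assumes geod: "geodesic_space (real_pts V le) (len_metric V le sd)"
    and fan: "\<And>p q r \<gamma> \<gamma>' a. p \<in> real_pts V le \<Longrightarrow> q \<in> real_pts V le \<Longrightarrow> r \<in> real_pts V le \<Longrightarrow>
       is_geodesic (real_pts V le) (len_metric V le sd) \<gamma> p q \<Longrightarrow> is_geodesic (real_pts V le) (len_metric V le sd) \<gamma>' p r \<Longrightarrow>
       0 \<le> a \<Longrightarrow> a \<le> len_metric V le sd p q \<Longrightarrow> a \<le> len_metric V le sd p r \<Longrightarrow>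
       len_metric V le sd (\<gamma> a) (\<gamma>' a) \<le> len_metric V le sd q r"
begin

sublocale M: Metric_space X d
  using geod by (simp add: geodesic_space_def)

lemma geodesic_ex: "x \<in> X \<Longrightarrow> y \<in> X \<Longrightarrow> \<exists>\<gamma>. is_geodesic X d \<gamma> x y"
  using geod by (auto simp: geodesic_space_def)

text \<open>Pairs joined by no string all have the same distance, the value of
  \<open>Inf {}\<close>. The midpoint of a geodesic between such a pair lies at half that positive
  distance from both ends, hence is joined to both by strings, and these concatenate.\<close>

lemma strings_nonempty: assumes "x \<in> X" "y \<in> X" shows "strings V le x y \<noteq> {}"
proof
  assume e: "strings V le x y = {}"
  have eq: "d p q = Inf {}" if "strings V le p q = {}" for p q using that unfolding d_alt by simp
  have "[x] \<in> strings V le x x" using assms by (auto simp: strings_def)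
  then have "x \<noteq> y" using e by auto
  then have pos: "d x y > 0" using assms M.mdist_pos_less by auto
  obtain \<gamma> where \<gamma>: "is_geodesic X d \<gamma> x y" using geodesic_ex assms by blast
  define m where "m = \<gamma> (d x y / 2)"
  have g: "\<gamma> 0 = x" "\<gamma> (d x y) = y" "\<And>s t. s \<in> {0..d x y} \<Longrightarrow> t \<in> {0..d x y} \<Longrightarrow> d (\<gamma> s) (\<gamma> t) = \<bar>s - t\<bar>"
    using \<gamma> by (auto simp: is_geodesic_def)
  have "d x m = d x y / 2" "d m y = d x y / 2"
    unfolding m_def using g(3)[of 0 "d x y / 2"] g(3)[of "d x y / 2" "d x y"] pos g(1,2) by auto
  then have "strings V le x m \<noteq> {}" "strings V le m y \<noteq> {}" using eq[of x m] eq[of m y] eq[OF e] pos by auto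
  then show False using strings_append e by blast
qed

definition coord_bound :: "real \<Rightarrow> 'v \<Rightarrow> bool" where
  "coord_bound K u \<longleftrightarrow> K > 0 \<and> (\<forall>\<sigma> x y. is_chain V le \<sigma> \<longrightarrow> u \<in> \<sigma> \<longrightarrow> x \<in> X \<longrightarrow> y \<in> X \<longrightarrow> supp x \<subseteq> \<sigma> \<longrightarrow> supp y \<subseteq> \<sigma> \<longrightarrow>
      \<bar>x u - y u\<bar> \<le> K * sd \<sigma> x y)"

text \<open>Only finitely many simplices contain \<open>u\<close>, so the sum of their Lipschitz
  constants serves for all of them; adding 1 keeps it positive.\<close>

lemma coord_local: assumes "fin u" shows "\<exists>K. coord_bound K u"
proof -
  let ?F = "{\<sigma>. is_chain V le \<sigma> \<and> u \<in> \<sigma>}"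
  have "\<forall>\<sigma>\<in>?F. \<exists>C>0. \<forall>x\<in>X. \<forall>y\<in>X. supp x \<subseteq> \<sigma> \<and> supp y \<subseteq> \<sigma> \<longrightarrow> \<bar>x u - y u\<bar> \<le> C * sd \<sigma> x y"
    using sd_coord by simp
  from bchoice[OF this] obtain C where C: "\<forall>\<sigma>\<in>?F. C \<sigma> > 0 \<and> 
     (\<forall>x\<in>X. \<forall>y\<in>X. supp x \<subseteq> \<sigma> \<and> supp y \<subseteq> \<sigma> \<longrightarrow> \<bar>x u - y u\<bar> \<le> C \<sigma> * sd \<sigma> x y)" ..
  have F: "finite ?F" using assms by (simp add: fin_def)
  have nn: "0 \<le> C \<sigma>" if "\<sigma> \<in> ?F" for \<sigma> using bspec[OF C that] by simp
  define K where "K = sum C ?F + 1"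
  have K: "K > 0" unfolding K_def using sum_nonneg[of ?F C] nn by fastforce
  have "\<bar>x u - y u\<bar> \<le> K * sd \<sigma> x y" if h: "is_chain V le \<sigma>" "u \<in> \<sigma>" "x \<in> X" "y \<in> X" "supp x \<subseteq> \<sigma>" "supp y \<subseteq> \<sigma>" for \<sigma> x y
  proof -
    have s: "\<sigma> \<in> ?F" using h by simp
    have "C \<sigma> \<le> sum C ?F" by (rule member_le_sum[OF s _ F]) (use nn in simp)
    then have "C \<sigma> \<le> K" by (simp add: K_def)
    have "\<bar>x u - y u\<bar> \<le> C \<sigma> * sd \<sigma> x y" using bspec[OF C s] h by simp
    also have "\<dots> \<le> K * sd \<sigma> x y" by (rule mult_right_mono[OF \<open>C \<sigma> \<le> K\<close>]) (rule sd_nonneg[OF h(1,3,4,5,6)])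
    finally show ?thesis .
  qed
  then show ?thesis using K unfolding coord_bound_def by (intro exI[of _ K] conjI allI impI)
qed

lemma coord_lipschitz: assumes "fin u" shows "\<exists>C>0. \<forall>x\<in>X. \<forall>y\<in>X. \<bar>x u - y u\<bar> \<le> C * d x y"
proof -
  obtain K where Kb: "coord_bound K u" using coord_local[OF assms] ..
  have K: "K > 0" using Kb by (simp add: coord_bound_def)
  have C: "\<bar>x u - y u\<bar> \<le> K * sd \<sigma> x y" if "is_chain V le \<sigma>" "u \<in> \<sigma>" "x \<in> X" "y \<in> X" "supp x \<subseteq> \<sigma>" "supp y \<subseteq> \<sigma>" for \<sigma> x y
    using Kb that by (simp add: coord_bound_def)
  have step: "\<bar>x u - y u\<bar> \<le> K * sd (supp x \<union> supp y) x y" if "x \<in> X" "y \<in> X" "is_chain V le (supp x \<union> supp y)" for x y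
  proof -
    have nn: "0 \<le> sd (supp x \<union> supp y) x y" using that by (intro sd_nonneg) auto
    show ?thesis
    proof (cases "u \<in> supp x \<union> supp y")
      case True
      show ?thesis by (rule C[OF that(3) True that(1,2)]) auto
    next
      case False
      then have "x u = 0" "y u = 0" by (auto simp: supp_def)
      then show ?thesis using nn K by simp
    qed
  qed
  show ?thesis
    by (rule exI[of _ K]) (use K lipschitz_d[of K "\<lambda>x. x u"] step strings_nonempty in auto)
qed

text \<open>The test function is the distance to \<open>v\<close> inside a simplex, cut off at a
  level \<open>\<epsilon>\<close> and extended by the constant \<open>\<epsilon>\<close> outside the
  open star of \<open>v\<close>. It is 1-Lipschitz on every simplex. Together with
  \<open>d_le_sd\<close> this identifies \<open>d\<close> with the simplex metric close to
  \<open>v\<close>.\<close>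

lemma d_vertex_ge:
  assumes "fin v" "is_chain V le {v}"
  shows "\<exists>\<epsilon>>0. \<forall>y\<in>X. \<forall>\<sigma>. is_chain V le \<sigma> \<longrightarrow> v \<in> \<sigma> \<longrightarrow> supp y \<subseteq> \<sigma> \<longrightarrow> min \<epsilon> (sd \<sigma> (pt v) y) \<le> d (pt v) y"
proof -
  note ptX = pt_X[OF assms(2)]
  let ?F = "{\<sigma>. is_chain V le \<sigma> \<and> v \<in> \<sigma>}"
  obtain K where Kb: "coord_bound K v" using coord_local[OF assms(1)] ..
  have K: "K > 0" using Kb by (simp add: coord_bound_def)
  have C: "\<bar>x v - y v\<bar> \<le> K * sd \<sigma> x y" if "is_chain V le \<sigma>" "v \<in> \<sigma>" "x \<in> X" "y \<in> X" "supp x \<subseteq> \<sigma>" "supp y \<subseteq> \<sigma>" for \<sigma> x y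
    using Kb that by (simp add: coord_bound_def)
  \<comment> \<open>Leaving the open star changes the coordinate at \<open>v\<close> from 1 to 0,
    which costs at least distance \<open>1 / K\<close>; the cutoff therefore matches on the boundary
    of the star.\<close>
  define \<epsilon> where "\<epsilon> = 1 / K"
  have \<epsilon>: "\<epsilon> > 0" using K by (simp add: \<epsilon>_def)
  have far: "\<epsilon> \<le> sd \<sigma> (pt v) y" if "\<sigma> \<in> ?F" "y \<in> X" "supp y \<subseteq> \<sigma>" "y v = 0" for \<sigma> y
  proof -
    have "1 \<le> K * sd \<sigma> (pt v) y" using C[of \<sigma> "pt v" y] ptX that by simp
    then show ?thesis using K by (simp add: \<epsilon>_def field_simps)
  qed
  define \<rho> where "\<rho> y = (if y v > 0 then min \<epsilon> (sd (supp y) (pt v) y) else \<epsilon>)" for y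
  have \<rho>: "\<rho> y = min \<epsilon> (sd \<sigma> (pt v) y)" if "\<sigma> \<in> ?F" "y \<in> X" "supp y \<subseteq> \<sigma>" for \<sigma> y
  proof (cases "y v > 0")
    case True
    then have "v \<in> supp y" by (auto simp: supp_def)
    then have "sd (supp y) (pt v) y = sd \<sigma> (pt v) y" using that ptX by (intro face_eq) auto
    then show ?thesis using True by (simp add: \<rho>_def)
  next
    case False
    then have "y v = 0" using X_D(1)[OF that(2), of v] by simp
    then show ?thesis using far[OF that] False by (simp add: \<rho>_def)
  qed
  have step: "\<bar>\<rho> x - \<rho> y\<bar> \<le> 1 * sd (supp x \<union> supp y) x y" if "x \<in> X" "y \<in> X" "is_chain V le (supp x \<union> supp y)" for x y
  proof (cases "v \<in> supp x \<union> supp y")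
    case True
    then have F: "supp x \<union> supp y \<in> ?F" using that by simp
    have "\<bar>sd (supp x \<union> supp y) (pt v) x - sd (supp x \<union> supp y) (pt v) y\<bar> \<le> sd (supp x \<union> supp y) x y"
      using that True by (intro sd_vertex) auto
    then show ?thesis using \<rho>[OF F that(1)] \<rho>[OF F that(2)] by auto
  next
    case False
    then have "x v = 0" "y v = 0" by (auto simp: supp_def)
    then show ?thesis using sd_nonneg[OF that(3,1,2)] by (simp add: \<rho>_def)
  qed
  have "min \<epsilon> (sd \<sigma> (pt v) y) \<le> d (pt v) y" if h: "y \<in> X" "is_chain V le \<sigma>" "v \<in> \<sigma>" "supp y \<subseteq> \<sigma>" for y \<sigma>
  proof -
    have "\<rho> (pt v) = 0" using \<rho>[of "{v}" "pt v"] assms(2) ptX sd_refl[OF assms(2) ptX] \<epsilon> by auto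
    moreover have "\<bar>\<rho> (pt v) - \<rho> y\<bar> \<le> 1 * d (pt v) y"
      by (rule lipschitz_d[OF _ step]) (use strings_nonempty[OF ptX h(1)] in auto)
    ultimately show ?thesis using \<rho>[of \<sigma> y] h by auto
  qed
  then show ?thesis using \<epsilon> by blast
qed

end

section \<open>Closed loops in links\<close>

text \<open>The point \<open>q * cis \<Phi>\<close> is where the chord meets the intermediate ray.\<close>

lemma chord_crosses_ray:
  fixes \<Phi> \<phi> r t :: real
  assumes "0 \<le> \<Phi>" "\<Phi> \<le> \<phi>" "\<phi> < pi" "0 \<le> r" "r \<le> t"
  shows "\<exists>q::real. 0 \<le> q \<and> q \<le> t \<and> cmod (of_real t - q * cis \<Phi>) + cmod (q * cis \<Phi> - r * cis \<phi>) = cmod (of_real t - r * cis \<phi>)"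
proof -
  \<comment> \<open>\<open>A\<close> and \<open>B\<close> are the distances of the two ends of the
    chord from the intermediate ray; the crossing point divides the chord in the ratio
    \<open>A : B\<close>.\<close>
  define A where "A = t * sin \<Phi>"
  define B where "B = r * sin (\<phi> - \<Phi>)"
  have A: "A \<ge> 0" unfolding A_def using assms by (intro mult_nonneg_nonneg sin_ge_zero) auto
  have B: "B \<ge> 0" unfolding B_def using assms by (intro mult_nonneg_nonneg sin_ge_zero) auto
  show ?thesis
  proof (cases "A + B = 0")
    case True
    then have AB: "A = 0" "B = 0" using A B by auto
    consider "t = 0" | "t \<noteq> 0" "\<Phi> = 0" using AB(1) assms sin_gt_zero[of \<Phi>] by (fastforce simp: A_def)
    then show ?thesis
    proof cases
      case 1 then show ?thesis using assms by (intro exI[of _ 0]) auto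
    next
      case 2
      show ?thesis using assms 2 by (intro exI[of _ t]) auto
    qed
  next
    case False
    then have AB: "A + B > 0" using A B by linarith
    define s where "s = A / (A + B)"
    have s: "0 \<le> s" "s \<le> 1" using A B AB by (auto simp: s_def)
    define Z where "Z = of_real (1 - s) * of_real t + of_real s * (r * cis \<phi>)"
    \<comment> \<open>Found by areas: the triangle with corners 0, \<open>t\<close> and
      \<open>r * cis \<phi>\<close> is cut by the ray into two triangles with common side
      \<open>q\<close>.\<close>
    define q where "q = t * r * sin \<phi> / (A + B)"
    have q0: "q \<ge> 0" unfolding q_def using assms AB by (intro divide_nonneg_nonneg mult_nonneg_nonneg sin_ge_zero) auto
    have s1: "1 - s = B / (A + B)" using AB by (simp add: s_def field_simps)
    have sp: "sin \<phi> = sin (\<phi> - \<Phi>) * cos \<Phi> + cos (\<phi> - \<Phi>) * sin \<Phi>" using sin_add[of "\<phi> - \<Phi>" \<Phi>] by simp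
    have cp: "cos \<phi> = cos (\<phi> - \<Phi>) * cos \<Phi> - sin (\<phi> - \<Phi>) * sin \<Phi>" using cos_add[of "\<phi> - \<Phi>" \<Phi>] by simp
    have Re: "Re Z = q * cos \<Phi>"
    proof -
      have "Re Z * (A + B) = B * t + A * (r * cos \<phi>)"
      proof -
        have "Re Z * (A + B) = ((1 - s) * (A + B)) * t + (s * (A + B)) * (r * cos \<phi>)"
          unfolding Z_def by (simp add: algebra_simps)
        also have "(1 - s) * (A + B) = B" using AB by (simp add: s1)
        also have "s * (A + B) = A" using AB by (simp add: s_def)
        finally show ?thesis .
      qed
      also have "\<dots> = t * r * (sin (\<phi> - \<Phi>) + sin \<Phi> * cos \<phi>)" by (simp add: A_def B_def algebra_simps)
      also have "sin (\<phi> - \<Phi>) + sin \<Phi> * cos \<phi> = sin \<phi> * cos \<Phi>"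
      proof -
        have "sin (\<phi> - \<Phi>) = sin \<phi> * cos \<Phi> - cos \<phi> * sin \<Phi>" by (rule sin_diff)
        then show ?thesis by simp
      qed
      finally show ?thesis using AB by (simp add: q_def field_simps)
    qed
    have Im: "Im Z = q * sin \<Phi>"
      using AB unfolding Z_def q_def by (simp add: s_def A_def field_simps)
    have Zq: "Z = q * cis \<Phi>" by (rule complex_eqI) (simp_all add: Re Im)
    have d1: "of_real t - Z = of_real s * (of_real t - r * cis \<phi>)" by (simp add: Z_def algebra_simps)
    have d2: "Z - r * cis \<phi> = of_real (1 - s) * (of_real t - r * cis \<phi>)" by (simp add: Z_def algebra_simps)
    have "cmod (of_real t - Z) + cmod (Z - r * cis \<phi>) = cmod (of_real t - r * cis \<phi>)"
      unfolding d1 d2 norm_mult norm_of_real using s by (simp add: algebra_simps)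
    moreover have "q \<le> t"
    proof -
      have "q = cmod Z" using q0 by (simp add: Zq norm_mult)
      also have "\<dots> \<le> (1 - s) * t + s * r"
        unfolding Z_def by (rule norm_triangle_le) (use s assms in \<open>simp add: norm_mult del: of_real_diff\<close>)
      also have "\<dots> \<le> (1 - s) * t + s * t" using s assms by (intro add_left_mono mult_left_mono) auto
      finally show ?thesis by (simp add: algebra_simps)
    qed
    ultimately show ?thesis using q0 Zq by auto
  qed
qed

lemma cmod_cis_diff_le: fixes a b :: real shows "cmod (cis a - cis b) \<le> \<bar>a - b\<bar>"
proof -
  have "cis a - cis b = cis b * (cis (a - b) - 1)" by (simp add: algebra_simps cis_mult)
  then have "cmod (cis a - cis b) = cmod (cis (a - b) - 1)" by (simp add: norm_mult)
  also have "cis (a - b) - 1 = exp (\<i> * of_real (a - b)) - 1" by (simp add: cis_conv_exp mult.commute)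
  also have "cmod (exp (\<i> * of_real (a - b)) - 1) = 2 * \<bar>sin ((a - b) / 2)\<bar>"
    by (rule dist_exp_i_1)
  also have "\<dots> \<le> 2 * \<bar>(a - b) / 2\<bar>" by (intro mult_left_mono abs_sin_x_le_abs_x) auto
  finally show ?thesis by simp
qed

text \<open>\<open>corner_map\<close> sends barycentric coordinates to the tangent plane at \<open>v\<close>; \<open>sector_pt\<close> is its inverse in
  polar coordinates.\<close>

definition corner_map :: "('v \<Rightarrow> real) \<Rightarrow> 'v \<Rightarrow> 'v \<Rightarrow> real \<Rightarrow> ('v \<Rightarrow> real) \<Rightarrow> complex" where
  "corner_map tg u w \<theta> x = of_real (x u * tg u) + of_real (x w * tg w) * cis \<theta>"

definition sector_pt :: "'v \<Rightarrow> ('v \<Rightarrow> real) \<Rightarrow> 'v \<Rightarrow> 'v \<Rightarrow> real \<Rightarrow> real \<Rightarrow> real \<Rightarrow> ('v \<Rightarrow> real)" where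
  "sector_pt v tg u w \<theta> r \<phi> = (let \<alpha> = r * sin (\<theta> - \<phi>) / (sin \<theta> * tg u); \<beta> = r * sin \<phi> / (sin \<theta> * tg w)
     in (\<lambda>x. if x = u then \<alpha> else if x = w then \<beta> else if x = v then 1 - \<alpha> - \<beta> else 0))"

lemma sector_pt_swap: assumes "u \<noteq> w" shows "sector_pt v tg u w \<theta> r \<phi> = sector_pt v tg w u \<theta> r (\<theta> - \<phi>)"
  using assms by (auto simp: sector_pt_def Let_def fun_eq_iff)

context geodesic_simplex_metric
begin

text \<open>Near the vertex \<open>v\<close> the simplex \<open>{v, u, w}\<close> looks like a Euclidean sector of angle \<open>\<theta>\<close>; \<open>tg u\<close> is the
  speed at which one leaves \<open>v\<close> when the barycentric coordinate of \<open>u\<close> grows.\<close>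

definition corner :: "('v \<Rightarrow> real) \<Rightarrow> 'v \<Rightarrow> 'v \<Rightarrow> 'v \<Rightarrow> real \<Rightarrow> bool" where
  "corner tg v u w \<theta> \<longleftrightarrow> 0 < \<theta> \<and> \<theta> < pi \<and> 0 < tg u \<and> 0 < tg w \<and>
     (\<forall>e>0. \<exists>\<delta>>0. \<forall>x\<in>X. \<forall>y\<in>X. supp x \<subseteq> {v, u, w} \<and> supp y \<subseteq> {v, u, w} \<and> 1 - x v < \<delta> \<and> 1 - y v < \<delta> \<longrightarrow>
        sd {v, u, w} x y \<le> (1 + e) * cmod (corner_map tg u w \<theta> x - corner_map tg u w \<theta> y) \<and>
        (1 - e) * cmod (corner_map tg u w \<theta> x) \<le> sd {v, u, w} (pt v) x)"

text \<open>The infinitesimal statement \<open>corner\<close> made uniform up to radius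
  \<open>t\<close>, with \<open>d\<close> in place of the simplex metric. Upper bounds hold for all
  pairs, a lower bound only towards \<open>v\<close>: exactly what is needed to show that going
  around \<open>v\<close> is shorter than going through it.\<close>

definition sector :: "('v \<Rightarrow> real) \<Rightarrow> real \<Rightarrow> real \<Rightarrow> 'v \<Rightarrow> 'v \<Rightarrow> 'v \<Rightarrow> real \<Rightarrow> bool" where
  "sector tg e t v u w \<theta> \<longleftrightarrow> u \<noteq> w \<and> u \<noteq> v \<and> w \<noteq> v \<and> 0 < \<theta> \<and> \<theta> < pi \<and>
    (\<forall>r \<phi>. 0 \<le> r \<and> r \<le> t \<and> 0 \<le> \<phi> \<and> \<phi> \<le> \<theta> \<longrightarrow> sector_pt v tg u w \<theta> r \<phi> \<in> X \<and>
       (1 - e) * r \<le> d (pt v) (sector_pt v tg u w \<theta> r \<phi>)) \<and>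
    (\<forall>r \<phi> r' \<phi>'. 0 \<le> r \<and> r \<le> t \<and> 0 \<le> \<phi> \<and> \<phi> \<le> \<theta> \<and> 0 \<le> r' \<and> r' \<le> t \<and> 0 \<le> \<phi>' \<and> \<phi>' \<le> \<theta> \<longrightarrow>
       d (sector_pt v tg u w \<theta> r \<phi>) (sector_pt v tg u w \<theta> r' \<phi>') \<le> (1 + e) * cmod (r * cis \<phi> - r' * cis \<phi>'))"

text \<open>Reflection of the sector in its bisector, \<open>z\<close> to
  \<open>cis \<theta> * cnj z\<close>, is an isometry exchanging the two sides.\<close>

lemma sector_swap: assumes "sector tg e t v u w \<theta>" shows "sector tg e t v w u \<theta>"
proof -
  have c: "cmod (r * cis \<phi> - r' * cis \<phi>') = cmod (r * cis (\<theta> - \<phi>) - r' * cis (\<theta> - \<phi>'))" for r \<phi> r' \<phi>' :: real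
  proof -
    have k: "cis (\<theta> - \<phi>) = cis \<theta> * cis (- \<phi>)" for \<phi> by (simp add: cis_mult)
    have "r * cis (\<theta> - \<phi>) - r' * cis (\<theta> - \<phi>') = cis \<theta> * cnj (r * cis \<phi> - r' * cis \<phi>')"
      unfolding k by (simp add: cis_cnj algebra_simps)
    then show ?thesis by (simp only: norm_mult complex_mod_cnj norm_cis mult_1)
  qed
  have uw: "w \<noteq> u" using assms by (auto simp: sector_def)
  have H: "u \<noteq> v" "w \<noteq> v" "0 < \<theta>" "\<theta> < pi"
    and H1: "\<And>r \<phi>. 0 \<le> r \<Longrightarrow> r \<le> t \<Longrightarrow> 0 \<le> \<phi> \<Longrightarrow> \<phi> \<le> \<theta> \<Longrightarrow> sector_pt v tg u w \<theta> r \<phi> \<in> X \<and>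
       (1 - e) * r \<le> d (pt v) (sector_pt v tg u w \<theta> r \<phi>)"
    and H2: "\<And>r \<phi> r' \<phi>'. 0 \<le> r \<Longrightarrow> r \<le> t \<Longrightarrow> 0 \<le> \<phi> \<Longrightarrow> \<phi> \<le> \<theta> \<Longrightarrow> 0 \<le> r' \<Longrightarrow> r' \<le> t \<Longrightarrow> 0 \<le> \<phi>' \<Longrightarrow> \<phi>' \<le> \<theta> \<Longrightarrow>
       d (sector_pt v tg u w \<theta> r \<phi>) (sector_pt v tg u w \<theta> r' \<phi>') \<le> (1 + e) * cmod (r * cis \<phi> - r' * cis \<phi>')"
    using assms unfolding sector_def by simp_all
  have "d (sector_pt v tg w u \<theta> r \<phi>) (sector_pt v tg w u \<theta> r' \<phi>') \<le> (1 + e) * cmod (r * cis \<phi> - r' * cis \<phi>')"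
    if "0 \<le> r" "r \<le> t" "0 \<le> \<phi>" "\<phi> \<le> \<theta>" "0 \<le> r'" "r' \<le> t" "0 \<le> \<phi>'" "\<phi>' \<le> \<theta>" for r \<phi> r' \<phi>'
    unfolding sector_pt_swap[OF uw] c[of r \<phi> r' \<phi>'] by (rule H2) (use that in auto)
  moreover have "sector_pt v tg w u \<theta> r \<phi> \<in> X \<and> (1 - e) * r \<le> d (pt v) (sector_pt v tg w u \<theta> r \<phi>)"
    if "0 \<le> r" "r \<le> t" "0 \<le> \<phi>" "\<phi> \<le> \<theta>" for r \<phi>
    unfolding sector_pt_swap[OF uw] by (rule H1) (use that in auto)
  ultimately show ?thesis using H uw unfolding sector_def by simp
qed

lemma sector_of_corner:
  assumes "corner tg v u w \<theta>" "is_chain V le {v, u, w}" "u \<noteq> w" "u \<noteq> v" "w \<noteq> v" "fin v" "0 < e" "e < 1"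
  shows "\<exists>t0>0. \<forall>t. 0 < t \<and> t \<le> t0 \<longrightarrow> sector tg e t v u w \<theta>"
proof -
  have c: "0 < \<theta>" "\<theta> < pi" "0 < tg u" "0 < tg w" using assms(1) by (auto simp: corner_def)
  obtain \<delta> where \<delta>: "\<delta> > 0" "\<And>x y. x \<in> X \<Longrightarrow> y \<in> X \<Longrightarrow> supp x \<subseteq> {v, u, w} \<Longrightarrow> supp y \<subseteq> {v, u, w} \<Longrightarrow> 1 - x v < \<delta> \<Longrightarrow> 1 - y v < \<delta> \<Longrightarrow>
        sd {v, u, w} x y \<le> (1 + e) * cmod (corner_map tg u w \<theta> x - corner_map tg u w \<theta> y) \<and>
        (1 - e) * cmod (corner_map tg u w \<theta> x) \<le> sd {v, u, w} (pt v) x"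
    using assms(1,7) unfolding corner_def by meson
  have cv: "is_chain V le {v}" by (rule chain_subset[OF assms(2)]) auto
  obtain \<epsilon> where \<epsilon>: "\<epsilon> > 0" "\<And>y \<sigma>. y \<in> X \<Longrightarrow> is_chain V le \<sigma> \<Longrightarrow> v \<in> \<sigma> \<Longrightarrow> supp y \<subseteq> \<sigma> \<Longrightarrow> min \<epsilon> (sd \<sigma> (pt v) y) \<le> d (pt v) y"
    using d_vertex_ge[OF assms(6) cv] by meson
  have s: "sin \<theta> > 0" using c by (intro sin_gt_zero) auto
  define K where "K = 1 / (sin \<theta> * tg u) + 1 / (sin \<theta> * tg w)"
  have K: "K > 0" unfolding K_def using s c by (intro add_pos_pos divide_pos_pos mult_pos_pos) auto
  \<comment> \<open>\<open>K\<close> bounds the total mass off \<open>v\<close> per unit radius. The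
    three terms keep the radius within reach of \<open>d_vertex_ge\<close>, within the range of the
    corner estimate, and small enough that the coordinate at \<open>v\<close> stays
    nonnegative.\<close>
  define t0 where "t0 = min \<epsilon> (min (\<delta> / (2 * K)) (1 / (2 * K)))"
  have t0: "t0 > 0" using \<epsilon> \<delta> K by (simp add: t0_def)
  have "sector tg e t v u w \<theta>" if t: "0 < t" "t \<le> t0" for t
  proof -
    have tK: "t * K < \<delta>" "t * K < 1" "t \<le> \<epsilon>"
    proof -
      have "t \<le> \<delta> / (2 * K)" "t \<le> 1 / (2 * K)" "t \<le> \<epsilon>" using t by (auto simp: t0_def)
      then have "t * (2 * K) \<le> \<delta>" "t * (2 * K) \<le> 1" using K by (auto simp: field_simps)
      moreover have "t * K < t * (2 * K)" using t K by simp
      ultimately show "t * K < \<delta>" "t * K < 1" "t \<le> \<epsilon>" using \<open>t \<le> \<epsilon>\<close> by linarith+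
    qed
    have pt_props: "sector_pt v tg u w \<theta> r \<phi> \<in> X \<and> supp (sector_pt v tg u w \<theta> r \<phi>) \<subseteq> {v, u, w} \<and> 1 - sector_pt v tg u w \<theta> r \<phi> v < \<delta> \<and>
       corner_map tg u w \<theta> (sector_pt v tg u w \<theta> r \<phi>) = r * cis \<phi>"
      if r: "0 \<le> r" "r \<le> t" "0 \<le> \<phi>" "\<phi> \<le> \<theta>" for r \<phi>
    proof -
      define p where "p = sector_pt v tg u w \<theta> r \<phi>"
      define \<alpha> where "\<alpha> = r * sin (\<theta> - \<phi>) / (sin \<theta> * tg u)"
      define \<beta> where "\<beta> = r * sin \<phi> / (sin \<theta> * tg w)"
      have p: "p = (\<lambda>x. if x = u then \<alpha> else if x = w then \<beta> else if x = v then 1 - \<alpha> - \<beta> else 0)"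
        unfolding p_def sector_pt_def \<alpha>_def \<beta>_def Let_def by (rule refl)
      have s1: "0 \<le> sin (\<theta> - \<phi>)" "0 \<le> sin \<phi>" using r c by (auto intro!: sin_ge_zero)
      have \<alpha>0: "0 \<le> \<alpha>" "0 \<le> \<beta>" unfolding \<alpha>_def \<beta>_def using r s s1 c by auto
      have "r * sin (\<theta> - \<phi>) \<le> t * 1" "r * sin \<phi> \<le> t * 1" using mult_mono[of r t "sin (\<theta> - \<phi>)" 1] mult_mono[of r t "sin \<phi>" 1] r t s1 by auto
      then have "\<alpha> \<le> t / (sin \<theta> * tg u)" "\<beta> \<le> t / (sin \<theta> * tg w)" unfolding \<alpha>_def \<beta>_def
        using s c by (auto intro!: divide_right_mono)
      then have ab: "\<alpha> + \<beta> \<le> t * K" unfolding K_def by (simp add: algebra_simps)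
      have sub: "supp p \<subseteq> {v, u, w}" by (auto simp: supp_def p split: if_splits)
      have tot: "sum p {v, u, w} = 1" using assms(3,4,5) by (auto simp: p)
      have "sum p (supp p) = sum p {v, u, w}" by (rule sum.mono_neutral_left) (use sub in \<open>auto simp: supp_def\<close>)
      then have "sum p (supp p) = 1" using tot by simp
      moreover have "supp p \<noteq> {}" using calculation by auto
      moreover have "0 \<le> p x" for x using \<alpha>0 ab tK by (auto simp: p)
      ultimately have "p \<in> X" using chain_subset[OF assms(2) sub] by (simp add: real_pts_def)
      moreover have "1 - p v < \<delta>" using ab tK assms(4,5) by (simp add: p)
      moreover have "corner_map tg u w \<theta> p = r * cis \<phi>"
      proof -
        have 1: "\<alpha> * tg u = r * sin (\<theta> - \<phi>) / sin \<theta>" "\<beta> * tg w = r * sin \<phi> / sin \<theta>" using c s by (simp_all add: \<alpha>_def \<beta>_def)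
        have "sin (\<theta> - \<phi>) + sin \<phi> * cos \<theta> = cos \<phi> * sin \<theta>" by (simp add: sin_diff)
        then have "r * sin (\<theta> - \<phi>) / sin \<theta> + r * sin \<phi> / sin \<theta> * cos \<theta> = r * cos \<phi>"
          using s by (simp add: field_simps) (metis distrib_left mult.assoc mult.commute)
        then show ?thesis using assms(3,4,5) s by (intro complex_eqI) (simp_all add: corner_map_def p 1)
      qed
      ultimately show ?thesis using sub unfolding p_def by blast
    qed
    have low: "(1 - e) * r \<le> d (pt v) (sector_pt v tg u w \<theta> r \<phi>)" if r: "0 \<le> r" "r \<le> t" "0 \<le> \<phi>" "\<phi> \<le> \<theta>" for r \<phi>
    proof -
      note P = pt_props[OF r]
      have "(1 - e) * r \<le> sd {v, u, w} (pt v) (sector_pt v tg u w \<theta> r \<phi>)"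
        using \<delta>(2)[of "sector_pt v tg u w \<theta> r \<phi>" "sector_pt v tg u w \<theta> r \<phi>"] P r by (simp add: norm_mult)
      moreover have "(1 - e) * r \<le> 1 * \<epsilon>" using r tK assms by (intro mult_mono) auto
      ultimately have "(1 - e) * r \<le> min \<epsilon> (sd {v, u, w} (pt v) (sector_pt v tg u w \<theta> r \<phi>))" by simp
      also have "\<dots> \<le> d (pt v) (sector_pt v tg u w \<theta> r \<phi>)" by (rule \<epsilon>(2)) (use P assms in auto)
      finally show ?thesis .
    qed
    have up: "d (sector_pt v tg u w \<theta> r \<phi>) (sector_pt v tg u w \<theta> r' \<phi>') \<le> (1 + e) * cmod (r * cis \<phi> - r' * cis \<phi>')"
      if r: "0 \<le> r" "r \<le> t" "0 \<le> \<phi>" "\<phi> \<le> \<theta>" "0 \<le> r'" "r' \<le> t" "0 \<le> \<phi>'" "\<phi>' \<le> \<theta>" for r \<phi> r' \<phi>'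
    proof -
      note P = pt_props[OF r(1-4)] and P' = pt_props[OF r(5-8)]
      have "d (sector_pt v tg u w \<theta> r \<phi>) (sector_pt v tg u w \<theta> r' \<phi>') \<le> sd {v, u, w} (sector_pt v tg u w \<theta> r \<phi>) (sector_pt v tg u w \<theta> r' \<phi>')"
        using P P' assms by (intro d_le_sd) auto
      also have "\<dots> \<le> (1 + e) * cmod (corner_map tg u w \<theta> (sector_pt v tg u w \<theta> r \<phi>) - corner_map tg u w \<theta> (sector_pt v tg u w \<theta> r' \<phi>'))"
        using \<delta>(2)[of "sector_pt v tg u w \<theta> r \<phi>" "sector_pt v tg u w \<theta> r' \<phi>'"] P P' by blast
      finally show ?thesis using P P' by simp
    qed
    show ?thesis unfolding sector_def using assms(3,4,5) c pt_props low up by blast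
  qed
  then show ?thesis using t0 by blast
qed

text \<open>Development of consecutive sectors in the plane: as long as the total angle stays below \<open>\<pi>\<close>, the planar
  chord is realised by a string of points on the separating rays.\<close>

lemma develop:
  assumes S: "\<And>i. i < m \<Longrightarrow> sector tg e t v (us i) (us (Suc i)) (\<theta> i)" and e: "0 < e" and t: "0 < t"
    and tg: "\<And>i. i \<le> m \<Longrightarrow> tg (us i) > 0"
  shows "i < m \<Longrightarrow> 0 \<le> r \<Longrightarrow> r \<le> t \<Longrightarrow> 0 \<le> \<psi> \<Longrightarrow> \<psi> \<le> \<theta> i \<Longrightarrow> (\<Sum>j<i. \<theta> j) + \<psi> < pi \<Longrightarrow>
     d (sector_pt v tg (us 0) (us (Suc 0)) (\<theta> 0) t 0) (sector_pt v tg (us i) (us (Suc i)) (\<theta> i) r \<psi>)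
       \<le> (1 + e) * cmod (of_real t - r * cis ((\<Sum>j<i. \<theta> j) + \<psi>))"
proof (induction i arbitrary: r \<psi>)
  case 0
  note S0 = S[OF 0(1), unfolded sector_def]
  have "0 < \<theta> 0" using S0 by blast
  then have "d (sector_pt v tg (us 0) (us (Suc 0)) (\<theta> 0) t 0) (sector_pt v tg (us 0) (us (Suc 0)) (\<theta> 0) r \<psi>) \<le>
     (1 + e) * cmod (t * cis 0 - r * cis \<psi>)" using S0 0 t by (metis less_eq_real_def order_refl)
  then show ?case by simp
next
  case (Suc i)
  let ?S = "\<lambda>i. sector_pt v tg (us i) (us (Suc i)) (\<theta> i)"
  have i: "i < m" "Suc i < m" using Suc.prems by auto
  note Si = S[OF i(1), unfolded sector_def] and Ssi = S[OF i(2), unfolded sector_def]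
  have th: "\<theta> j > 0" if "j < m" for j using S[OF that] by (simp add: sector_def)
  define \<Phi> where "\<Phi> = (\<Sum>j<Suc i. \<theta> j)"
  have \<Phi>: "0 \<le> \<Phi>" unfolding \<Phi>_def using th i by (intro sum_nonneg) (auto intro: less_imp_le)
  \<comment> \<open>The chord meets the ray separating the sectors \<open>i\<close> and
    \<open>Suc i\<close> at distance \<open>q\<close>. As \<open>q \<le> t\<close>, that point lies
    in both sectors and the induction hypothesis applies to it.\<close>
  obtain q :: real where q: "0 \<le> q" "q \<le> t" "cmod (of_real t - q * cis \<Phi>) + cmod (q * cis \<Phi> - r * cis (\<Phi> + \<psi>)) = cmod (of_real t - r * cis (\<Phi> + \<psi>))"
    using chord_crosses_ray[of \<Phi> "\<Phi> + \<psi>" r t] \<Phi> Suc.prems unfolding \<Phi>_def by auto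
  have same: "?S (Suc i) q 0 = ?S i q (\<theta> i)"
  proof -
    have "sin (\<theta> i) > 0" "sin (\<theta> (Suc i)) > 0" using Si Ssi by (auto intro!: sin_gt_zero)
    then show ?thesis using Si Ssi tg[of "Suc i"] i by (auto simp: sector_pt_def Let_def fun_eq_iff)
  qed
  have X: "?S 0 t 0 \<in> X" "?S i q (\<theta> i) \<in> X" "?S (Suc i) r \<psi> \<in> X"
  proof -
    have "0 < m" using i by simp
    note S0 = S[OF this, unfolded sector_def]
    have "0 < \<theta> 0" using S0 by blast
    then show "?S 0 t 0 \<in> X" using S0 t by (meson less_eq_real_def order_refl)
    have "0 < \<theta> i" using Si by blast
    then show "?S i q (\<theta> i) \<in> X" using Si q by (meson less_eq_real_def order_refl)
    show "?S (Suc i) r \<psi> \<in> X" using Ssi Suc.prems by blast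
  qed
  have "d (?S 0 t 0) (?S (Suc i) r \<psi>) \<le> d (?S 0 t 0) (?S i q (\<theta> i)) + d (?S i q (\<theta> i)) (?S (Suc i) r \<psi>)"
    by (rule M.triangle) (use X in auto)
  also have "d (?S 0 t 0) (?S i q (\<theta> i)) \<le> (1 + e) * cmod (of_real t - q * cis ((\<Sum>j<i. \<theta> j) + \<theta> i))"
    by (rule Suc.IH) (use i q th[of i] Suc.prems in auto)
  also have "(\<Sum>j<i. \<theta> j) + \<theta> i = \<Phi>" by (simp add: \<Phi>_def)
  also have "d (?S i q (\<theta> i)) (?S (Suc i) r \<psi>) \<le> (1 + e) * cmod (q * cis 0 - r * cis \<psi>)"
  proof -
    have "0 < \<theta> (Suc i)" using Ssi by blast
    then have "d (?S (Suc i) q 0) (?S (Suc i) r \<psi>) \<le> (1 + e) * cmod (q * cis 0 - r * cis \<psi>)"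
      using Ssi q Suc.prems by (metis less_eq_real_def order_refl)
    then show ?thesis by (simp only: same)
  qed
  also have "cmod (q * cis 0 - r * cis \<psi>) = cmod (q * cis \<Phi> - r * cis (\<Phi> + \<psi>))"
  proof -
    have "q * cis \<Phi> - r * cis (\<Phi> + \<psi>) = cis \<Phi> * (q * cis 0 - r * cis \<psi>)" by (simp add: algebra_simps cis_mult)
    then show ?thesis by (simp only: norm_mult norm_cis mult_1)
  qed
  also have "(1 + e) * cmod (of_real t - q * cis \<Phi>) + (1 + e) * cmod (q * cis \<Phi> - r * cis (\<Phi> + \<psi>)) =
     (1 + e) * cmod (of_real t - r * cis (\<Phi> + \<psi>))" unfolding q(3)[symmetric] by (simp add: algebra_simps)
  finally show ?case unfolding \<Phi>_def by simp
qed


text \<open>A closed loop around \<open>v\<close> that runs exactly once through the sector spanned by \<open>u\<close> and \<open>w\<close> cannot be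
  coned off by geodesics missing \<open>v\<close>: the function \<open>G\<close> below does not vanish near \<open>v\<close> except at \<open>v\<close>,
  and it turns once around 0 along the loop.\<close>

lemma no_cone_off:
  fixes loop :: "real \<Rightarrow> 'v \<Rightarrow> real"
  assumes dist: "u \<noteq> w" "u \<noteq> v" "w \<noteq> v" and chain: "is_chain V le {v, u, w}"
    and maximal: "\<And>\<sigma>. is_chain V le \<sigma> \<Longrightarrow> {v, u, w} \<subseteq> \<sigma> \<Longrightarrow> \<sigma> = {v, u, w}"
    and fin: "fin v" "fin u" "fin w" and tg: "0 < tu" "0 < tw"
    and T: "0 < \<theta>" "\<theta> \<le> T"
    and loopX: "\<And>\<phi>. 0 \<le> \<phi> \<Longrightarrow> \<phi> \<le> T \<Longrightarrow> loop \<phi> \<in> X"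
    and lip: "0 \<le> K" "\<And>a b. 0 \<le> a \<Longrightarrow> a \<le> T \<Longrightarrow> 0 \<le> b \<Longrightarrow> b \<le> T \<Longrightarrow> d (loop a) (loop b) \<le> K * \<bar>a - b\<bar>"
    and closed: "loop 0 = loop T"
    and miss: "\<And>\<phi>. 0 \<le> \<phi> \<Longrightarrow> \<phi> \<le> T \<Longrightarrow> d (loop 0) (loop \<phi>) < d (loop 0) (pt v) + d (pt v) (loop \<phi>)"
    and near: "\<And>\<phi>. 0 \<le> \<phi> \<Longrightarrow> \<phi> \<le> T \<Longrightarrow> d (pt v) (loop \<phi>) \<le> \<rho>" 
    and Cv: "\<And>x y. x \<in> X \<Longrightarrow> y \<in> X \<Longrightarrow> \<bar>x v - y v\<bar> \<le> Cv * d x y" "0 < Cv" "3 * \<rho> * Cv < 1"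
    and first: "\<And>\<phi>. 0 \<le> \<phi> \<Longrightarrow> \<phi> \<le> \<theta> / 2 \<Longrightarrow> loop \<phi> w * tw \<le> loop \<phi> u * tu"
      "\<And>\<phi>. \<theta> / 2 \<le> \<phi> \<Longrightarrow> \<phi> \<le> \<theta> \<Longrightarrow> loop \<phi> u * tu \<le> loop \<phi> w * tw"
      "0 < loop (\<theta> / 2) u" "loop (\<theta> / 2) v + loop (\<theta> / 2) u + loop (\<theta> / 2) w = 1"
    and rest: "\<And>\<phi>. \<theta> \<le> \<phi> \<Longrightarrow> \<phi> \<le> T \<Longrightarrow> loop \<phi> u * loop \<phi> w = 0"
  shows False
proof -
  have ptv: "pt v \<in> X" by (rule pt_X, rule chain_subset[OF chain]) auto
  define L where "L \<phi> = d (loop 0) (loop \<phi>)" for \<phi>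
  define \<gamma> where "\<gamma> \<phi> = (SOME g. is_geodesic X d g (loop 0) (loop \<phi>))" for \<phi>
  have T0: "0 \<le> T" using T by simp
  have l0: "loop 0 \<in> X" using loopX T0 by simp
  have \<gamma>: "is_geodesic X d (\<gamma> \<phi>) (loop 0) (loop \<phi>)" if "0 \<le> \<phi>" "\<phi> \<le> T" for \<phi>
    unfolding \<gamma>_def using geodesic_ex[OF l0 loopX[OF that]] by (rule someI_ex)
  have \<gamma>1: "\<gamma> \<phi> 0 = loop 0" "\<gamma> \<phi> (L \<phi>) = loop \<phi>" if "0 \<le> \<phi>" "\<phi> \<le> T" for \<phi>
    using \<gamma>[OF that] by (auto simp: is_geodesic_def L_def)
  have \<gamma>2: "\<gamma> \<phi> s \<in> X" if "0 \<le> \<phi>" "\<phi> \<le> T" "0 \<le> s" "s \<le> L \<phi>" for \<phi> s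
    using \<gamma>[OF that(1,2)] that by (auto simp: is_geodesic_def L_def)
  have \<gamma>3: "d (\<gamma> \<phi> s) (\<gamma> \<phi> t) = \<bar>s - t\<bar>" if "0 \<le> \<phi>" "\<phi> \<le> T" "0 \<le> s" "s \<le> L \<phi>" "0 \<le> t" "t \<le> L \<phi>" for \<phi> s t
    using \<gamma>[OF that(1,2)] that by (auto simp: is_geodesic_def L_def)
  have L0: "0 \<le> L \<phi>" for \<phi> by (simp add: L_def)
  have LR: "L \<phi> \<le> 2 * \<rho>" if "0 \<le> \<phi>" "\<phi> \<le> T" for \<phi>
  proof -
    have "L \<phi> < d (pt v) (loop 0) + d (pt v) (loop \<phi>)" using miss[OF that] M.commute[of "loop 0" "pt v"] by (simp add: L_def)
    then show ?thesis using near[OF that] near[of 0] T0 by simp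
  qed
  \<comment> \<open>No geodesic is longer than \<open>2 * \<rho>\<close>. The \<open>min\<close> in
    \<open>H\<close> lets shorter ones rest at their end, so the cone is parametrised by a rectangle
    whose side \<open>snd p = R\<close> is the loop.\<close>
  define R where "R = 2 * \<rho>"
  have R: "0 \<le> R" using LR[of 0] L0[of 0] T0 unfolding R_def by simp
  define H where "H p = \<gamma> (fst p) (min (snd p) (L (fst p)))" for p
  let ?S = "{0..T} \<times> {0..R}"
  have pS: "0 \<le> fst p" "fst p \<le> T" "0 \<le> snd p" "snd p \<le> R" if "p \<in> ?S" for p using that by auto
  have HX: "H p \<in> X" if "p \<in> ?S" for p unfolding H_def using pS[OF that] L0 by (intro \<gamma>2) auto
  \<comment> \<open>Points are compared at the smaller of the two arc lengths, where
    \<open>fan\<close> gives one \<open>K\<close>; the difference of the lengths of the two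
    geodesics accounts for the other.\<close>
  have Hd: "d (H p) (H q) \<le> (1 + 2 * K) * dist p q" if p: "p \<in> ?S" and q: "q \<in> ?S" for p q
  proof -
    define a where "a = min (snd p) (L (fst p))"
    define a' where "a' = min (snd q) (L (fst q))"
    define b where "b = min a a'"
    note P = pS[OF p] and Q = pS[OF q]
    have a: "0 \<le> a" "a \<le> L (fst p)" "0 \<le> a'" "a' \<le> L (fst q)" using P Q L0 by (auto simp: a_def a'_def)
    have b: "0 \<le> b" "b \<le> L (fst p)" "b \<le> L (fst q)" using a by (auto simp: b_def)
    have X: "\<gamma> (fst p) a \<in> X" "\<gamma> (fst p) b \<in> X" "\<gamma> (fst q) b \<in> X" "\<gamma> (fst q) a' \<in> X" "loop (fst p) \<in> X" "loop (fst q) \<in> X"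
      using \<gamma>2 a b P Q loopX by auto
    have lp: "d (loop (fst p)) (loop (fst q)) \<le> K * \<bar>fst p - fst q\<bar>" using lip P Q by simp
    have "d (H p) (H q) \<le> d (\<gamma> (fst p) a) (\<gamma> (fst p) b) + d (\<gamma> (fst p) b) (\<gamma> (fst q) a')"
      unfolding H_def a_def[symmetric] a'_def[symmetric] by (rule M.triangle) (use X in auto)
    also have "d (\<gamma> (fst p) b) (\<gamma> (fst q) a') \<le> d (\<gamma> (fst p) b) (\<gamma> (fst q) b) + d (\<gamma> (fst q) b) (\<gamma> (fst q) a')"
      by (rule M.triangle) (use X in auto)
    also have "d (\<gamma> (fst p) b) (\<gamma> (fst q) b) \<le> d (loop (fst p)) (loop (fst q))"
      by (rule fan[OF l0 X(5,6) \<gamma>[OF P(1,2)] \<gamma>[OF Q(1,2)]]) (use b in \<open>auto simp: L_def\<close>)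
    also have "d (\<gamma> (fst p) a) (\<gamma> (fst p) b) = \<bar>a - b\<bar>" using \<gamma>3 P a b by simp
    also have "d (\<gamma> (fst q) b) (\<gamma> (fst q) a') = \<bar>b - a'\<bar>" using \<gamma>3 Q a b by simp
    finally have "d (H p) (H q) \<le> \<bar>a - a'\<bar> + d (loop (fst p)) (loop (fst q))" by (auto simp: b_def)
    moreover have "\<bar>L (fst p) - L (fst q)\<bar> \<le> d (loop (fst p)) (loop (fst q))"
      using M.triangle[OF l0 X(5,6)] M.triangle[OF l0 X(6,5)] M.commute[of "loop (fst p)" "loop (fst q)"] by (simp add: L_def)
    moreover have "\<bar>a - a'\<bar> \<le> \<bar>snd p - snd q\<bar> + \<bar>L (fst p) - L (fst q)\<bar>" unfolding a_def a'_def by (simp add: min_def) arith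
    ultimately have "d (H p) (H q) \<le> \<bar>snd p - snd q\<bar> + 2 * (K * \<bar>fst p - fst q\<bar>)" using lp by linarith
    also have "\<bar>snd p - snd q\<bar> \<le> dist p q" using dist_snd_le[of p q] by (simp add: dist_real_def)
    also have "K * \<bar>fst p - fst q\<bar> \<le> K * dist p q" using dist_fst_le[of p q] lip(1) by (intro mult_left_mono) (simp_all add: dist_real_def)
    finally show ?thesis by (simp add: algebra_simps)
  qed
  have cont: "continuous_on ?S (\<lambda>p. H p z)" if z: "fin z" for z
  proof -
    obtain C where C: "C > 0" "\<forall>x\<in>X. \<forall>y\<in>X. \<bar>x z - y z\<bar> \<le> C * d x y" using coord_lipschitz[OF z] by blast
    have "(C * (1 + 2 * K))-lipschitz_on ?S (\<lambda>p. H p z)"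
    proof (rule lipschitz_onI)
      fix p q assume pq: "p \<in> ?S" "q \<in> ?S"
      have "\<bar>H p z - H q z\<bar> \<le> C * d (H p) (H q)" using C(2) HX pq by blast
      also have "\<dots> \<le> C * ((1 + 2 * K) * dist p q)" using Hd[OF pq] C(1) by (intro mult_left_mono) auto
      finally show "dist (H p z) (H q z) \<le> C * (1 + 2 * K) * dist p q" by (simp add: dist_real_def mult.assoc)
    qed (use C lip in auto)
    then show ?thesis by (rule lipschitz_on_continuous_on)
  qed
  \<comment> \<open>The cone stays within \<open>3 * \<rho>\<close> of \<open>v\<close>, so its
    coordinate at \<open>v\<close> cannot fall from 1 to 0.\<close>
  have Hv: "H p v > 0" if p: "p \<in> ?S" for p
  proof -
    note P = pS[OF p]
    have "d (pt v) (H p) \<le> d (pt v) (loop 0) + d (loop 0) (H p)" by (rule M.triangle) (use ptv l0 HX p in auto)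
    also have "d (loop 0) (H p) = min (snd p) (L (fst p))"
      using \<gamma>3[of "fst p" 0 "min (snd p) (L (fst p))"] \<gamma>1[of "fst p"] P L0 unfolding H_def by simp
    also have "\<dots> \<le> 2 * \<rho>" using LR P by (simp add: min_le_iff_disj)
    finally have "d (pt v) (H p) \<le> 3 * \<rho>" using near[of 0] T0 by simp
    then have "Cv * d (pt v) (H p) < 1" using Cv(2,3) by (smt (verit) mult.commute mult_left_mono)
    then have "\<bar>pt v v - H p v\<bar> < 1" using Cv(1)[OF ptv HX[OF p]] by simp
    then show ?thesis by simp
  qed
  \<comment> \<open>A geodesic through \<open>v\<close> would turn \<open>miss\<close> into an
    equality.\<close>
  have Hne: "H p \<noteq> pt v" if p: "p \<in> ?S" for p
  proof
    assume e: "H p = pt v"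
    note P = pS[OF p]
    define a where "a = min (snd p) (L (fst p))"
    have a: "0 \<le> a" "a \<le> L (fst p)" using P L0 by (auto simp: a_def)
    have "d (loop 0) (pt v) = a" using \<gamma>3[of "fst p" 0 a] \<gamma>1[of "fst p"] P a L0 e unfolding H_def a_def[symmetric] by simp
    moreover have "d (pt v) (loop (fst p)) = L (fst p) - a"
      using \<gamma>3[of "fst p" a "L (fst p)"] \<gamma>1[of "fst p"] P a L0 e unfolding H_def a_def[symmetric] by simp
    ultimately show False using miss[OF P(1,2)] by (simp add: L_def)
  qed
  define A where "A y = y u * tu" for y :: "'v \<Rightarrow> real"
  define B where "B y = y w * tw" for y :: "'v \<Rightarrow> real"
  define r where "r y = 1 - y v - y u - y w" for y :: "'v \<Rightarrow> real"
  \<comment> \<open>\<open>A\<close> and \<open>B\<close> are the tangential coordinates in the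
    triangle and \<open>r\<close> is the mass off it. If \<open>A y * B y = 0\<close> the value is
    real and nonnegative. Inside the triangle \<open>r = 0\<close>, and the value is real only on
    the bisector \<open>A = B\<close>, where it equals \<open>-4 * A\<^sup>2\<close>; any factor
    above 4 in place of 8 would make it negative. Crossing the triangle once therefore means one
    turn around 0.\<close>
  define G where "G y = Complex ((A y + B y + r y)\<^sup>2 - 8 * (A y * B y)) (A y * B y * (A y - B y))" for y
  have sumle: "y v + y u + y w \<le> 1" "y v + y u + y w = 1 \<Longrightarrow> \<forall>z. z \<notin> {v, u, w} \<longrightarrow> y z = 0"
     "supp y \<subseteq> {v, u, w} \<Longrightarrow> y v + y u + y w = 1" if y: "y \<in> X" for y
  proof -
    note D = X_D[OF y]
    have 1: "sum y (supp y \<union> {v, u, w}) = 1"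
      using D by (subst sum.mono_neutral_right[of _ "supp y"]) (auto simp: supp_def)
    have 2: "sum y (supp y \<union> {v, u, w}) = sum y (supp y - {v, u, w}) + sum y {v, u, w}"
    proof -
      have "supp y \<union> {v, u, w} = (supp y - {v, u, w}) \<union> {v, u, w}" by auto
      then show ?thesis using D(5) by (subst sum.union_disjoint[symmetric]) auto
    qed
    have 3: "sum y {v, u, w} = y v + y u + y w" using dist by simp
    have 4: "0 \<le> sum y (supp y - {v, u, w})" using D(1) by (intro sum_nonneg)
    show "y v + y u + y w \<le> 1" using 1 2 3 4 by simp
    show "\<forall>z. z \<notin> {v, u, w} \<longrightarrow> y z = 0" if "y v + y u + y w = 1"
    proof -
      have "sum y (supp y - {v, u, w}) = 0" using 1 2 3 that by simp
      then have "\<forall>z\<in>supp y - {v, u, w}. y z = 0" using D by (subst (asm) sum_nonneg_eq_0_iff) auto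
      then show ?thesis by (auto simp: supp_def)
    qed
    show "y v + y u + y w = 1" if "supp y \<subseteq> {v, u, w}"
    proof -
      have "supp y - {v, u, w} = {}" using that by blast
      then have "sum y (supp y - {v, u, w}) = 0" by (simp only: sum.empty)
      then show ?thesis using 1 2 3 by simp
    qed
  qed
  have nonneg: "0 \<le> A y" "0 \<le> B y" "0 \<le> r y" if "y \<in> X" for y
    using X_D(1)[OF that] sumle(1)[OF that] tg by (auto simp: A_def B_def r_def)
  have Gpos: "Re (G y) > 0" if y: "y \<in> X" "y \<noteq> pt v" "A y * B y = 0" for y
  proof -
    have "A y + B y + r y \<noteq> 0"
    proof
      assume "A y + B y + r y = 0"
      then have z: "A y = 0" "B y = 0" "r y = 0" using nonneg[OF y(1)] by auto
      then have uw: "y u = 0" "y w = 0" using tg by (auto simp: A_def B_def)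
      then have v1: "y v = 1" using z by (simp add: r_def)
      then have "\<forall>z. z \<notin> {v, u, w} \<longrightarrow> y z = 0" using sumle(2)[OF y(1)] uw by simp
      then have "y = pt v" using uw v1 by (auto simp: pt_def fun_eq_iff)
      then show False using y by simp
    qed
    then have "(A y + B y + r y)\<^sup>2 > 0" by simp
    then show ?thesis unfolding G_def complex.sel y(3) by simp
  qed
  have Gne: "G y \<noteq> 0" if y: "y \<in> X" "y \<noteq> pt v" "y v > 0" for y
  proof (cases "A y * B y = 0")
    case True then show ?thesis using Gpos[OF y(1,2)] by auto
  next
    case False
    show ?thesis
    proof
      assume "G y = 0"
      then have e: "(A y + B y + r y)\<^sup>2 - 8 * (A y * B y) = 0" "A y * B y * (A y - B y) = 0" by (auto simp: G_def complex_eq_iff)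
      then have AB: "A y = B y" using False by simp
      have "y u \<noteq> 0" "y w \<noteq> 0" using False by (auto simp: A_def B_def)
      \<comment> \<open>Three positive coordinates force the support to be the whole maximal
        simplex, so no mass remains for \<open>r\<close>.\<close>
      then have "{v, u, w} \<subseteq> supp y" using y(3) by (auto simp: supp_def)
      then have "supp y = {v, u, w}" using maximal X_D(2)[OF y(1)] by blast
      then have "r y = 0" using sumle(3)[OF y(1)] by (simp add: r_def)
      then have "(A y)\<^sup>2 = 0" using e(1) AB by (simp add: power2_eq_square algebra_simps)
      then show False using False by simp
    qed
  qed
  have contG: "continuous_on ?S (\<lambda>p. G (H p))"
    unfolding G_def A_def B_def r_def Complex_eq by (intro continuous_intros cont fin)
  have cS: "contractible ?S" by (intro convex_imp_contractible convex_Times) auto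
  \<comment> \<open>A zero-free function on the contractible rectangle has a continuous logarithm;
    its imaginary part is a continuous argument along the loop.\<close>
  obtain g where g: "continuous_on ?S g" "\<And>p. p \<in> ?S \<Longrightarrow> G (H p) = exp (g p)"
    by (rule continuous_logarithm_on_contractible[OF contG cS]) (use Gne HX Hne Hv in auto)
  have const: "f a = f b" if f: "continuous_on S f" "connected S" "\<And>x y. x \<in> S \<Longrightarrow> y \<in> S \<Longrightarrow> f x \<noteq> f y \<Longrightarrow> 1 \<le> norm (f x - f y)"
     "a \<in> S" "b \<in> S" for f :: "'b::topological_space \<Rightarrow> complex" and S a b
  proof -
    have "f constant_on S" by (rule continuous_discrete_range_constant[OF f(2,1)]) (use f(3) in \<open>auto intro!: exI[of _ 1]\<close>)
    then show ?thesis using f(4,5) by (auto simp: constant_on_def)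
  qed
  \<comment> \<open>Distinct logarithms of one number differ by a nonzero multiple of
    \<open>2 * pi * \<i>\<close>, so a continuous choice of logarithm of a constant cannot
    jump.\<close>
  have expne: "1 \<le> norm (z - z')" if "exp z = exp z'" "z \<noteq> z'" for z z' :: complex
  proof -
    from iffD1[OF exp_eq that(1)] obtain n :: int where n: "z = z' + (of_int (2 * n) * pi) * \<i>" ..
    then have "n \<noteq> 0" using that(2) by auto
    then have "1 \<le> \<bar>real_of_int n\<bar>" by linarith
    have "norm (z - z') = 2 * \<bar>real_of_int n\<bar> * pi" unfolding n by (simp add: norm_mult)
    moreover have "1 * 1 \<le> 2 * \<bar>real_of_int n\<bar> * pi" using \<open>1 \<le> \<bar>real_of_int n\<bar>\<close> pi_gt3 by (intro mult_mono) auto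
    ultimately show ?thesis by simp
  qed
  have base: "H p = loop 0" if "p \<in> ?S" "fst p = 0 \<or> fst p = T \<or> snd p = 0" for p
  proof -
    have "L 0 = 0" "L T = 0" using l0 closed by (auto simp: L_def)
    then have "min (snd p) (L (fst p)) = 0" using that pS[OF that(1)] L0[of "fst p"] by (auto simp: min_def)
    then show ?thesis unfolding H_def using \<gamma>1 pS[OF that(1)] by simp
  qed
  have top: "H (\<phi>, R) = loop \<phi>" if "0 \<le> \<phi>" "\<phi> \<le> T" for \<phi>
    using LR[OF that] \<gamma>1[OF that] by (simp add: H_def R_def min_def)
  have gsame: "g p = g q" if h: "connected S" "S \<subseteq> ?S" "\<And>z. z \<in> S \<Longrightarrow> H z = loop 0" "p \<in> S" "q \<in> S" for p q S
  proof (rule const[OF continuous_on_subset[OF g(1) h(2)] h(1) _ h(4,5)])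
    fix x y assume xy: "x \<in> S" "y \<in> S" "g x \<noteq> g y"
    have "exp (g x) = exp (g y)" using g(2)[of x] g(2)[of y] h(2,3) xy by (metis subsetD)
    then show "1 \<le> norm (g x - g y)" using expne xy by blast
  qed
  \<comment> \<open>Three sides of the rectangle are mapped to the base point. Following them shows
    that the argument returns to its initial value along the loop.\<close>
  have "g (0, R) = g (0, 0)"
    by (rule gsame[of "{0} \<times> {0..R}"]) (use R T0 base in \<open>auto intro!: connected_Times\<close>)
  moreover have "g (0, 0) = g (T, 0)"
    by (rule gsame[of "{0..T} \<times> {0}"]) (use R T0 base in \<open>auto intro!: connected_Times\<close>)
  moreover have "g (T, 0) = g (T, R)"
    by (rule gsame[of "{T} \<times> {0..R}"]) (use R T0 base in \<open>auto intro!: connected_Times\<close>)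
  ultimately have ends: "g (0, R) = g (T, R)" by simp
  define I where "I \<phi> = Im (g (\<phi>, R))" for \<phi>
  have contI: "continuous_on {0..T} I" unfolding I_def
    by (intro continuous_on_Im continuous_on_compose2[OF g(1)] continuous_intros) (use R in auto)
  have ReG: "Re (G (loop \<phi>)) = exp (Re (g (\<phi>, R))) * cos (I \<phi>)" "Im (G (loop \<phi>)) = exp (Re (g (\<phi>, R))) * sin (I \<phi>)"
    if "0 \<le> \<phi>" "\<phi> \<le> T" for \<phi>
    using g(2)[of "(\<phi>, R)"] top[OF that] that R by (auto simp: Re_exp Im_exp I_def)
  have loopne: "loop \<phi> \<noteq> pt v" if "0 \<le> \<phi>" "\<phi> \<le> T" for \<phi> using Hne[of "(\<phi>, R)"] top[OF that] that R by auto
  have restI: "sin (I \<phi>) = 0 \<and> cos (I \<phi>) = 1" if "\<theta> \<le> \<phi>" "\<phi> \<le> T" for \<phi>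
  proof -
    have p: "0 \<le> \<phi>" using that T by simp
    have AB: "A (loop \<phi>) * B (loop \<phi>) = 0" using rest[OF that] by (auto simp: A_def B_def)
    then have "Im (G (loop \<phi>)) = 0" by (simp add: G_def)
    then have s: "sin (I \<phi>) = 0" using ReG[OF p that(2)] by simp
    have "Re (G (loop \<phi>)) > 0" using Gpos[OF loopX[OF p that(2)] loopne[OF p that(2)] AB] .
    then have "cos (I \<phi>) > 0" using ReG[OF p that(2)] by (simp add: zero_less_mult_iff)
    then show ?thesis using s sin_zero_abs_cos_one[OF s] by simp
  qed
  \<comment> \<open>After the first triangle has been traversed the values are positive reals, so
    the argument stays at one multiple of \<open>2 * pi\<close>.\<close>
  have I\<theta>: "I \<theta> = I T"
  proof -
    have "complex_of_real (I \<theta>) = complex_of_real (I T)"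
    proof (rule const[of "{\<theta>..T}" "\<lambda>\<phi>. complex_of_real (I \<phi>)"])
      show "continuous_on {\<theta>..T} (\<lambda>\<phi>. complex_of_real (I \<phi>))"
        using contI T by (intro continuous_on_of_real continuous_on_subset[OF contI]) auto
      fix x y assume "x \<in> {\<theta>..T}" "y \<in> {\<theta>..T}" "complex_of_real (I x) \<noteq> complex_of_real (I y)"
      moreover have "cis (I x) = cis (I y)" using calculation restI[of x] restI[of y] by (simp add: complex_eq_iff)
      ultimately show "1 \<le> norm (complex_of_real (I x) - complex_of_real (I y))"
        using expne[of "\<i> * I x" "\<i> * I y"] by (simp add: cis_conv_exp norm_mult flip: right_diff_distrib)
    qed (use T in auto)
    then show ?thesis by simp
  qed
  define J where "J \<phi> = I \<phi> - I T" for \<phi>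
  have IT: "sin (I T) = 0" "cos (I T) = 1" using restI[of T] T by auto
  have sJ: "sin (J \<phi>) = sin (I \<phi>)" "cos (J \<phi>) = cos (I \<phi>)" for \<phi> using IT by (simp_all add: J_def sin_diff cos_diff)
  have J0: "J 0 = 0" "J \<theta> = 0" using ends I\<theta> by (auto simp: J_def I_def)
  have contJ: "continuous_on {0..T} J" unfolding J_def by (intro continuous_intros contI)
  have mid: "0 \<le> \<theta> / 2" "\<theta> / 2 \<le> T" using T by auto
  have ABmid: "A (loop (\<theta> / 2)) = B (loop (\<theta> / 2))" using first(1)[of "\<theta> / 2"] first(2)[of "\<theta> / 2"] T by (auto simp: A_def B_def)
  have Apos: "A (loop (\<theta> / 2)) > 0" using first(3) tg by (simp add: A_def)
  have r0: "r (loop (\<theta> / 2)) = 0" using first(4) by (simp add: r_def)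
  have "Re (G (loop (\<theta> / 2))) < 0"
    using mult_pos_pos[OF Apos Apos] by (simp add: G_def ABmid[symmetric] r0 power2_eq_square)
  then have cneg: "cos (J (\<theta> / 2)) < 0" using ReG[OF mid] by (simp add: sJ mult_less_0_iff)
  have s1: "0 \<le> sin (J \<phi>)" if "0 \<le> \<phi>" "\<phi> \<le> \<theta> / 2" for \<phi>
  proof -
    have p: "0 \<le> \<phi>" "\<phi> \<le> T" using that T by auto
    have "0 \<le> Im (G (loop \<phi>))" using first(1)[OF that] nonneg[OF loopX[OF p]] by (simp add: G_def A_def B_def)
    then show ?thesis using ReG[OF p] by (simp add: sJ zero_le_mult_iff)
  qed
  have s2: "sin (J \<phi>) \<le> 0" if "\<theta> / 2 \<le> \<phi>" "\<phi> \<le> \<theta>" for \<phi>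
  proof -
    have p: "0 \<le> \<phi>" "\<phi> \<le> T" using that T by auto
    have "Im (G (loop \<phi>)) \<le> 0" using first(2)[OF that] nonneg[OF loopX[OF p]]
      by (simp add: G_def A_def B_def mult_nonneg_nonpos)
    then show ?thesis using ReG[OF p] by (simp add: sJ mult_le_0_iff)
  qed
  \<comment> \<open>The argument relative to its final value is 0 at both ends of the first sector
    and has negative cosine in the middle. If it is large and positive there, it passes
    \<open>pi / 2\<close> on the way back, where the sine should be nonpositive; if it is large and
    negative, it passes \<open>-(pi / 2)\<close> on the way in, where the sine should be
    nonnegative.\<close>
  have "\<not> \<bar>J (\<theta> / 2)\<bar> \<le> pi / 2" 
  proof
    assume "\<bar>J (\<theta> / 2)\<bar> \<le> pi / 2"
    then have "- (pi / 2) \<le> J (\<theta> / 2)" "J (\<theta> / 2) \<le> pi / 2" by linarith+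
    then show False using cneg cos_ge_zero[of "J (\<theta> / 2)"] by linarith
  qed
  then consider "J (\<theta> / 2) \<ge> pi / 2" | "J (\<theta> / 2) \<le> - (pi / 2)" by linarith
  then show False
  proof cases
    case 1
    have "\<exists>x\<ge>\<theta> / 2. x \<le> \<theta> \<and> J x = pi / 2"
      by (rule IVT2') (use 1 J0 T pi_gt_zero in \<open>auto intro: continuous_on_subset[OF contJ]\<close>)
    then obtain x where "\<theta> / 2 \<le> x" "x \<le> \<theta>" "J x = pi / 2" by blast
    then have "sin (pi / 2) \<le> 0" using s2[of x] by metis
    then show False by simp
  next
    case 2
    have "\<exists>x\<ge>0. x \<le> \<theta> / 2 \<and> J x = - (pi / 2)"
      by (rule IVT2') (use 2 J0 T pi_gt_zero in \<open>auto intro: continuous_on_subset[OF contJ]\<close>)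
    then obtain x where "0 \<le> x" "x \<le> \<theta> / 2" "J x = - (pi / 2)" by blast
    then have "0 \<le> sin (- (pi / 2))" using s1[of x] by metis
    then show False by simp
  qed
qed

end

section \<open>The total angle of a closed cycle in a link\<close>

lemma sector_pt_start: assumes "sin \<theta> \<noteq> 0"
  shows "sector_pt v tg u w \<theta> r 0 = (\<lambda>x. if x = u then r / tg u else if x = w then 0 else if x = v then 1 - r / tg u else 0)"
  using assms by (auto simp: sector_pt_def Let_def fun_eq_iff)

lemma sector_pt_join:
  assumes "sin \<theta> \<noteq> 0" "sin \<theta>' \<noteq> 0" "u \<noteq> w" "w \<noteq> z" "u \<noteq> v" "w \<noteq> v" "z \<noteq> v"
  shows "sector_pt v tg u w \<theta> r \<theta> = sector_pt v tg w z \<theta>' r 0"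
  using assms unfolding sector_pt_swap[OF assms(3)] by (auto simp: sector_pt_start fun_eq_iff)

context geodesic_simplex_metric
begin

text \<open>Suppose the total angle \<open>T\<close> is below \<open>2 * pi\<close> and go around
  \<open>v\<close> on arcs of small radius. Every point of this loop is reached from the base point
  through a total angle of at most \<open>T / 2 < pi\<close> in one of the two directions, so the
  developed chord is definitely shorter than the detour through \<open>v\<close>. Then
  \<open>no_cone_off\<close> applies; \<open>uniq\<close> guarantees that the loop meets the
  interior of the first triangle during its first arc only.\<close>

lemma link_cycle:
  fixes us :: "nat \<Rightarrow> 'v" and \<theta> :: "nat \<Rightarrow> real"
  assumes m: "0 < m" and closed: "us m = us 0"
    and tri: "\<And>i. i < m \<Longrightarrow> is_chain V le {v, us i, us (Suc i)} \<and> us i \<noteq> us (Suc i) \<and> us i \<noteq> v \<and> us (Suc i) \<noteq> v"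
    and cor: "\<And>i. i < m \<Longrightarrow> corner tg v (us i) (us (Suc i)) (\<theta> i)"
    and uniq: "\<And>i. 0 < i \<Longrightarrow> i < m \<Longrightarrow> \<not> {us 0, us 1} \<subseteq> {us i, us (Suc i)}"
    and maximal: "\<And>\<sigma>. is_chain V le \<sigma> \<Longrightarrow> {v, us 0, us 1} \<subseteq> \<sigma> \<Longrightarrow> \<sigma> = {v, us 0, us 1}"
    and fin: "fin v" "fin (us 0)" "fin (us 1)"
  shows "2 * pi \<le> (\<Sum>i<m. \<theta> i)"
proof (rule ccontr)
  define \<Phi> where "\<Phi> i = (\<Sum>j<i. \<theta> j)" for i
  define T where "T = \<Phi> m"
  assume "\<not> 2 * pi \<le> (\<Sum>i<m. \<theta> i)"
  then have T2: "T < 2 * pi" by (simp add: T_def \<Phi>_def)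
  have th: "0 < \<theta> i" "\<theta> i < pi" if "i < m" for i using cor[OF that] by (auto simp: corner_def)
  have tgp: "tg (us i) > 0" if "i \<le> m" for i
  proof (cases "i < m")
    case True then show ?thesis using cor[OF True] by (simp add: corner_def)
  next
    case False then have "us i = us 0" using that closed by (simp add: not_less) 
    then show ?thesis using cor[OF m] by (simp add: corner_def)
  qed
  have sn: "sin (\<theta> i) > 0" if "i < m" for i using th[OF that] by (intro sin_gt_zero) auto
  have \<Phi>S: "\<Phi> (Suc i) = \<Phi> i + \<theta> i" for i by (simp add: \<Phi>_def)
  have \<Phi>0: "\<Phi> 0 = 0" by (simp add: \<Phi>_def)
  have \<Phi>mono: "\<Phi> i \<le> \<Phi> j" if "i \<le> j" "j \<le> m" for i j
    using that
  proof (induction j)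
    case (Suc j) then show ?case using th(1)[of j] \<Phi>S[of j] by (cases "i = Suc j") auto
  qed simp
  have \<Phi>strict: "\<Phi> i < \<Phi> j" if "i < j" "j \<le> m" for i j
    using \<Phi>mono[of "Suc i" j] that th(1)[of i] \<Phi>S[of i] by simp
  have Tpos: "0 < T" using \<Phi>strict[of 0 m] m \<Phi>0 by (simp add: T_def)
  \<comment> \<open>A chord of angle at most \<open>T / 2\<close> in a circle of radius
    \<open>t\<close> has length at most \<open>2 * t * q\<close>.\<close>
  define q where "q = sin (T / 4)"
  have q: "0 < q" "q < 1"
  proof -
    show "0 < q" unfolding q_def using Tpos T2 by (intro sin_gt_zero) auto
    have "sin (T / 4) < sin (pi / 2)" using Tpos T2 by (intro sin_monotone_2pi) auto
    then show "q < 1" by (simp add: q_def)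
  qed
  \<comment> \<open>Chosen so that the distortion of the sectors preserves the gap between chord and
    detour: \<open>(1 + e) * q < 1 - e\<close>.\<close>
  define e where "e = (1 - q) / 4"
  have e: "0 < e" "e < 1" using q by (auto simp: e_def)
  have qe: "(1 + e) * q < 1 - e"
  proof -
    have "e * q \<le> e * 1" using e q by (intro mult_left_mono) auto
    moreover have "(1 + e) * q = q + e * q" by (simp add: algebra_simps)
    moreover have "q + e < 1 - e" using q by (simp add: e_def field_simps)
    ultimately show ?thesis by linarith
  qed
  have "\<forall>i\<in>{..<m}. \<exists>t0>0. \<forall>t. 0 < t \<and> t \<le> t0 \<longrightarrow> sector tg e t v (us i) (us (Suc i)) (\<theta> i)"
    using sector_of_corner[OF cor _ _ _ _ fin(1) e] tri by simp
  from bchoice[OF this] obtain f where f: "\<forall>i\<in>{..<m}. 0 < f i \<and> (\<forall>t. 0 < t \<and> t \<le> f i \<longrightarrow> sector tg e t v (us i) (us (Suc i)) (\<theta> i))" ..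
  obtain Cv where Cv: "Cv > 0" "\<forall>x\<in>X. \<forall>y\<in>X. \<bar>x v - y v\<bar> \<le> Cv * d x y" using coord_lipschitz[OF fin(1)] by blast
  \<comment> \<open>The loop stays within \<open>2 * t\<close> of \<open>v\<close>, so the smallness
    condition of \<open>no_cone_off\<close> reads \<open>6 * t * Cv < 1\<close>.\<close>
  define t where "t = min (Min (f ` {..<m})) (1 / (7 * Cv))"
  have fm: "f ` {..<m} \<noteq> {}" "finite (f ` {..<m})" using m by auto
  have "0 < Min (f ` {..<m})" using Min_in[OF fm(2,1)] f by auto
  then have t: "0 < t" using Cv by (simp add: t_def)
  have S: "sector tg e t v (us i) (us (Suc i)) (\<theta> i)" if "i < m" for i
  proof -
    have "Min (f ` {..<m}) \<le> f i" by (rule Min_le[OF fm(2)]) (use that in simp)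
    then have "t \<le> f i" unfolding t_def by (rule min.coboundedI1)
    then show ?thesis using f that t by auto
  qed
  have tCv: "3 * (2 * t) * Cv < 1"
  proof -
    have "t \<le> 1 / (7 * Cv)" by (simp add: t_def)
    then have "t * (7 * Cv) \<le> 1" using Cv(1) by (simp add: field_simps)
    moreover have "0 < t * Cv" using t Cv by simp
    ultimately show ?thesis by (simp add: algebra_simps)
  qed
  define P where "P i r \<psi> = sector_pt v tg (us i) (us (Suc i)) (\<theta> i) r \<psi>" for i r \<psi>
  have PX: "P i r \<psi> \<in> X" "(1 - e) * r \<le> d (pt v) (P i r \<psi>)" if "i < m" "0 \<le> r" "r \<le> t" "0 \<le> \<psi>" "\<psi> \<le> \<theta> i" for i r \<psi>
    using S[OF that(1)] that unfolding sector_def P_def by auto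
  have Pd: "d (P i r \<psi>) (P i r' \<psi>') \<le> (1 + e) * cmod (r * cis \<psi> - r' * cis \<psi>')"
    if "i < m" "0 \<le> r" "r \<le> t" "0 \<le> \<psi>" "\<psi> \<le> \<theta> i" "0 \<le> r'" "r' \<le> t" "0 \<le> \<psi>'" "\<psi>' \<le> \<theta> i" for i r \<psi> r' \<psi>'
    using S[OF that(1)] that unfolding sector_def P_def by auto
  have join: "P i r (\<theta> i) = P (Suc i) r 0" if "Suc i < m" for i r
  proof -
    have i: "i < m" using that by simp
    have "sin (\<theta> i) \<noteq> 0" "sin (\<theta> (Suc i)) \<noteq> 0" using sn[OF i] sn[OF that] by linarith+
    then show ?thesis unfolding P_def by (rule sector_pt_join) (use tri[OF i] tri[OF that] in blast)+
  qed
  have join0: "P (m - 1) r (\<theta> (m - 1)) = P 0 r 0" for r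
  proof -
    have "us (Suc (m - 1)) = us 0" using closed m by simp
    then show ?thesis unfolding P_def
      using sector_pt_join[of "\<theta> (m - 1)" "\<theta> 0" "us (m - 1)" "us 0" "us (Suc 0)" v tg r] tri[of "m - 1"] tri[of 0] sn[of "m - 1"] sn[of 0] m by simp
  qed
  \<comment> \<open>At a junction angle two sectors qualify; \<open>LEAST\<close> takes the earlier
    one, and \<open>join\<close> shows that the other gives the same point.\<close>
  define loop where "loop \<phi> = (let i = (LEAST i. \<phi> \<le> \<Phi> (Suc i)) in P i t (\<phi> - \<Phi> i))" for \<phi>
  have loop: "loop \<phi> = P i t (\<phi> - \<Phi> i)" if "i < m" "\<Phi> i \<le> \<phi>" "\<phi> \<le> \<Phi> (Suc i)" for i \<phi>
  proof -
    define j where "j = (LEAST i. \<phi> \<le> \<Phi> (Suc i))"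
    have j: "j \<le> i" "\<phi> \<le> \<Phi> (Suc j)" unfolding j_def using that by (auto intro: Least_le LeastI)
    show ?thesis
    proof (cases "j = i")
      case True then show ?thesis by (simp add: loop_def j_def Let_def)
    next
      case False
      then have "Suc j \<le> i" using j by simp
      then have "\<Phi> (Suc j) \<le> \<Phi> i" using \<Phi>mono that by simp
      then have eq: "\<phi> = \<Phi> i" "\<Phi> (Suc j) = \<Phi> i" using j that by auto
      then have "i = Suc j" using \<Phi>strict[of "Suc j" i] \<open>Suc j \<le> i\<close> that by (metis le_neq_implies_less less_irrefl less_imp_le)
      have a: "\<phi> - \<Phi> j = \<theta> j" "\<phi> - \<Phi> i = 0" using eq \<Phi>S[of j] by linarith+
      have "loop \<phi> = P j t (\<phi> - \<Phi> j)" by (simp add: loop_def j_def Let_def)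
      also have "\<dots> = P j t (\<theta> j)" by (simp only: a)
      also have "\<dots> = P (Suc j) t 0" by (rule join) (use \<open>i = Suc j\<close> that(1) in simp)
      finally show ?thesis unfolding a(2) by (simp only: \<open>i = Suc j\<close>)
    qed
  qed
  have cover: "\<exists>i<n. \<Phi> i \<le> \<phi> \<and> \<phi> \<le> \<Phi> (Suc i)" if "0 < n" "0 \<le> \<phi>" "\<phi> \<le> \<Phi> n" for n \<phi>
    using that
  proof (induction n)
    case (Suc n)
    show ?case
    proof (cases "\<phi> \<le> \<Phi> n \<and> 0 < n")
      case True then show ?thesis using Suc less_SucI by blast
    next
      case False
      then have "\<Phi> n \<le> \<phi>" using Suc \<Phi>0 by (cases "n = 0") auto
      then show ?thesis using Suc by blast
    qed
  qed simp
  have sec: "\<exists>i<m. \<Phi> i \<le> \<phi> \<and> \<phi> \<le> \<Phi> (Suc i)" if "0 \<le> \<phi>" "\<phi> \<le> T" for \<phi>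
    using cover[of m \<phi>] m that by (simp add: T_def)
  have loopX: "loop \<phi> \<in> X" and looplow: "(1 - e) * t \<le> d (pt v) (loop \<phi>)" if h: "0 \<le> \<phi>" "\<phi> \<le> T" for \<phi>
  proof -
    obtain i where i: "i < m" "\<Phi> i \<le> \<phi>" "\<phi> \<le> \<Phi> (Suc i)" using sec[OF h] by blast
    then show "loop \<phi> \<in> X" "(1 - e) * t \<le> d (pt v) (loop \<phi>)" using loop[OF i] PX[of i t "\<phi> - \<Phi> i"] t \<Phi>S[of i] by auto
  qed
  have ptv: "pt v \<in> X" by (rule pt_X, rule chain_subset[of "{v, us 0, us (Suc 0)}"]) (use tri[OF m] in auto)
  have start: "loop 0 = P 0 t 0" using loop[of 0 0] m \<Phi>0 th(1)[of 0] \<Phi>S[of 0] by simp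
  have T_eq: "\<Phi> (Suc (m - 1)) = T" using m by (simp add: T_def)
  have stop: "loop T = P (m - 1) t (\<theta> (m - 1))"
    using loop[of "m - 1" T] m T_eq \<Phi>S[of "m - 1"] th(1)[of "m - 1"] by simp
  have ends: "loop 0 = loop T" using start stop join0 by simp
  define K where "K = (1 + e) * t"
  have K: "0 \<le> K" using e t by (simp add: K_def)
  have lip1: "d (loop a) (loop b) \<le> K * \<bar>a - b\<bar>" if h: "i < m" "\<Phi> i \<le> a" "a \<le> \<Phi> (Suc i)" "\<Phi> i \<le> b" "b \<le> \<Phi> (Suc i)" for i a b
  proof -
    have "d (loop a) (loop b) \<le> (1 + e) * cmod (t * cis (a - \<Phi> i) - t * cis (b - \<Phi> i))"
      unfolding loop[OF h(1,2,3)] loop[OF h(1,4,5)] by (rule Pd) (use h t \<Phi>S[of i] in auto)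
    also have "t * cis (a - \<Phi> i) - t * cis (b - \<Phi> i) = t * (cis (a - \<Phi> i) - cis (b - \<Phi> i))" by (simp add: algebra_simps)
    also have "cmod \<dots> = t * cmod (cis (a - \<Phi> i) - cis (b - \<Phi> i))" using t by (simp add: norm_mult)
    also have "(1 + e) * \<dots> \<le> (1 + e) * (t * \<bar>a - b\<bar>)"
      using cmod_cis_diff_le[of "a - \<Phi> i" "b - \<Phi> i"] e t by (intro mult_left_mono) auto
    finally show ?thesis by (simp add: K_def mult.assoc)
  qed
  have lip2: "d (loop a) (loop b) \<le> K * (b - a)" if "n \<le> m" "0 \<le> a" "a \<le> b" "b \<le> \<Phi> n" for n a b
    using that
  proof (induction n arbitrary: a b)
    case 0
    then have ab: "a = 0" "b = 0" using \<Phi>0 by auto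
    show ?case using loopX[of 0] Tpos unfolding ab by simp
  next
    case (Suc n)
    have nT: "\<Phi> n \<le> T" "0 \<le> \<Phi> n" "b \<le> T" using \<Phi>mono[of n m] \<Phi>mono[of 0 n] \<Phi>mono[of "Suc n" m] \<Phi>0 Suc.prems by (auto simp: T_def)
    consider "b \<le> \<Phi> n" | "\<Phi> n \<le> a" "\<Phi> n < b" | "a < \<Phi> n" "\<Phi> n < b" by linarith
    then show ?case
    proof cases
      case 1 then show ?thesis using Suc by auto
    next
      case 2
      have "\<bar>a - b\<bar> = b - a" using Suc.prems by linarith
      then show ?thesis using lip1[of n a b] Suc.prems 2 by simp
    next
      case 3
      have "d (loop a) (loop b) \<le> d (loop a) (loop (\<Phi> n)) + d (loop (\<Phi> n)) (loop b)"
        by (rule M.triangle) (use loopX nT Suc.prems 3 in auto)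
      also have "d (loop a) (loop (\<Phi> n)) \<le> K * (\<Phi> n - a)" using Suc 3 by auto
      also have "d (loop (\<Phi> n)) (loop b) \<le> K * (b - \<Phi> n)" using lip1[of n "\<Phi> n" b] Suc.prems 3 \<Phi>mono[of n "Suc n"] by (simp add: abs_if)
      finally show ?thesis by (simp add: algebra_simps)
    qed
  qed
  have lip: "d (loop a) (loop b) \<le> K * \<bar>a - b\<bar>" if "0 \<le> a" "a \<le> T" "0 \<le> b" "b \<le> T" for a b
    using lip2[of m a b] lip2[of m b a] that M.commute[of "loop a" "loop b"] by (cases "a \<le> b") (auto simp: T_def abs_if)
  have chord: "(1 + e) * cmod (of_real t - t * cis \<phi>) < 2 * (1 - e) * t" if h: "0 \<le> \<phi>" "\<phi> \<le> T / 2" for \<phi>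
  proof -
    have "of_real t - t * cis \<phi> = - (t * (exp (\<i> * of_real \<phi>) - 1))" by (simp add: cis_conv_exp algebra_simps)
    then have "cmod (of_real t - t * cis \<phi>) = t * (2 * \<bar>sin (\<phi> / 2)\<bar>)"
      using t by (simp only: norm_minus_cancel norm_mult dist_exp_i_1 norm_of_real abs_of_pos)
    also have "\<bar>sin (\<phi> / 2)\<bar> = sin (\<phi> / 2)" using h T2 by (simp add: sin_ge_zero)
    also have "sin (\<phi> / 2) \<le> q" unfolding q_def using h T2 by (intro sin_monotone_2pi_le) auto
    finally have "cmod (of_real t - t * cis \<phi>) \<le> t * (2 * q)" using t by simp
    then have "(1 + e) * cmod (of_real t - t * cis \<phi>) \<le> (1 + e) * (t * (2 * q))" using e by (intro mult_left_mono) auto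
    also have "\<dots> = 2 * t * ((1 + e) * q)" by simp
    also have "\<dots> < 2 * t * (1 - e)" using qe t by simp
    finally show ?thesis by (simp add: mult_ac)
  qed
  have near_chord: "d (loop 0) (loop \<phi>) < 2 * (1 - e) * t" if h: "0 \<le> \<phi>" "\<phi> \<le> T" for \<phi>
  proof -
    obtain i where i: "i < m" "\<Phi> i \<le> \<phi>" "\<phi> \<le> \<Phi> (Suc i)" using sec[OF h] by blast
    show ?thesis
    proof (cases "\<phi> \<le> T / 2")
      case True
      have "d (P 0 t 0) (P i t (\<phi> - \<Phi> i)) \<le> (1 + e) * cmod (of_real t - t * cis ((\<Sum>j<i. \<theta> j) + (\<phi> - \<Phi> i)))"
        unfolding P_def by (rule develop[where m=m]) (use S e t tgp i \<Phi>S[of i] True T2 in \<open>auto simp: \<Phi>_def\<close>)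
      also have "(\<Sum>j<i. \<theta> j) + (\<phi> - \<Phi> i) = \<phi>" by (simp add: \<Phi>_def)
      finally show ?thesis using chord[OF h(1) True] unfolding start loop[OF i] by linarith
    next
      case False
      \<comment> \<open>Beyond half of the total angle the cycle is developed backwards, from the
        base point as the end of the last sector; the angle to be covered is then
        \<open>T - \<phi>\<close>.\<close>
      define us' where "us' k = us (m - k)" for k
      define \<theta>' where "\<theta>' k = \<theta> (m - 1 - k)" for k
      define i' where "i' = m - 1 - i"
      have i': "i' < m" "m - 1 - i' = i" "m - i' = Suc i" "m - Suc i' = i" using i by (auto simp: i'_def)
      have S': "sector tg e t v (us' k) (us' (Suc k)) (\<theta>' k)" if "k < m" for k
      proof -
        have k: "m - 1 - k < m" "Suc (m - 1 - k) = m - k" "m - Suc k = m - 1 - k" using that by auto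
        from sector_swap[OF S[OF k(1)]] show ?thesis unfolding us'_def \<theta>'_def by (simp only: k(2,3))
      qed
      have sum': "(\<Sum>j<i'. \<theta>' j) = T - \<Phi> (Suc i)"
      proof -
        have "(\<Sum>j<i'. \<theta>' j) = (\<Sum>j\<in>{Suc i..<m}. \<theta> j)"
          by (rule sum.reindex_bij_witness[of _ "\<lambda>j. m - 1 - j" "\<lambda>j. m - 1 - j"]) (use i in \<open>auto simp: i'_def \<theta>'_def\<close>)
        moreover have "(\<Sum>j\<in>{..<m}. \<theta> j) = (\<Sum>j\<in>{..<Suc i}. \<theta> j) + (\<Sum>j\<in>{Suc i..<m}. \<theta> j)"
          using i by (subst sum.union_disjoint[symmetric]) (auto intro!: sum.cong)
        ultimately show ?thesis by (simp add: T_def \<Phi>_def)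
      qed
      have "d (sector_pt v tg (us' 0) (us' (Suc 0)) (\<theta>' 0) t 0) (sector_pt v tg (us' i') (us' (Suc i')) (\<theta>' i') t (\<Phi> (Suc i) - \<phi>)) \<le>
         (1 + e) * cmod (of_real t - t * cis ((\<Sum>j<i'. \<theta>' j) + (\<Phi> (Suc i) - \<phi>)))"
        by (rule develop[where m=m]) (use S' e t tgp i i' \<Phi>S[of i] False T2 sum' in \<open>auto simp: us'_def \<theta>'_def\<close>)
      also have "(\<Sum>j<i'. \<theta>' j) + (\<Phi> (Suc i) - \<phi>) = T - \<phi>" by (simp add: sum')
      also have "sector_pt v tg (us' 0) (us' (Suc 0)) (\<theta>' 0) t 0 = loop 0"
      proof -
        have "us (m - 1) \<noteq> us m" using tri[of "m - 1"] m by auto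
        then have "sector_pt v tg (us (m - 1)) (us m) (\<theta> (m - 1)) t (\<theta> (m - 1)) = sector_pt v tg (us m) (us (m - 1)) (\<theta> (m - 1)) t 0"
          using sector_pt_swap[of "us (m - 1)" "us m" v tg "\<theta> (m - 1)" t "\<theta> (m - 1)"] by simp
        then show ?thesis unfolding ends stop P_def us'_def \<theta>'_def using m by simp
      qed
      also have "sector_pt v tg (us' i') (us' (Suc i')) (\<theta>' i') t (\<Phi> (Suc i) - \<phi>) = loop \<phi>"
      proof -
        have "us i \<noteq> us (Suc i)" using tri[OF i(1)] by simp
        then show ?thesis unfolding loop[OF i] P_def us'_def \<theta>'_def i'
          by (subst sector_pt_swap[of "us i" "us (Suc i)"]) (simp_all add: \<Phi>S diff_diff_eq2 add.commute)
      qed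
      finally show ?thesis using chord[of "T - \<phi>"] h False by simp
    qed
  qed
  have first: "loop \<phi> (us 0) * tg (us 0) = t * sin (\<theta> 0 - \<phi>) / sin (\<theta> 0)" "loop \<phi> (us 1) * tg (us 1) = t * sin \<phi> / sin (\<theta> 0)"
      "loop \<phi> v + loop \<phi> (us 0) + loop \<phi> (us 1) = 1" if "0 \<le> \<phi>" "\<phi> \<le> \<theta> 0" for \<phi>
    using loop[of 0 \<phi>] m \<Phi>0 \<Phi>S[of 0] that tri[of 0] tgp[of 0] tgp[of 1] sn[of 0] by (auto simp: P_def sector_pt_def Let_def)
  have mono: "t * sin x / sin (\<theta> 0) \<le> t * sin y / sin (\<theta> 0)" if "sin x \<le> sin y" for x y
    using that t sn[OF m] by (intro divide_right_mono mult_left_mono) auto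
  have sins: "sin \<phi> \<le> sin (\<theta> 0 - \<phi>)" if "0 \<le> \<phi>" "\<phi> \<le> \<theta> 0 / 2" for \<phi>
  proof -
    have "sin (\<theta> 0 - \<phi>) - sin \<phi> = 2 * (sin ((\<theta> 0 - 2 * \<phi>) / 2) * cos (\<theta> 0 / 2))"
      by (subst sin_diff_sin) (simp add: field_simps)
    moreover have "0 \<le> sin ((\<theta> 0 - 2 * \<phi>) / 2)" "0 \<le> cos (\<theta> 0 / 2)" using that th[OF m] by (auto intro!: sin_ge_zero cos_ge_zero)
    ultimately show ?thesis by (smt (verit) mult_nonneg_nonneg)
  qed
  show False
  proof (rule no_cone_off[of "us 0" "us 1" v "tg (us 0)" "tg (us 1)" "\<theta> 0" T loop K "2 * t" Cv])
    show "us 0 \<noteq> us 1" "us 0 \<noteq> v" "us 1 \<noteq> v" "is_chain V le {v, us 0, us 1}" using tri[OF m] by auto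
    show "\<sigma> = {v, us 0, us 1}" if "is_chain V le \<sigma>" "{v, us 0, us 1} \<subseteq> \<sigma>" for \<sigma> using maximal that .
    show "fin v" "fin (us 0)" "fin (us 1)" by (rule fin)+
    show "0 < tg (us 0)" "0 < tg (us 1)" using tgp m by auto
    show "0 < \<theta> 0" using th m by simp
    show "\<theta> 0 \<le> T" using \<Phi>mono[of 1 m] m \<Phi>0 \<Phi>S[of 0] by (simp add: T_def)
    show "loop \<phi> \<in> X" if "0 \<le> \<phi>" "\<phi> \<le> T" for \<phi> using loopX that .
    show "0 \<le> K" by (rule K)
    show "d (loop a) (loop b) \<le> K * \<bar>a - b\<bar>" if "0 \<le> a" "a \<le> T" "0 \<le> b" "b \<le> T" for a b using lip that .
    show "loop 0 = loop T" by (rule ends)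
    show "d (loop 0) (loop \<phi>) < d (loop 0) (pt v) + d (pt v) (loop \<phi>)" if "0 \<le> \<phi>" "\<phi> \<le> T" for \<phi>
      using near_chord[OF that] looplow[OF that] looplow[of 0] Tpos M.commute[of "loop 0" "pt v"] by (simp add: algebra_simps)
    show "d (pt v) (loop \<phi>) \<le> 2 * t" if h: "0 \<le> \<phi>" "\<phi> \<le> T" for \<phi>
    proof -
      obtain i where i: "i < m" "\<Phi> i \<le> \<phi>" "\<phi> \<le> \<Phi> (Suc i)" using sec[OF h] by blast
      have "pt v = P i 0 0" using tri[OF i(1)] by (auto simp: P_def sector_pt_def Let_def pt_def fun_eq_iff)
      then have "d (pt v) (loop \<phi>) \<le> (1 + e) * cmod (0 * cis 0 - t * cis (\<phi> - \<Phi> i))"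
        unfolding loop[OF i] using Pd[of i 0 0 t "\<phi> - \<Phi> i"] i t \<Phi>S[of i] th(1)[OF i(1)] by simp
      also have "\<dots> = (1 + e) * t" using t by (simp add: norm_mult)
      also have "\<dots> \<le> 2 * t" using e t by simp
      finally show ?thesis .
    qed
    show "\<bar>x v - y v\<bar> \<le> Cv * d x y" if "x \<in> X" "y \<in> X" for x y using Cv that by blast
    show "0 < Cv" by (rule Cv)
    show "3 * (2 * t) * Cv < 1" by (rule tCv)
    show "loop \<phi> (us 1) * tg (us 1) \<le> loop \<phi> (us 0) * tg (us 0)" if "0 \<le> \<phi>" "\<phi> \<le> \<theta> 0 / 2" for \<phi>
      using first[of \<phi>] mono[OF sins[OF that]] that by simp
    show "loop \<phi> (us 0) * tg (us 0) \<le> loop \<phi> (us 1) * tg (us 1)" if "\<theta> 0 / 2 \<le> \<phi>" "\<phi> \<le> \<theta> 0" for \<phi>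
      using first[of \<phi>] mono[OF sins[of "\<theta> 0 - \<phi>"]] that th[OF m] by simp
    have half: "0 \<le> \<theta> 0 / 2" "\<theta> 0 / 2 \<le> \<theta> 0" using th[OF m] by auto
    have "0 < sin (\<theta> 0 / 2)" using th[OF m] by (intro sin_gt_zero) auto
    then have "0 < loop (\<theta> 0 / 2) (us 0) * tg (us 0)" unfolding first(1)[OF half] using t sn[OF m] by simp
    then show "0 < loop (\<theta> 0 / 2) (us 0)" using tgp[of 0] by (simp add: zero_less_mult_iff)
    show "loop (\<theta> 0 / 2) v + loop (\<theta> 0 / 2) (us 0) + loop (\<theta> 0 / 2) (us 1) = 1" by (rule first(3)[OF half])
    show "loop \<phi> (us 0) * loop \<phi> (us 1) = 0" if h: "\<theta> 0 \<le> \<phi>" "\<phi> \<le> T" for \<phi>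
    proof -
      obtain i where i: "i < m" "\<Phi> i \<le> \<phi>" "\<phi> \<le> \<Phi> (Suc i)" using sec[of \<phi>] h th[OF m] by auto
      show ?thesis
      proof (cases "i = 0")
        case True
        then have "\<phi> = \<theta> 0" using i h \<Phi>0 \<Phi>S[of 0] by simp
        then have "loop \<phi> (us 0) * tg (us 0) = 0" using first(1)[of \<phi>] th[OF m] by simp
        then show ?thesis using tgp[of 0] by simp
      next
        case False
        then have "us 0 \<notin> {us i, us (Suc i)} \<or> us 1 \<notin> {us i, us (Suc i)}" using uniq[of i] i by auto
        moreover have "us 0 \<noteq> v" "us 1 \<noteq> v" using tri[OF m] by auto
        ultimately show ?thesis unfolding loop[OF i] P_def sector_pt_def Let_def by auto
      qed
    qed
  qed
qed

end

section \<open>Angles in Euclidean simplices\<close>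

text \<open>Dual vectors by induction on the number of vectors. With a dual system for
  \<open>S\<close>, subtract from the new vector its projection to the span of \<open>S\<close>;
  independence leaves a remainder \<open>R\<close> with some coordinate \<open>i0\<close> nonzero,
  and reading off that coordinate detects the new vector.\<close>

lemma dual_vectors:
  fixes P :: "'v \<Rightarrow> nat \<Rightarrow> real"
  assumes "finite S" "\<And>c. (\<And>i. i < M \<Longrightarrow> (\<Sum>x\<in>S. c x * P x i) = 0) \<Longrightarrow> \<forall>x\<in>S. c x = 0" "u \<in> S"
  shows "\<exists>q. \<forall>x\<in>S. (\<Sum>i<M. q i * P x i) = (if x = u then 1 else 0)"
  using assms
proof (induction S arbitrary: u rule: finite_induct)
  case (insert s S)
  have indep: "\<forall>x\<in>S. c x = 0" if c: "\<And>i. i < M \<Longrightarrow> (\<Sum>x\<in>S. c x * P x i) = 0" for c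
  proof -
    have "(\<Sum>x\<in>insert s S. (c(s := 0)) x * P x i) = (\<Sum>x\<in>S. c x * P x i)" for i
    proof -
      have "(\<Sum>x\<in>S. (c(s := 0)) x * P x i) = (\<Sum>x\<in>S. c x * P x i)"
        by (rule sum.cong) (use insert.hyps in auto)
      then show ?thesis using insert.hyps by simp
    qed
    then have z: "\<And>i. i < M \<Longrightarrow> (\<Sum>x\<in>insert s S. (c(s := 0)) x * P x i) = 0" using c by (simp only:)
    show ?thesis
    proof
      fix x assume "x \<in> S"
      moreover have "x \<noteq> s" using calculation insert.hyps(2) by blast
      ultimately show "c x = 0" using insert.prems(1)[OF z] by (metis fun_upd_other insertI2)
    qed
  qed
  have "\<forall>y\<in>S. \<exists>q. \<forall>x\<in>S. (\<Sum>i<M. q i * P x i) = (if x = y then 1 else 0)"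
    using insert.IH[OF indep] by blast
  from bchoice[OF this] obtain Q where Q: "\<forall>y\<in>S. \<forall>x\<in>S. (\<Sum>i<M. Q y i * P x i) = (if x = y then 1 else 0)" ..
  define k where "k y = (\<Sum>i<M. Q y i * P s i)" for y
  define R where "R i = P s i - (\<Sum>x\<in>S. k x * P x i)" for i
  have "\<exists>i0<M. R i0 \<noteq> 0"
  proof (rule ccontr)
    assume "\<not> (\<exists>i0<M. R i0 \<noteq> 0)"
    then have R0: "R i = 0" if "i < M" for i using that by auto
    let ?c = "\<lambda>x. if x = s then 1 else - k x"
    have "(\<Sum>x\<in>insert s S. ?c x * P x i) = R i" for i
    proof -
      have "(\<Sum>x\<in>S. ?c x * P x i) = (\<Sum>x\<in>S. - (k x * P x i))"
        by (rule sum.cong) (use insert.hyps in auto)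
      then show ?thesis using insert.hyps by (simp add: R_def sum_negf)
    qed
    then have "\<forall>x\<in>insert s S. ?c x = 0" using R0 by (intro insert.prems(1)) simp
    then show False by simp
  qed
  then obtain i0 where i0: "i0 < M" "R i0 \<noteq> 0" by blast
  \<comment> \<open>Represents the functional \<open>w \<mapsto>\<close> the
    \<open>i0\<close>-coordinate of \<open>w\<close> minus its projection, scaled to be 1 at the new
    vector.\<close>
  define qs where "qs i = ((if i = i0 then 1 else 0) - (\<Sum>x\<in>S. Q x i * P x i0)) / R i0" for i
  have qs: "(\<Sum>i<M. qs i * w i) = (w i0 - (\<Sum>x\<in>S. (\<Sum>i<M. Q x i * w i) * P x i0)) / R i0" for w
  proof -
    have "(\<Sum>i<M. qs i * w i) = (\<Sum>i<M. (if i = i0 then w i else 0) - (\<Sum>x\<in>S. Q x i * w i * P x i0)) / R i0"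
      unfolding sum_divide_distrib by (rule sum.cong) (auto simp: qs_def field_simps sum_distrib_left)
    also have "(\<Sum>i<M. (if i = i0 then w i else 0) - (\<Sum>x\<in>S. Q x i * w i * P x i0)) = w i0 - (\<Sum>i<M. \<Sum>x\<in>S. Q x i * w i * P x i0)"
      using i0 by (simp add: sum_subtractf)
    also have "(\<Sum>i<M. \<Sum>x\<in>S. Q x i * w i * P x i0) = (\<Sum>x\<in>S. (\<Sum>i<M. Q x i * w i) * P x i0)"
      by (subst sum.swap) (simp add: sum_distrib_right)
    finally show ?thesis .
  qed
  have qsS: "(\<Sum>i<M. qs i * P y i) = 0" if "y \<in> S" for y
  proof -
    have "(\<Sum>x\<in>S. (\<Sum>i<M. Q x i * P y i) * P x i0) = (\<Sum>x\<in>S. (if y = x then P x i0 else 0))"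
      by (rule sum.cong) (use Q that in auto)
    also have "\<dots> = P y i0" using that insert.hyps(1) by simp
    finally show ?thesis unfolding qs by simp
  qed
  have qss: "(\<Sum>i<M. qs i * P s i) = 1" unfolding qs using i0 by (simp add: R_def k_def)
  show ?case
  proof (cases "u = s")
    case True
    then show ?thesis using qsS qss insert.hyps by (intro exI[of _ qs]) auto
  next
    case False
    then have u: "u \<in> S" using insert.prems by simp
    have lin: "(\<Sum>i<M. (Q u i - k u * qs i) * P x i) = (\<Sum>i<M. Q u i * P x i) - k u * (\<Sum>i<M. qs i * P x i)" for x
      by (simp add: algebra_simps sum_subtractf sum_distrib_left)
    show ?thesis
    proof (rule exI[of _ "\<lambda>i. Q u i - k u * qs i"], intro ballI)
      fix x assume x: "x \<in> insert s S"
      show "(\<Sum>i<M. (Q u i - k u * qs i) * P x i) = (if x = u then 1 else 0)"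
      proof (cases "x = s")
        case True
        have "(\<Sum>i<M. Q u i * P s i) = k u" by (simp add: k_def)
        then show ?thesis unfolding True lin using qss False by simp
      next
        case xs: False
        then have "x \<in> S" using x by simp
        then show ?thesis unfolding lin using qsS Q u by simp
      qed
    qed
  qed
qed simp

text \<open>Each barycentric coordinate is a fixed linear functional of the position in the ambient
  space; the Lipschitz bounds for coordinates in both geometries come from this.\<close>

lemma dual_functional:
  fixes P :: "'v \<Rightarrow> nat \<Rightarrow> real"
  assumes "finite S" "\<And>c. (\<And>i. i < M \<Longrightarrow> (\<Sum>x\<in>S. c x * P x i) = 0) \<Longrightarrow> \<forall>x\<in>S. c x = 0" "u \<in> S"
  shows "\<exists>q. \<forall>c. c u = (\<Sum>i<M. q i * (\<Sum>x\<in>S. c x * P x i))"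
proof -
  obtain q where q: "\<forall>x\<in>S. (\<Sum>i<M. q i * P x i) = (if x = u then 1 else 0)" using dual_vectors[OF assms] by blast
  have "c u = (\<Sum>i<M. q i * (\<Sum>x\<in>S. c x * P x i))" for c
  proof -
    have "(\<Sum>i<M. q i * (\<Sum>x\<in>S. c x * P x i)) = (\<Sum>i<M. \<Sum>x\<in>S. c x * (q i * P x i))"
      by (simp add: sum_distrib_left mult_ac)
    also have "\<dots> = (\<Sum>x\<in>S. c x * (\<Sum>i<M. q i * P x i))" by (subst sum.swap) (simp add: sum_distrib_left)
    also have "\<dots> = (\<Sum>x\<in>S. if x = u then c x else 0)" by (rule sum.cong) (use q in auto)
    also have "\<dots> = c u" using assms by simp
    finally show ?thesis by simp
  qed
  then show ?thesis by blast
qed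

definition seg :: "'v \<Rightarrow> 'v \<Rightarrow> real \<Rightarrow> 'v \<Rightarrow> real" where
  "seg v u s = (\<lambda>x. if x = v then 1 - s else if x = u then s else 0)"

definition elen :: "('v set \<Rightarrow> ('v \<Rightarrow> real) \<Rightarrow> ('v \<Rightarrow> real) \<Rightarrow> real) \<Rightarrow> 'v \<Rightarrow> 'v \<Rightarrow> real" where
  "elen sd u w = sd {u, w} (pt u) (pt w)"

text \<open>\<open>edge s a\<close> is the distance from a vertex to the point with coordinate
  \<open>s\<close> on an edge of length \<open>a\<close>, and \<open>speed a\<close> is the initial
  rate of that distance. They are kept abstract because in the hyperboloid model barycentric
  coordinates are not proportional to arc length. Injectivity of \<open>edge\<close> in
  \<open>a\<close> lets edge lengths be recovered from distances near a vertex.\<close>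

locale angled_metric = geodesic_simplex_metric V le sd
  for V :: "'v set" and le :: "'v \<Rightarrow> 'v \<Rightarrow> bool" and sd +
  fixes ang :: "real \<Rightarrow> real \<Rightarrow> real \<Rightarrow> real" and speed :: "real \<Rightarrow> real" and edge :: "real \<Rightarrow> real \<Rightarrow> real"
  assumes corner_ang: "\<And>v u w. is_chain V le {v, u, w} \<Longrightarrow> u \<noteq> w \<Longrightarrow> u \<noteq> v \<Longrightarrow> w \<noteq> v \<Longrightarrow>
      corner (\<lambda>z. speed (elen sd v z)) v u w (ang (elen sd v u) (elen sd v w) (elen sd u w))"
    and ang_sum: "\<And>v u w. is_chain V le {v, u, w} \<Longrightarrow> u \<noteq> w \<Longrightarrow> u \<noteq> v \<Longrightarrow> w \<noteq> v \<Longrightarrow>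
      ang (elen sd v u) (elen sd v w) (elen sd u w) + ang (elen sd u v) (elen sd u w) (elen sd v w) + ang (elen sd w v) (elen sd w u) (elen sd v u) \<le> pi"
    and ang_commute: "\<And>a b c. ang a b c = ang b a c"
    and elen_commute: "\<And>u w. is_chain V le {u, w} \<Longrightarrow> elen sd u w = elen sd w u"
    and edge: "\<And>v u s. is_chain V le {v, u} \<Longrightarrow> v \<noteq> u \<Longrightarrow> 0 \<le> s \<Longrightarrow> s \<le> 1 \<Longrightarrow> sd {v, u} (pt v) (seg v u s) = edge s (elen sd v u)"
    and elen_pos: "\<And>v u. is_chain V le {v, u} \<Longrightarrow> v \<noteq> u \<Longrightarrow> 0 < elen sd v u"
    and edge_inj: "\<And>s a b. 0 < s \<Longrightarrow> s \<le> 1 \<Longrightarrow> 0 < a \<Longrightarrow> 0 < b \<Longrightarrow> edge s a = edge s b \<Longrightarrow> a = b"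
    and edge_small: "\<And>a \<epsilon>. 0 < a \<Longrightarrow> 0 < \<epsilon> \<Longrightarrow> \<exists>s0>0. \<forall>s. 0 < s \<and> s \<le> s0 \<longrightarrow> edge s a < \<epsilon>"

text \<open>An inequality of this kind says \<open>- cos (x + y) \<le> cos z\<close>, hence
  \<open>z \<le> \<bar>pi - (x + y)\<bar>\<close>. This leaves the desired bound or
  \<open>z + pi \<le> x + y\<close>. If the second alternative held for both hypotheses, adding them
  would give \<open>pi \<le> A\<close>.\<close>

lemma angle_sum_le_pi:
  fixes A B C :: real
  assumes "0 < A" "A < pi" "0 < B" "B < pi" "0 < C" "C < pi"
    and "sin A * sin B \<le> cos A * cos B + cos C" "sin A * sin C \<le> cos A * cos C + cos B"
  shows "A + B + C \<le> pi"
proof -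
  have key: "x + y + z \<le> pi \<or> z + pi \<le> x + y" if "0 < x" "x < pi" "0 < y" "y < pi" "0 < z" "z < pi"
     "sin x * sin y \<le> cos x * cos y + cos z" for x y z :: real
  proof -
    have "cos z \<ge> - cos (x + y)" using that by (simp add: cos_add)
    then have "cos (pi - (x + y)) \<le> cos z" by simp
    then have "cos \<bar>pi - (x + y)\<bar> \<le> cos z" by (simp add: abs_if)
    then have "z \<le> \<bar>pi - (x + y)\<bar>" using that by (subst (asm) cos_mono_le_eq) (auto simp: abs_if)
    then show ?thesis by (auto simp: abs_if split: if_splits)
  qed
  show ?thesis using key[OF assms(1-6,7)] key[OF assms(1,2,5,6,3,4,8)] assms by linarith
qed

lemma cmod_corner: "(cmod (of_real a + of_real b * cis \<theta>))\<^sup>2 = a\<^sup>2 + b\<^sup>2 + 2 * a * b * cos \<theta>"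
proof -
  have "(cmod (of_real a + of_real b * cis \<theta>))\<^sup>2 = (a + b * cos \<theta>)\<^sup>2 + (b * sin \<theta>)\<^sup>2" by (simp add: cmod_power2)
  also have "\<dots> = a\<^sup>2 + 2 * a * b * cos \<theta> + b\<^sup>2 * ((cos \<theta>)\<^sup>2 + (sin \<theta>)\<^sup>2)" by algebra
  finally show ?thesis by simp
qed

definition angE :: "real \<Rightarrow> real \<Rightarrow> real \<Rightarrow> real" where
  "angE a b c = arccos ((a\<^sup>2 + b\<^sup>2 - c\<^sup>2) / (2 * a * b))"

lemma angE_commute: "angE a b c = angE b a c" by (simp add: angE_def add.commute mult.commute mult.left_commute)

text \<open>Hypotheses in Heron form: the Gram determinant of the triangle is positive.\<close>

lemma angE_cos:
  assumes "0 < a" "0 < b" "0 < c" "(a\<^sup>2 + b\<^sup>2 - c\<^sup>2)\<^sup>2 < 4 * a\<^sup>2 * b\<^sup>2"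
  shows "cos (angE a b c) = (a\<^sup>2 + b\<^sup>2 - c\<^sup>2) / (2 * a * b)" "0 < angE a b c" "angE a b c < pi"
    "sin (angE a b c) = sqrt (4 * a\<^sup>2 * b\<^sup>2 - (a\<^sup>2 + b\<^sup>2 - c\<^sup>2)\<^sup>2) / (2 * a * b)"
proof -
  define k where "k = (a\<^sup>2 + b\<^sup>2 - c\<^sup>2) / (2 * a * b)"
  have ab: "0 < 2 * a * b" using assms by simp
  have "k\<^sup>2 < 1"
  proof -
    have "k\<^sup>2 = (a\<^sup>2 + b\<^sup>2 - c\<^sup>2)\<^sup>2 / (4 * a\<^sup>2 * b\<^sup>2)" by (simp add: k_def power_divide power_mult_distrib)
    then show ?thesis using assms by simp
  qed
  then have k: "-1 < k" "k < 1" using abs_square_less_1[of k] by auto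
  show 1: "cos (angE a b c) = (a\<^sup>2 + b\<^sup>2 - c\<^sup>2) / (2 * a * b)" using k unfolding angE_def k_def[symmetric] by simp
  show "0 < angE a b c" "angE a b c < pi" using arccos_lt_bounded[OF k] unfolding angE_def k_def[symmetric] by auto
  have "sin (angE a b c) = sqrt (1 - k\<^sup>2)" using k unfolding angE_def k_def[symmetric] by (simp add: sin_arccos)
  also have "1 - k\<^sup>2 = (4 * a\<^sup>2 * b\<^sup>2 - (a\<^sup>2 + b\<^sup>2 - c\<^sup>2)\<^sup>2) / (2 * a * b)\<^sup>2"
    using assms by (simp add: k_def power_divide power_mult_distrib field_simps)
  also have "sqrt \<dots> = sqrt (4 * a\<^sup>2 * b\<^sup>2 - (a\<^sup>2 + b\<^sup>2 - c\<^sup>2)\<^sup>2) / (2 * a * b)"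
    using ab by (simp add: real_sqrt_divide)
  finally show "sin (angE a b c) = sqrt (4 * a\<^sup>2 * b\<^sup>2 - (a\<^sup>2 + b\<^sup>2 - c\<^sup>2)\<^sup>2) / (2 * a * b)" .
qed

text \<open>With \<open>D\<close> sixteen times the squared area, a quantity symmetric in the sides,
  both the product of two sines and the corresponding cosine expression equal the same multiple of
  \<open>D\<close>. The hypotheses of \<open>angle_sum_le_pi\<close> thus hold with
  equality.\<close>

lemma angE_sum:
  assumes p: "0 < a" "0 < b" "0 < c" and h: "(a\<^sup>2 + b\<^sup>2 - c\<^sup>2)\<^sup>2 < 4 * a\<^sup>2 * b\<^sup>2"
  shows "angE a b c + angE a c b + angE b c a \<le> pi"
proof -
  have h2: "(a\<^sup>2 + c\<^sup>2 - b\<^sup>2)\<^sup>2 < 4 * a\<^sup>2 * c\<^sup>2" "(b\<^sup>2 + c\<^sup>2 - a\<^sup>2)\<^sup>2 < 4 * b\<^sup>2 * c\<^sup>2"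
    using h by (simp_all add: power2_eq_square algebra_simps)
  define D where "D = 4 * a\<^sup>2 * b\<^sup>2 - (a\<^sup>2 + b\<^sup>2 - c\<^sup>2)\<^sup>2"
  have D: "4 * a\<^sup>2 * c\<^sup>2 - (a\<^sup>2 + c\<^sup>2 - b\<^sup>2)\<^sup>2 = D" "4 * b\<^sup>2 * c\<^sup>2 - (b\<^sup>2 + c\<^sup>2 - a\<^sup>2)\<^sup>2 = D"
    by (simp_all add: D_def power2_eq_square algebra_simps)
  have D0: "0 \<le> D" using h by (simp add: D_def)
  note A = angE_cos[OF p h] and B = angE_cos[OF p(1,3,2) h2(1)] and C = angE_cos[OF p(2,3,1) h2(2)]
  have s: "sqrt D * sqrt D = D" using D0 by simp
  show ?thesis
  proof (rule angle_sum_le_pi)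
    have "sin (angE a b c) * sin (angE a c b) = D / (4 * a\<^sup>2 * b * c)"
      unfolding A(4) B(4) D D_def[symmetric] using s by (simp add: power2_eq_square mult_ac)
    moreover have "cos (angE a b c) * cos (angE a c b) + cos (angE b c a) = D / (4 * a\<^sup>2 * b * c)"
      unfolding A(1) B(1) C(1) D_def using p by (simp add: field_simps power2_eq_square)
    ultimately show "sin (angE a b c) * sin (angE a c b) \<le> cos (angE a b c) * cos (angE a c b) + cos (angE b c a)" by simp
    have "sin (angE a b c) * sin (angE b c a) = D / (4 * a * b\<^sup>2 * c)"
      unfolding A(4) C(4) D D_def[symmetric] using s by (simp add: power2_eq_square mult_ac)
    moreover have "cos (angE a b c) * cos (angE b c a) + cos (angE a c b) = D / (4 * a * b\<^sup>2 * c)"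
      unfolding A(1) B(1) C(1) D_def using p by (simp add: field_simps power2_eq_square)
    ultimately show "sin (angE a b c) * sin (angE b c a) \<le> cos (angE a b c) * cos (angE b c a) + cos (angE a c b)" by simp
  qed (rule A B C)+
qed

section \<open>Euclidean simplices\<close>

lemma real_pts_sum:
  assumes "x \<in> real_pts V le" "finite \<sigma>" "supp x \<subseteq> \<sigma>" shows "sum x \<sigma> = 1"
proof -
  have "sum x \<sigma> = sum x (supp x)" by (rule sum.mono_neutral_right) (use assms in \<open>auto simp: supp_def\<close>)
  then show ?thesis using assms by (simp add: real_pts_def)
qed

lemma chain_finite: "is_chain V le \<sigma> \<Longrightarrow> finite \<sigma>" by (simp add: is_chain_def)

lemma eucl_sd_L2: "eucl_sd N p \<sigma> x y = L2_set (\<lambda>i. \<Sum>v\<in>\<sigma>. (x v - y v) * p \<sigma> v i) {..<N \<sigma>}"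
  by (simp add: eucl_sd_def L2_set_def)

lemma eucl_sd_commute: "eucl_sd N p \<sigma> x y = eucl_sd N p \<sigma> y x"
proof -
  have "(\<Sum>v\<in>\<sigma>. (x v - y v) * p \<sigma> v i) = - (\<Sum>v\<in>\<sigma>. (y v - x v) * p \<sigma> v i)" for i
    unfolding sum_negf[symmetric] by (rule sum.cong) (auto simp: algebra_simps)
  then show ?thesis by (simp add: eucl_sd_def)
qed

lemma eucl_sd_triangle: "eucl_sd N p \<sigma> x z \<le> eucl_sd N p \<sigma> x y + eucl_sd N p \<sigma> y z"
proof -
  have "(\<Sum>v\<in>\<sigma>. (x v - z v) * p \<sigma> v i) = (\<Sum>v\<in>\<sigma>. (x v - y v) * p \<sigma> v i) + (\<Sum>v\<in>\<sigma>. (y v - z v) * p \<sigma> v i)" for i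
    unfolding sum.distrib[symmetric] by (rule sum.cong) (auto simp: algebra_simps)
  then show ?thesis unfolding eucl_sd_L2 by (simp add: L2_set_triangle_ineq)
qed

lemma eucl_coord_bound:
  assumes ok: "eucl_ok V le N p" and c: "is_chain V le \<sigma>" "u \<in> \<sigma>"
  shows "\<exists>C>0. \<forall>x\<in>real_pts V le. \<forall>y\<in>real_pts V le. supp x \<subseteq> \<sigma> \<and> supp y \<subseteq> \<sigma> \<longrightarrow> \<bar>x u - y u\<bar> \<le> C * eucl_sd N p \<sigma> x y"
proof -
  \<comment> \<open>Appending a coordinate equal to 1 turns affine independence of the vertices into
    linear independence.\<close>
  define P where "P v i = (if i < N \<sigma> then p \<sigma> v i else 1)" for v i
  have "\<forall>x\<in>\<sigma>. c x = 0" if h: "\<And>i. i < Suc (N \<sigma>) \<Longrightarrow> (\<Sum>x\<in>\<sigma>. c x * P x i) = 0" for c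
  proof -
    have "(\<Sum>x\<in>\<sigma>. c x * P x (N \<sigma>)) = 0" by (rule h) simp
    then have "(\<Sum>x\<in>\<sigma>. c x) = 0" by (simp add: P_def)
    moreover have "\<forall>i<N \<sigma>. (\<Sum>x\<in>\<sigma>. c x * p \<sigma> x i) = 0"
    proof (intro allI impI)
      fix i assume i: "i < N \<sigma>"
      have "(\<Sum>x\<in>\<sigma>. c x * P x i) = 0" by (rule h) (use i in simp)
      then show "(\<Sum>x\<in>\<sigma>. c x * p \<sigma> x i) = 0" using i by (simp add: P_def)
    qed
    ultimately show ?thesis using ok c(1) unfolding eucl_ok_def by simp
  qed
  from dual_functional[OF chain_finite[OF c(1)] this c(2)]
  obtain q where q: "\<forall>c. c u = (\<Sum>i<Suc (N \<sigma>). q i * (\<Sum>x\<in>\<sigma>. c x * P x i))" by blast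
  define C where "C = (\<Sum>i<N \<sigma>. \<bar>q i\<bar>) + 1"
  have C: "C > 0" unfolding C_def by (smt (verit) sum_nonneg abs_ge_zero)
  have "\<bar>x u - y u\<bar> \<le> C * eucl_sd N p \<sigma> x y" if "x \<in> real_pts V le" "y \<in> real_pts V le" "supp x \<subseteq> \<sigma>" "supp y \<subseteq> \<sigma>" for x y
  proof -
    let ?f = "\<lambda>i. \<Sum>v\<in>\<sigma>. (x v - y v) * p \<sigma> v i"
    have "(\<Sum>v\<in>\<sigma>. (x v - y v) * P v (N \<sigma>)) = 0"
      using real_pts_sum[OF that(1) chain_finite[OF c(1)] that(3)] real_pts_sum[OF that(2) chain_finite[OF c(1)] that(4)]
      by (simp add: P_def sum_subtractf)
    then have "x u - y u = (\<Sum>i<N \<sigma>. q i * ?f i)"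
      using q[rule_format, of "\<lambda>v. x v - y v"] by (simp add: P_def)
    also have "\<bar>\<dots>\<bar> \<le> (\<Sum>i<N \<sigma>. \<bar>q i\<bar> * eucl_sd N p \<sigma> x y)"
    proof (rule order_trans[OF sum_abs], rule sum_mono)
      fix i assume i: "i \<in> {..<N \<sigma>}"
      have "\<bar>?f i\<bar> \<le> sqrt ((?f i)\<^sup>2)" by simp
      also have "\<dots> \<le> eucl_sd N p \<sigma> x y" unfolding eucl_sd_def
        by (intro real_sqrt_le_mono member_le_sum[OF i]) auto
      finally show "\<bar>q i * ?f i\<bar> \<le> \<bar>q i\<bar> * eucl_sd N p \<sigma> x y" by (simp add: abs_mult mult_left_mono)
    qed
    also have "\<dots> \<le> C * eucl_sd N p \<sigma> x y"
    proof -
      have "0 \<le> eucl_sd N p \<sigma> x y" by (simp add: eucl_sd_L2)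
      then show ?thesis by (simp add: C_def sum_distrib_right[symmetric] distrib_right)
    qed
    finally show ?thesis .
  qed
  then show ?thesis using C by blast
qed

lemma eucl_simplex_metric:
  assumes ok: "eucl_ok V le N p" and fi: "face_iso V le (eucl_sd N p)"
  shows "simplex_metric V le (eucl_sd N p)"
proof
  show "0 \<le> eucl_sd N p \<sigma> x y" for \<sigma> x y by (simp add: eucl_sd_L2)
  show "eucl_sd N p \<sigma> x x = 0" for \<sigma> x by (simp add: eucl_sd_def)
  show "\<bar>eucl_sd N p \<sigma> (pt v) x - eucl_sd N p \<sigma> (pt v) y\<bar> \<le> eucl_sd N p \<sigma> x y" for \<sigma> v x y
    using eucl_sd_triangle[of N p \<sigma> "pt v" x y] eucl_sd_triangle[of N p \<sigma> "pt v" y x] eucl_sd_commute[of N p \<sigma> x y] by simp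
  show "\<exists>C>0. \<forall>x\<in>real_pts V le. \<forall>y\<in>real_pts V le. supp x \<subseteq> \<sigma> \<and> supp y \<subseteq> \<sigma> \<longrightarrow> \<bar>x u - y u\<bar> \<le> C * eucl_sd N p \<sigma> x y"
    if "is_chain V le \<sigma>" "u \<in> \<sigma>" for \<sigma> u using eucl_coord_bound[OF ok that] .
  show "face_iso V le (eucl_sd N p)" by (rule fi)
qed

text \<open>Put the comparison triangle with its apex at 0 and let \<open>k\<close> be the cosine of
  the apex angle. The points at distance \<open>s\<close> on the two sides have squared distance
  \<open>2 * s\<^sup>2 * (1 - k)\<close>, while the third side satisfies
  \<open>c\<^sup>2 = (a - b)\<^sup>2 + 2 * a * b * (1 - k)\<close>. Since \<open>s\<close> is at
  most both \<open>a\<close> and \<open>b\<close>, the claim follows.\<close>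

lemma fan_CAT0:
  assumes cat: "CAT0 X d" and pqr: "p \<in> X" "q \<in> X" "r \<in> X"
    and g: "is_geodesic X d \<gamma> p q" "is_geodesic X d \<gamma>' p r" and s: "0 \<le> s" "s \<le> d p q" "s \<le> d p r"
  shows "d (\<gamma> s) (\<gamma>' s) \<le> d q r"
proof (cases "s = 0")
  interpret M: Metric_space X d using cat by (simp add: CAT0_def geodesic_space_def)
  case True
  have "\<gamma> 0 = p" "\<gamma>' 0 = p" using g by (auto simp: is_geodesic_def)
  then show ?thesis using pqr True by simp
next
  case False
  interpret M: Metric_space X d using cat by (simp add: CAT0_def geodesic_space_def)
  define a b c where "a = d p q" and "b = d p r" and "c = d q r"
  have pos: "0 < s" "0 < a" "0 < b" using False s by (auto simp: a_def b_def)
  have tri: "c \<le> a + b" "a \<le> b + c" "b \<le> a + c"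
    using M.triangle[of q p r] M.triangle[of p r q] M.triangle[of p q r] pqr M.commute by (auto simp: a_def b_def c_def)
  define k where "k = (a\<^sup>2 + b\<^sup>2 - c\<^sup>2) / (2 * a * b)"
  have c0: "0 \<le> c" by (simp add: c_def)
  have "c\<^sup>2 \<le> (a + b)\<^sup>2" using tri c0 by (intro power_mono) auto
  moreover have "(a - b)\<^sup>2 \<le> c\<^sup>2" using tri c0 by (intro abs_le_square_iff[THEN iffD1]) auto
  ultimately have k: "-1 \<le> k" "k \<le> 1" unfolding k_def using pos by (simp_all add: field_simps power2_eq_square)
  define \<theta> where "\<theta> = arccos k"
  have ct: "cos \<theta> = k" using k by (simp add: \<theta>_def)
  define P Q R :: complex where "P = 0" and "Q = of_real a" and "R = of_real b * cis \<theta>"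
  have norm2: "(cmod (of_real x - of_real y * cis \<theta>))\<^sup>2 = x\<^sup>2 + y\<^sup>2 - 2 * x * y * k" for x y
    using cmod_corner[of x "- y" \<theta>] by (simp add: ct)
  have PQ: "cmod (P - Q) = d p q" using pos by (simp add: P_def Q_def a_def)
  have RP: "cmod (R - P) = d r p" using pos M.commute[of r p] by (simp add: P_def R_def b_def norm_mult)
  have "(cmod (Q - R))\<^sup>2 = c\<^sup>2" unfolding Q_def R_def norm2 using pos by (simp add: k_def)
  then have QR: "cmod (Q - R) = d q r" using c0 by (simp add: c_def)
  obtain \<gamma>2 where g2: "is_geodesic X d \<gamma>2 q r" using cat pqr unfolding CAT0_def geodesic_space_def by blast
  define \<gamma>3 where "\<gamma>3 t = \<gamma>' (b - t)" for t
  have g3: "is_geodesic X d \<gamma>3 r p"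
    using g(2) unfolding is_geodesic_def \<gamma>3_def M.commute[of r p] b_def by auto
  let ?C = "side_pts_E \<gamma> (d p q) P Q \<union> side_pts_E \<gamma>2 (d q r) Q R \<union> side_pts_E \<gamma>3 (d r p) R P"
  have C: "\<forall>(x, xb)\<in>?C. \<forall>(y, yb)\<in>?C. d x y \<le> cmod (xb - yb)"
    using cat pqr g g2 g3 PQ QR RP unfolding CAT0_def Let_def by blast
  have 1: "(\<gamma> s, P + of_real (s / d p q) * (Q - P)) \<in> ?C" using s by (auto simp: side_pts_E_def)
  have b': "d r p = b" by (simp add: b_def M.commute)
  have "(\<gamma>3 (b - s), R + of_real ((b - s) / d r p) * (P - R)) \<in> side_pts_E \<gamma>3 (d r p) R P"
    unfolding side_pts_E_def b' using s by (auto simp: b_def intro!: exI[of _ "b - s"])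
  then have 2: "(\<gamma>' s, R + of_real ((b - s) / d r p) * (P - R)) \<in> ?C" by (simp add: \<gamma>3_def)
  have "d (\<gamma> s) (\<gamma>' s) \<le> cmod ((P + of_real (s / d p q) * (Q - P)) - (R + of_real ((b - s) / d r p) * (P - R)))"
    using C 1 2 by fastforce
  also have "P + of_real (s / d p q) * (Q - P) = of_real s" using pos by (simp add: P_def Q_def a_def)
  also have "R + of_real ((b - s) / d r p) * (P - R) = of_real s * cis \<theta>"
  proof -
    have "R + of_real ((b - s) / b) * (P - R) = of_real (b - (b - s) / b * b) * cis \<theta>" by (simp add: P_def R_def algebra_simps diff_divide_distrib)
    then show ?thesis unfolding b' using pos by simp
  qed
  also have "cmod (of_real s - of_real s * cis \<theta>) \<le> c"
  proof (rule power2_le_imp_le)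
    have "s * s \<le> a * b" using s pos by (intro mult_mono) (auto simp: a_def b_def)
    then have "s * s * (1 - k) \<le> a * b * (1 - k)" using k by (intro mult_right_mono) auto
    moreover have "c\<^sup>2 = (a - b)\<^sup>2 + 2 * (a * b * (1 - k))" using pos by (simp add: k_def power2_eq_square field_simps)
    moreover have "0 \<le> (a - b)\<^sup>2" by simp
    ultimately have "2 * (s * s * (1 - k)) \<le> c\<^sup>2" by linarith
    then show "(cmod (of_real s - of_real s * cis \<theta>))\<^sup>2 \<le> c\<^sup>2" unfolding norm2 by (simp add: power2_eq_square algebra_simps)
  qed (rule c0)
  finally show ?thesis by (simp add: c_def)
qed

text \<open>The three numbers are the Gram matrix of the edge vectors at \<open>v\<close>; affine
  independence makes it positive definite.\<close>

lemma eucl_form: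
  assumes ok: "eucl_ok V le N p" and c: "is_chain V le {v, u, w}" and dist: "u \<noteq> w" "u \<noteq> v" "w \<noteq> v"
  obtains AA AB BB where
    "\<And>x y. x \<in> real_pts V le \<Longrightarrow> y \<in> real_pts V le \<Longrightarrow> supp x \<subseteq> {v, u, w} \<Longrightarrow> supp y \<subseteq> {v, u, w} \<Longrightarrow>
       (eucl_sd N p {v, u, w} x y)\<^sup>2 = (x u - y u)\<^sup>2 * AA + 2 * (x u - y u) * (x w - y w) * AB + (x w - y w)\<^sup>2 * BB"
    "0 < AA" "0 < BB" "AB\<^sup>2 < AA * BB"
proof -
  let ?\<sigma> = "{v, u, w}" let ?N = "N {v, u, w}"
  define A where "A i = p ?\<sigma> u i - p ?\<sigma> v i" for i
  define B where "B i = p ?\<sigma> w i - p ?\<sigma> v i" for i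
  define AA AB BB where "AA = (\<Sum>i<?N. (A i)\<^sup>2)" and "AB = (\<Sum>i<?N. A i * B i)" and "BB = (\<Sum>i<?N. (B i)\<^sup>2)"
  have expand: "(\<Sum>i<?N. (s * A i + t * B i)\<^sup>2) = s\<^sup>2 * AA + 2 * s * t * AB + t\<^sup>2 * BB" for s t
  proof -
    have "(\<Sum>i<?N. (s * A i + t * B i)\<^sup>2) = (\<Sum>i<?N. s\<^sup>2 * (A i)\<^sup>2 + 2 * s * t * (A i * B i) + t\<^sup>2 * (B i)\<^sup>2)"
      by (rule sum.cong) (auto simp: power2_eq_square algebra_simps)
    then show ?thesis by (simp add: AA_def AB_def BB_def sum.distrib sum_distrib_left)
  qed
  have comb: "(\<Sum>z\<in>?\<sigma>. c z * p ?\<sigma> z i) = c u * A i + c w * B i" if "sum c ?\<sigma> = 0" for c i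
  proof -
    have cv: "c v = - c u - c w" using that dist by simp
    show ?thesis using dist by (simp add: cv A_def B_def algebra_simps)
  qed
  have form: "(eucl_sd N p ?\<sigma> x y)\<^sup>2 = (x u - y u)\<^sup>2 * AA + 2 * (x u - y u) * (x w - y w) * AB + (x w - y w)\<^sup>2 * BB"
    if "x \<in> real_pts V le" "y \<in> real_pts V le" "supp x \<subseteq> ?\<sigma>" "supp y \<subseteq> ?\<sigma>" for x y
  proof -
    have s0: "(\<Sum>z\<in>?\<sigma>. x z - y z) = 0" unfolding sum_subtractf
      using real_pts_sum[OF that(1) _ that(3)] real_pts_sum[OF that(2) _ that(4)] by simp
    have "(eucl_sd N p ?\<sigma> x y)\<^sup>2 = (\<Sum>i<?N. (\<Sum>z\<in>?\<sigma>. (x z - y z) * p ?\<sigma> z i)\<^sup>2)"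
      unfolding eucl_sd_def by (intro real_sqrt_pow2 sum_nonneg) auto
    also have "\<dots> = (\<Sum>i<?N. ((x u - y u) * A i + (x w - y w) * B i)\<^sup>2)" unfolding comb[OF s0] ..
    finally show ?thesis unfolding expand .
  qed
  have pd: "0 < s\<^sup>2 * AA + 2 * s * t * AB + t\<^sup>2 * BB" if "s \<noteq> 0 \<or> t \<noteq> 0" for s t
  proof (rule ccontr)
    assume "\<not> ?thesis"
    then have "(\<Sum>i<?N. (s * A i + t * B i)\<^sup>2) \<le> 0" unfolding expand by simp
    then have "(\<Sum>i<?N. (s * A i + t * B i)\<^sup>2) = 0" by (meson antisym sum_nonneg zero_le_power2)
    then have z: "\<forall>i<?N. s * A i + t * B i = 0" by (subst (asm) sum_nonneg_eq_0_iff) auto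
    define c where "c x = (if x = u then s else if x = w then t else if x = v then - s - t else 0)" for x
    have c0: "sum c ?\<sigma> = 0" using dist by (simp add: c_def)
    have "\<forall>i<?N. (\<Sum>z\<in>?\<sigma>. c z * p ?\<sigma> z i) = 0" unfolding comb[OF c0] using z dist by (simp add: c_def)
    then have "\<forall>x\<in>?\<sigma>. c x = 0" using ok c c0 unfolding eucl_ok_def by blast
    then show False using that dist by (auto simp: c_def)
  qed
  have AA: "0 < AA" using pd[of 1 0] by simp
  moreover have "0 < BB" using pd[of 0 1] by simp
  moreover have "AB\<^sup>2 < AA * BB"
  proof -
    \<comment> \<open>The form is evaluated at a multiple of the component of the second edge vector
      orthogonal to the first.\<close>
    have "0 < AB\<^sup>2 * AA + 2 * AB * (- AA) * AB + (- AA)\<^sup>2 * BB" using AA by (intro pd) auto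
    also have "\<dots> = AA * (AA * BB - AB\<^sup>2)" by (simp add: power2_eq_square algebra_simps)
    finally show ?thesis using AA by (simp add: zero_less_mult_iff)
  qed
  ultimately show ?thesis using that form by blast
qed

lemma supp_seg: "supp (seg v u s) \<subseteq> {v, u}" by (auto simp: supp_def seg_def split: if_splits)

lemma eucl_angled:
  assumes PE: "eucl_ok V le N p" "face_iso V le (eucl_sd N p)" and cat: "CAT0 (real_pts V le) (len_metric V le (eucl_sd N p))"
  shows "angled_metric V le (eucl_sd N p) angE (\<lambda>a. a) (\<lambda>s a. s * a)"
proof -
  interpret S: simplex_metric V le "eucl_sd N p" by (rule eucl_simplex_metric[OF PE])
  interpret G: geodesic_simplex_metric V le "eucl_sd N p"
    by unfold_locales (use cat fan_CAT0[OF cat] in \<open>auto simp: CAT0_def\<close>)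
  let ?sd = "eucl_sd N p" let ?L = "elen (eucl_sd N p)"
  have L0: "0 \<le> ?L u w" for u w by (simp add: elen_def eucl_sd_L2)
  have Lcom: "?L u w = ?L w u" for u w unfolding elen_def by (simp add: eucl_sd_commute insert_commute)
  have ptX: "pt z \<in> real_pts V le" if "is_chain V le \<sigma>" "z \<in> \<sigma>" for z \<sigma>
    by (rule S.pt_X, rule S.chain_subset[OF that(1)]) (use that in auto)
  have edge: "?sd {v, u} (pt v) (seg v u s) = s * ?L v u" if "v \<noteq> u" "0 \<le> s" for v u s
  proof -
    have E: "(\<Sum>z\<in>{v, u}. (pt v z - seg v u s z) * p {v, u} z i) = s * (\<Sum>z\<in>{v, u}. (pt v z - pt u z) * p {v, u} z i)" for i
      using that by (simp add: seg_def pt_other algebra_simps)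
    have "?sd {v, u} (pt v) (seg v u s) = sqrt (s\<^sup>2 * (\<Sum>i<N {v, u}. (\<Sum>z\<in>{v, u}. (pt v z - pt u z) * p {v, u} z i)\<^sup>2))"
      unfolding eucl_sd_def E power_mult_distrib by (simp only: sum_distrib_left[symmetric])
    then show ?thesis unfolding elen_def eucl_sd_def real_sqrt_mult using that by simp
  qed
  have Lpos: "0 < ?L v u" if c: "is_chain V le {v, u}" "v \<noteq> u" for v u
  proof (rule ccontr)
    assume "\<not> 0 < ?L v u"
    then have "?L v u = 0" using L0[of v u] by simp
    then have "\<forall>i<N {v, u}. (\<Sum>z\<in>{v, u}. (pt v z - pt u z) * p {v, u} z i) = 0"
      unfolding elen_def eucl_sd_def by (simp add: sum_nonneg_eq_0_iff)
    moreover have "(\<Sum>z\<in>{v, u}. pt v z - pt u z) = 0" using c by (simp add: pt_other)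
    ultimately have "\<forall>z\<in>{v, u}. pt v z - pt u z = 0" using PE(1) c(1) unfolding eucl_ok_def by blast
    then show False using c by (simp add: pt_other)
  qed
  have tri: "\<exists>AA AB BB. ?L v u ^ 2 = AA \<and> ?L v w ^ 2 = BB \<and> ?L u w ^ 2 = AA - 2 * AB + BB \<and> AB\<^sup>2 < AA * BB \<and>
     (\<forall>x y. x \<in> real_pts V le \<longrightarrow> y \<in> real_pts V le \<longrightarrow> supp x \<subseteq> {v, u, w} \<longrightarrow> supp y \<subseteq> {v, u, w} \<longrightarrow>
       (eucl_sd N p {v, u, w} x y)\<^sup>2 = (x u - y u)\<^sup>2 * AA + 2 * (x u - y u) * (x w - y w) * AB + (x w - y w)\<^sup>2 * BB)"
    if c: "is_chain V le {v, u, w}" "u \<noteq> w" "u \<noteq> v" "w \<noteq> v" for v u w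
  proof -
    obtain AA AB BB where F: "\<And>x y. x \<in> real_pts V le \<Longrightarrow> y \<in> real_pts V le \<Longrightarrow> supp x \<subseteq> {v, u, w} \<Longrightarrow> supp y \<subseteq> {v, u, w} \<Longrightarrow>
       (eucl_sd N p {v, u, w} x y)\<^sup>2 = (x u - y u)\<^sup>2 * AA + 2 * (x u - y u) * (x w - y w) * AB + (x w - y w)\<^sup>2 * BB"
      and pos: "0 < AA" "0 < BB" "AB\<^sup>2 < AA * BB" using eucl_form[OF PE(1) c] by metis
    have Lf: "?L a b = ?sd {v, u, w} (pt a) (pt b)" if "a \<in> {v, u, w}" "b \<in> {v, u, w}" for a b
      unfolding elen_def by (rule S.face_eq[OF c(1) ptX[OF c(1)] ptX[OF c(1)]]) (use that in auto)
    have P: "pt v \<in> real_pts V le" "pt u \<in> real_pts V le" "pt w \<in> real_pts V le" using ptX[OF c(1)] by auto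
    have "?L v u ^ 2 = AA" "?L v w ^ 2 = BB" "?L u w ^ 2 = AA - 2 * AB + BB"
      using F[OF P(1,2)] F[OF P(1,3)] F[OF P(2,3)] c by (auto simp: Lf pt_other)
    then show ?thesis using F pos by blast
  qed
  have heron: "(?L v u ^ 2 + ?L v w ^ 2 - ?L u w ^ 2)\<^sup>2 < 4 * ?L v u ^ 2 * ?L v w ^ 2"
    if c: "is_chain V le {v, u, w}" "u \<noteq> w" "u \<noteq> v" "w \<noteq> v" for v u w
  proof -
    obtain AA AB BB where h: "?L v u ^ 2 = AA" "?L v w ^ 2 = BB" "?L u w ^ 2 = AA - 2 * AB + BB" "AB\<^sup>2 < AA * BB"
      using tri[OF c] by blast
    show ?thesis unfolding h(1-3) using h(4) by (simp add: power2_eq_square algebra_simps)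
  qed
  have pos3: "0 < ?L v u" "0 < ?L v w" "0 < ?L u w" if c: "is_chain V le {v, u, w}" "u \<noteq> w" "u \<noteq> v" "w \<noteq> v" for v u w
    using Lpos[OF S.chain_subset[OF c(1), of "{v, u}"]] Lpos[OF S.chain_subset[OF c(1), of "{v, w}"]] Lpos[OF S.chain_subset[OF c(1), of "{u, w}"]] c by auto
  show ?thesis
  proof unfold_locales
    fix v u w assume c: "is_chain V le {v, u, w}" "u \<noteq> w" "u \<noteq> v" "w \<noteq> v"
    note pos = pos3[OF c] and he = heron[OF c]
    note ang = angE_cos[OF pos he]
    obtain AA AB BB where h: "?L v u ^ 2 = AA" "?L v w ^ 2 = BB" "?L u w ^ 2 = AA - 2 * AB + BB"
      and F: "\<And>x y. x \<in> real_pts V le \<Longrightarrow> y \<in> real_pts V le \<Longrightarrow> supp x \<subseteq> {v, u, w} \<Longrightarrow> supp y \<subseteq> {v, u, w} \<Longrightarrow>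
       (eucl_sd N p {v, u, w} x y)\<^sup>2 = (x u - y u)\<^sup>2 * AA + 2 * (x u - y u) * (x w - y w) * AB + (x w - y w)\<^sup>2 * BB"
      using tri[OF c] by blast
    define \<theta> where "\<theta> = angE (?L v u) (?L v w) (?L u w)"
    have "cos \<theta> * (?L v u * ?L v w) = AB" unfolding \<theta>_def ang(1) h using pos by simp
    \<comment> \<open>By the law of cosines \<open>corner_map\<close> is an isometry on a flat
      triangle, so both corner estimates hold at every scale and any \<open>\<delta>\<close>
      works.\<close>
    have eq: "?sd {v, u, w} x y = cmod (corner_map (?L v) u w \<theta> x - corner_map (?L v) u w \<theta> y)"
      if xy: "x \<in> real_pts V le" "y \<in> real_pts V le" "supp x \<subseteq> {v, u, w}" "supp y \<subseteq> {v, u, w}" for x y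
    proof (rule power2_eq_imp_eq)
      have "corner_map (?L v) u w \<theta> x - corner_map (?L v) u w \<theta> y = of_real ((x u - y u) * ?L v u) + of_real ((x w - y w) * ?L v w) * cis \<theta>"
        by (simp add: corner_map_def algebra_simps)
      then have "(cmod (corner_map (?L v) u w \<theta> x - corner_map (?L v) u w \<theta> y))\<^sup>2 =
         ((x u - y u) * ?L v u)\<^sup>2 + ((x w - y w) * ?L v w)\<^sup>2 + 2 * ((x u - y u) * ?L v u) * ((x w - y w) * ?L v w) * cos \<theta>"
        by (simp only: cmod_corner)
      also have "\<dots> = (x u - y u)\<^sup>2 * AA + 2 * (x u - y u) * (x w - y w) * AB + (x w - y w)\<^sup>2 * BB"
        unfolding h(1)[symmetric] h(2)[symmetric] \<open>cos \<theta> * _ = AB\<close>[symmetric] by (simp add: power_mult_distrib)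
      finally show "(?sd {v, u, w} x y)\<^sup>2 = (cmod (corner_map (?L v) u w \<theta> x - corner_map (?L v) u w \<theta> y))\<^sup>2" using F[OF xy] by simp
    qed (auto simp: eucl_sd_L2)
    have ptv: "pt v \<in> real_pts V le" using ptX[OF c(1)] by simp
    have cm0: "corner_map (?L v) u w \<theta> (pt v) = 0" using c by (simp add: corner_map_def pt_other)
    have main: "?sd {v, u, w} x y \<le> (1 + e) * cmod (corner_map (?L v) u w \<theta> x - corner_map (?L v) u w \<theta> y) \<and>
        (1 - e) * cmod (corner_map (?L v) u w \<theta> x) \<le> ?sd {v, u, w} (pt v) x"
      if "x \<in> real_pts V le" "y \<in> real_pts V le" "supp x \<subseteq> {v, u, w}" "supp y \<subseteq> {v, u, w}" "0 < e" for x y e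
    proof -
      have "?sd {v, u, w} (pt v) x = cmod (corner_map (?L v) u w \<theta> x)" using eq[OF ptv that(1) _ that(3)] cm0 by simp
      then show ?thesis using eq[OF that(1-4)] that(5) by (simp add: mult_le_cancel_right1 mult_le_cancel_right2)
    qed
    show "G.corner (\<lambda>z. ?L v z) v u w (angE (?L v u) (?L v w) (?L u w))"
      unfolding G.corner_def \<theta>_def[symmetric]
      using ang(2,3)[folded \<theta>_def] pos main by (auto intro!: exI[of _ "1::real"])
    show "angE (?L v u) (?L v w) (?L u w) + angE (?L u v) (?L u w) (?L v w) + angE (?L w v) (?L w u) (?L v u) \<le> pi"
      using angE_sum[OF pos he] Lcom[of u v] Lcom[of w v] Lcom[of w u] by (simp add: angE_commute)
  next
    fix a \<epsilon> :: real assume "0 < a" "0 < \<epsilon>"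
    then show "\<exists>s0>0. \<forall>s. 0 < s \<and> s \<le> s0 \<longrightarrow> s * a < \<epsilon>"
      by (intro exI[of _ "\<epsilon> / (2 * a)"]) (auto simp: field_simps)
  qed (use angE_commute Lcom edge Lpos in auto)
qed

section \<open>Angles in hyperbolic simplices\<close>

lemma mink_commute: "mink n u w = mink n w u" by (simp add: mink_def mult.commute)

lemma mink_sum_left: "finite S \<Longrightarrow> mink n (\<lambda>i. \<Sum>v\<in>S. x v * p v i) w = (\<Sum>v\<in>S. x v * mink n (p v) w)"
proof -
  have "(\<Sum>i<n. (\<Sum>v\<in>S. x v * p v i) * w i) = (\<Sum>v\<in>S. x v * (\<Sum>i<n. p v i * w i))"
    by (simp add: sum_distrib_left sum_distrib_right mult_ac) (rule sum.swap)
  then show ?thesis by (simp add: mink_def right_diff_distrib sum_subtractf sum_distrib_left mult_ac)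
qed

lemma mink_sum_right: "finite S \<Longrightarrow> mink n w (\<lambda>i. \<Sum>v\<in>S. x v * p v i) = (\<Sum>v\<in>S. x v * mink n w (p v))"
  using mink_sum_left[of S n x p w] by (simp add: mink_commute)

lemma mink_lin: "mink n (\<lambda>i. a * s i + b * t i) w = a * mink n s w + b * mink n t w"
  by (simp add: mink_def sum.distrib sum_distrib_left algebra_simps)

text \<open>With \<open>a\<close> and \<open>b\<close> the spatial norms, timelike means
  \<open>a < u n\<close> and \<open>b < w n\<close>. Ordinary Cauchy-Schwarz bounds the spatial
  product by \<open>a * b\<close>, and \<open>(u n * w n - a * b)\<^sup>2\<close> exceeds the
  product of the two Minkowski norms by a perfect square.\<close>

lemma reverse_cauchy_schwarz:
  assumes u: "mink n u u < 0" "u n > 0" and w: "mink n w w < 0" "w n > 0"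
  shows "0 < - mink n u w" "mink n u u * mink n w w \<le> (mink n u w)\<^sup>2"
proof -
  define a b c where "a = sqrt (\<Sum>i<n. (u i)\<^sup>2)" and "b = sqrt (\<Sum>i<n. (w i)\<^sup>2)" and "c = (\<Sum>i<n. u i * w i)"
  have s: "0 \<le> (\<Sum>i<n. (u i)\<^sup>2)" "0 \<le> (\<Sum>i<n. (w i)\<^sup>2)" by (auto intro: sum_nonneg)
  have ab: "0 \<le> a" "0 \<le> b" "a\<^sup>2 = (\<Sum>i<n. (u i)\<^sup>2)" "b\<^sup>2 = (\<Sum>i<n. (w i)\<^sup>2)" using s by (auto simp: a_def b_def)
  have uu: "mink n u u = a\<^sup>2 - (u n)\<^sup>2" "mink n w w = b\<^sup>2 - (w n)\<^sup>2" "mink n u w = c - u n * w n"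
    unfolding mink_def c_def ab(3,4) by (simp_all add: power2_eq_square)
  have "a < u n" "b < w n" using u w uu ab by (auto intro: power_less_imp_less_base[of _ 2])
  have "c\<^sup>2 \<le> (a * b)\<^sup>2" unfolding power_mult_distrib ab c_def by (rule Cauchy_Schwarz_ineq_sum)
  then have c: "\<bar>c\<bar> \<le> a * b" using ab by (metis abs_le_square_iff abs_of_nonneg mult_nonneg_nonneg)
  have "a * b < u n * w n" using ab \<open>a < u n\<close> \<open>b < w n\<close> by (intro mult_strict_mono') auto
  then show pos: "0 < - mink n u w" using c uu by linarith
  have "(u n * w n - a * b)\<^sup>2 \<le> (- mink n u w)\<^sup>2"
    using c \<open>a * b < u n * w n\<close> uu by (intro power_mono) auto
  moreover have "(u n * w n - a * b)\<^sup>2 - mink n u u * mink n w w = (u n * b - w n * a)\<^sup>2"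
    unfolding uu by (simp add: power2_eq_square algebra_simps)
  moreover have "0 \<le> (u n * b - w n * a)\<^sup>2" by (rule zero_le_power2)
  ultimately have "mink n u u * mink n w w \<le> (- mink n u w)\<^sup>2" by linarith
  then show "mink n u u * mink n w w \<le> (mink n u w)\<^sup>2" by simp
qed

text \<open>A quantitative form of the fact that the Minkowski form is positive on the complement of
  a timelike vector: it even bounds the spatial norm, which later turns null vectors into zero
  vectors.\<close>

lemma mink_perp:
  assumes P: "mink n P P = -1" "P n > 0" and s: "mink n P s = 0"
  shows "(\<Sum>i<n. (s i)\<^sup>2) \<le> (P n)\<^sup>2 * mink n s s"
proof -
  define A B where "A = (\<Sum>i<n. (P i)\<^sup>2)" and "B = (\<Sum>i<n. (s i)\<^sup>2)"
  have A: "(P n)\<^sup>2 = A + 1" using P(1) by (simp add: mink_def A_def power2_eq_square)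
  have "(\<Sum>i<n. P i * s i) = P n * s n" using s by (simp add: mink_def)
  then have "(P n * s n)\<^sup>2 \<le> A * B" using Cauchy_Schwarz_ineq_sum[of P s "{..<n}"] by (simp add: A_def B_def)
  then have "(P n)\<^sup>2 * (s n)\<^sup>2 \<le> ((P n)\<^sup>2 - 1) * B" by (simp add: A power_mult_distrib)
  moreover have e: "mink n s s = B - (s n)\<^sup>2" by (simp add: mink_def B_def power2_eq_square)
  ultimately show ?thesis unfolding B_def[symmetric] e by (simp add: algebra_simps)
qed

text \<open>The positive semidefinite form induced on the orthogonal complement of the unit timelike vector \<open>P\<close>.\<close>

definition ip :: "nat \<Rightarrow> (nat \<Rightarrow> real) \<Rightarrow> (nat \<Rightarrow> real) \<Rightarrow> (nat \<Rightarrow> real) \<Rightarrow> real" where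
  "ip n P s t = mink n s t + mink n P s * mink n P t"

lemma ip_commute: "ip n P s t = ip n P t s" by (simp add: ip_def mink_commute[of n s] mult.commute)

lemma ip_lin: "ip n P (\<lambda>i. a * s i + b * t i) w = a * ip n P s w + b * ip n P t w"
  unfolding ip_def mink_lin mink_commute[of n P] by (simp add: algebra_simps)

lemma ip_perp: assumes "mink n P P = -1"
  shows "mink n P (\<lambda>i. 1 * s i + mink n P s * P i) = 0"
    "mink n (\<lambda>i. 1 * s i + mink n P s * P i) (\<lambda>i. 1 * s i + mink n P s * P i) = ip n P s s"
proof -
  have "mink n (\<lambda>i. 1 * s i + mink n P s * P i) w = mink n s w + mink n P s * mink n P w" for w
    unfolding mink_lin by simp
  note L = this
  show 0: "mink n P (\<lambda>i. 1 * s i + mink n P s * P i) = 0" using assms L[of P] by (simp add: mink_commute)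
  show "mink n (\<lambda>i. 1 * s i + mink n P s * P i) (\<lambda>i. 1 * s i + mink n P s * P i) = ip n P s s"
    unfolding L[of "\<lambda>i. 1 * s i + mink n P s * P i"] 0
    using L[of s] mink_commute[of n s "\<lambda>i. 1 * s i + mink n P s * P i"] by (simp only: ip_def mult_zero_right add_0_right)
qed

lemma ip_nonneg: assumes "mink n P P = -1" "P n > 0" shows "0 \<le> ip n P s s"
proof -
  have "0 \<le> (P n)\<^sup>2 * ip n P s s"
    using mink_perp[OF assms ip_perp(1)[OF assms(1), of s]] unfolding ip_perp(2)[OF assms(1)]
    by (rule order_trans[rotated]) (auto intro: sum_nonneg)
  then show ?thesis using assms by (simp add: zero_le_mult_iff)
qed

lemma ip_zero: assumes "mink n P P = -1" "P n > 0" "ip n P s s = 0" "i \<le> n" shows "s i = - mink n P s * P i"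
proof -
  define t where "t = (\<lambda>i. 1 * s i + mink n P s * P i)"
  have t: "mink n P t = 0" "mink n t t = 0" using ip_perp[OF assms(1), of s] assms(3) by (auto simp: t_def)
  have "(\<Sum>i<n. (t i)\<^sup>2) \<le> 0" using mink_perp[OF assms(1,2) t(1)] t(2) by simp
  then have z: "(\<Sum>i<n. (t i)\<^sup>2) = 0" by (meson antisym sum_nonneg zero_le_power2)
  then have "\<forall>i<n. t i = 0" by (subst (asm) sum_nonneg_eq_0_iff) auto
  moreover have "t n = 0" using t(2) z by (simp add: mink_def power2_eq_square)
  ultimately have "t i = 0" using assms(4) by (cases "i = n") auto
  then show ?thesis by (simp add: t_def)
qed

lemma ip_cauchy_schwarz: assumes P: "mink n P P = -1" "P n > 0" shows "(ip n P s t)\<^sup>2 \<le> ip n P s s * ip n P t t"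
proof -
  have q: "0 \<le> a\<^sup>2 * ip n P s s + 2 * a * b * ip n P s t + b\<^sup>2 * ip n P t t" for a b
  proof -
    have "ip n P (\<lambda>i. a * s i + b * t i) (\<lambda>i. a * s i + b * t i) = a\<^sup>2 * ip n P s s + 2 * a * b * ip n P s t + b\<^sup>2 * ip n P t t"
      unfolding ip_lin ip_commute[of n P s "\<lambda>i. a * s i + b * t i"] ip_commute[of n P t "\<lambda>i. a * s i + b * t i"]
      unfolding ip_lin ip_commute[of n P t s] by (simp add: power2_eq_square algebra_simps)
    then show ?thesis using ip_nonneg[OF P, of "\<lambda>i. a * s i + b * t i"] by simp
  qed
  show ?thesis
  proof (cases "ip n P t t = 0")
    case True
    have "ip n P s t = 0"
    proof (rule ccontr)
      assume ne: "ip n P s t \<noteq> 0"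
      \<comment> \<open>With \<open>t\<close> null the form is affine in the coefficient of
        \<open>t\<close>; this choice of coefficient gives it the value -1.\<close>
      show False using q[of 1 "- (ip n P s s + 1) / (2 * ip n P s t)"] ne True by (simp add: field_simps)
    qed
    then show ?thesis using True by simp
  next
    case False
    then have t: "0 < ip n P t t" using ip_nonneg[OF P, of t] by simp
    have "0 \<le> (ip n P t t)\<^sup>2 * ip n P s s + 2 * ip n P t t * (- ip n P s t) * ip n P s t + (- ip n P s t)\<^sup>2 * ip n P t t" by (rule q)
    also have "\<dots> = ip n P t t * (ip n P s s * ip n P t t - (ip n P s t)\<^sup>2)" by (simp add: power2_eq_square algebra_simps)
    finally show ?thesis using t by (simp add: zero_le_mult_iff)
  qed
qed

section \<open>Hyperbolic functions and hyperbolic angles\<close>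

lemma sinh_ge_arg: "0 \<le> (x::real) \<Longrightarrow> x \<le> sinh x"
proof -
  assume x: "0 \<le> x"
  have "sinh 0 - 0 \<le> sinh x - x"
    by (rule DERIV_nonneg_imp_nondecreasing[OF x]) (auto intro!: exI derivative_eq_intros simp: cosh_real_ge_1)
  then show ?thesis by simp
qed

lemma sinh_le_arg_cosh: "0 \<le> (x::real) \<Longrightarrow> sinh x \<le> x * cosh x"
proof -
  assume x: "0 \<le> x"
  have "0 * cosh 0 - sinh 0 \<le> x * cosh x - sinh x"
  proof (rule DERIV_nonneg_imp_nondecreasing[OF x])
    fix y :: real assume y: "0 \<le> y" "y \<le> x"
    have "((\<lambda>a. a * cosh a - sinh a) has_real_derivative y * sinh y) (at y)" by (auto intro!: derivative_eq_intros)
    then show "\<exists>D. ((\<lambda>a. a * cosh a - sinh a) has_real_derivative D) (at y) \<and> 0 \<le> D" using y by (intro exI[of _ "y * sinh y"]) simp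
  qed
  then show ?thesis by simp
qed

lemma sinh_le_two: "0 \<le> (x::real) \<Longrightarrow> x \<le> 1 \<Longrightarrow> sinh x \<le> 2 * x"
proof -
  assume x: "0 \<le> x" "x \<le> 1"
  have "exp x \<le> 1 + x + x\<^sup>2" using x by (intro exp_bound) auto
  moreover have "1 - x \<le> exp (- x)" using exp_ge_add_one_self[of "- x"] by simp
  moreover have "x\<^sup>2 \<le> x" using x by (simp add: power2_eq_square mult_left_le)
  ultimately have "exp x - exp (- x) \<le> 4 * x" using x by linarith
  then show ?thesis by (simp add: sinh_field_def)
qed

lemma arcosh_le_iff: "1 \<le> (x::real) \<Longrightarrow> 0 \<le> c \<Longrightarrow> x \<le> cosh c \<Longrightarrow> arcosh x \<le> c"
  using cosh_real_nonneg_le_iff[of "arcosh x" c] by simp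

definition angH :: "real \<Rightarrow> real \<Rightarrow> real \<Rightarrow> real" where
  "angH a b c = arccos ((cosh a * cosh b - cosh c) / (sinh a * sinh b))"

lemma angH_commute: "angH a b c = angH b a c" by (simp add: angH_def mult.commute)

text \<open>The determinant of the symmetric matrix with ones on the diagonal and the three
  hyperbolic cosines off it. It is symmetric in the sides and plays the role of Heron's
  expression.\<close>

definition gram3 :: "real \<Rightarrow> real \<Rightarrow> real \<Rightarrow> real" where
  "gram3 a b c = 1 + 2 * cosh a * cosh b * cosh c - (cosh a)\<^sup>2 - (cosh b)\<^sup>2 - (cosh c)\<^sup>2"

lemma gram3_eq: "gram3 a b c = (sinh a)\<^sup>2 * (sinh b)\<^sup>2 - (cosh a * cosh b - cosh c)\<^sup>2"
  unfolding gram3_def sinh_square_eq by (simp add: power2_eq_square algebra_simps)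

lemma angH_cos:
  assumes "0 < a" "0 < b" "0 < gram3 a b c"
  shows "cos (angH a b c) = (cosh a * cosh b - cosh c) / (sinh a * sinh b)" "0 < angH a b c" "angH a b c < pi"
    "sin (angH a b c) = sqrt (gram3 a b c) / (sinh a * sinh b)"
proof -
  define k where "k = (cosh a * cosh b - cosh c) / (sinh a * sinh b)"
  have s: "0 < sinh a" "0 < sinh b" using assms by auto
  then have ab: "0 < sinh a * sinh b" by simp
  have eq: "1 - k\<^sup>2 = gram3 a b c / (sinh a * sinh b)\<^sup>2"
    using s unfolding gram3_eq k_def power_divide by (simp add: field_simps power_mult_distrib)
  also have "\<dots> > 0" using assms s by simp
  finally have "k\<^sup>2 < 1" by simp
  then have k: "-1 < k" "k < 1" using abs_square_less_1[of k] by auto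
  show 1: "cos (angH a b c) = (cosh a * cosh b - cosh c) / (sinh a * sinh b)" using k unfolding angH_def k_def[symmetric] by simp
  show "0 < angH a b c" "angH a b c < pi" using arccos_lt_bounded[OF k] unfolding angH_def k_def[symmetric] by auto
  have "sin (angH a b c) = sqrt (1 - k\<^sup>2)" using k unfolding angH_def k_def[symmetric] by (simp add: sin_arccos)
  also have "\<dots> = sqrt (gram3 a b c) / (sinh a * sinh b)" unfolding eq using ab by (simp add: real_sqrt_divide)
  finally show "sin (angH a b c) = sqrt (gram3 a b c) / (sinh a * sinh b)" .
qed

text \<open>The dual law of cosines: the cosine expression equals the product of the two sines times
  \<open>cosh\<close> of the side between these two angles. As \<open>cosh\<close> is at least 1 and
  the sines are positive, the hypotheses of \<open>angle_sum_le_pi\<close> hold.\<close>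

lemma angH_sum:
  assumes p: "0 < a" "0 < b" "0 < c" and h: "0 < gram3 a b c"
  shows "angH a b c + angH a c b + angH b c a \<le> pi"
proof -
  define D where "D = gram3 a b c"
  have D: "gram3 a b c = D" "gram3 a c b = D" "gram3 b c a = D" by (simp_all add: D_def gram3_def algebra_simps)
  have D0: "0 < D" using h D by simp
  note A = angH_cos[OF p(1,2), of c] and B = angH_cos[OF p(1,3), of b] and C = angH_cos[OF p(2,3), of a]
  note A = A[unfolded D, OF D0] and B = B[unfolded D, OF D0] and C = C[unfolded D, OF D0]
  have s: "sqrt D * sqrt D = D" using D0 by simp
  have sh: "0 < sinh a" "0 < sinh b" "0 < sinh c" using p by auto
  have key: "D / ((sinh x)\<^sup>2 * sinh y * sinh z) \<le> (cosh x * cosh y - cosh z) / (sinh x * sinh y) * ((cosh x * cosh z - cosh y) / (sinh x * sinh z)) + (cosh y * cosh z - cosh x) / (sinh y * sinh z)"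
    if xyz: "0 < x" "0 < y" "0 < z" "gram3 x y z = D" for x y z
  proof -
    have sx: "0 < sinh x" "0 < sinh y" "0 < sinh z" using xyz by auto
    have "(cosh x * cosh y - cosh z) / (sinh x * sinh y) * ((cosh x * cosh z - cosh y) / (sinh x * sinh z)) + (cosh y * cosh z - cosh x) / (sinh y * sinh z)
      = ((cosh x * cosh y - cosh z) * (cosh x * cosh z - cosh y) + (cosh y * cosh z - cosh x) * (sinh x)\<^sup>2) / ((sinh x)\<^sup>2 * sinh y * sinh z)"
      using sx by (simp add: field_simps power2_eq_square)
    also have "(cosh x * cosh y - cosh z) * (cosh x * cosh z - cosh y) + (cosh y * cosh z - cosh x) * (sinh x)\<^sup>2 = cosh x * gram3 x y z"
      unfolding gram3_def sinh_square_eq by (simp add: power2_eq_square algebra_simps)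
    finally have e: "(cosh x * cosh y - cosh z) / (sinh x * sinh y) * ((cosh x * cosh z - cosh y) / (sinh x * sinh z)) + (cosh y * cosh z - cosh x) / (sinh y * sinh z)
       = cosh x * D / ((sinh x)\<^sup>2 * sinh y * sinh z)" using xyz by simp
    have "1 * D \<le> cosh x * D" using D0 cosh_real_ge_1[of x] by (intro mult_right_mono) auto
    then show ?thesis unfolding e using sx by (intro divide_right_mono) auto
  qed
  show ?thesis
  proof (rule angle_sum_le_pi)
    have "sin (angH a b c) * sin (angH a c b) = D / ((sinh a)\<^sup>2 * sinh b * sinh c)"
      unfolding A(4) B(4) using s by (simp add: power2_eq_square mult_ac)
    then show "sin (angH a b c) * sin (angH a c b) \<le> cos (angH a b c) * cos (angH a c b) + cos (angH b c a)"
      unfolding A(1) B(1) C(1) using key[OF p D(1)] by simp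
    have "sin (angH a b c) * sin (angH b c a) = D / ((sinh b)\<^sup>2 * sinh a * sinh c)"
      unfolding A(4) C(4) using s by (simp add: power2_eq_square mult_ac)
    then show "sin (angH a b c) * sin (angH b c a) \<le> cos (angH a b c) * cos (angH b c a) + cos (angH a c b)"
      unfolding A(1) B(1) C(1) using key[of b a c] p D by (simp add: mult_ac gram3_def)
  qed (rule A B C)+
qed

text \<open>The comparison triangle is placed in the hyperboloid model with its apex at \<open>(0, 0, 1)\<close>.\<close>

lemma fan_CATm1:
  assumes cat: "CATm1 X d" and pqr: "p \<in> X" "q \<in> X" "r \<in> X"
    and g: "is_geodesic X d \<gamma> p q" "is_geodesic X d \<gamma>' p r" and s: "0 \<le> s" "s \<le> d p q" "s \<le> d p r"
  shows "d (\<gamma> s) (\<gamma>' s) \<le> d q r"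
proof (cases "s = 0")
  interpret M: Metric_space X d using cat by (simp add: CATm1_def geodesic_space_def)
  case True
  have "\<gamma> 0 = p" "\<gamma>' 0 = p" using g by (auto simp: is_geodesic_def)
  then show ?thesis using pqr True by simp
next
  case False
  interpret M: Metric_space X d using cat by (simp add: CATm1_def geodesic_space_def)
  define a b c where "a = d p q" and "b = d p r" and "c = d q r"
  have pos: "0 < s" "0 < a" "0 < b" using False s by (auto simp: a_def b_def)
  have sh: "0 < sinh s" "0 < sinh a" "0 < sinh b" using pos by auto
  have tri: "c \<le> a + b" "a \<le> b + c" "b \<le> a + c"
    using M.triangle[of q p r] M.triangle[of p r q] M.triangle[of p q r] pqr M.commute by (auto simp: a_def b_def c_def)
  define k where "k = (cosh a * cosh b - cosh c) / (sinh a * sinh b)"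
  have c0: "0 \<le> c" by (simp add: c_def)
  have "cosh c \<le> cosh (a + b)" using tri c0 pos by (subst cosh_real_nonneg_le_iff) auto
  moreover have "cosh \<bar>a - b\<bar> \<le> cosh c" using tri c0 by (subst cosh_real_nonneg_le_iff) auto
  then have "cosh (a - b) \<le> cosh c" by simp
  ultimately have k: "-1 \<le> k" "k \<le> 1" unfolding k_def using sh by (simp_all add: field_simps cosh_add cosh_diff)
  define \<theta> where "\<theta> = arccos k"
  have ct: "cos \<theta> = k" using k by (simp add: \<theta>_def)
  define pp where "pp x \<phi> = (sinh x * cos \<phi>, sinh x * sin \<phi>, cosh x)" for x \<phi> :: real
  have m: "- mink3 (pp x \<phi>) (pp y \<psi>) = cosh x * cosh y - sinh x * sinh y * cos (\<phi> - \<psi>)" for x y \<phi> \<psi>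
    by (simp add: mink3_def pp_def cos_diff algebra_simps)
  have H: "pp x \<phi> \<in> H2" for x \<phi>
  proof -
    have "- mink3 (pp x \<phi>) (pp x \<phi>) = (cosh x)\<^sup>2 - (sinh x)\<^sup>2" unfolding m by (simp add: power2_eq_square)
    then have "mink3 (pp x \<phi>) (pp x \<phi>) = -1" by (simp add: cosh_square_eq)
    then show ?thesis by (simp add: H2_def pp_def cosh_real_pos)
  qed
  define P Q R where "P = pp 0 0" and "Q = pp a 0" and "R = pp b \<theta>"
  have PQ: "hdist P Q = d p q" unfolding hdist_def P_def Q_def m using pos by (simp add: a_def[symmetric] arcosh_cosh_real)
  have RP: "hdist R P = d r p" unfolding hdist_def P_def R_def m using pos by (simp add: b_def[symmetric] M.commute[of r p] arcosh_cosh_real)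
  have QR: "hdist Q R = d q r"
  proof -
    have "cosh a * cosh b - sinh a * sinh b * cos (0 - \<theta>) = cosh c" using sh by (simp add: ct k_def)
    then show ?thesis unfolding hdist_def Q_def R_def m using c0 by (simp add: c_def[symmetric] arcosh_cosh_real)
  qed
  obtain \<gamma>2 where g2: "is_geodesic X d \<gamma>2 q r" using cat pqr unfolding CATm1_def geodesic_space_def by blast
  define \<gamma>3 where "\<gamma>3 t = \<gamma>' (b - t)" for t
  have g3: "is_geodesic X d \<gamma>3 r p"
    using g(2) unfolding is_geodesic_def \<gamma>3_def M.commute[of r p] b_def by auto
  let ?C = "side_pts_H \<gamma> (d p q) P Q \<union> side_pts_H \<gamma>2 (d q r) Q R \<union> side_pts_H \<gamma>3 (d r p) R P"
  have inH: "P \<in> H2" "Q \<in> H2" "R \<in> H2" unfolding P_def Q_def R_def by (rule H)+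
  have C: "\<forall>(x, xb)\<in>?C. \<forall>(y, yb)\<in>?C. d x y \<le> hdist xb yb"
    using cat pqr g g2 g3 PQ QR RP inH unfolding CATm1_def Let_def by blast
  have 1: "(\<gamma> s, hgeo P Q (d p q) s) \<in> ?C" using s by (auto simp: side_pts_H_def)
  have b': "d r p = b" by (simp add: b_def M.commute)
  have "(\<gamma>3 (b - s), hgeo R P (d r p) (b - s)) \<in> side_pts_H \<gamma>3 (d r p) R P"
    unfolding side_pts_H_def b' using s by (auto simp: b_def intro!: exI[of _ "b - s"])
  then have 2: "(\<gamma>' s, hgeo R P (d r p) (b - s)) \<in> ?C" by (simp add: \<gamma>3_def)
  have radial: "(sinh (x - s) / sinh x) *\<^sub>R pp 0 0 + (sinh s / sinh x) *\<^sub>R pp x \<phi> = pp s \<phi>" if "0 < sinh x" for x \<phi>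
    using that by (simp add: pp_def sinh_diff field_simps)
  have "d (\<gamma> s) (\<gamma>' s) \<le> hdist (hgeo P Q (d p q) s) (hgeo R P (d r p) (b - s))"
    using bspec[OF bspec[OF C 1, unfolded prod.case] 2, unfolded prod.case] .
  also have "hgeo P Q (d p q) s = pp s 0"
    using radial[OF sh(2), of 0] pos unfolding a_def[symmetric] by (simp add: hgeo_def P_def Q_def)
  also have "hgeo R P (d r p) (b - s) = pp s \<theta>"
    using radial[OF sh(3), of \<theta>] pos unfolding b' by (simp add: hgeo_def P_def R_def add.commute)
  also have "hdist (pp s 0) (pp s \<theta>) \<le> c"
    unfolding hdist_def m
  proof (rule arcosh_le_iff)
    have e: "cosh s * cosh s - sinh s * sinh s * cos (0 - \<theta>) = 1 + (sinh s)\<^sup>2 * (1 - k)"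
      using cosh_square_eq[of s] by (simp add: ct power2_eq_square algebra_simps)
    show "1 \<le> cosh s * cosh s - sinh s * sinh s * cos (0 - \<theta>)" unfolding e using k by simp
    have "sinh s * sinh s \<le> sinh a * sinh b" using s sh by (intro mult_mono) (auto simp: a_def b_def)
    then have "(sinh s)\<^sup>2 * (1 - k) \<le> sinh a * sinh b * (1 - k)" unfolding power2_eq_square using k by (intro mult_right_mono) auto
    moreover have "cosh c = cosh (a - b) + sinh a * sinh b * (1 - k)" using sh by (simp add: k_def cosh_diff field_simps)
    moreover have "1 \<le> cosh (a - b)" by (rule cosh_real_ge_1)
    ultimately show "cosh s * cosh s - sinh s * sinh s * cos (0 - \<theta>) \<le> cosh c" unfolding e by linarith
  qed (rule c0)
  finally show ?thesis by (simp add: c_def)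
qed

section \<open>Hyperbolic simplices\<close>

definition hZ :: "('v set \<Rightarrow> 'v \<Rightarrow> nat \<Rightarrow> real) \<Rightarrow> 'v set \<Rightarrow> ('v \<Rightarrow> real) \<Rightarrow> nat \<Rightarrow> real" where
  "hZ p \<sigma> x i = (\<Sum>v\<in>\<sigma>. x v * p \<sigma> v i)"

lemma hyp_sd_alt: "hyp_sd N p \<sigma> x y = arcosh (- mink (N \<sigma>) (hZ p \<sigma> x) (hZ p \<sigma> y) /
    sqrt (mink (N \<sigma>) (hZ p \<sigma> x) (hZ p \<sigma> x) * mink (N \<sigma>) (hZ p \<sigma> y) (hZ p \<sigma> y)))"
  by (simp add: hyp_sd_def hZ_def[abs_def] Let_def)

lemma hZ_pt: assumes "finite \<sigma>" "v \<in> \<sigma>" shows "hZ p \<sigma> (pt v) = p \<sigma> v"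
proof
  fix i
  have "hZ p \<sigma> (pt v) i = (\<Sum>w\<in>\<sigma>. if w = v then p \<sigma> v i else 0)"
    unfolding hZ_def by (rule sum.cong) (auto simp: pt_def)
  then show "hZ p \<sigma> (pt v) i = p \<sigma> v i" using assms by simp
qed

lemma mink_hZ: "finite \<sigma> \<Longrightarrow> mink n (hZ p \<sigma> x) w = (\<Sum>v\<in>\<sigma>. x v * mink n (p \<sigma> v) w)"
  unfolding hZ_def[abs_def] by (rule mink_sum_left)

lemma mink_hZ': "finite \<sigma> \<Longrightarrow> mink n w (hZ p \<sigma> x) = (\<Sum>v\<in>\<sigma>. x v * mink n w (p \<sigma> v))"
  unfolding hZ_def[abs_def] by (rule mink_sum_right)

text \<open>Distance from the first vector to the normalisation of \<open>(1 - s)\<close> times it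
  plus \<open>s\<close> times the second, for unit vectors at distance \<open>a\<close>; the
  radicand is minus the Minkowski norm of the combination.\<close>

definition edgeH :: "real \<Rightarrow> real \<Rightarrow> real" where
  "edgeH s a = arcosh (((1 - s) + s * cosh a) / sqrt ((1 - s)\<^sup>2 + s\<^sup>2 + 2 * s * (1 - s) * cosh a))"

lemma edgeH_den: fixes s a :: real assumes "0 \<le> s" "s \<le> 1" shows "1 \<le> (1 - s)\<^sup>2 + s\<^sup>2 + 2 * s * (1 - s) * cosh a"
proof -
  have "2 * s * (1 - s) * 1 \<le> 2 * s * (1 - s) * cosh a" using assms cosh_real_ge_1[of a] by (intro mult_left_mono) auto
  then show ?thesis by (simp add: power2_eq_square algebra_simps)
qed

lemma edgeH_ratio:
  fixes s a :: real
  assumes "0 \<le> s" "s \<le> 1" 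
  shows "(((1 - s) + s * cosh a) / sqrt ((1 - s)\<^sup>2 + s\<^sup>2 + 2 * s * (1 - s) * cosh a))\<^sup>2 =
     1 + s\<^sup>2 * ((cosh a)\<^sup>2 - 1) / ((1 - s)\<^sup>2 + s\<^sup>2 + 2 * s * (1 - s) * cosh a)"
    "1 \<le> ((1 - s) + s * cosh a) / sqrt ((1 - s)\<^sup>2 + s\<^sup>2 + 2 * s * (1 - s) * cosh a)"
proof -
  define D where "D = (1 - s)\<^sup>2 + s\<^sup>2 + 2 * s * (1 - s) * cosh a"
  have D: "1 \<le> D" unfolding D_def by (rule edgeH_den[OF assms])
  have "((1 - s) + s * cosh a)\<^sup>2 = D + s\<^sup>2 * ((cosh a)\<^sup>2 - 1)" by (simp add: D_def power2_eq_square algebra_simps)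
  note sq = this
  have e: "(((1 - s) + s * cosh a) / sqrt D)\<^sup>2 = 1 + s\<^sup>2 * ((cosh a)\<^sup>2 - 1) / D"
    unfolding power_divide sq using D by (simp add: add_divide_distrib)
  then show "(((1 - s) + s * cosh a) / sqrt ((1 - s)\<^sup>2 + s\<^sup>2 + 2 * s * (1 - s) * cosh a))\<^sup>2 =
     1 + s\<^sup>2 * ((cosh a)\<^sup>2 - 1) / ((1 - s)\<^sup>2 + s\<^sup>2 + 2 * s * (1 - s) * cosh a)" by (simp add: D_def)
  have "0 \<le> (cosh a)\<^sup>2 - 1" by (simp add: sinh_square_eq[symmetric])
  then have "1\<^sup>2 \<le> (((1 - s) + s * cosh a) / sqrt D)\<^sup>2" unfolding e using D by simp
  moreover have "0 \<le> ((1 - s) + s * cosh a) / sqrt D" using assms D by (intro divide_nonneg_nonneg add_nonneg_nonneg mult_nonneg_nonneg) auto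
  ultimately show "1 \<le> ((1 - s) + s * cosh a) / sqrt ((1 - s)\<^sup>2 + s\<^sup>2 + 2 * s * (1 - s) * cosh a)"
    unfolding D_def[symmetric] by (rule power2_le_imp_le)
qed

text \<open>Squaring reduces the claim to injectivity of
  \<open>c \<mapsto> (c\<^sup>2 - 1) / F c\<close> on values \<open>c\<close> of
  \<open>cosh\<close>. Cross-multiplied differences factor as the difference of the two arguments
  times a positive number.\<close>

lemma edgeH_inj:
  assumes s: "0 < s" "s \<le> 1" and ab: "0 < a" "0 < b" and e: "edgeH s a = edgeH s b"
  shows "a = b"
proof -
  define F where "F c = (1 - s)\<^sup>2 + s\<^sup>2 + 2 * s * (1 - s) * c" for c :: real
  have s': "0 \<le> s" "s \<le> 1" using s by auto
  have "((1 - s) + s * cosh a) / sqrt (F (cosh a)) = ((1 - s) + s * cosh b) / sqrt (F (cosh b))"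
    using e edgeH_ratio(2)[OF s', of a] edgeH_ratio(2)[OF s', of b] cosh_arcosh_real unfolding edgeH_def F_def by metis
  then have "1 + s\<^sup>2 * ((cosh a)\<^sup>2 - 1) / F (cosh a) = 1 + s\<^sup>2 * ((cosh b)\<^sup>2 - 1) / F (cosh b)"
    using edgeH_ratio(1)[OF s', of a] edgeH_ratio(1)[OF s', of b] unfolding F_def by metis
  moreover have Fp: "0 < F (cosh a)" "0 < F (cosh b)" using edgeH_den[OF s', of a] edgeH_den[OF s', of b] by (auto simp: F_def)
  ultimately have "s\<^sup>2 * (((cosh a)\<^sup>2 - 1) / F (cosh a)) = s\<^sup>2 * (((cosh b)\<^sup>2 - 1) / F (cosh b))" by simp
  then have "((cosh a)\<^sup>2 - 1) / F (cosh a) = ((cosh b)\<^sup>2 - 1) / F (cosh b)" 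
    using mult_left_cancel[of "s\<^sup>2" "((cosh a)\<^sup>2 - 1) / F (cosh a)" "((cosh b)\<^sup>2 - 1) / F (cosh b)"] s by simp
  then have eq: "((cosh a)\<^sup>2 - 1) * F (cosh b) = ((cosh b)\<^sup>2 - 1) * F (cosh a)" using Fp by (simp add: frac_eq_eq)
  have id: "(y\<^sup>2 - 1) * F x - (x\<^sup>2 - 1) * F y = (y - x) * (((1 - s)\<^sup>2 + s\<^sup>2) * (y + x) + 2 * s * (1 - s) * (x * y + 1))" for x y
    by (simp add: F_def power2_eq_square algebra_simps)
  have "0 < ((1 - s)\<^sup>2 + s\<^sup>2) * (cosh b + cosh a) + 2 * s * (1 - s) * (cosh a * cosh b + 1)"
  proof (rule add_pos_nonneg)
    have "0 < (1 - s)\<^sup>2 + s\<^sup>2" using s by (simp add: add_nonneg_pos)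
    then show "0 < ((1 - s)\<^sup>2 + s\<^sup>2) * (cosh b + cosh a)" by (rule mult_pos_pos) (simp add: add_pos_pos)
  qed (use s in auto)
  then have "cosh b - cosh a = 0" using id[of "cosh b" "cosh a"] eq by (metis diff_self less_irrefl mult_eq_0_iff)
  then show ?thesis using ab by simp
qed

lemma edgeH_small:
  assumes "0 < a" "0 < \<epsilon>" shows "\<exists>s0>0. s0 \<le> 1 \<and> (\<forall>s. 0 < s \<and> s \<le> s0 \<longrightarrow> edgeH s a < \<epsilon>)"
proof -
  define s0 where "s0 = min 1 (\<epsilon> / (2 * sinh a))"
  have sa: "0 < sinh a" using assms by simp
  have "edgeH s a < \<epsilon>" if s: "0 < s" "s \<le> s0" for s
  proof -
    have s': "0 \<le> s" "s \<le> 1" using s by (auto simp: s0_def)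
    define D where "D = edgeH s a"
    note R = edgeH_ratio[OF s', of a]
    have "cosh D = ((1 - s) + s * cosh a) / sqrt ((1 - s)\<^sup>2 + s\<^sup>2 + 2 * s * (1 - s) * cosh a)"
      unfolding D_def edgeH_def by (rule cosh_arcosh_real[OF R(2)])
    then have "(sinh D)\<^sup>2 = s\<^sup>2 * (sinh a)\<^sup>2 / ((1 - s)\<^sup>2 + s\<^sup>2 + 2 * s * (1 - s) * cosh a)"
      using R(1) by (simp add: sinh_square_eq)
    also have "\<dots> \<le> s\<^sup>2 * (sinh a)\<^sup>2 / 1" using edgeH_den[OF s', of a] by (intro divide_left_mono) auto
    finally have "(sinh D)\<^sup>2 \<le> (s * sinh a)\<^sup>2" by (simp add: power_mult_distrib)
    then have "sinh D \<le> s * sinh a" by (rule power2_le_imp_le) (use s' sa in simp)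
    moreover have "0 \<le> D" unfolding D_def edgeH_def by (rule arcosh_nonneg_real[OF R(2)])
    then have "D \<le> sinh D" by (rule sinh_ge_arg)
    moreover have "s * (2 * sinh a) \<le> \<epsilon>"
    proof -
      have "s \<le> \<epsilon> / (2 * sinh a)" using s by (simp add: s0_def)
      then show ?thesis using sa by (simp add: field_simps)
    qed
    moreover have "0 < s * sinh a" using s sa by simp
    ultimately show ?thesis unfolding D_def by linarith
  qed
  moreover have "0 < s0" "s0 \<le> 1" using assms sa by (auto simp: s0_def)
  ultimately show ?thesis by blast
qed

locale hyp_complex =
  fixes V :: "'v set" and le :: "'v \<Rightarrow> 'v \<Rightarrow> bool" and N :: "'v set \<Rightarrow> nat" and p :: "'v set \<Rightarrow> 'v \<Rightarrow> nat \<Rightarrow> real"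
  assumes hok: "hyp_ok V le N p" and hface: "face_iso V le (hyp_sd N p)"
begin

definition pts :: "'v set \<Rightarrow> ('v \<Rightarrow> real) set" where "pts \<sigma> = {x \<in> real_pts V le. supp x \<subseteq> \<sigma>}"

text \<open>Bilinear and not normalised. On convex combinations of the vertices it is at least 1,
  because it is so on vertices; normalising it gives \<open>cosh\<close> of the distance.\<close>

definition m :: "'v set \<Rightarrow> ('v \<Rightarrow> real) \<Rightarrow> ('v \<Rightarrow> real) \<Rightarrow> real" where "m \<sigma> x y = - mink (N \<sigma>) (hZ p \<sigma> x) (hZ p \<sigma> y)"

lemma vert: assumes "is_chain V le \<sigma>" "v \<in> \<sigma>" shows "mink (N \<sigma>) (p \<sigma> v) (p \<sigma> v) = -1" "p \<sigma> v (N \<sigma>) > 0"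
  using hok assms unfolding hyp_ok_def by blast+

lemma indep: assumes "is_chain V le \<sigma>" "\<And>i. i \<le> N \<sigma> \<Longrightarrow> (\<Sum>v\<in>\<sigma>. c v * p \<sigma> v i) = 0" "v \<in> \<sigma>" shows "c v = 0"
  using hok assms unfolding hyp_ok_def by blast

lemma vertex_prod_ge: assumes "is_chain V le \<sigma>" "u \<in> \<sigma>" "w \<in> \<sigma>" shows "1 \<le> - mink (N \<sigma>) (p \<sigma> u) (p \<sigma> w)"
proof -
  note U = vert[OF assms(1,2)] and W = vert[OF assms(1,3)]
  have pos: "1 \<le> (mink (N \<sigma>) (p \<sigma> u) (p \<sigma> w))\<^sup>2" "0 < - mink (N \<sigma>) (p \<sigma> u) (p \<sigma> w)"
    using reverse_cauchy_schwarz[of "N \<sigma>" "p \<sigma> u" "p \<sigma> w"] U W by auto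
  have "1\<^sup>2 \<le> (- mink (N \<sigma>) (p \<sigma> u) (p \<sigma> w))\<^sup>2" using pos(1) by simp
  then show ?thesis by (rule power2_le_imp_le) (use pos(2) in simp)
qed

lemma vertex_time_ge: assumes "is_chain V le \<sigma>" "v \<in> \<sigma>" shows "1 \<le> p \<sigma> v (N \<sigma>)"
proof -
  have "0 \<le> (\<Sum>i<N \<sigma>. (p \<sigma> v i)\<^sup>2)" by (intro sum_nonneg) auto
  then have "1\<^sup>2 \<le> (p \<sigma> v (N \<sigma>))\<^sup>2" using vert(1)[OF assms] by (simp add: mink_def power2_eq_square)
  then show ?thesis by (rule power2_le_imp_le) (use vert[OF assms] in simp)
qed

lemma convex_ge: assumes "is_chain V le \<sigma>" "x \<in> pts \<sigma>" "\<And>v. v \<in> \<sigma> \<Longrightarrow> 1 \<le> f v" shows "1 \<le> (\<Sum>v\<in>\<sigma>. x v * f v)"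
proof -
  have x: "x \<in> real_pts V le" "supp x \<subseteq> \<sigma>" using assms by (auto simp: pts_def)
  have "(\<Sum>v\<in>\<sigma>. x v * 1) \<le> (\<Sum>v\<in>\<sigma>. x v * f v)"
    using x assms(3) by (intro sum_mono mult_left_mono) (auto simp: real_pts_def)
  then show ?thesis using real_pts_sum[OF x(1) chain_finite[OF assms(1)] x(2)] by simp
qed

lemma m_ge: assumes "is_chain V le \<sigma>" "x \<in> pts \<sigma>" "y \<in> pts \<sigma>" shows "1 \<le> m \<sigma> x y"
proof -
  note F = chain_finite[OF assms(1)]
  have 1: "1 \<le> - mink (N \<sigma>) (p \<sigma> v) (hZ p \<sigma> y)" if "v \<in> \<sigma>" for v
    using convex_ge[OF assms(1,3), of "\<lambda>w. - mink (N \<sigma>) (p \<sigma> v) (p \<sigma> w)"] vertex_prod_ge[OF assms(1) that] by (simp add: mink_hZ'[OF F] sum_negf)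
  have "m \<sigma> x y = (\<Sum>v\<in>\<sigma>. x v * (- mink (N \<sigma>) (p \<sigma> v) (hZ p \<sigma> y)))" unfolding m_def mink_hZ[OF F] by (simp add: sum_negf)
  also have "1 \<le> \<dots>" by (rule convex_ge[OF assms(1,2) 1])
  finally show ?thesis .
qed

lemma hZ_time_ge: assumes "is_chain V le \<sigma>" "x \<in> pts \<sigma>" shows "1 \<le> hZ p \<sigma> x (N \<sigma>)"
  unfolding hZ_def by (rule convex_ge[OF assms]) (rule vertex_time_ge[OF assms(1)])

lemma m_rcs: assumes c: "is_chain V le \<sigma>" "x \<in> pts \<sigma>" "y \<in> pts \<sigma>" shows "m \<sigma> x x * m \<sigma> y y \<le> (m \<sigma> x y)\<^sup>2"
  using reverse_cauchy_schwarz(2)[of "N \<sigma>" "hZ p \<sigma> x" "hZ p \<sigma> y"] m_ge[OF c(1,2,2)] m_ge[OF c(1,3,3)] hZ_time_ge[OF c(1,2)] hZ_time_ge[OF c(1,3)]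
  by (simp add: m_def)

text \<open>The reversed Cauchy-Schwarz inequality places the argument of \<open>arcosh\<close>
  where \<open>cosh\<close> inverts it. The estimates below are carried out for \<open>cosh\<close>
  and \<open>sinh\<close> and return to the distance at the end.\<close>

lemma sd_cosh:
  assumes c: "is_chain V le \<sigma>" "x \<in> pts \<sigma>" "y \<in> pts \<sigma>"
  shows "0 \<le> hyp_sd N p \<sigma> x y" "cosh (hyp_sd N p \<sigma> x y) = m \<sigma> x y / sqrt (m \<sigma> x x * m \<sigma> y y)"
    "(sinh (hyp_sd N p \<sigma> x y))\<^sup>2 = ((m \<sigma> x y)\<^sup>2 - m \<sigma> x x * m \<sigma> y y) / (m \<sigma> x x * m \<sigma> y y)"
proof -
  have q: "1 \<le> m \<sigma> x x" "1 \<le> m \<sigma> y y" "1 \<le> m \<sigma> x y" using m_ge c by auto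
  then have nz: "m \<sigma> x x \<noteq> 0" "m \<sigma> y y \<noteq> 0" by auto
  have qq: "0 < m \<sigma> x x * m \<sigma> y y" using q by simp
  have sd: "hyp_sd N p \<sigma> x y = arcosh (m \<sigma> x y / sqrt (m \<sigma> x x * m \<sigma> y y))" by (simp add: hyp_sd_alt m_def)
  have "sqrt (m \<sigma> x x * m \<sigma> y y) \<le> m \<sigma> x y" using m_rcs[OF c] q by (intro real_le_lsqrt) auto
  then have ge: "1 \<le> m \<sigma> x y / sqrt (m \<sigma> x x * m \<sigma> y y)" using qq by simp
  show "0 \<le> hyp_sd N p \<sigma> x y" unfolding sd by (rule arcosh_nonneg_real[OF ge])
  show ch: "cosh (hyp_sd N p \<sigma> x y) = m \<sigma> x y / sqrt (m \<sigma> x x * m \<sigma> y y)" unfolding sd by (rule cosh_arcosh_real[OF ge])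
  show "(sinh (hyp_sd N p \<sigma> x y))\<^sup>2 = ((m \<sigma> x y)\<^sup>2 - m \<sigma> x x * m \<sigma> y y) / (m \<sigma> x x * m \<sigma> y y)"
    unfolding sinh_square_eq ch using qq nz by (simp add: power_divide diff_divide_distrib)
qed

lemma sd_refl: assumes "is_chain V le \<sigma>" "x \<in> pts \<sigma>" shows "hyp_sd N p \<sigma> x x = 0"
proof -
  have "1 \<le> m \<sigma> x x" using m_ge assms by simp
  then have "sqrt (m \<sigma> x x * m \<sigma> x x) = m \<sigma> x x" by simp
  then have "cosh (hyp_sd N p \<sigma> x x) = 1" using sd_cosh(2)[OF assms assms(2)] \<open>1 \<le> m \<sigma> x x\<close> by simp
  then show ?thesis by simp
qed

lemma pt_pts: assumes "is_chain V le \<sigma>" "v \<in> \<sigma>" shows "pt v \<in> pts \<sigma>"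
proof -
  have "is_chain V le {v}" using assms by (auto simp: is_chain_def)
  then have "pt v \<in> real_pts V le" by (simp add: real_pts_def) (simp add: pt_def)
  then show ?thesis using assms by (simp add: pts_def)
qed

lemma m_pt: assumes "is_chain V le \<sigma>" "v \<in> \<sigma>" shows "m \<sigma> (pt v) x = - mink (N \<sigma>) (p \<sigma> v) (hZ p \<sigma> x)" "m \<sigma> (pt v) (pt v) = 1"
  using hZ_pt[OF chain_finite[OF assms(1)] assms(2)] vert(1)[OF assms] by (auto simp: m_def)

text \<open>With the vector of \<open>v\<close> split off, \<open>cosh\<close> of the difference of
  the two distances to \<open>v\<close> is the product of the components along \<open>v\<close>
  minus the product of the orthogonal lengths. Cauchy-Schwarz for \<open>ip\<close> bounds this by
  \<open>cosh\<close> of the distance of the two points.\<close>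

lemma sd_vertex:
  assumes c: "is_chain V le \<sigma>" "v \<in> \<sigma>" "x \<in> pts \<sigma>" "y \<in> pts \<sigma>"
  shows "\<bar>hyp_sd N p \<sigma> (pt v) x - hyp_sd N p \<sigma> (pt v) y\<bar> \<le> hyp_sd N p \<sigma> x y"
proof -
  define n P S T where "n = N \<sigma>" and "P = p \<sigma> v" and "S = hZ p \<sigma> x" and "T = hZ p \<sigma> y"
  note defs = n_def[symmetric] P_def[symmetric] S_def[symmetric] T_def[symmetric]
  have P: "mink n P P = -1" "P n > 0" using vert[OF c(1,2)] by (auto simp: n_def P_def)
  define \<alpha> \<beta> q q' where "\<alpha> = m \<sigma> (pt v) x" and "\<beta> = m \<sigma> (pt v) y" and "q = m \<sigma> x x" and "q' = m \<sigma> y y"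
  have \<alpha>: "mink n P S = - \<alpha>" "mink n P T = - \<beta>" using m_pt[OF c(1,2)] by (auto simp: \<alpha>_def \<beta>_def defs)
  have q: "mink n S S = - q" "mink n T T = - q'" by (auto simp: q_def q'_def m_def defs)
  have q1: "1 \<le> q" "1 \<le> q'" unfolding q_def q'_def using m_ge c by auto
  define a b D where "a = hyp_sd N p \<sigma> (pt v) x" and "b = hyp_sd N p \<sigma> (pt v) y" and "D = hyp_sd N p \<sigma> x y"
  note pv = pt_pts[OF c(1,2)]
  note A = sd_cosh[OF c(1) pv c(3), folded a_def, unfolded m_pt(2)[OF c(1,2)], folded \<alpha>_def q_def]
  note B = sd_cosh[OF c(1) pv c(4), folded b_def, unfolded m_pt(2)[OF c(1,2)], folded \<beta>_def q'_def]
  note C = sd_cosh[OF c(1,3,4), folded D_def q_def q'_def]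
  have ipS: "ip n P S S = \<alpha>\<^sup>2 - q" "ip n P T T = \<beta>\<^sup>2 - q'" "ip n P S T = \<alpha> * \<beta> - m \<sigma> x y"
    by (simp_all add: ip_def \<alpha> q power2_eq_square m_def defs)
  have sa: "sinh a = sqrt (\<alpha>\<^sup>2 - q) / sqrt q"
  proof -
    have "sinh a = sqrt ((sinh a)\<^sup>2)" using A(1) by simp
    then show ?thesis unfolding A(3) by (simp add: real_sqrt_divide)
  qed
  have sb: "sinh b = sqrt (\<beta>\<^sup>2 - q') / sqrt q'"
  proof -
    have "sinh b = sqrt ((sinh b)\<^sup>2)" using B(1) by simp
    then show ?thesis unfolding B(3) by (simp add: real_sqrt_divide)
  qed
  have "(\<alpha> * \<beta> - m \<sigma> x y)\<^sup>2 \<le> (\<alpha>\<^sup>2 - q) * (\<beta>\<^sup>2 - q')" using ip_cauchy_schwarz[OF P, of S T] unfolding ipS .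
  then have "\<bar>\<alpha> * \<beta> - m \<sigma> x y\<bar> \<le> sqrt ((\<alpha>\<^sup>2 - q) * (\<beta>\<^sup>2 - q'))" using real_le_rsqrt real_sqrt_le_mono by fastforce
  then have "\<alpha> * \<beta> - sqrt (\<alpha>\<^sup>2 - q) * sqrt (\<beta>\<^sup>2 - q') \<le> m \<sigma> x y" unfolding real_sqrt_mult by linarith
  then have "(\<alpha> * \<beta> - sqrt (\<alpha>\<^sup>2 - q) * sqrt (\<beta>\<^sup>2 - q')) / (sqrt q * sqrt q') \<le> m \<sigma> x y / (sqrt q * sqrt q')"
    using q1 by (intro divide_right_mono) auto
  moreover have "cosh (a - b) = (\<alpha> * \<beta> - sqrt (\<alpha>\<^sup>2 - q) * sqrt (\<beta>\<^sup>2 - q')) / (sqrt q * sqrt q')"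
    unfolding cosh_diff A(2) B(2) sa sb by (simp add: diff_divide_distrib)
  ultimately have "cosh \<bar>a - b\<bar> \<le> cosh D" unfolding C(2) by (simp add: real_sqrt_mult)
  then show ?thesis unfolding a_def[symmetric] b_def[symmetric] D_def[symmetric]
    using C(1) by (subst (asm) cosh_real_nonneg_le_iff) auto
qed


text \<open>Division by the time coordinate moves the points to the projective ball model, where the
  Euclidean distance \<open>\<delta>\<close> is at most \<open>sinh\<close> of the hyperbolic one.
  Dual functionals bound the differences of the rescaled coordinates by \<open>\<delta>\<close>, and
  the normalisation to total mass 1 undoes the scaling.\<close>

lemma sd_coord:
  assumes c: "is_chain V le \<sigma>" "u \<in> \<sigma>"
  shows "\<exists>C>0. \<forall>x\<in>real_pts V le. \<forall>y\<in>real_pts V le. supp x \<subseteq> \<sigma> \<and> supp y \<subseteq> \<sigma> \<longrightarrow> \<bar>x u - y u\<bar> \<le> C * hyp_sd N p \<sigma> x y"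
proof -
  define n where "n = N \<sigma>"
  note F = chain_finite[OF c(1)]
  have ind: "\<forall>x\<in>\<sigma>. f x = 0" if "\<And>i. i < Suc n \<Longrightarrow> (\<Sum>x\<in>\<sigma>. f x * p \<sigma> x i) = 0" for f
    using indep[OF c(1)] that by (auto simp: n_def)
  have "\<forall>v\<in>\<sigma>. \<exists>q. \<forall>f. f v = (\<Sum>i<Suc n. q i * (\<Sum>x\<in>\<sigma>. f x * p \<sigma> x i))"
    using dual_functional[OF F ind] by blast
  from bchoice[OF this] obtain q where q: "\<forall>v\<in>\<sigma>. \<forall>f. f v = (\<Sum>i<Suc n. q v i * (\<Sum>x\<in>\<sigma>. f x * p \<sigma> x i))" ..
  define C where "C v = (\<Sum>i<n. \<bar>q v i\<bar>)" for v
  have C0: "0 \<le> C v" for v unfolding C_def by (intro sum_nonneg) auto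
  define M where "M = (\<Sum>v\<in>\<sigma>. p \<sigma> v n)"
  have pn: "1 \<le> p \<sigma> v n" if "v \<in> \<sigma>" for v using vertex_time_ge[OF c(1) that] by (simp add: n_def)
  define K where "K = M * C u + M\<^sup>2 * (\<Sum>v\<in>\<sigma>. C v)"
  have M0: "0 \<le> M" unfolding M_def using pn by (intro sum_nonneg) (auto intro: order_trans[of 0 1])
  have K0: "0 \<le> K" unfolding K_def using M0 C0 by (intro add_nonneg_nonneg mult_nonneg_nonneg sum_nonneg) auto
  have "\<bar>x u - y u\<bar> \<le> (2 * K + 1) * hyp_sd N p \<sigma> x y" if xy: "x \<in> pts \<sigma>" "y \<in> pts \<sigma>" for x y
  proof -
    define D where "D = hyp_sd N p \<sigma> x y"
    note sd = sd_cosh[OF c(1) xy, folded D_def]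
    have X: "x \<in> real_pts V le" "y \<in> real_pts V le" "supp x \<subseteq> \<sigma>" "supp y \<subseteq> \<sigma>" using xy by (auto simp: pts_def)
    have nn: "0 \<le> x z" "0 \<le> y z" for z using X by (auto simp: real_pts_def)
    have sx: "sum x \<sigma> = 1" "sum y \<sigma> = 1" using real_pts_sum X F by metis+
    have le1: "x z \<le> 1" "y z \<le> 1" if "z \<in> \<sigma>" for z
      using member_le_sum[of z \<sigma> x] member_le_sum[of z \<sigma> y] that F nn sx by auto
    define \<alpha> \<beta> where "\<alpha> = hZ p \<sigma> x n" and "\<beta> = hZ p \<sigma> y n"
    have ab1: "1 \<le> \<alpha>" "1 \<le> \<beta>" using hZ_time_ge[OF c(1)] xy by (auto simp: \<alpha>_def \<beta>_def n_def)
    have "x z * p \<sigma> z n \<le> 1 * p \<sigma> z n" "y z * p \<sigma> z n \<le> 1 * p \<sigma> z n" if "z \<in> \<sigma>" for z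
      by (rule mult_right_mono; use le1[OF that] pn[OF that] in linarith)+
    then have abM: "\<alpha> \<le> M" "\<beta> \<le> M" unfolding \<alpha>_def \<beta>_def M_def hZ_def
      by (auto intro!: sum_mono)
    define k l where "k i = hZ p \<sigma> x i / \<alpha>" and "l i = hZ p \<sigma> y i / \<beta>" for i
    define a b cc where "a = (\<Sum>i<n. (k i)\<^sup>2)" and "b = (\<Sum>i<n. (l i)\<^sup>2)" and "cc = (\<Sum>i<n. k i * l i)"
    have mxx: "m \<sigma> x x = \<alpha>\<^sup>2 * (1 - a)"
    proof -
      have "(\<Sum>i<n. hZ p \<sigma> x i * hZ p \<sigma> x i) = \<alpha>\<^sup>2 * a" unfolding a_def sum_distrib_left
        by (rule sum.cong) (use ab1 in \<open>auto simp: k_def power2_eq_square\<close>)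
      then show ?thesis by (simp add: m_def mink_def n_def[symmetric] \<alpha>_def[symmetric] power2_eq_square algebra_simps)
    qed
    have myy: "m \<sigma> y y = \<beta>\<^sup>2 * (1 - b)"
    proof -
      have "(\<Sum>i<n. hZ p \<sigma> y i * hZ p \<sigma> y i) = \<beta>\<^sup>2 * b" unfolding b_def sum_distrib_left
        by (rule sum.cong) (use ab1 in \<open>auto simp: l_def power2_eq_square\<close>)
      then show ?thesis by (simp add: m_def mink_def n_def[symmetric] \<beta>_def[symmetric] power2_eq_square algebra_simps)
    qed
    have mxy: "m \<sigma> x y = \<alpha> * \<beta> * (1 - cc)"
    proof -
      have "(\<Sum>i<n. hZ p \<sigma> x i * hZ p \<sigma> y i) = \<alpha> * \<beta> * cc" unfolding cc_def sum_distrib_left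
        by (rule sum.cong) (use ab1 in \<open>auto simp: k_def l_def\<close>)
      then show ?thesis by (simp add: m_def mink_def n_def[symmetric] \<alpha>_def[symmetric] \<beta>_def[symmetric] algebra_simps)
    qed
    have ab0: "0 \<le> a" "0 \<le> b" unfolding a_def b_def by (auto intro: sum_nonneg)
    have lt: "0 < 1 - a" "0 < 1 - b"
      using m_ge[OF c(1) xy(1,1)] m_ge[OF c(1) xy(2,2)] ab1 unfolding mxx myy by (smt (verit) mult_nonneg_nonpos zero_le_power2)+
    define \<delta> where "\<delta> = sqrt (\<Sum>i<n. (k i - l i)\<^sup>2)"
    have \<delta>0: "0 \<le> \<delta>" unfolding \<delta>_def by (intro real_sqrt_ge_zero sum_nonneg) auto
    have \<delta>2: "\<delta>\<^sup>2 = a + b - 2 * cc"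
    proof -
      have "\<delta>\<^sup>2 = (\<Sum>i<n. (k i - l i)\<^sup>2)" unfolding \<delta>_def by (intro real_sqrt_pow2 sum_nonneg) auto
      also have "\<dots> = (\<Sum>i<n. (k i)\<^sup>2 + (l i)\<^sup>2 - 2 * (k i * l i))" by (rule sum.cong) (auto simp: power2_eq_square algebra_simps)
      finally show ?thesis by (simp add: a_def b_def cc_def sum.distrib sum_subtractf sum_distrib_left)
    qed
    \<comment> \<open>In the ball, \<open>(sinh D)\<^sup>2\<close> has numerator
      \<open>(1 - a) * \<delta>\<^sup>2\<close> plus a square, and its denominator
      \<open>(1 - a) * (1 - b)\<close> is at most \<open>1 - a\<close>.\<close>
    have "\<delta> \<le> sinh D"
    proof (rule power2_le_imp_le)
      have e: "(sinh D)\<^sup>2 = ((1 - cc)\<^sup>2 - (1 - a) * (1 - b)) / ((1 - a) * (1 - b))"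
      proof -
        have n: "(\<alpha> * \<beta> * (1 - cc))\<^sup>2 - \<alpha>\<^sup>2 * \<beta>\<^sup>2 * ((1 - a) * (1 - b)) = (\<alpha>\<^sup>2 * \<beta>\<^sup>2) * ((1 - cc)\<^sup>2 - (1 - a) * (1 - b))"
          by (simp add: power2_eq_square algebra_simps)
        have m: "\<alpha>\<^sup>2 * (1 - a) * (\<beta>\<^sup>2 * (1 - b)) = (\<alpha>\<^sup>2 * \<beta>\<^sup>2) * ((1 - a) * (1 - b))" by (simp add: mult_ac)
        have "\<alpha>\<^sup>2 * \<beta>\<^sup>2 \<noteq> 0" using ab1 by simp
        then show ?thesis unfolding sd(3) mxx myy mxy m n by (rule mult_divide_mult_cancel_left)
      qed
      have "(1 - cc)\<^sup>2 - (1 - a) * (1 - b) = (1 - a) * \<delta>\<^sup>2 + (cc - a)\<^sup>2"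
        unfolding \<delta>2 by (simp add: power2_eq_square algebra_simps)
      moreover have "(1 - a) * (1 - b) * \<delta>\<^sup>2 \<le> (1 - a) * \<delta>\<^sup>2"
        using lt ab0 by (intro mult_right_mono) (auto simp: mult_le_cancel_left1)
      ultimately have "\<delta>\<^sup>2 * ((1 - a) * (1 - b)) \<le> (1 - cc)\<^sup>2 - (1 - a) * (1 - b)" by (smt (verit) mult.commute zero_le_power2)
      then show "\<delta>\<^sup>2 \<le> (sinh D)\<^sup>2" unfolding e using lt by (simp add: pos_le_divide_eq)
    qed (use sd(1) in simp)
    define f where "f z = x z / \<alpha> - y z / \<beta>" for z
    have fs: "(\<Sum>z\<in>\<sigma>. f z * p \<sigma> z i) = k i - l i" for i
      by (simp add: f_def k_def l_def hZ_def sum_divide_distrib left_diff_distrib sum_subtractf)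
    have fn: "k n - l n = 0" using ab1 by (simp add: k_def l_def \<alpha>_def[symmetric] \<beta>_def[symmetric])
    have fb: "\<bar>f z\<bar> \<le> C z * \<delta>" if z: "z \<in> \<sigma>" for z
    proof -
      have "f z = (\<Sum>i<Suc n. q z i * (k i - l i))" using q z unfolding fs[symmetric] by blast
      also have "\<dots> = (\<Sum>i<n. q z i * (k i - l i))" using fn by simp
      also have "\<bar>\<dots>\<bar> \<le> (\<Sum>i<n. \<bar>q z i\<bar> * \<delta>)"
      proof (rule order_trans[OF sum_abs], rule sum_mono)
        fix i assume i: "i \<in> {..<n}"
        have "\<bar>k i - l i\<bar> \<le> sqrt ((k i - l i)\<^sup>2)" by simp
        also have "\<dots> \<le> \<delta>" unfolding \<delta>_def by (intro real_sqrt_le_mono member_le_sum[OF i]) auto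
        finally show "\<bar>q z i * (k i - l i)\<bar> \<le> \<bar>q z i\<bar> * \<delta>" by (simp add: abs_mult mult_left_mono)
      qed
      finally show ?thesis by (simp add: C_def sum_distrib_right)
    qed
    \<comment> \<open>The time coordinates are compared through the coordinate sums: both points
      have total mass 1, so \<open>1 / \<beta> - 1 / \<alpha>\<close> is minus the sum of the
      rescaled differences.\<close>
    have "\<alpha> - \<beta> = \<alpha> * \<beta> * (1 / \<beta> - 1 / \<alpha>)" using ab1 by (simp add: field_simps)
    also have "1 / \<beta> - 1 / \<alpha> = - (\<Sum>z\<in>\<sigma>. f z)"
      unfolding f_def sum_subtractf sum_divide_distrib[symmetric] sx by simp
    finally have "\<bar>\<alpha> - \<beta>\<bar> = \<alpha> * \<beta> * \<bar>\<Sum>z\<in>\<sigma>. f z\<bar>" using ab1 by (simp add: abs_mult)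
    also have "\<dots> \<le> M * M * (\<Sum>z\<in>\<sigma>. C z * \<delta>)"
      using ab1 abM fb by (intro mult_mono order_trans[OF sum_abs sum_mono]) auto
    finally have ab: "\<bar>\<alpha> - \<beta>\<bar> \<le> M\<^sup>2 * (\<Sum>z\<in>\<sigma>. C z) * \<delta>" by (simp add: power2_eq_square sum_distrib_right mult.assoc)
    have "x u - y u = \<alpha> * f u + (\<alpha> - \<beta>) * (y u / \<beta>)" using ab1 by (simp add: f_def field_simps)
    then have "\<bar>x u - y u\<bar> \<le> \<bar>\<alpha> * f u\<bar> + \<bar>(\<alpha> - \<beta>) * (y u / \<beta>)\<bar>" by (metis abs_triangle_ineq)
    also have "\<bar>\<alpha> * f u\<bar> \<le> M * (C u * \<delta>)" unfolding abs_mult using ab1 abM fb[OF c(2)] M0 by (intro mult_mono) auto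
    also have "\<bar>(\<alpha> - \<beta>) * (y u / \<beta>)\<bar> \<le> \<bar>\<alpha> - \<beta>\<bar> * 1" unfolding abs_mult
      using ab1 nn[of u] le1[OF c(2)] by (intro mult_left_mono) auto
    finally have "\<bar>x u - y u\<bar> \<le> K * \<delta>" using ab by (simp add: K_def algebra_simps)
    also have "\<dots> \<le> K * sinh D" using \<open>\<delta> \<le> sinh D\<close> K0 by (rule mult_left_mono)
    finally have Kd: "\<bar>x u - y u\<bar> \<le> K * sinh D" .
    show ?thesis
    \<comment> \<open>For small \<open>D\<close> the function \<open>sinh\<close> is at most
      \<open>2 * D\<close>; for \<open>D > 1\<close> the trivial bound 1 on coordinate differences
      suffices, which explains the constant \<open>2 * K + 1\<close>.\<close>
    proof (cases "D \<le> 1")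
      case True
      have "K * sinh D \<le> K * (2 * D)" using sinh_le_two[OF sd(1) True] K0 by (rule mult_left_mono)
      then show ?thesis using Kd sd(1) unfolding D_def[symmetric] by (simp add: algebra_simps)
    next
      case False
      have "\<bar>x u - y u\<bar> \<le> 1" using nn[of u] le1[OF c(2)] by (simp add: abs_le_iff)
      moreover have "1 * 1 \<le> (2 * K + 1) * D" using False K0 by (intro mult_mono) auto
      ultimately show ?thesis unfolding D_def[symmetric] by linarith
    qed
  qed
  then show ?thesis using K0 by (intro exI[of _ "2 * K + 1"]) (auto simp: pts_def)
qed

lemma hyp_simplex_metric: "simplex_metric V le (hyp_sd N p)"
proof
  show "0 \<le> hyp_sd N p \<sigma> x y" if "is_chain V le \<sigma>" "x \<in> real_pts V le" "y \<in> real_pts V le" "supp x \<subseteq> \<sigma>" "supp y \<subseteq> \<sigma>" for \<sigma> x y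
    by (rule sd_cosh(1)) (use that in \<open>auto simp: pts_def\<close>)
  show "hyp_sd N p \<sigma> x x = 0" if "is_chain V le \<sigma>" "x \<in> real_pts V le" "supp x \<subseteq> \<sigma>" for \<sigma> x
    by (rule sd_refl) (use that in \<open>auto simp: pts_def\<close>)
  show "\<bar>hyp_sd N p \<sigma> (pt v) x - hyp_sd N p \<sigma> (pt v) y\<bar> \<le> hyp_sd N p \<sigma> x y"
    if "is_chain V le \<sigma>" "v \<in> \<sigma>" "x \<in> real_pts V le" "y \<in> real_pts V le" "supp x \<subseteq> \<sigma>" "supp y \<subseteq> \<sigma>" for \<sigma> v x y
    by (rule sd_vertex) (use that in \<open>auto simp: pts_def\<close>)
  show "\<exists>C>0. \<forall>x\<in>real_pts V le. \<forall>y\<in>real_pts V le. supp x \<subseteq> \<sigma> \<and> supp y \<subseteq> \<sigma> \<longrightarrow> \<bar>x u - y u\<bar> \<le> C * hyp_sd N p \<sigma> x y"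
    if "is_chain V le \<sigma>" "u \<in> \<sigma>" for \<sigma> u using sd_coord[OF that] .
  show "face_iso V le (hyp_sd N p)" by (rule hface)
qed

lemma cosh_vertices:
  assumes "is_chain V le \<sigma>" "u \<in> \<sigma>" "w \<in> \<sigma>"
  shows "cosh (hyp_sd N p \<sigma> (pt u) (pt w)) = - mink (N \<sigma>) (p \<sigma> u) (p \<sigma> w)"
proof -
  have "m \<sigma> (pt u) (pt w) = - mink (N \<sigma>) (p \<sigma> u) (p \<sigma> w)"
    using m_pt(1)[OF assms(1,2)] hZ_pt[OF chain_finite[OF assms(1)] assms(3)] by simp
  then show ?thesis using sd_cosh(2)[OF assms(1) pt_pts[OF assms(1,2)] pt_pts[OF assms(1,3)]] m_pt(2) assms by simp
qed

lemma elen_eq: assumes "is_chain V le \<sigma>" "u \<in> \<sigma>" "w \<in> \<sigma>"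
  shows "cosh (elen (hyp_sd N p) u w) = - mink (N \<sigma>) (p \<sigma> u) (p \<sigma> w)" "0 \<le> elen (hyp_sd N p) u w"
proof -
  interpret S: simplex_metric V le "hyp_sd N p" by (rule hyp_simplex_metric)
  have X: "pt u \<in> real_pts V le" "pt w \<in> real_pts V le" using pt_pts[OF assms(1)] assms by (auto simp: pts_def)
  have "elen (hyp_sd N p) u w = hyp_sd N p \<sigma> (pt u) (pt w)"
    unfolding elen_def by (rule S.face_eq[OF assms(1) X]) (use assms in auto)
  then show "cosh (elen (hyp_sd N p) u w) = - mink (N \<sigma>) (p \<sigma> u) (p \<sigma> w)" "0 \<le> elen (hyp_sd N p) u w"
    using cosh_vertices[OF assms] sd_cosh(1)[OF assms(1) pt_pts[OF assms(1,2)] pt_pts[OF assms(1,3)]] by auto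
qed

lemma elen_commute: "is_chain V le {u, w} \<Longrightarrow> elen (hyp_sd N p) u w = elen (hyp_sd N p) w u"
  using elen_eq[of "{u, w}" u w] elen_eq[of "{u, w}" w u] by (simp add: mink_commute) (metis abs_of_nonneg cosh_real_eq_iff)

text \<open>At distance 0 the Minkowski product is -1, so the component of the second vector
  orthogonal to the first is null. Hence the vectors coincide, contradicting general
  position.\<close>

lemma elen_pos:
  assumes "is_chain V le {v, u}" "v \<noteq> u" shows "0 < elen (hyp_sd N p) v u"
proof (rule ccontr)
  let ?\<sigma> = "{v, u}" let ?n = "N {v, u}"
  assume "\<not> ?thesis"
  then have "elen (hyp_sd N p) v u = 0" using elen_eq(2)[of ?\<sigma> v u] assms by simp
  then have 1: "mink ?n (p ?\<sigma> v) (p ?\<sigma> u) = -1" using elen_eq(1)[of ?\<sigma> v u] assms by simp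
  note V = vert[OF assms(1), of v] and U = vert[OF assms(1), of u]
  have "ip ?n (p ?\<sigma> v) (p ?\<sigma> u) (p ?\<sigma> u) = 0" using 1 U by (simp add: ip_def)
  then have "p ?\<sigma> u i = p ?\<sigma> v i" if "i \<le> ?n" for i using ip_zero[of ?n "p ?\<sigma> v" "p ?\<sigma> u" i] V 1 that by simp
  then have "(\<Sum>z\<in>?\<sigma>. (if z = v then -1 else 1) * p ?\<sigma> z i) = 0" if "i \<le> ?n" for i using assms that by simp
  then have "(if v = v then -1 else 1 :: real) = 0" using indep[OF assms(1), of "\<lambda>z. if z = v then -1 else 1" v] by simp
  then show False by simp
qed

lemma edge_eq:
  assumes c: "is_chain V le {v, u}" "v \<noteq> u" and s: "0 \<le> s" "s \<le> 1"
  shows "hyp_sd N p {v, u} (pt v) (seg v u s) = edgeH s (elen (hyp_sd N p) v u)"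
proof -
  let ?\<sigma> = "{v, u}" let ?n = "N {v, u}"
  define C where "C = cosh (elen (hyp_sd N p) v u)"
  have C: "mink ?n (p ?\<sigma> v) (p ?\<sigma> u) = - C" "mink ?n (p ?\<sigma> u) (p ?\<sigma> v) = - C"
    using elen_eq(1)[OF c(1), of v u] by (auto simp: C_def mink_commute)
  have us: "u \<in> ?\<sigma>" by simp
  note V = vert[OF c(1) insertI1] and U = vert[OF c(1) us]
  have F: "finite ?\<sigma>" by simp
  have 1: "mink ?n (p ?\<sigma> v) (hZ p ?\<sigma> (seg v u s)) = - ((1 - s) + s * C)"
    unfolding mink_hZ'[OF F] using c C V by (simp add: seg_def)
  have 2: "mink ?n (hZ p ?\<sigma> (seg v u s)) (hZ p ?\<sigma> (seg v u s)) = - ((1 - s)\<^sup>2 + s\<^sup>2 + 2 * s * (1 - s) * C)"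
    unfolding mink_hZ[OF F] mink_hZ'[OF F] using c C V U by (simp add: seg_def power2_eq_square algebra_simps)
  show ?thesis unfolding hyp_sd_alt hZ_pt[OF F insertI1] 1 2 edgeH_def C_def[symmetric] V(1)
    by (simp only: minus_minus mult_minus_left mult_minus_right mult_1_left)
qed


text \<open>Every vector of the cone over the triangle splits into its part along the vector of
  \<open>v\<close> and its part orthogonal to it. The orthogonal plane is Euclidean with the
  hyperbolic angle between the edge directions, and \<open>corner_map\<close> with speeds
  \<open>sinh\<close> is that projection; the formula for \<open>m\<close> expresses the
  splitting.\<close>

lemma corner_data:
  fixes v u w :: 'v
  defines "\<sigma> \<equiv> {v, u, w}"
  defines "a \<equiv> elen (hyp_sd N p) v u" and "b \<equiv> elen (hyp_sd N p) v w" and "c \<equiv> elen (hyp_sd N p) u w"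
  assumes ch: "is_chain V le {v, u, w}" and dist: "u \<noteq> w" "u \<noteq> v" "w \<noteq> v"
  shows "0 < a" "0 < b" "0 < c" "0 < gram3 a b c"
    "\<And>x y. x \<in> pts \<sigma> \<Longrightarrow> y \<in> pts \<sigma> \<Longrightarrow>
       m \<sigma> x y = (1 + x u * (cosh a - 1) + x w * (cosh b - 1)) * (1 + y u * (cosh a - 1) + y w * (cosh b - 1)) -
         Re (corner_map (\<lambda>z. sinh (elen (hyp_sd N p) v z)) u w (angH a b c) x * cnj (corner_map (\<lambda>z. sinh (elen (hyp_sd N p) v z)) u w (angH a b c) y))"
proof -
  interpret S: simplex_metric V le "hyp_sd N p" by (rule hyp_simplex_metric)
  have sub: "is_chain V le {v, u}" "is_chain V le {v, w}" "is_chain V le {u, w}"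
    by (rule S.chain_subset[OF ch]; auto)+
  have pos: "0 < a" "0 < b" "0 < c" unfolding a_def b_def c_def using elen_pos sub dist by auto
  then show "0 < a" "0 < b" "0 < c" by auto
  have ch': "is_chain V le \<sigma>" using ch by (simp add: \<sigma>_def)
  have mem: "v \<in> \<sigma>" "u \<in> \<sigma>" "w \<in> \<sigma>" by (auto simp: \<sigma>_def)
  define n where "n = N \<sigma>"
  define P U W where "P = p \<sigma> v" and "U = p \<sigma> u" and "W = p \<sigma> w"
  note vt = vert[OF ch' mem(1), folded n_def P_def] vert[OF ch' mem(2), folded n_def U_def] vert[OF ch' mem(3), folded n_def W_def]
  have ca: "mink n P U = - cosh a" "mink n U P = - cosh a" using elen_eq(1)[OF ch' mem(1,2)] by (auto simp: a_def n_def P_def U_def mink_commute)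
  have cb: "mink n P W = - cosh b" "mink n W P = - cosh b" using elen_eq(1)[OF ch' mem(1,3)] by (auto simp: b_def n_def P_def W_def mink_commute)
  have cc: "mink n U W = - cosh c" "mink n W U = - cosh c" using elen_eq(1)[OF ch' mem(2,3)] by (auto simp: c_def n_def U_def W_def mink_commute)
  have ipUU: "ip n P U U = (sinh a)\<^sup>2" unfolding ip_def vt ca sinh_square_eq by (simp add: power2_eq_square)
  have ipWW: "ip n P W W = (sinh b)\<^sup>2" unfolding ip_def vt cb sinh_square_eq by (simp add: power2_eq_square)
  have ipUW: "ip n P U W = cosh a * cosh b - cosh c" by (simp add: ip_def ca cb cc)
  have g: "gram3 a b c = ip n P U U * ip n P W W - (ip n P U W)\<^sup>2" unfolding ipUU ipWW ipUW gram3_eq ..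
  have "0 \<le> gram3 a b c" unfolding g using ip_cauchy_schwarz[OF vt(1,2), of U W] by simp
  \<comment> \<open>A vanishing Gram determinant yields a combination of \<open>U\<close> and
    \<open>W\<close> whose part orthogonal to \<open>P\<close> is null, that is, a linear dependence
    among the three vertex vectors.\<close>
  moreover have "gram3 a b c \<noteq> 0"
  proof
    assume g0: "gram3 a b c = 0"
    define s t where "s = ip n P U W" and "t = - ip n P U U"
    define Q where "Q = (\<lambda>i. s * U i + t * W i)"
    have "ip n P Q Q = s * (s * ip n P U U + t * ip n P U W) + t * (s * ip n P U W + t * ip n P W W)"
      unfolding Q_def ip_lin ip_commute[of n P U "\<lambda>i. s * U i + t * W i"] ip_commute[of n P W "\<lambda>i. s * U i + t * W i"]
      unfolding ip_lin ip_commute[of n P W U] ..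
    also have "\<dots> = ip n P U U * gram3 a b c" unfolding g s_def t_def by (simp add: power2_eq_square algebra_simps)
    finally have "ip n P Q Q = 0" using g0 by simp
    then have Q: "Q i = - mink n P Q * P i" if "i \<le> n" for i using ip_zero[OF vt(1,2) _ that] by blast
    define f where "f z = (if z = u then s else if z = w then t else mink n P Q)" for z
    have "(\<Sum>z\<in>\<sigma>. f z * p \<sigma> z i) = 0" if "i \<le> N \<sigma>" for i
    proof -
      have "(\<Sum>z\<in>\<sigma>. f z * p \<sigma> z i) = mink n P Q * P i + (s * U i + t * W i)"
        unfolding \<sigma>_def using dist by (simp add: f_def P_def U_def W_def \<sigma>_def)
      then show ?thesis using Q[of i] that by (simp add: Q_def n_def)
    qed
    then have "f w = 0" by (rule indep[OF ch' _ mem(3)])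
    then have "t = 0" using dist by (simp add: f_def)
    then show False using pos by (simp add: t_def ipUU)
  qed
  ultimately show gp: "0 < gram3 a b c" by simp
  define \<theta> where "\<theta> = angH a b c"
  have ct: "cos \<theta> * (sinh a * sinh b) = cosh a * cosh b - cosh c"
    unfolding \<theta>_def angH_cos(1)[OF pos(1,2) gp] using pos by simp
  fix x y assume xy: "x \<in> pts \<sigma>" "y \<in> pts \<sigma>"
  have F: "finite \<sigma>" by (simp add: \<sigma>_def)
  have sx: "x v = 1 - x u - x w" "y v = 1 - y u - y w"
    using real_pts_sum[of x V le \<sigma>] real_pts_sum[of y V le \<sigma>] xy F dist by (auto simp: pts_def \<sigma>_def)
  have mxy: "m \<sigma> x y = x v * (y v * 1 + y u * cosh a + y w * cosh b) + x u * (y v * cosh a + y u * 1 + y w * cosh c) + x w * (y v * cosh b + y u * cosh c + y w * 1)"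
    unfolding m_def mink_hZ[OF F] mink_hZ'[OF F] n_def[symmetric] using dist
    by (simp add: \<sigma>_def P_def[symmetric, unfolded \<sigma>_def] U_def[symmetric, unfolded \<sigma>_def] W_def[symmetric, unfolded \<sigma>_def] vt ca cb cc algebra_simps)
  have "Re (corner_map (\<lambda>z. sinh (elen (hyp_sd N p) v z)) u w \<theta> x * cnj (corner_map (\<lambda>z. sinh (elen (hyp_sd N p) v z)) u w \<theta> y)) =
     (x u * sinh a + x w * sinh b * cos \<theta>) * (y u * sinh a + y w * sinh b * cos \<theta>) + (x w * sinh b * sin \<theta>) * (y w * sinh b * sin \<theta>)"
    by (simp add: corner_map_def a_def[symmetric] b_def[symmetric])
  also have "\<dots> = x u * y u * (sinh a)\<^sup>2 + (x u * y w + x w * y u) * (cos \<theta> * (sinh a * sinh b)) + x w * y w * (sinh b)\<^sup>2 * ((cos \<theta>)\<^sup>2 + (sin \<theta>)\<^sup>2)"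
    by algebra
  also have "\<dots> = x u * y u * ((cosh a)\<^sup>2 - 1) + (x u * y w + x w * y u) * (cosh a * cosh b - cosh c) + x w * y w * ((cosh b)\<^sup>2 - 1)"
    unfolding ct sinh_square_eq by simp
  finally have re: "Re (corner_map (\<lambda>z. sinh (elen (hyp_sd N p) v z)) u w \<theta> x * cnj (corner_map (\<lambda>z. sinh (elen (hyp_sd N p) v z)) u w \<theta> y)) =
     x u * y u * ((cosh a)\<^sup>2 - 1) + (x u * y w + x w * y u) * (cosh a * cosh b - cosh c) + x w * y w * ((cosh b)\<^sup>2 - 1)" .
  show "m \<sigma> x y = (1 + x u * (cosh a - 1) + x w * (cosh b - 1)) * (1 + y u * (cosh a - 1) + y w * (cosh b - 1)) -
         Re (corner_map (\<lambda>z. sinh (elen (hyp_sd N p) v z)) u w (angH a b c) x * cnj (corner_map (\<lambda>z. sinh (elen (hyp_sd N p) v z)) u w (angH a b c) y))"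
    unfolding \<theta>_def[symmetric] re mxy sx by algebra
qed

text \<open>Near \<open>v\<close> the component \<open>\<alpha>\<close> along \<open>v\<close> is
  close to 1 and is Lipschitz in terms of \<open>corner_map\<close>. Upper bound:
  \<open>sinh\<close> of the distance is at most
  \<open>cmod (\<alpha> y * z - \<alpha> x * z')\<close>. Lower bound: the relation of
  \<open>sinh\<close> and \<open>cosh\<close> at \<open>v\<close> gives
  \<open>cmod (cm x) \<le> D * \<alpha> x\<close>.\<close>

lemma corner_estimate:
  fixes v u w :: 'v
  defines "\<sigma> \<equiv> {v, u, w}"
  defines "a \<equiv> elen (hyp_sd N p) v u" and "b \<equiv> elen (hyp_sd N p) v w" and "c \<equiv> elen (hyp_sd N p) u w"
  defines "cm \<equiv> corner_map (\<lambda>z. sinh (elen (hyp_sd N p) v z)) u w (angH a b c)"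
  assumes ch: "is_chain V le {v, u, w}" and dist: "u \<noteq> w" "u \<noteq> v" "w \<noteq> v" and e: "0 < e"
  shows "\<exists>\<delta>>0. \<forall>x\<in>pts \<sigma>. \<forall>y\<in>pts \<sigma>. 1 - x v < \<delta> \<longrightarrow> 1 - y v < \<delta> \<longrightarrow>
     hyp_sd N p \<sigma> x y \<le> (1 + e) * cmod (cm x - cm y) \<and> (1 - e) * cmod (cm x) \<le> hyp_sd N p \<sigma> (pt v) x"
proof -
  note CD = corner_data[OF ch dist, folded \<sigma>_def, folded a_def b_def c_def, folded cm_def]
  have ch': "is_chain V le \<sigma>" using ch by (simp add: \<sigma>_def)
  have mem: "v \<in> \<sigma>" by (simp add: \<sigma>_def)
  define \<theta> where "\<theta> = angH a b c"
  note ang = angH_cos[OF CD(1,2,4), folded \<theta>_def]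
  have st: "0 < sin \<theta>" using ang by (intro sin_gt_zero) auto
  have sh: "0 < sinh a" "0 < sinh b" using CD by auto
  have ch1: "1 \<le> cosh a" "1 \<le> cosh b" by (rule cosh_real_ge_1)+
  define \<alpha> where "\<alpha> x = 1 + x u * (cosh a - 1) + x w * (cosh b - 1)" for x :: "'v \<Rightarrow> real"
  define M where "M = cosh a + cosh b"
  define K where "K = (cosh a - 1) / (sinh a * sin \<theta>) + (cosh b - 1) / (sinh b * sin \<theta>)"
  define R where "R = sinh a + sinh b"
  have K0: "0 \<le> K" unfolding K_def using sh st ch1 by (intro add_nonneg_nonneg divide_nonneg_nonneg) auto
  have R0: "0 \<le> R" "2 \<le> M" unfolding R_def M_def using sh ch1 by auto
  \<comment> \<open>The first-order error of \<open>\<alpha>\<close> contributes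
    \<open>\<delta> * M\<close>, its variation \<open>K * (\<delta> * R)\<close>; they are made to
    add up to \<open>e\<close>.\<close>
  define \<delta> where "\<delta> = e / (M + K * R)"
  have MKR: "0 < M + K * R" using K0 R0 by (smt (verit) mult_nonneg_nonneg)
  have \<delta>: "0 < \<delta>" unfolding \<delta>_def using e MKR by simp
  have "\<delta> * M + K * (\<delta> * R) = \<delta> * (M + K * R)" by (simp add: algebra_simps)
  then have \<delta>e: "\<delta> * M + K * (\<delta> * R) = e" using MKR by (simp add: \<delta>_def)
  have cm_eq: "cm x = of_real (x u * sinh a) + of_real (x w * sinh b) * cis \<theta>" for x
    by (simp add: cm_def corner_map_def a_def b_def \<theta>_def)
  have small: "0 \<le> x u \<and> 0 \<le> x w \<and> x u + x w < \<delta> \<and> 1 \<le> \<alpha> x \<and> \<alpha> x \<le> 1 + \<delta> * M \<and> cmod (cm x) \<le> \<delta> * R"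
    if x: "x \<in> pts \<sigma>" "1 - x v < \<delta>" for x
  proof -
    have X: "x \<in> real_pts V le" "supp x \<subseteq> \<sigma>" using x by (auto simp: pts_def)
    have nn: "0 \<le> x u" "0 \<le> x w" using X by (auto simp: real_pts_def)
    have "sum x \<sigma> = 1" by (rule real_pts_sum[OF X(1) chain_finite[OF ch'] X(2)])
    then have s: "x u + x w < \<delta>" using x(2) dist by (simp add: \<sigma>_def)
    have u: "x u \<le> \<delta>" "x w \<le> \<delta>" using nn s by linarith+
    have 1: "1 \<le> \<alpha> x" unfolding \<alpha>_def using nn ch1 by simp
    have "x u * (cosh a - 1) \<le> \<delta> * cosh a" "x w * (cosh b - 1) \<le> \<delta> * cosh b"
      using u nn ch1 \<delta> by (auto intro!: mult_mono)
    then have 2: "\<alpha> x \<le> 1 + \<delta> * M" unfolding \<alpha>_def M_def by (simp add: algebra_simps)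
    have "cmod (cm x) \<le> x u * sinh a + x w * sinh b"
      unfolding cm_eq by (rule norm_triangle_le) (use nn sh in \<open>simp add: norm_mult\<close>)
    also have "\<dots> \<le> \<delta> * sinh a + \<delta> * sinh b" using u sh by (intro add_mono mult_right_mono) auto
    finally show ?thesis using nn s 1 2 by (simp add: R_def algebra_simps)
  qed
  have up: "hyp_sd N p \<sigma> x y \<le> (1 + e) * cmod (cm x - cm y)" if h: "x \<in> pts \<sigma>" "y \<in> pts \<sigma>" "1 - x v < \<delta>" "1 - y v < \<delta>" for x y
  proof -
    define D where "D = hyp_sd N p \<sigma> x y"
    note sd = sd_cosh[OF ch' h(1,2), folded D_def]
    have q: "1 \<le> m \<sigma> x x" "1 \<le> m \<sigma> y y" using m_ge[OF ch'] h by auto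
    define z z' where "z = cm x" and "z' = cm y"
    have mm: "m \<sigma> x x = (\<alpha> x)\<^sup>2 - (cmod z)\<^sup>2" "m \<sigma> y y = (\<alpha> y)\<^sup>2 - (cmod z')\<^sup>2" "m \<sigma> x y = \<alpha> x * \<alpha> y - Re (z * cnj z')"
      unfolding CD(5)[OF h(1,1)] CD(5)[OF h(2,2)] CD(5)[OF h(1,2)] \<alpha>_def z_def z'_def
      by (auto simp: power2_eq_square cmod_power2[unfolded power2_eq_square])
    have id: "(m \<sigma> x y)\<^sup>2 - m \<sigma> x x * m \<sigma> y y = (cmod (\<alpha> y * z - \<alpha> x * z'))\<^sup>2 - ((cmod z)\<^sup>2 * (cmod z')\<^sup>2 - (Re (z * cnj z'))\<^sup>2)"
      unfolding mm cmod_power2 by (simp add: power2_eq_square algebra_simps)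
    have "(Re (z * cnj z'))\<^sup>2 \<le> (cmod (z * cnj z'))\<^sup>2" 
      using power_mono[OF abs_Re_le_cmod[of "z * cnj z'"] abs_ge_zero, of 2] by (simp only: power2_abs)
    then have "(m \<sigma> x y)\<^sup>2 - m \<sigma> x x * m \<sigma> y y \<le> (cmod (\<alpha> y * z - \<alpha> x * z'))\<^sup>2" unfolding id by (simp add: norm_mult power_mult_distrib)
    moreover have "(sinh D)\<^sup>2 \<le> (m \<sigma> x y)\<^sup>2 - m \<sigma> x x * m \<sigma> y y"
    proof -
      have "1 * 1 \<le> m \<sigma> x x * m \<sigma> y y" using q by (intro mult_mono) auto
      then show ?thesis unfolding sd(3) using m_rcs[OF ch' h(1,2)] by (simp add: divide_le_eq mult_le_cancel_left1)
    qed
    ultimately have "(sinh D)\<^sup>2 \<le> (cmod (\<alpha> y * z - \<alpha> x * z'))\<^sup>2" by linarith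
    then have "sinh D \<le> cmod (\<alpha> y * z - \<alpha> x * z')" by (rule power2_le_imp_le) simp
    also have "\<alpha> y * z - \<alpha> x * z' = \<alpha> y * (z - z') + of_real (\<alpha> y - \<alpha> x) * z'" by (simp add: algebra_simps)
    also have "cmod \<dots> \<le> \<alpha> y * cmod (z - z') + \<bar>\<alpha> y - \<alpha> x\<bar> * cmod z'"
      using small[OF h(2,4)] by (intro norm_triangle_le) (simp add: norm_mult del: of_real_diff)
    also have "\<dots> \<le> (1 + \<delta> * M) * cmod (z - z') + (K * cmod (z - z')) * (\<delta> * R)"
    proof (intro add_mono mult_mono)
      define s t where "s = x u - y u" and "t = x w - y w"
      have zz: "z - z' = of_real (s * sinh a) + of_real (t * sinh b) * cis \<theta>"
        by (simp add: z_def z'_def cm_eq s_def t_def algebra_simps)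
      have "\<bar>Im (z - z')\<bar> \<le> cmod (z - z')" by (rule abs_Im_le_cmod)
      then have t: "\<bar>t\<bar> * (sinh b * sin \<theta>) \<le> cmod (z - z')" unfolding zz using sh st by (simp add: abs_mult mult_ac)
      \<comment> \<open>Rotating by \<open>-\<theta>\<close> makes the second edge real, so the
        imaginary part isolates the coordinate of \<open>u\<close>.\<close>
      have "\<bar>Im ((z - z') * cis (- \<theta>))\<bar> \<le> cmod (z - z')" using abs_Im_le_cmod[of "(z - z') * cis (- \<theta>)"] by (simp add: norm_mult)
      moreover have rot: "(z - z') * cis (- \<theta>) = of_real (s * sinh a) * cis (- \<theta>) + of_real (t * sinh b)"
        unfolding zz by (simp add: algebra_simps cis_mult)
      ultimately have "\<bar>- (s * (sinh a * sin \<theta>))\<bar> \<le> cmod (z - z')" unfolding rot by (simp add: mult_ac)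
      then have s: "\<bar>s\<bar> * (sinh a * sin \<theta>) \<le> cmod (z - z')" using sh st by (simp add: abs_mult)
      have "\<bar>s\<bar> \<le> cmod (z - z') / (sinh a * sin \<theta>)" (is "_ \<le> ?A") and "\<bar>t\<bar> \<le> cmod (z - z') / (sinh b * sin \<theta>)" (is "_ \<le> ?B")
        using s t sh st by (simp_all add: pos_le_divide_eq)
      then have "\<bar>s\<bar> * (cosh a - 1) \<le> cmod (z - z') / (sinh a * sin \<theta>) * (cosh a - 1)"
         "\<bar>t\<bar> * (cosh b - 1) \<le> cmod (z - z') / (sinh b * sin \<theta>) * (cosh b - 1)" using mult_right_mono[of "\<bar>s\<bar>" ?A "cosh a - 1"] mult_right_mono[of "\<bar>t\<bar>" ?B "cosh b - 1"] ch1 by linarith+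
      moreover have "\<alpha> y - \<alpha> x = - (s * (cosh a - 1) + t * (cosh b - 1))" by (simp add: \<alpha>_def s_def t_def algebra_simps)
      moreover have "\<bar>s * (cosh a - 1) + t * (cosh b - 1)\<bar> \<le> \<bar>s\<bar> * (cosh a - 1) + \<bar>t\<bar> * (cosh b - 1)"
        using abs_triangle_ineq[of "s * (cosh a - 1)" "t * (cosh b - 1)"] ch1 by (simp add: abs_mult)
      ultimately have "\<bar>\<alpha> y - \<alpha> x\<bar> \<le> cmod (z - z') / (sinh a * sin \<theta>) * (cosh a - 1) + cmod (z - z') / (sinh b * sin \<theta>) * (cosh b - 1)"
        by (simp only: abs_minus_cancel)
      also have "\<dots> = K * cmod (z - z')" by (simp add: K_def algebra_simps)
      finally show "\<bar>\<alpha> y - \<alpha> x\<bar> \<le> K * cmod (z - z')" .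
    qed (use small[OF h(2,4)] K0 R0 \<delta> in \<open>auto simp: z'_def\<close>)
    also have "\<dots> = (1 + (\<delta> * M + K * (\<delta> * R))) * cmod (z - z')" by (simp add: algebra_simps)
    finally have "sinh D \<le> (1 + e) * cmod (z - z')" unfolding \<delta>e .
    then show ?thesis using sinh_ge_arg[OF sd(1)] unfolding D_def z_def z'_def by linarith
  qed
  have low: "(1 - e) * cmod (cm x) \<le> hyp_sd N p \<sigma> (pt v) x" if h: "x \<in> pts \<sigma>" "1 - x v < \<delta>" for x
  proof -
    define D where "D = hyp_sd N p \<sigma> (pt v) x"
    have pv: "pt v \<in> pts \<sigma>" by (rule pt_pts[OF ch' mem])
    note sd = sd_cosh[OF ch' pv h(1), folded D_def, unfolded m_pt(2)[OF ch' mem]]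
    have q: "1 \<le> m \<sigma> x x" using m_ge[OF ch'] h by auto
    have cm0: "cm (pt v) = 0" unfolding cm_eq using dist by (simp add: pt_other)
    have mx: "m \<sigma> x x = (\<alpha> x)\<^sup>2 - (cmod (cm x))\<^sup>2"
      unfolding CD(5)[OF h(1,1)] \<alpha>_def by (auto simp: power2_eq_square cmod_power2[unfolded power2_eq_square])
    have mv: "m \<sigma> (pt v) x = \<alpha> x" unfolding CD(5)[OF pv h(1)] cm0 \<alpha>_def using dist by (simp add: pt_other)
    have sinhD: "sinh D = cmod (cm x) / sqrt (m \<sigma> x x)"
    proof -
      have "(sinh D)\<^sup>2 = (cmod (cm x))\<^sup>2 / m \<sigma> x x" unfolding sd(3) mv by (simp add: mx)
      then have "sqrt ((sinh D)\<^sup>2) = sqrt ((cmod (cm x))\<^sup>2 / m \<sigma> x x)" by simp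
      then show ?thesis using sd(1) by (simp add: real_sqrt_divide)
    qed
    have "sinh D \<le> D * cosh D" by (rule sinh_le_arg_cosh[OF sd(1)])
    then have "cmod (cm x) / sqrt (m \<sigma> x x) \<le> D * \<alpha> x / sqrt (m \<sigma> x x)" unfolding sinhD sd(2) mv by simp
    then have D: "cmod (cm x) \<le> D * \<alpha> x" using q by (simp add: divide_le_cancel)
    show ?thesis
    proof (cases "e < 1")
      case True
      have "\<alpha> x \<le> 1 + e" using small[OF h] \<delta>e K0 R0 \<delta> by (smt (verit) mult_nonneg_nonneg)
      then have "(1 - e) * \<alpha> x \<le> (1 - e) * (1 + e)" using True by (intro mult_left_mono) auto
      also have "\<dots> \<le> 1" by (simp add: algebra_simps)
      finally have le1: "(1 - e) * \<alpha> x \<le> 1" .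
      have "(1 - e) * cmod (cm x) \<le> (1 - e) * (D * \<alpha> x)" using D True by (intro mult_left_mono) auto
      also have "\<dots> = D * ((1 - e) * \<alpha> x)" by simp
      also have "\<dots> \<le> D * 1" using le1 sd(1) by (intro mult_left_mono) auto
      finally show ?thesis by (simp add: D_def)
    next
      case False
      then have "(1 - e) * cmod (cm x) \<le> 0" by (simp add: mult_nonpos_nonneg)
      then show ?thesis using sd(1) unfolding D_def by linarith
    qed
  qed
  show ?thesis using \<delta> up low by blast
qed

lemma hyp_angled:
  assumes cat: "CATm1 (real_pts V le) (len_metric V le (hyp_sd N p))"
  shows "angled_metric V le (hyp_sd N p) angH sinh edgeH"
proof -
  interpret S: simplex_metric V le "hyp_sd N p" by (rule hyp_simplex_metric)
  interpret G: geodesic_simplex_metric V le "hyp_sd N p"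
    by unfold_locales (use cat fan_CATm1[OF cat] in \<open>auto simp: CATm1_def\<close>)
  show ?thesis
  proof unfold_locales
    fix v u w assume c: "is_chain V le {v, u, w}" "u \<noteq> w" "u \<noteq> v" "w \<noteq> v"
    note CD = corner_data[OF c]
    note ang = angH_cos[OF CD(1,2,4)]
    show "G.corner (\<lambda>z. sinh (elen (hyp_sd N p) v z)) v u w (angH (elen (hyp_sd N p) v u) (elen (hyp_sd N p) v w) (elen (hyp_sd N p) u w))"
      unfolding G.corner_def
    proof (intro conjI allI impI)
      fix e :: real assume e: "0 < e"
      from corner_estimate[OF c e] obtain \<delta> where \<delta>: "\<delta> > 0" and H: "\<forall>x\<in>pts {v, u, w}. \<forall>y\<in>pts {v, u, w}. 1 - x v < \<delta> \<longrightarrow> 1 - y v < \<delta> \<longrightarrow>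
         hyp_sd N p {v, u, w} x y \<le> (1 + e) * cmod (corner_map (\<lambda>z. sinh (elen (hyp_sd N p) v z)) u w (angH (elen (hyp_sd N p) v u) (elen (hyp_sd N p) v w) (elen (hyp_sd N p) u w)) x -
            corner_map (\<lambda>z. sinh (elen (hyp_sd N p) v z)) u w (angH (elen (hyp_sd N p) v u) (elen (hyp_sd N p) v w) (elen (hyp_sd N p) u w)) y) \<and>
         (1 - e) * cmod (corner_map (\<lambda>z. sinh (elen (hyp_sd N p) v z)) u w (angH (elen (hyp_sd N p) v u) (elen (hyp_sd N p) v w) (elen (hyp_sd N p) u w)) x) \<le> hyp_sd N p {v, u, w} (pt v) x"
        by blast
      show "\<exists>\<delta>>0. \<forall>x\<in>real_pts V le. \<forall>y\<in>real_pts V le. supp x \<subseteq> {v, u, w} \<and> supp y \<subseteq> {v, u, w} \<and> 1 - x v < \<delta> \<and> 1 - y v < \<delta> \<longrightarrow>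
         hyp_sd N p {v, u, w} x y \<le> (1 + e) * cmod (corner_map (\<lambda>z. sinh (elen (hyp_sd N p) v z)) u w (angH (elen (hyp_sd N p) v u) (elen (hyp_sd N p) v w) (elen (hyp_sd N p) u w)) x -
            corner_map (\<lambda>z. sinh (elen (hyp_sd N p) v z)) u w (angH (elen (hyp_sd N p) v u) (elen (hyp_sd N p) v w) (elen (hyp_sd N p) u w)) y) \<and>
         (1 - e) * cmod (corner_map (\<lambda>z. sinh (elen (hyp_sd N p) v z)) u w (angH (elen (hyp_sd N p) v u) (elen (hyp_sd N p) v w) (elen (hyp_sd N p) u w)) x) \<le> hyp_sd N p {v, u, w} (pt v) x"
      proof (rule exI[of _ \<delta>], intro conjI ballI impI \<delta>)
        fix x y assume xy: "x \<in> real_pts V le" "y \<in> real_pts V le"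
          "supp x \<subseteq> {v, u, w} \<and> supp y \<subseteq> {v, u, w} \<and> 1 - x v < \<delta> \<and> 1 - y v < \<delta>"
        then have P: "x \<in> pts {v, u, w}" "y \<in> pts {v, u, w}" "1 - x v < \<delta>" "1 - y v < \<delta>" by (simp_all add: pts_def)
        note h = mp[OF mp[OF bspec[OF bspec[OF H P(1)] P(2)] P(3)] P(4)]
        show "hyp_sd N p {v, u, w} x y \<le> (1 + e) * cmod (corner_map (\<lambda>z. sinh (elen (hyp_sd N p) v z)) u w (angH (elen (hyp_sd N p) v u) (elen (hyp_sd N p) v w) (elen (hyp_sd N p) u w)) x -
            corner_map (\<lambda>z. sinh (elen (hyp_sd N p) v z)) u w (angH (elen (hyp_sd N p) v u) (elen (hyp_sd N p) v w) (elen (hyp_sd N p) u w)) y)"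
          by (rule conjunct1[OF h])
        show "(1 - e) * cmod (corner_map (\<lambda>z. sinh (elen (hyp_sd N p) v z)) u w (angH (elen (hyp_sd N p) v u) (elen (hyp_sd N p) v w) (elen (hyp_sd N p) u w)) x) \<le> hyp_sd N p {v, u, w} (pt v) x"
          by (rule conjunct2[OF h])
      qed
    qed (use ang CD in auto)
    have com: "elen (hyp_sd N p) u v = elen (hyp_sd N p) v u" "elen (hyp_sd N p) w v = elen (hyp_sd N p) v w" "elen (hyp_sd N p) w u = elen (hyp_sd N p) u w"
      by (rule elen_commute, rule S.chain_subset[OF c(1)]; auto)+
    show "angH (elen (hyp_sd N p) v u) (elen (hyp_sd N p) v w) (elen (hyp_sd N p) u w) +
       angH (elen (hyp_sd N p) u v) (elen (hyp_sd N p) u w) (elen (hyp_sd N p) v w) +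
       angH (elen (hyp_sd N p) w v) (elen (hyp_sd N p) w u) (elen (hyp_sd N p) v u) \<le> pi"
      unfolding com using angH_sum[OF CD(1-4)] by simp
  next
    fix a \<epsilon> :: real assume "0 < a" "0 < \<epsilon>"
    then show "\<exists>s0>0. \<forall>s. 0 < s \<and> s \<le> s0 \<longrightarrow> edgeH s a < \<epsilon>" using edgeH_small by blast
  qed (use angH_commute elen_commute edge_eq elen_pos edgeH_inj in auto)
qed

end

section \<open>The complex \<open>K\<^sub>4\<close>\<close>

abbreviation vx :: "outel \<Rightarrow> hyp \<Rightarrow> mmv" where "vx \<equiv> mm_class 4"
abbreviation chain4 :: "mmv set \<Rightarrow> bool" where "chain4 \<equiv> is_chain (MMV 4) (MMle 4)"

text \<open>All members of a class have the same hypertree, so the choice is immaterial.\<close>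

definition rank :: "mmv \<Rightarrow> nat" where "rank u = (SOME k. \<exists>\<alpha> \<Theta>. (\<alpha>, \<Theta>) \<in> u \<and> k = card \<Theta>)"

lemma rank_vx: assumes "\<alpha> \<in> Out0 4" shows "rank (vx \<alpha> \<Theta>) = card \<Theta>"
  unfolding rank_def
proof (rule some_equality)
  show "\<exists>\<beta> \<Lambda>. (\<beta>, \<Lambda>) \<in> vx \<alpha> \<Theta> \<and> card \<Theta> = card \<Lambda>" using mm_class_self[OF assms] by blast
qed (auto simp: mem_mm_class)

lemma vx_eqD: assumes "\<alpha> \<in> Out0 4" "vx \<alpha> \<Theta> = vx \<beta> \<Lambda>" shows "\<Theta> = \<Lambda> \<and> carried_by 4 \<Theta> \<beta> \<alpha>"
  using mm_class_self[OF assms(1), of \<Theta>] unfolding assms(2) mem_mm_class by simp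

lemma vx_ne: "\<alpha> \<in> Out0 4 \<Longrightarrow> \<Theta> \<noteq> \<Lambda> \<Longrightarrow> vx \<alpha> \<Theta> \<noteq> vx \<beta> \<Lambda>"
  using vx_eqD by blast

lemma MMV_cases: assumes "u \<in> MMV n" obtains \<alpha> \<Theta> where "\<alpha> \<in> Out0 n" "\<Theta> \<in> HT n" "u = mm_class n \<alpha> \<Theta>"
  using assms unfolding MMV_def by blast

lemma rank_range: assumes "u \<in> MMV 4" shows "rank u \<in> {1..3}"
proof -
  obtain \<alpha> \<Theta> where u: "\<alpha> \<in> Out0 4" "\<Theta> \<in> HT 4" "u = vx \<alpha> \<Theta>" using assms by (rule MMV_cases)
  have "(1::nat) \<in> {1..4}" "(2::nat) \<in> {1..4}" by auto
  then obtain w where w: "walk \<Theta> (fst w) (snd w)" "hd (fst w) = 1" "last (fst w) = 2"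
    using u(2) unfolding HT_def by blast
  have "\<Theta> \<noteq> {}"
  proof
    assume "\<Theta> = {}"
    then have "snd w = []" using w(1) by (simp add: walk_def)
    then have "length (fst w) = 1" using w(1) by (auto simp: walk_def Suc_leI le_antisym length_greater_0_conv)
    then obtain a where "fst w = [a]" by (auto simp: length_Suc_conv)
    then show False using w by simp
  qed
  then have "1 \<le> card \<Theta>" using finite_HT_mem[OF u(2)] by (simp add: Suc_leI card_gt_0_iff)
  moreover have "card \<Theta> < 4" using card_HT_less[OF u(2)] by simp
  ultimately show ?thesis using rank_vx[OF u(1)] u(3) by simp
qed

lemma MMle_rank: assumes "MMle 4 u v" shows "u = v \<or> rank u < rank v"
proof -
  obtain \<alpha> \<Theta> \<Lambda> where h: "\<alpha> \<in> Out0 4" "\<Theta> \<in> HT 4" "\<Lambda> \<in> HT 4" "ht_le \<Theta> \<Lambda>" "u = vx \<alpha> \<Theta>" "v = vx \<alpha> \<Lambda>"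
    using MMle_D[OF assms] by blast
  show ?thesis using ht_le_card[OF h(4) finite_HT_mem[OF h(3)]] h rank_vx[OF h(1)] by auto
qed

lemma chain_rank_inj: assumes "chain4 \<sigma>" shows "inj_on rank \<sigma>"
proof (rule inj_onI)
  fix u v assume h: "u \<in> \<sigma>" "v \<in> \<sigma>" "rank u = rank v"
  then have "MMle 4 u v \<or> MMle 4 v u" using assms unfolding is_chain_def by blast
  then show "u = v" using MMle_rank[of u v] MMle_rank[of v u] h(3) by auto
qed

text \<open>The number of hyperedges is injective on a chain and takes only the values 1, 2, 3; this
  is the two-dimensionality of the complex.\<close>

lemma triangle_maximal:
  assumes "chain4 \<sigma>" "{u, v, w} \<subseteq> \<sigma>" "u \<noteq> v" "u \<noteq> w" "v \<noteq> w" shows "\<sigma> = {u, v, w}"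
proof -
  have fs: "finite \<sigma>" "\<sigma> \<subseteq> MMV 4" using assms(1) by (auto simp: is_chain_def)
  have "rank ` \<sigma> \<subseteq> {1..3}" using rank_range fs(2) by blast
  then have "card \<sigma> \<le> card {1..3::nat}" by (rule card_inj_on_le[OF chain_rank_inj[OF assms(1)]]) simp
  then have "card \<sigma> \<le> card {u, v, w}" using assms(3-5) by simp
  then show ?thesis using card_seteq[OF fs(1) assms(2)] by simp
qed

text \<open>A comparable vertex shares a representative with the given one, and these
  representatives range over a coset of the carried group; only finitely many hypertrees can go with
  them.\<close>

lemma locally_finite:
  assumes "\<alpha> \<in> Out0 4" "finite (carried_out 4 \<Theta>)"
  shows "finite {\<sigma>. chain4 \<sigma> \<and> vx \<alpha> \<Theta> \<in> \<sigma>}"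
proof -
  let ?N = "(\<lambda>(\<gamma>, \<Lambda>). vx (out_mult 4 \<alpha> \<gamma>) \<Lambda>) ` (carried_out 4 \<Theta> \<times> HT 4)"
  have nb: "vx \<beta> \<Lambda> \<in> ?N" if "\<beta> \<in> Out0 4" "vx \<alpha> \<Theta> = vx \<beta> \<Theta>'" "\<Lambda> \<in> HT 4" for \<beta> \<Theta>' \<Lambda>
  proof -
    have "carried_by 4 \<Theta> \<alpha> \<beta>" using vx_eqD[OF that(1) that(2)[symmetric]] by auto
    then obtain \<gamma> where "\<gamma> \<in> carried_out 4 \<Theta>" "\<beta> = out_mult 4 \<alpha> \<gamma>" unfolding carried_by_def by blast
    then show ?thesis using that(3) by (auto intro!: image_eqI[of _ _ "(\<gamma>, \<Lambda>)"])
  qed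
  have "w \<in> ?N" if "chain4 \<sigma>" "vx \<alpha> \<Theta> \<in> \<sigma>" "w \<in> \<sigma>" for \<sigma> w
  proof -
    have "MMle 4 (vx \<alpha> \<Theta>) w \<or> MMle 4 w (vx \<alpha> \<Theta>)" using that unfolding is_chain_def by blast
    then show ?thesis
    proof
      assume "MMle 4 (vx \<alpha> \<Theta>) w" from MMle_D[OF this] show ?thesis using nb by blast
    next
      assume "MMle 4 w (vx \<alpha> \<Theta>)" from MMle_D[OF this] show ?thesis using nb by blast
    qed
  qed
  then have "{\<sigma>. chain4 \<sigma> \<and> vx \<alpha> \<Theta> \<in> \<sigma>} \<subseteq> Pow ?N" by blast
  moreover have "finite ?N" using assms(2) finite_HT by simp
  ultimately show ?thesis by (rule finite_subset[OF _ iffD2[OF finite_Pow_iff]])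
qed

lemma mm_act_class: assumes "\<phi> \<in> Out0 n" "\<alpha> \<in> Out0 n"
  shows "mm_act n \<phi> (mm_class n \<alpha> \<Theta>) = mm_class n (out_mult n \<phi> \<alpha>) \<Theta>"
proof -
  have "(\<beta>, \<Lambda>) \<in> mm_act n \<phi> (mm_class n \<alpha> \<Theta>) \<longleftrightarrow> (\<beta>, \<Lambda>) \<in> mm_class n (out_mult n \<phi> \<alpha>) \<Theta>" for \<beta> \<Lambda>
  proof
    assume "(\<beta>, \<Lambda>) \<in> mm_act n \<phi> (mm_class n \<alpha> \<Theta>)"
    then obtain \<delta> where "\<beta> = out_mult n \<phi> \<delta>" "(\<delta>, \<Lambda>) \<in> mm_class n \<alpha> \<Theta>" by (auto simp: mm_act_def)
    then show "(\<beta>, \<Lambda>) \<in> mm_class n (out_mult n \<phi> \<alpha>) \<Theta>"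
      using assms out_mult_Out0 carried_out_mult_left unfolding mem_mm_class by blast
  next
    assume "(\<beta>, \<Lambda>) \<in> mm_class n (out_mult n \<phi> \<alpha>) \<Theta>"
    then obtain \<gamma> where g: "\<Lambda> = \<Theta>" "\<gamma> \<in> carried_out n \<Theta>" "\<beta> = out_mult n (out_mult n \<phi> \<alpha>) \<gamma>"
      unfolding mem_mm_class carried_by_def by blast
    have "\<beta> = out_mult n \<phi> (out_mult n \<alpha> \<gamma>)" using g assms carried_Out0 by (simp add: out_mult_assoc)
    moreover have "(out_mult n \<alpha> \<gamma>, \<Theta>) \<in> mm_class n \<alpha> \<Theta>"
      using g assms carried_Out0 out_mult_Out0 unfolding mem_mm_class carried_by_def by blast
    ultimately show "(\<beta>, \<Lambda>) \<in> mm_act n \<phi> (mm_class n \<alpha> \<Theta>)" using g(1) unfolding mm_act_def by blast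
  qed
  then show ?thesis by (intro set_eqI) (simp add: split_paired_all)
qed

lemma push_pt_pt: "push_pt f (pt v) = pt (f v)"
proof
  fix w
  have "{u \<in> {v}. f u = w} = (if w = f v then {v} else {})" by auto
  then show "push_pt f (pt v) w = pt (f v) w" unfolding push_pt_def supp_pt by (simp add: pt_def)
qed

lemma push_pt_seg: assumes "v \<noteq> u" "f v \<noteq> f u" "0 < s" "s < 1"
  shows "push_pt f (seg v u s) = seg (f v) (f u) s"
proof
  fix w
  have S: "supp (seg v u s) = {v, u}" using assms by (auto simp: supp_def seg_def)
  consider "w = f v" | "w = f u" | "w \<noteq> f v" "w \<noteq> f u" by blast
  then show "push_pt f (seg v u s) w = seg (f v) (f u) s w"
  proof cases
    case 1 then have "{z \<in> {v, u}. f z = w} = {v}" using assms by auto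
    then show ?thesis using 1 assms unfolding push_pt_def S by (simp add: seg_def)
  next
    case 2 then have "{z \<in> {v, u}. f z = w} = {u}" using assms by auto
    then show ?thesis using 2 assms unfolding push_pt_def S by (simp add: seg_def)
  next
    case 3 then have E: "{z \<in> {v, u}. f z = w} = {}" by auto
    show ?thesis unfolding push_pt_def S E using 3 by (simp add: seg_def)
  qed
qed

text \<open>Near a vertex the length metric restricts to the simplex metric on each edge, so it determines the edge lengths.\<close>

context angled_metric
begin

lemma seg_X: assumes "is_chain V le {v, u}" "v \<noteq> u" "0 \<le> s" "s \<le> 1" shows "seg v u s \<in> X"
proof -
  have "seg v u s v \<noteq> 0 \<or> seg v u s u \<noteq> 0" using assms by (auto simp: seg_def)
  then have ne: "supp (seg v u s) \<noteq> {}" by (auto simp: supp_def)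
  have "sum (seg v u s) (supp (seg v u s)) = sum (seg v u s) {v, u}"
    by (rule sum.mono_neutral_left) (auto simp: supp_def seg_def)
  also have "\<dots> = 1" using assms(2) by (simp add: seg_def)
  finally show ?thesis unfolding real_pts_def
    using assms chain_subset[OF assms(1) supp_seg ne] by (auto simp: seg_def)
qed

lemma d_edge:
  assumes "fin v" "is_chain V le {v, u}" "v \<noteq> u"
  shows "\<exists>s0>0. \<forall>s. 0 < s \<and> s \<le> s0 \<and> s \<le> 1 \<longrightarrow> d (pt v) (seg v u s) = edge s (elen sd v u)"
proof -
  have cv: "is_chain V le {v}" by (rule chain_subset[OF assms(2)]) auto
  from d_vertex_ge[OF assms(1) cv] obtain \<epsilon> where e: "\<epsilon> > 0" and E: "\<forall>y\<in>X. \<forall>\<sigma>. is_chain V le \<sigma> \<longrightarrow> v \<in> \<sigma> \<longrightarrow> supp y \<subseteq> \<sigma> \<longrightarrow> min \<epsilon> (sd \<sigma> (pt v) y) \<le> d (pt v) y"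
    by (elim exE conjE)
  obtain s0 where s0: "s0 > 0" "\<forall>s. 0 < s \<and> s \<le> s0 \<longrightarrow> edge s (elen sd v u) < \<epsilon>"
    using edge_small[OF elen_pos[OF assms(2,3)] e] by blast
  have "d (pt v) (seg v u s) = edge s (elen sd v u)" if "0 < s" "s \<le> s0" "s \<le> 1" for s
  proof -
    have sX: "seg v u s \<in> X" using seg_X[OF assms(2,3)] that by simp
    have eq: "sd {v, u} (pt v) (seg v u s) = edge s (elen sd v u)" using edge[OF assms(2,3)] that by simp
    have "min \<epsilon> (sd {v, u} (pt v) (seg v u s)) \<le> d (pt v) (seg v u s)"
      using mp[OF mp[OF mp[OF spec[OF bspec[OF E sX], of "{v, u}"] assms(2)]] supp_seg] by simp
    moreover have "edge s (elen sd v u) < \<epsilon>" using s0 that by blast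
    moreover have "d (pt v) (seg v u s) \<le> sd {v, u} (pt v) (seg v u s)"
      by (rule d_le_sd[OF assms(2) pt_X[OF cv] sX _ supp_seg]) simp
    ultimately show ?thesis using eq by simp
  qed
  then show ?thesis using s0(1) by blast
qed

end

section \<open>Incident hypertrees, invariant edge lengths and angles\<close>

definition tame :: "hyp \<Rightarrow> bool" where "tame \<Theta> \<longleftrightarrow> \<Theta> \<in> HT 4 \<and> finite (carried_out 4 \<Theta>)"

definition incident :: "hyp \<Rightarrow> hyp \<Rightarrow> bool" where
  "incident \<Theta> \<Lambda> \<longleftrightarrow> tame \<Theta> \<and> tame \<Lambda> \<and> \<Theta> \<noteq> \<Lambda> \<and> (ht_le \<Theta> \<Lambda> \<or> ht_le \<Lambda> \<Theta>)"

lemma incident_sym: "incident \<Theta> \<Lambda> \<Longrightarrow> incident \<Lambda> \<Theta>" by (auto simp: incident_def)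

lemma incident_MMle: "incident \<Theta> \<Lambda> \<Longrightarrow> \<alpha> \<in> Out0 4 \<Longrightarrow> MMle 4 (vx \<alpha> \<Theta>) (vx \<alpha> \<Lambda>) \<or> MMle 4 (vx \<alpha> \<Lambda>) (vx \<alpha> \<Theta>)"
  unfolding incident_def tame_def using MMle_I by blast

lemma MMle_refl: "tame \<Theta> \<Longrightarrow> \<alpha> \<in> Out0 4 \<Longrightarrow> MMle 4 (vx \<alpha> \<Theta>) (vx \<alpha> \<Theta>)"
  unfolding tame_def by (rule MMle_I) (auto simp: ht_le_def)

lemma vx_MMV: "tame \<Theta> \<Longrightarrow> \<alpha> \<in> Out0 4 \<Longrightarrow> vx \<alpha> \<Theta> \<in> MMV 4"
  unfolding tame_def using mm_class_MMV by blast

lemma incident_tame: "incident \<Theta> \<Lambda> \<Longrightarrow> tame \<Theta>" "incident \<Theta> \<Lambda> \<Longrightarrow> tame \<Lambda>" by (auto simp: incident_def)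

lemma chain_edge: assumes "incident \<Theta> \<Lambda>" "\<alpha> \<in> Out0 4" shows "chain4 {vx \<alpha> \<Theta>, vx \<alpha> \<Lambda>}"
  using incident_MMle[OF assms] MMle_refl[OF incident_tame(1)[OF assms(1)] assms(2)] MMle_refl[OF incident_tame(2)[OF assms(1)] assms(2)]
    vx_MMV[OF incident_tame(1)[OF assms(1)] assms(2)] vx_MMV[OF incident_tame(2)[OF assms(1)] assms(2)]
  by (auto simp: is_chain_def)

lemma chain_triangle: assumes "incident \<Theta> \<Lambda>" "incident \<Theta> \<Xi>" "incident \<Lambda> \<Xi>" "\<alpha> \<in> Out0 4" shows "chain4 {vx \<alpha> \<Theta>, vx \<alpha> \<Lambda>, vx \<alpha> \<Xi>}"
  using chain_edge[OF assms(1,4)] chain_edge[OF assms(2,4)] chain_edge[OF assms(3,4)]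
  by (auto simp: is_chain_def)

locale mm_metric = angled_metric "MMV 4" "MMle 4" sd ang speed edge for sd ang speed edge +
  assumes equivariant: "mm_equivariant 4 (len_metric (MMV 4) (MMle 4) sd)"
begin

definition edge_length :: "hyp \<Rightarrow> hyp \<Rightarrow> real" where "edge_length \<Theta> \<Lambda> = elen sd (vx (out_one 4) \<Theta>) (vx (out_one 4) \<Lambda>)"
definition angle :: "hyp \<Rightarrow> hyp \<Rightarrow> hyp \<Rightarrow> real" where "angle \<Theta> \<Lambda> \<Xi> = ang (edge_length \<Theta> \<Lambda>) (edge_length \<Theta> \<Xi>) (edge_length \<Lambda> \<Xi>)"

lemma fin_vx: "tame \<Theta> \<Longrightarrow> \<alpha> \<in> Out0 4 \<Longrightarrow> fin (vx \<alpha> \<Theta>)"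
  unfolding fin_def tame_def by (intro locally_finite) auto

lemma edge_length_commute: "incident \<Theta> \<Lambda> \<Longrightarrow> edge_length \<Theta> \<Lambda> = edge_length \<Lambda> \<Theta>"
  unfolding edge_length_def by (rule elen_commute[OF chain_edge[OF _ out_one_Out0]])

lemma angle_commute: "incident \<Lambda> \<Xi> \<Longrightarrow> angle \<Theta> \<Lambda> \<Xi> = angle \<Theta> \<Xi> \<Lambda>"
  unfolding angle_def using edge_length_commute[of \<Lambda> \<Xi>] by (simp add: ang_commute)

lemma elen_invariant: assumes "incident \<Theta> \<Lambda>" "\<phi> \<in> Out0 4" shows "elen sd (vx \<phi> \<Theta>) (vx \<phi> \<Lambda>) = edge_length \<Theta> \<Lambda>"
proof -
  let ?v = "vx (out_one 4) \<Theta>" and ?u = "vx (out_one 4) \<Lambda>"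
  have ne: "\<Theta> \<noteq> \<Lambda>" and g: "tame \<Theta>" using assms(1) by (auto simp: incident_def)
  note c1 = chain_edge[OF assms(1) out_one_Out0] and c2 = chain_edge[OF assms]
  note n1 = vx_ne[OF out_one_Out0 ne, of "out_one 4"] and n2 = vx_ne[OF assms(2) ne, of \<phi>]
  obtain s1 where s1: "s1 > 0" "\<forall>s. 0 < s \<and> s \<le> s1 \<and> s \<le> 1 \<longrightarrow> d (pt ?v) (seg ?v ?u s) = edge s (elen sd ?v ?u)"
    using d_edge[OF fin_vx[OF g out_one_Out0] c1 n1] by (elim exE conjE)
  obtain s2 where s2: "s2 > 0" "\<forall>s. 0 < s \<and> s \<le> s2 \<and> s \<le> 1 \<longrightarrow> d (pt (vx \<phi> \<Theta>)) (seg (vx \<phi> \<Theta>) (vx \<phi> \<Lambda>) s) = edge s (elen sd (vx \<phi> \<Theta>) (vx \<phi> \<Lambda>))"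
    using d_edge[OF fin_vx[OF g assms(2)] c2 n2] by (elim exE conjE)
  \<comment> \<open>Small enough for the local comparison at both vertices, and strictly below 1 so
    that both coordinates of the segment point are nonzero and the action moves them
    separately.\<close>
  define s where "s = min (1/2) (min s1 s2)"
  have s: "0 < s" "s < 1" "s \<le> s1" "s \<le> s2" using s1(1) s2(1) by (auto simp: s_def)
  have act: "mm_act 4 \<phi> ?v = vx \<phi> \<Theta>" "mm_act 4 \<phi> ?u = vx \<phi> \<Lambda>"
    using mm_act_class[OF assms(2) out_one_Out0] assms(2) by (simp_all add: out_mult_one)
  have "is_chain (MMV 4) (MMle 4) {?v}" by (rule chain_subset[OF c1]) auto
  then have X: "pt ?v \<in> X" "seg ?v ?u s \<in> X" using pt_X seg_X[OF c1 n1] s by auto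
  have "d (push_pt (mm_act 4 \<phi>) (pt ?v)) (push_pt (mm_act 4 \<phi>) (seg ?v ?u s)) = d (pt ?v) (seg ?v ?u s)"
    using equivariant X assms(2) unfolding mm_equivariant_def by blast
  moreover have "push_pt (mm_act 4 \<phi>) (pt ?v) = pt (vx \<phi> \<Theta>)" by (simp add: push_pt_pt act)
  moreover have "push_pt (mm_act 4 \<phi>) (seg ?v ?u s) = seg (vx \<phi> \<Theta>) (vx \<phi> \<Lambda>) s"
    using push_pt_seg[OF n1, of "mm_act 4 \<phi>" s] n2 s by (simp add: act)
  ultimately have "edge s (elen sd (vx \<phi> \<Theta>) (vx \<phi> \<Lambda>)) = edge s (elen sd ?v ?u)"
    using s1(2) s2(2) s by simp
  then show ?thesis unfolding edge_length_def
    by (rule edge_inj[rotated 4]) (use s elen_pos[OF c1 n1] elen_pos[OF c2 n2] in auto)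
qed

lemma angle_sum: assumes "incident \<Theta> \<Lambda>" "incident \<Theta> \<Xi>" "incident \<Lambda> \<Xi>" shows "angle \<Theta> \<Lambda> \<Xi> + angle \<Lambda> \<Theta> \<Xi> + angle \<Xi> \<Theta> \<Lambda> \<le> pi"
proof -
  have ne: "\<Theta> \<noteq> \<Lambda>" "\<Theta> \<noteq> \<Xi>" "\<Lambda> \<noteq> \<Xi>" using assms by (auto simp: incident_def)
  note vn = vx_ne[OF out_one_Out0, of _ _ "out_one 4"]
  have "ang (edge_length \<Theta> \<Lambda>) (edge_length \<Theta> \<Xi>) (edge_length \<Lambda> \<Xi>) + ang (edge_length \<Lambda> \<Theta>) (edge_length \<Lambda> \<Xi>) (edge_length \<Theta> \<Xi>) + ang (edge_length \<Xi> \<Theta>) (edge_length \<Xi> \<Lambda>) (edge_length \<Theta> \<Lambda>) \<le> pi"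
    unfolding edge_length_def by (rule ang_sum[OF chain_triangle[OF assms out_one_Out0]]) (use ne vn in metis)+
  then show ?thesis unfolding angle_def .
qed

lemma corner_vx: assumes "incident \<Theta> \<Lambda>" "incident \<Theta> \<Xi>" "incident \<Lambda> \<Xi>" "\<alpha> \<in> Out0 4"
  shows "corner (\<lambda>z. speed (elen sd (vx \<alpha> \<Theta>) z)) (vx \<alpha> \<Theta>) (vx \<alpha> \<Lambda>) (vx \<alpha> \<Xi>) (angle \<Theta> \<Lambda> \<Xi>)"
proof -
  have ne: "\<Lambda> \<noteq> \<Theta>" "\<Xi> \<noteq> \<Theta>" "\<Lambda> \<noteq> \<Xi>" using assms by (auto simp: incident_def)
  note vn = vx_ne[OF assms(4), of _ _ \<alpha>]
  show ?thesis
    using corner_ang[OF chain_triangle[OF assms] vn[OF ne(3)] vn[OF ne(1)] vn[OF ne(2)]]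
    unfolding elen_invariant[OF assms(1,4)] elen_invariant[OF assms(2,4)] elen_invariant[OF assms(3,4)] angle_def .
qed

text \<open>The link of \<open>[1, \<Theta>]\<close> contains the cycle with vertices \<open>[\<beta> i, \<Lambda> i] = [\<beta> (i - 1), \<Lambda> i]\<close>.\<close>

lemma link_cycle_vx:
  fixes \<Lambda> :: "nat \<Rightarrow> hyp" and \<beta> :: "nat \<Rightarrow> outel"
  assumes m: "0 < m" and \<beta>0: "\<beta> 0 = out_one 4" and \<beta>m: "\<beta> m = out_one 4" and \<Lambda>m: "\<Lambda> m = \<Lambda> 0"
    and flag: "\<And>i. i < m \<Longrightarrow> incident \<Theta> (\<Lambda> i) \<and> incident (\<Lambda> i) (\<Lambda> (Suc i))"
    and \<beta>O: "\<And>i. i < m \<Longrightarrow> \<beta> i \<in> Out0 4"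
    and \<beta>\<Theta>: "\<And>i. i < m \<Longrightarrow> \<beta> i \<in> carried_out 4 \<Theta>"
    and \<beta>\<Lambda>: "\<And>i. i < m \<Longrightarrow> carried_by 4 (\<Lambda> (Suc i)) (\<beta> i) (\<beta> (Suc i))"
    and uniq: "\<And>i. 0 < i \<Longrightarrow> i < m \<Longrightarrow> {\<Lambda> 0, \<Lambda> 1} = {\<Lambda> i, \<Lambda> (Suc i)} \<Longrightarrow>
       \<Lambda> 0 = T0 \<and> (if \<Lambda> i = T0 then \<beta> i else \<beta> (Suc i)) \<noteq> out_one 4"
  shows "2 * pi \<le> (\<Sum>i<m. angle \<Theta> (\<Lambda> i) (\<Lambda> (Suc i)))"
proof -
  define us where "us i = vx (\<beta> i) (\<Lambda> i)" for i
  let ?v = "vx (out_one 4) \<Theta>"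
  have O: "\<beta> i \<in> Out0 4" if "i \<le> m" for i using \<beta>O[of i] \<beta>m out_one_Out0 that by (cases "i = m") auto
  have flag': "incident \<Theta> (\<Lambda> (Suc i))" if "i < m" for i
    using flag[of "Suc i"] flag[OF m] \<Lambda>m that by (cases "Suc i = m") auto
  have v: "?v = vx (\<beta> i) \<Theta>" if "i < m" for i
  proof (rule mm_class_eqI[OF out_one_Out0])
    show "carried_by 4 \<Theta> (out_one 4) (\<beta> i)" unfolding carried_by_def
      using \<beta>\<Theta>[OF that] O[of i] that by (intro bexI[of _ "\<beta> i"]) (auto simp: out_mult_one)
  qed (use O that in auto)
  have S: "us (Suc i) = vx (\<beta> i) (\<Lambda> (Suc i))" if "i < m" for i
    unfolding us_def by (rule mm_class_eqI[symmetric]) (use O \<beta>\<Lambda> that in auto)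
  have ne: "us i \<noteq> us (Suc i) \<and> us i \<noteq> ?v \<and> us (Suc i) \<noteq> ?v" if "i < m" for i
  proof -
    have "\<Lambda> i \<noteq> \<Lambda> (Suc i)" "\<Lambda> i \<noteq> \<Theta>" "\<Lambda> (Suc i) \<noteq> \<Theta>" using flag[OF that] flag'[OF that] by (auto simp: incident_def)
    moreover have "\<beta> i \<in> Out0 4" "\<beta> (Suc i) \<in> Out0 4" using O that by auto
    ultimately show ?thesis unfolding us_def using vx_ne by blast
  qed
  have us0: "us 0 = vx (out_one 4) (\<Lambda> 0)" "us 1 = vx (out_one 4) (\<Lambda> 1)"
    using S[OF m] \<beta>0 by (simp_all add: us_def)
  show ?thesis
  proof (rule link_cycle[where us = us and v = ?v and tg = "\<lambda>z. speed (elen sd ?v z)"])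
    fix i assume i: "i < m"
    show "chain4 {?v, us i, us (Suc i)} \<and> us i \<noteq> us (Suc i) \<and> us i \<noteq> ?v \<and> us (Suc i) \<noteq> ?v"
      using chain_triangle[OF _ flag'[OF i] _ O, of "\<Lambda> i"] flag[OF i] i ne[OF i] v[OF i] S[OF i] by (simp add: us_def)
    show "corner (\<lambda>z. speed (elen sd ?v z)) ?v (us i) (us (Suc i)) (angle \<Theta> (\<Lambda> i) (\<Lambda> (Suc i)))"
      using corner_vx[OF _ flag'[OF i] _ O, of "\<Lambda> i"] flag[OF i] i v[OF i] S[OF i] by (simp add: us_def)
  next
    fix i assume i: "0 < i" "i < m"
    show "\<not> {us 0, us 1} \<subseteq> {us i, us (Suc i)}"
    proof
      assume "{us 0, us 1} \<subseteq> {us i, us (Suc i)}"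
      moreover have "us 0 \<noteq> us 1" using ne[OF m] by simp
      ultimately have "us i = us 0 \<and> us (Suc i) = us 1 \<or> us i = us 1 \<and> us (Suc i) = us 0" by auto
      moreover have eq: "\<Lambda> i = \<Lambda> j \<and> carried_by 4 (\<Lambda> j) (out_one 4) (\<beta> i)" if "us i = us j" "us j = vx (out_one 4) (\<Lambda> j)" "i \<le> m" for i j
        using vx_eqD[OF O[OF that(3)], of "\<Lambda> i" "out_one 4" "\<Lambda> j"] that(1,2) unfolding us_def[of i] by metis
      ultimately have K: "\<Lambda> i = \<Lambda> 0 \<and> carried_by 4 (\<Lambda> 0) (out_one 4) (\<beta> i) \<and> \<Lambda> (Suc i) = \<Lambda> 1 \<or>
          \<Lambda> i = \<Lambda> 1 \<and> \<Lambda> (Suc i) = \<Lambda> 0 \<and> carried_by 4 (\<Lambda> 0) (out_one 4) (\<beta> (Suc i))"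
        using eq[OF _ us0(1), of i] eq[OF _ us0(2), of "Suc i"] eq[OF _ us0(2), of i] eq[OF _ us0(1), of "Suc i"] i by linarith
      then have "{\<Lambda> 0, \<Lambda> 1} = {\<Lambda> i, \<Lambda> (Suc i)}" by (elim disjE conjE) (simp_all only: insert_commute)
      note U = uniq[OF i this]
      \<comment> \<open>The group carried by \<open>T0\<close> is trivial, so a vertex over
        \<open>T0\<close> can coincide with the initial one only if its group element is the
        identity, which \<open>uniq\<close> excludes.\<close>
      have T: "\<beta> j = out_one 4" if "carried_by 4 T0 (out_one 4) (\<beta> j)" for j
        using that out_one_Out0 unfolding carried_by_def carried_T0 by (auto simp: out_mult_one)
      have "\<Lambda> 1 \<noteq> \<Lambda> 0" using flag[OF m] by (auto simp: incident_def)
      then show False using K U T[of i] T[of "Suc i"] by metis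
    qed
  next
    fix \<sigma> assume "chain4 \<sigma>" "{?v, us 0, us 1} \<subseteq> \<sigma>"
    then show "\<sigma> = {?v, us 0, us 1}" by (rule triangle_maximal) (use ne[OF m] in auto)
  next
    have "tame \<Theta>" "tame (\<Lambda> 0)" "tame (\<Lambda> 1)" using flag[OF m] flag'[OF m] by (auto simp: incident_def)
    then show "fin ?v" "fin (us 0)" "fin (us 1)" unfolding us0 using fin_vx out_one_Out0 by auto
  qed (use m \<beta>m \<beta>0 \<Lambda>m in \<open>auto simp: us_def\<close>)
qed

end

section \<open>Angle inequalities in the links\<close>

lemma tame_T0: "tame T0" unfolding tame_def by (simp add: T0_HT carried_T0)
lemma tame_RT: "quad i j k l \<Longrightarrow> tame (RT k l)" unfolding tame_def using RT_HT finite_carried_RT by blast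
lemma tame_ST: "quad i j k l \<Longrightarrow> tame (ST k)" unfolding tame_def using ST_HT finite_carried_ST by blast
lemma tame_PT: "quad i j k l \<Longrightarrow> tame (PT i j k l)" unfolding tame_def using PT_HT finite_carried_PT by blast

lemma incidentI: "tame \<Theta> \<Longrightarrow> tame \<Lambda> \<Longrightarrow> card \<Theta> \<noteq> card \<Lambda> \<Longrightarrow> ht_le \<Theta> \<Lambda> \<Longrightarrow> incident \<Theta> \<Lambda> \<and> incident \<Lambda> \<Theta>"
  unfolding incident_def by auto

lemma incident_T0_RT: assumes q: "quad i j k l" shows "incident T0 (RT k l) \<and> incident (RT k l) T0"
  by (rule incidentI) (simp_all add: tame_T0 tame_RT[OF q] card_T0 card_RT[OF q] T0_le_RT[OF q])
lemma incident_RT_ST: assumes q: "quad i j k l" shows "incident (RT k l) (ST k) \<and> incident (ST k) (RT k l)"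
  by (rule incidentI) (simp_all add: tame_ST[OF q] tame_RT[OF q] card_ST[OF q] card_RT[OF q] RT_le_ST[OF q])
lemma incident_RT_PT: assumes q: "quad i j k l" shows "incident (RT k l) (PT i j k l) \<and> incident (PT i j k l) (RT k l)"
  by (rule incidentI) (simp_all add: tame_PT[OF q] tame_RT[OF q] card_PT[OF q] card_RT[OF q] RT_le_PT[OF q])
lemma incident_RT_PT': assumes q: "quad i j k l" shows "incident (RT j i) (PT i j k l) \<and> incident (PT i j k l) (RT j i)"
  using incident_RT_PT[OF quad_perm(2)[OF q]] PT_rev by metis
lemma incident_T0_ST: assumes q: "quad i j k l" shows "incident T0 (ST k) \<and> incident (ST k) T0"
  by (rule incidentI) (simp_all add: tame_ST[OF q] tame_T0 card_ST[OF q] card_T0 ht_le_trans[OF T0_le_RT[OF q] RT_le_ST[OF q]])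
lemma incident_T0_PT: assumes q: "quad i j k l" shows "incident T0 (PT i j k l) \<and> incident (PT i j k l) T0"
  by (rule incidentI) (simp_all add: tame_PT[OF q] tame_T0 card_PT[OF q] card_T0 ht_le_trans[OF T0_le_RT[OF q] RT_le_PT[OF q]])

lemma RT_inject: assumes "k \<in> {1..4}" "l \<in> {1..4}" "k' \<in> {1..4}" "l' \<in> {1..4}" "k \<noteq> l" "k' \<noteq> l'" "RT k l = RT k' l'"
  shows "k = k' \<and> l = l'"
proof -
  have c: "card ({1..4} - {m}) = 3" if "m \<in> {1..4}" for m :: nat using that by simp
  have p: "card {k, l} = 2" "card {k', l'} = 2" using assms by auto
  have 1: "{k, l} \<in> {{1..4} - {l'}, {k', l'}}" "{1..4} - {l} \<in> {{1..4} - {l'}, {k', l'}}"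
    unfolding RT_def[of k' l', symmetric] assms(7)[symmetric] by (simp_all add: RT_def)
  have kl: "{k, l} = {k', l'}" using 1(1) p c[OF assms(4)] by (metis insert_iff numeral_eq_iff semiring_norm(89) empty_iff)
  have "{1..4} - {l} = {1..4} - {l'}" using 1(2) p c[OF assms(2)] by (metis insert_iff numeral_eq_iff semiring_norm(89) empty_iff)
  then have "l = l'" using assms(2,4) by blast
  then show ?thesis using kl assms(5,6) by (auto simp: doubleton_eq_iff)
qed

lemma quad_distinct: "quad i j k l \<Longrightarrow> i \<noteq> j \<and> i \<noteq> k \<and> i \<noteq> l \<and> j \<noteq> k \<and> j \<noteq> l \<and> k \<noteq> l"
  by (simp add: quad_def)

lemma all4: "(\<forall>i<4. P i) \<longleftrightarrow> P 0 \<and> P 1 \<and> P 2 \<and> P (3::nat)"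
  by (simp add: eval_nat_numeral All_less_Suc conj_ac)
lemma all6: "(\<forall>i<6. P i) \<longleftrightarrow> P 0 \<and> P 1 \<and> P 2 \<and> P (3::nat) \<and> P 4 \<and> P 5"
  by (simp add: eval_nat_numeral All_less_Suc conj_ac)
lemma all8: "(\<forall>i<8. P i) \<longleftrightarrow> P 0 \<and> P 1 \<and> P 2 \<and> P (3::nat) \<and> P 4 \<and> P 5 \<and> P 6 \<and> P 7"
  by (simp add: eval_nat_numeral All_less_Suc conj_ac)
lemma sum4: "(\<Sum>i<4. f i) = f 0 + f 1 + f 2 + f (3::nat)"
  by (simp add: eval_nat_numeral)
lemma sum6: "(\<Sum>i<6. f i) = f 0 + f 1 + f 2 + f (3::nat) + f 4 + f 5"
  by (simp add: eval_nat_numeral)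
lemma sum8: "(\<Sum>i<8. f i) = f 0 + f 1 + f 2 + f (3::nat) + f 4 + f 5 + f 6 + f 7"
  by (simp add: eval_nat_numeral)

lemma carried_by_gen: "\<gamma> \<in> carried_out 4 \<Theta> \<Longrightarrow> carried_by 4 \<Theta> \<alpha> (out_mult 4 \<alpha> \<gamma>)"
  unfolding carried_by_def by blast

lemma carried_by_eq: "\<gamma> \<in> carried_out 4 \<Theta> \<Longrightarrow> \<beta> = out_mult 4 \<alpha> \<gamma> \<Longrightarrow> carried_by 4 \<Theta> \<alpha> \<beta>"
  unfolding carried_by_def by blast

context mm_metric
begin

text \<open>Cycles are given as explicit lists of hypertrees and group elements, so that their side
  conditions become finite conjunctions.\<close>

lemma link_list:
  assumes "0 < m" "bs ! 0 = out_one 4" "bs ! m = out_one 4" "Ls ! m = Ls ! 0"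
    "\<forall>i<m. incident \<Theta> (Ls ! i)" "\<forall>i<m. incident (Ls ! i) (Ls ! Suc i)" "\<forall>i<m. bs ! i \<in> carried_out 4 \<Theta>"
    "\<forall>i<m. carried_by 4 (Ls ! Suc i) (bs ! i) (bs ! Suc i)"
    "\<forall>i<m. 0 < i \<longrightarrow> {Ls ! 0, Ls ! 1} = {Ls ! i, Ls ! Suc i} \<longrightarrow> Ls ! 0 = T0 \<and> (if Ls ! i = T0 then bs ! i else bs ! Suc i) \<noteq> out_one 4"
  shows "2 * pi \<le> (\<Sum>i<m. angle \<Theta> (Ls ! i) (Ls ! Suc i))"
proof (rule link_cycle_vx[where \<beta> = "(!) bs"])
  fix i assume i: "i < m"
  show "bs ! i \<in> carried_out 4 \<Theta>" using assms(7) i by blast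
  then show "bs ! i \<in> Out0 4" by (rule carried_Out0)
  show "incident \<Theta> (Ls ! i) \<and> incident (Ls ! i) (Ls ! Suc i)" using assms(5,6) i by blast
  show "carried_by 4 (Ls ! Suc i) (bs ! i) (bs ! Suc i)" using assms(8) i by blast
  assume "0 < i" "{Ls ! 0, Ls ! 1} = {Ls ! i, Ls ! Suc i}"
  then show "Ls ! 0 = T0 \<and> (if Ls ! i = T0 then bs ! i else bs ! Suc i) \<noteq> out_one 4" using assms(9) i by blast
qed (use assms in auto)

text \<open>Around \<open>RT k l\<close> there are two vertices over \<open>T0\<close>, belonging to
  1 and to \<open>xx k l\<close>. A hypertree above it that carries \<open>xx k l\<close> gives a
  vertex adjacent to both, so two such hypertrees span a quadrilateral in which each angle occurs
  twice.\<close>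

lemma link_R:
  assumes q: "quad i j k l" and T: "incident (RT k l) T" "incident T0 T" "xx k l \<in> carried_out 4 T"
    and T': "incident (RT k l) T'" "incident T0 T'" "xx k l \<in> carried_out 4 T'" and ne: "T \<noteq> T'"
  shows "pi \<le> angle (RT k l) T0 T + angle (RT k l) T0 T'"
proof -
  let ?x = "xx k l" and ?e = "out_one 4"
  have T0ne: "T \<noteq> T0" "T' \<noteq> T0" using T T' by (auto simp: incident_def)
  have "2 * pi \<le> (\<Sum>i<4. angle (RT k l) ([T0, T, T0, T', T0] ! i) ([T0, T, T0, T', T0] ! Suc i))"
  proof (rule link_list[where bs = "[?e, ?x, ?x, ?e, ?e]"])
    show "\<forall>i<4. incident (RT k l) ([T0, T, T0, T', T0] ! i)" using T T' incident_T0_RT[OF q] by (simp add: all4)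
    show "\<forall>i<4. incident ([T0, T, T0, T', T0] ! i) ([T0, T, T0, T', T0] ! Suc i)" using T T' incident_sym[OF T(2)] incident_sym[OF T'(2)] by (simp add: all4)
    show "\<forall>i<4. [?e, ?x, ?x, ?e, ?e] ! i \<in> carried_out 4 (RT k l)" using carried_one xx_carried(1)[OF q] by (simp add: all4)
    have c: "carried_by 4 T ?e ?x" "carried_by 4 T' ?x ?e"
      using carried_by_eq[OF T(3), of ?x ?e] carried_by_eq[OF T'(3), of ?e ?x] xx_square[OF q] xx_Out0[OF q] by (simp_all add: out_mult_one)
    then show "\<forall>i<4. carried_by 4 ([T0, T, T0, T', T0] ! Suc i) ([?e, ?x, ?x, ?e, ?e] ! i) ([?e, ?x, ?x, ?e, ?e] ! Suc i)"
      using carried_by_refl[OF xx_Out0[OF q]] carried_by_refl[OF out_one_Out0] by (simp add: all4)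
    show "\<forall>i<4. 0 < i \<longrightarrow> {[T0, T, T0, T', T0] ! 0, [T0, T, T0, T', T0] ! 1} = {[T0, T, T0, T', T0] ! i, [T0, T, T0, T', T0] ! Suc i} \<longrightarrow>
       [T0, T, T0, T', T0] ! 0 = T0 \<and> (if [T0, T, T0, T', T0] ! i = T0 then [?e, ?x, ?x, ?e, ?e] ! i else [?e, ?x, ?x, ?e, ?e] ! Suc i) \<noteq> ?e"
      using ne T0ne xx_nontrivial[OF q] by (simp add: all4 doubleton_eq_iff)
  qed simp_all
  then show ?thesis using angle_commute[OF T(2), of "RT k l"] angle_commute[OF T'(2), of "RT k l"] by (simp add: sum4)
qed

text \<open>The four vertices over \<open>T0\<close> belong to the Klein four-group of the path.
  Cosets of its two generators provide the vertices between them, closing up to an octagon in which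
  both angles occur four times.\<close>

lemma link_P: assumes q: "quad i j k l"
  shows "pi \<le> 2 * (angle (PT i j k l) T0 (RT k l) + angle (PT i j k l) T0 (RT j i))"
proof -
  let ?P = "PT i j k l" and ?x = "xx j i" and ?y = "xx k l" and ?e = "out_one 4" and ?X = "RT j i" and ?Y = "RT k l"
  let ?xy = "out_mult 4 ?x ?y"
  note q2 = quad_perm(2)[OF q]
  let ?Ls = "[T0, ?X, T0, ?Y, T0, ?X, T0, ?Y, T0]" and ?bs = "[?e, ?x, ?x, ?xy, ?xy, ?y, ?y, ?e, ?e]"
  have O: "?x \<in> Out0 4" "?y \<in> Out0 4" "?xy \<in> Out0 4" using xx_Out0[OF q] xx_Out0[OF q2] out_mult_Out0 by auto
  have XY: "?X \<noteq> ?Y" using RT_inject[of j i k l] quad_in[OF q] quad_distinct[OF q] by auto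
  have Xne: "?X \<noteq> T0" "?Y \<noteq> T0" using incident_T0_RT[OF q2] incident_T0_RT[OF q] by (auto simp: incident_def)
  have xP: "?x \<in> carried_out 4 ?P" "?y \<in> carried_out 4 ?P" using xx_carried(3)[OF q] xx_carried(3)[OF q2] PT_rev[of i j k l] by auto
  have yx: "out_mult 4 ?xy ?x = ?y" 
    using xx_commute[OF q] xx_square[OF q2] O by (simp add: out_mult_assoc[symmetric] out_mult_one) (simp add: out_mult_assoc out_mult_one)
  have "2 * pi \<le> (\<Sum>i<8. angle ?P (?Ls ! i) (?Ls ! Suc i))"
  proof (rule link_list[where bs = ?bs])
    show "\<forall>i<8. incident ?P (?Ls ! i)" using incident_T0_PT[OF q] incident_RT_PT[OF q] incident_RT_PT'[OF q] by (simp add: all8)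
    show "\<forall>i<8. incident (?Ls ! i) (?Ls ! Suc i)" using incident_T0_RT[OF q] incident_T0_RT[OF q2] by (simp add: all8)
    show "\<forall>i<8. ?bs ! i \<in> carried_out 4 ?P" using carried_one xP carried_mult[OF xP] by (simp add: all8)
    have "carried_by 4 ?X ?e ?x" "carried_by 4 ?Y ?x ?xy" "carried_by 4 ?X ?xy ?y" "carried_by 4 ?Y ?y ?e"
      using carried_by_gen[OF xx_carried(1)[OF q2], of ?e] carried_by_gen[OF xx_carried(1)[OF q], of ?x]
        carried_by_gen[OF xx_carried(1)[OF q2], of ?xy] carried_by_gen[OF xx_carried(1)[OF q], of ?y]
        O yx xx_square[OF q] by (simp_all add: out_mult_one)
    then show "\<forall>i<8. carried_by 4 (?Ls ! Suc i) (?bs ! i) (?bs ! Suc i)"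
      using carried_by_refl[OF O(1)] carried_by_refl[OF O(2)] carried_by_refl[OF O(3)] carried_by_refl[OF out_one_Out0] by (simp add: all8)
    show "\<forall>i<8. 0 < i \<longrightarrow> {?Ls ! 0, ?Ls ! 1} = {?Ls ! i, ?Ls ! Suc i} \<longrightarrow> ?Ls ! 0 = T0 \<and> (if ?Ls ! i = T0 then ?bs ! i else ?bs ! Suc i) \<noteq> ?e"
      using XY Xne xx_nontrivial[OF q] xx_nontrivial[OF q2] xx_xx_nontrivial[OF q] by (simp add: all8 doubleton_eq_iff)
  qed simp_all
  then show ?thesis using angle_commute[OF conjunct1[OF incident_T0_RT[OF q]], of ?P] angle_commute[OF conjunct1[OF incident_T0_RT[OF q2]], of ?P] by (simp add: sum8)
qed

text \<open>Around a star four vertices over \<open>T0\<close> belong to a Klein four-group, and any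
  two are joined through a coset of one of the three involutions. The hexagon is a triangle in this
  subdivided complete graph, through 1, \<open>xx k i\<close> and \<open>xx k l\<close>.\<close>

lemma link_S: assumes q: "quad i j k l"
  shows "pi \<le> angle (ST k) T0 (RT k i) + angle (ST k) T0 (RT k j) + angle (ST k) T0 (RT k l)"
proof -
  let ?S = "ST k" and ?x = "xx k i" and ?y = "xx k j" and ?z = "xx k l" and ?e = "out_one 4"
  let ?X = "RT k i" and ?Y = "RT k j" and ?Z = "RT k l"
  have qi: "quad j l k i" "quad i l k j" by (rule quad_rearrange[OF q]; auto)+
  let ?Ls = "[T0, ?X, T0, ?Y, T0, ?Z, T0]" and ?bs = "[?e, ?x, ?x, ?z, ?z, ?e, ?e]"
  have O: "?x \<in> Out0 4" "?y \<in> Out0 4" "?z \<in> Out0 4" using xx_Out0[OF q] xx_Out0[OF qi(1)] xx_Out0[OF qi(2)] by auto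
  have XY: "?X \<noteq> ?Y" "?X \<noteq> ?Z" using RT_inject[of k i k j] RT_inject[of k i k l] quad_in[OF q] quad_distinct[OF q] by auto
  have Xne: "?X \<noteq> T0" "?Y \<noteq> T0" "?Z \<noteq> T0" using incident_T0_RT[OF qi(1)] incident_T0_RT[OF qi(2)] incident_T0_RT[OF q] by (auto simp: incident_def)
  have "2 * pi \<le> (\<Sum>i<6. angle ?S (?Ls ! i) (?Ls ! Suc i))"
  proof (rule link_list[where bs = ?bs])
    show "\<forall>i<6. incident ?S (?Ls ! i)" using incident_T0_ST[OF q] incident_RT_ST[OF q] incident_RT_ST[OF qi(1)] incident_RT_ST[OF qi(2)] by (simp add: all6)
    show "\<forall>i<6. incident (?Ls ! i) (?Ls ! Suc i)" using incident_T0_RT[OF q] incident_T0_RT[OF qi(1)] incident_T0_RT[OF qi(2)] by (simp add: all6)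
    show "\<forall>i<6. ?bs ! i \<in> carried_out 4 ?S" using carried_one xx_carried(2)[OF q] xx_carried(2)[OF qi(1)] by (simp add: all6)
    have "carried_by 4 ?X ?e ?x" "carried_by 4 ?Y ?x ?z" "carried_by 4 ?Z ?z ?e"
      using carried_by_gen[OF xx_carried(1)[OF qi(1)], of ?e] carried_by_gen[OF xx_carried(1)[OF qi(2)], of ?x]
        carried_by_gen[OF xx_carried(1)[OF q], of ?z] O xx_xx[OF q] xx_square[OF q] by (simp_all add: out_mult_one)
    then show "\<forall>i<6. carried_by 4 (?Ls ! Suc i) (?bs ! i) (?bs ! Suc i)"
      using carried_by_refl[OF O(1)] carried_by_refl[OF O(3)] carried_by_refl[OF out_one_Out0] by (simp add: all6)
    show "\<forall>i<6. 0 < i \<longrightarrow> {?Ls ! 0, ?Ls ! 1} = {?Ls ! i, ?Ls ! Suc i} \<longrightarrow> ?Ls ! 0 = T0 \<and> (if ?Ls ! i = T0 then ?bs ! i else ?bs ! Suc i) \<noteq> ?e"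
      using XY Xne xx_nontrivial[OF qi(1)] by (simp add: all6 doubleton_eq_iff)
  qed simp_all
  then show ?thesis using angle_commute[OF conjunct1[OF incident_T0_RT[OF q]], of ?S] angle_commute[OF conjunct1[OF incident_T0_RT[OF qi(1)]], of ?S]
     angle_commute[OF conjunct1[OF incident_T0_RT[OF qi(2)]], of ?S] by (simp add: sum6)
qed

end

section \<open>Sums over labellings and the link of the one-hyperedge vertex\<close>

lemma RT_neq_PT: assumes "quad i j k l" "quad a b c e" shows "RT k l \<noteq> PT a b c e"
  using card_RT[OF assms(1)] card_PT[OF assms(2)] by auto

lemma RT_neq_ST: assumes "quad i j k l" "quad a b c e" shows "RT k l \<noteq> ST c"
  using card_RT[OF assms(1)] card_ST[OF assms(2)] by auto

lemma RT_neq: assumes "quad i j k l" "quad a b c e" "(k, l) \<noteq> (c, e)" shows "RT k l \<noteq> RT c e"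
  using RT_inject[of k l c e] assms(3) quad_in[OF assms(1)] quad_in[OF assms(2)] quad_distinct[OF assms(1)] quad_distinct[OF assms(2)] by auto

lemma PT_neq_PT: assumes "quad i j k l" "{a, b} \<in> {{i, j}, {j, k}, {k, l}}" "{a, b} \<notin> {{i', j'}, {j', k'}, {k', l'}}" shows "PT i j k l \<noteq> PT i' j' k' l'"
  using assms unfolding PT_def by metis

lemma PT_neq_ST: assumes q: "quad i j k l" "quad a b c e" shows "PT i j k l \<noteq> ST c"
proof
  assume "PT i j k l = ST c"
  moreover have "c \<in> E" if "E \<in> ST c" for E using that by (auto simp: ST_def)
  ultimately have "c \<in> {i, j} \<and> c \<in> {k, l}" unfolding PT_def by blast
  then show False using quad_distinct[OF q(1)] by auto
qed

text \<open>The angle inequalities are summed over all 24 labellings, so that symmetric ones need not be listed; every star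
  triangle is counted twice.\<close>

definition quads :: "(nat \<times> nat \<times> nat \<times> nat) set" where "quads = {(i, j, k, l). quad i j k l}"
definition qsum :: "(nat \<Rightarrow> nat \<Rightarrow> nat \<Rightarrow> nat \<Rightarrow> real) \<Rightarrow> real" where
  "qsum f = (\<Sum>(i, j, k, l)\<in>quads. f i j k l)"

lemma finite_quads: "finite quads"
proof (rule finite_subset)
  show "quads \<subseteq> {1..4} \<times> {1..4} \<times> {1..4} \<times> {1..4}" using quad_in by (auto simp: quads_def simp del: atLeastAtMost_iff)
qed simp

lemma qsum_mono: "(\<And>i j k l. quad i j k l \<Longrightarrow> f i j k l \<le> g i j k l) \<Longrightarrow> qsum f \<le> qsum g"
  unfolding qsum_def by (rule sum_mono) (auto simp: quads_def)

lemma qsum_add: "qsum (\<lambda>i j k l. f i j k l + g i j k l) = qsum f + qsum g"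
  unfolding qsum_def by (simp add: sum.distrib case_prod_unfold)

lemma qsum_cmult: "qsum (\<lambda>i j k l. c * f i j k l) = c * qsum f"
  unfolding qsum_def by (simp add: sum_distrib_left case_prod_unfold)

lemma qsum_const: "qsum (\<lambda>i j k l. c) = c * qsum (\<lambda>i j k l. 1)"
  using qsum_cmult[of c "\<lambda>i j k l. 1"] by simp

lemma qsum_swap:
  "qsum (\<lambda>i j k l. f j i k l) = qsum f" "qsum (\<lambda>i j k l. f i k j l) = qsum f" "qsum (\<lambda>i j k l. f i j l k) = qsum f"
  unfolding qsum_def
  subgoal by (rule sum.reindex_bij_witness[of _ "\<lambda>(i, j, k, l). (j, i, k, l)" "\<lambda>(i, j, k, l). (j, i, k, l)"])
      (clarsimp simp: quads_def, (erule quad_perm)?)+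
  subgoal by (rule sum.reindex_bij_witness[of _ "\<lambda>(i, j, k, l). (i, k, j, l)" "\<lambda>(i, j, k, l). (i, k, j, l)"])
      (clarsimp simp: quads_def, (erule quad_perm)?)+
  subgoal by (rule sum.reindex_bij_witness[of _ "\<lambda>(i, j, k, l). (i, j, l, k)" "\<lambda>(i, j, k, l). (i, j, l, k)"])
      (clarsimp simp: quads_def, (erule quad_perm)?)+
  done

text \<open>These permutations are composed of the adjacent transpositions handled in
  \<open>qsum_swap\<close>.\<close>

lemma qsum_perm:
  "qsum (\<lambda>i j k l. f l k i j) = qsum f" "qsum (\<lambda>i j k l. f k l i j) = qsum f" "qsum (\<lambda>i j k l. f j i l k) = qsum f"
  "qsum (\<lambda>i j k l. f k l j i) = qsum f" "qsum (\<lambda>i j k l. f l k j i) = qsum f" "qsum (\<lambda>i j k l. f l j k i) = qsum f"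
proof -
  have 1: "qsum (\<lambda>i j k l. g k l i j) = qsum g" for g :: "nat \<Rightarrow> nat \<Rightarrow> nat \<Rightarrow> nat \<Rightarrow> real"
    using qsum_swap(2)[of g] qsum_swap(1)[of "\<lambda>i j k l. g i k j l"] qsum_swap(3)[of "\<lambda>i j k l. g j k i l"]
      qsum_swap(2)[of "\<lambda>i j k l. g j l i k"] by simp
  have 2: "qsum (\<lambda>i j k l. g j i l k) = qsum g" for g :: "nat \<Rightarrow> nat \<Rightarrow> nat \<Rightarrow> nat \<Rightarrow> real"
    using qsum_swap(1)[of g] qsum_swap(3)[of "\<lambda>i j k l. g j i k l"] by simp
  show "qsum (\<lambda>i j k l. f l k i j) = qsum f" using 1[of "\<lambda>i j k l. f j i k l"] qsum_swap(1)[of f] by simp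
  show "qsum (\<lambda>i j k l. f k l j i) = qsum f" using 1[of "\<lambda>i j k l. f i j l k"] qsum_swap(3)[of f] by simp
  show 3: "qsum (\<lambda>i j k l. f l k j i) = qsum f" using 1[of "\<lambda>i j k l. f j i l k"] 2[of f] by simp
  show "qsum (\<lambda>i j k l. f l j k i) = qsum f" using qsum_swap(2)[of "\<lambda>i j k l. f l k j i"] 3 by simp
  show "qsum (\<lambda>i j k l. f k l i j) = qsum f" "qsum (\<lambda>i j k l. f j i l k) = qsum f" by (rule 1, rule 2)
qed

lemma qsum_one_pos: "0 < qsum (\<lambda>i j k l. 1)"
proof -
  have "(1, 2, 3, 4) \<in> quads" by (auto simp: quads_def quad_def)
  then have "0 < card quads" using finite_quads card_gt_0_iff by blast
  then show ?thesis by (simp add: qsum_def case_prod_unfold)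
qed

lemma qsum_ge: fixes x :: "nat \<Rightarrow> nat \<Rightarrow> nat \<Rightarrow> nat \<Rightarrow> real"
  assumes "\<And>i j k l. quad i j k l \<Longrightarrow> c \<le> x i j k l" shows "c * qsum (\<lambda>i j k l. 1) \<le> qsum x"
  using qsum_mono[of "\<lambda>i j k l. c" x] assms unfolding qsum_const[of c, symmetric] by simp

context mm_metric
begin

text \<open>The carried group is trivial, so the cycle is one of hypertrees only and all group
  elements are the identity.\<close>

lemma link_T0:
  assumes "0 < m" "length Ls = Suc m" "Ls ! m = Ls ! 0" "\<forall>i<m. incident T0 (Ls ! i)" "\<forall>i<m. incident (Ls ! i) (Ls ! Suc i)"
    "\<forall>i<m. 0 < i \<longrightarrow> {Ls ! 0, Ls ! 1} \<noteq> {Ls ! i, Ls ! Suc i}"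
  shows "2 * pi \<le> (\<Sum>i<m. angle T0 (Ls ! i) (Ls ! Suc i))"
  by (rule link_list[where bs = "replicate (Suc m) (out_one 4)"])
    (use assms carried_one carried_by_refl[OF out_one_Out0] in \<open>simp_all del: replicate_Suc\<close>)

text \<open>The letters a, b, c mark the angle at the vertex with one, two, three hyperedges; P and
  S mark the triangles ending in a path or a star. A path lies in two triangles, told apart by
  reversing the labelling.\<close>

definition aP where "aP i j k l = angle T0 (RT k l) (PT i j k l)"
definition bP where "bP i j k l = angle (RT k l) T0 (PT i j k l)"
definition cP where "cP i j k l = angle (PT i j k l) T0 (RT k l)"
definition aS where "aS k l = angle T0 (RT k l) (ST k)"
definition bS where "bS k l = angle (RT k l) T0 (ST k)"
definition cS where "cS k l = angle (ST k) T0 (RT k l)"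

lemma aP': assumes "quad i j k l" shows "angle T0 (PT i j k l) (RT k l) = aP i j k l" 
    "angle T0 (PT i j k l) (RT j i) = aP l k j i" "angle T0 (RT j i) (PT i j k l) = aP l k j i"
proof -
  show "angle T0 (PT i j k l) (RT k l) = aP i j k l" unfolding aP_def
    by (rule angle_commute) (use incident_RT_PT[OF assms] in simp)
  show 1: "angle T0 (RT j i) (PT i j k l) = aP l k j i" unfolding aP_def PT_rev[of i j k l] ..
  show "angle T0 (PT i j k l) (RT j i) = aP l k j i" unfolding 1[symmetric]
    by (rule angle_commute) (use incident_RT_PT'[OF assms] in simp)
qed

lemma aS': assumes "quad i j k l" shows "angle T0 (ST k) (RT k l) = aS k l"
  unfolding aS_def by (rule angle_commute) (use incident_RT_ST[OF assms] in simp)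

text \<open>The cycle passes through the four paths with end edges \<open>{i, j}\<close> and
  \<open>{k, l}\<close>, and the hypertrees between them are those with a leaf edge
  \<open>{i, j}\<close> or \<open>{k, l}\<close>. A labelling thus determines its octagon through
  its partition into two pairs.\<close>

lemma link_T0_paths: assumes q: "quad i j k l"
  shows "2 * pi \<le> aP j i k l + aP l k i j + aP k l i j + aP j i l k + aP i j l k + aP k l j i + aP l k j i + aP i j k l"
proof -
  let ?Ls = "[RT k l, PT l k i j, RT i j, PT j i l k, RT l k, PT k l j i, RT j i, PT i j k l, RT k l]"
  have q': "quad l k i j" "quad j i l k" "quad k l j i" by (rule quad_rearrange[OF q]; auto)+
  note d = quad_distinct[OF q]
  have n: "RT k l \<noteq> RT i j" "RT k l \<noteq> RT l k" "RT k l \<noteq> RT j i"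
    using RT_neq[OF q q'(1)] RT_neq[OF q q'(2)] RT_neq[OF q q'(3)] d by auto
  have p: "PT l k i j \<noteq> PT i j k l"
    by (rule PT_neq_PT[OF q'(1), of i k]) (use d in \<open>auto simp: doubleton_eq_iff\<close>)
  have r: "RT k l \<noteq> PT l k i j" "RT k l \<noteq> PT j i l k" "RT k l \<noteq> PT k l j i" "RT k l \<noteq> PT i j k l"
    using RT_neq_PT[OF q] q q' by auto
  have "2 * pi \<le> (\<Sum>i<8. angle T0 (?Ls ! i) (?Ls ! Suc i))"
  proof (rule link_T0)
    show "\<forall>i<8. incident T0 (?Ls ! i)"
      using incident_T0_RT[OF q] incident_T0_RT[OF q'(1)] incident_T0_RT[OF q'(2)] incident_T0_RT[OF q'(3)]
        incident_T0_PT[OF q] incident_T0_PT[OF q'(1)] incident_T0_PT[OF q'(2)] incident_T0_PT[OF q'(3)] by (simp add: all8)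
    show "\<forall>i<8. incident (?Ls ! i) (?Ls ! Suc i)"
      using incident_RT_PT[OF q] incident_RT_PT[OF q'(1)] incident_RT_PT[OF q'(2)] incident_RT_PT[OF q'(3)]
        incident_RT_PT'[OF q] incident_RT_PT'[OF q'(1)] incident_RT_PT'[OF q'(2)] incident_RT_PT'[OF q'(3)] by (simp add: all8)
    show "\<forall>i<8. 0 < i \<longrightarrow> {?Ls ! 0, ?Ls ! 1} \<noteq> {?Ls ! i, ?Ls ! Suc i}"
      using n p r by (simp add: all8 doubleton_eq_iff)
  qed simp_all
  then show ?thesis
    using aP'[OF q] aP'[OF q'(1)] aP'[OF q'(2)] aP'[OF q'(3)] by (simp add: sum8 aP_def[symmetric])
qed

text \<open>The cycle uses the stars at \<open>j\<close> and \<open>k\<close> and two paths with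
  middle edge \<open>{j, k}\<close>; half of its angles belong to star triangles. These octagons
  provide the lower bound on the star angles.\<close>

lemma link_T0_stars: assumes q: "quad i j k l"
  shows "2 * pi \<le> aP i j k l + aP l k j i + aS j i + aS j l + aP i k j l + aP l j k i + aS k i + aS k l"
proof -
  let ?Ls = "[RT k l, PT i j k l, RT j i, ST j, RT j l, PT l j k i, RT k i, ST k, RT k l]"
  have q': "quad l k j i" "quad i k j l" "quad l j k i" by (rule quad_rearrange[OF q]; auto)+
  note d = quad_distinct[OF q]
  have n: "RT k l \<noteq> RT j i" "RT k l \<noteq> RT j l" "RT k l \<noteq> RT k i"
    using RT_neq[OF q q'(1)] RT_neq[OF q q'(2)] RT_neq[OF q q'(3)] d by auto
  have p: "PT i j k l \<noteq> ST k" by (rule PT_neq_ST[OF q q])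
  have r: "RT k l \<noteq> PT i j k l" "RT k l \<noteq> PT l j k i" "RT k l \<noteq> ST j" "RT k l \<noteq> ST k"
    using RT_neq_PT[OF q q] RT_neq_PT[OF q q'(3)] RT_neq_ST[OF q q] RT_neq_ST[OF q q'(1)] by auto
  have "2 * pi \<le> (\<Sum>i<8. angle T0 (?Ls ! i) (?Ls ! Suc i))"
  proof (rule link_T0)
    show "\<forall>i<8. incident T0 (?Ls ! i)"
      using incident_T0_RT[OF q] incident_T0_RT[OF q'(1)] incident_T0_RT[OF q'(2)] incident_T0_RT[OF q'(3)]
        incident_T0_PT[OF q] incident_T0_PT[OF q'(3)] incident_T0_ST[OF q] incident_T0_ST[OF q'(1)] by (simp add: all8)
    show "\<forall>i<8. incident (?Ls ! i) (?Ls ! Suc i)"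
      using incident_RT_PT[OF q] incident_RT_PT'[OF q] incident_RT_PT[OF q'(3)] incident_RT_PT'[OF q'(3)]
        incident_RT_ST[OF q] incident_RT_ST[OF q'(1)] incident_RT_ST[OF q'(2)] incident_RT_ST[OF q'(3)] by (simp add: all8)
    show "\<forall>i<8. 0 < i \<longrightarrow> {?Ls ! 0, ?Ls ! 1} \<noteq> {?Ls ! i, ?Ls ! Suc i}"
      using n p r by (simp add: all8 doubleton_eq_iff)
  qed simp_all
  then show ?thesis
    using aP'[OF q] aP'[OF q'(3)] aS'[OF q] aS'[OF q'(1)] aS'[OF q'(2)] aS'[OF q'(3)]
    by (simp add: sum8 aP_def[symmetric] aS_def[symmetric])
qed

lemma no_equivariant_angles: False
proof -
  \<comment> \<open>With 24 labellings this is \<open>24 * pi\<close>; every bound below is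
    expressed as a multiple of it.\<close>
  define N where "N = pi * qsum (\<lambda>i j k l. 1)"
  have N: "0 < N" using qsum_one_pos pi_gt_zero by (simp add: N_def)
  have bound: "c * N \<le> qsum x" if "\<And>i j k l. quad i j k l \<Longrightarrow> c * pi \<le> x i j k l" for c x
    using qsum_ge[of "c * pi" x] that by (simp add: N_def mult_ac)
  have tP: "aP i j k l + bP i j k l + cP i j k l \<le> pi" if q: "quad i j k l" for i j k l
    using angle_sum[OF conjunct1[OF incident_T0_RT[OF q]] conjunct1[OF incident_T0_PT[OF q]] conjunct1[OF incident_RT_PT[OF q]]]
    by (simp add: aP_def bP_def cP_def)
  have tS: "aS k l + bS k l + cS k l \<le> pi" if q: "quad i j k l" for i j k l
    using angle_sum[OF conjunct1[OF incident_T0_RT[OF q]] conjunct1[OF incident_T0_ST[OF q]] conjunct1[OF incident_RT_ST[OF q]]]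
    by (simp add: aS_def bS_def cS_def)
  have R1: "pi \<le> bP i j k l + bP j i k l" if q: "quad i j k l" for i j k l
  proof -
    note q2 = quad_perm(1)[OF q] and d = quad_distinct[OF q]
    have "PT i j k l \<noteq> PT j i k l" by (rule PT_neq_PT[OF q, of j k]) (use d in \<open>auto simp: doubleton_eq_iff\<close>)
    from link_R[OF q conjunct1[OF incident_RT_PT[OF q]] conjunct1[OF incident_T0_PT[OF q]] xx_carried(3)[OF q]
        conjunct1[OF incident_RT_PT[OF q2]] conjunct1[OF incident_T0_PT[OF q2]] xx_carried(3)[OF q2] this]
    show ?thesis by (simp add: bP_def)
  qed
  have R2: "pi \<le> bS k l + bP i j k l" if q: "quad i j k l" for i j k l
    using link_R[OF q conjunct1[OF incident_RT_PT[OF q]] conjunct1[OF incident_T0_PT[OF q]] xx_carried(3)[OF q]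
        conjunct1[OF incident_RT_ST[OF q]] conjunct1[OF incident_T0_ST[OF q]] xx_carried(2)[OF q] PT_neq_ST[OF q q]]
    by (simp add: bP_def bS_def)
  have P: "pi \<le> 2 * (cP i j k l + cP l k j i)" if q: "quad i j k l" for i j k l
    using link_P[OF q] unfolding cP_def by (simp add: PT_rev[of l k j i])
  have S: "pi \<le> cS k i + cS k j + cS k l" if q: "quad i j k l" for i j k l
    using link_S[OF q] unfolding cS_def .
  define sa sb sc where "sa = qsum (\<lambda>i j k l. aS k l)" and "sb = qsum (\<lambda>i j k l. bS k l)" and "sc = qsum (\<lambda>i j k l. cS k l)"
  have "qsum (\<lambda>i j k l. aP i j k l + bP i j k l + cP i j k l) \<le> qsum (\<lambda>i j k l. pi)" by (rule qsum_mono[OF tP])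
  then have 1: "qsum aP + qsum bP + qsum cP \<le> N" unfolding qsum_add qsum_const[of pi] N_def .
  have "qsum (\<lambda>i j k l. aS k l + bS k l + cS k l) \<le> qsum (\<lambda>i j k l. pi)" by (rule qsum_mono[OF tS])
  then have 2: "sa + sb + sc \<le> N" unfolding qsum_add qsum_const[of pi] N_def sa_def sb_def sc_def .
  have "1 * N \<le> qsum (\<lambda>i j k l. bP i j k l + bP j i k l)" by (rule bound) (use R1 in simp)
  then have 3: "N \<le> 2 * qsum bP" unfolding qsum_add qsum_swap(1)[of bP] by simp
  have "1 * N \<le> qsum (\<lambda>i j k l. bS k l + bP i j k l)" by (rule bound) (use R2 in simp)
  then have 4: "N \<le> sb + qsum bP" unfolding qsum_add sb_def by simp
  have "1 * N \<le> qsum (\<lambda>i j k l. 2 * (cP i j k l + cP l k j i))" by (rule bound) (use P in simp)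
  then have 5: "N \<le> 4 * qsum cP" unfolding qsum_cmult qsum_add qsum_perm(5)[of cP] by simp
  \<comment> \<open>A summand depending on an ordered pair of labels has the same total for every
    choice of the two positions.\<close>
  have k: "qsum (\<lambda>i j k l. f k i) = qsum (\<lambda>i j k l. f k l)" "qsum (\<lambda>i j k l. f j i) = qsum (\<lambda>i j k l. f k l)"
    "qsum (\<lambda>i j k l. f j l) = qsum (\<lambda>i j k l. f k l)" "qsum (\<lambda>i j k l. f k j) = qsum (\<lambda>i j k l. f k l)"  for f
    using qsum_perm(6)[of "\<lambda>i j k l. f k l"] qsum_perm(5)[of "\<lambda>i j k l. f k l"] qsum_swap(2)[of "\<lambda>i j k l. f k l"]
      qsum_perm(6)[of "\<lambda>i j k l. f k i"] qsum_swap(1)[of "\<lambda>i j k l. f k i"] by simp_all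
  have "1 * N \<le> qsum (\<lambda>i j k l. cS k i + cS k j + cS k l)" by (rule bound) (use S in simp)
  then have 6: "N \<le> 3 * sc" unfolding qsum_add k(1)[of cS] k(4)[of cS] sc_def by simp
  have "2 * N \<le> qsum (\<lambda>i j k l. aP j i k l + aP l k i j + aP k l i j + aP j i l k + aP i j l k + aP k l j i + aP l k j i + aP i j k l)"
    by (rule bound) (rule link_T0_paths)
  then have 7: "2 * N \<le> 8 * qsum aP" unfolding qsum_add qsum_swap[of aP] qsum_perm[of aP] by simp
  have "2 * N \<le> qsum (\<lambda>i j k l. aP i j k l + aP l k j i + aS j i + aS j l + aP i k j l + aP l j k i + aS k i + aS k l)"
    by (rule bound) (rule link_T0_stars)
  then have 8: "2 * N \<le> 4 * qsum aP + 4 * sa"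
    unfolding qsum_add qsum_swap(2)[of aP] qsum_perm(5,6)[of aP] k(1-3)[of aS] sa_def by simp
  \<comment> \<open>Add 1 and half of 2, since star triangles are counted twice: the total is at
    most \<open>3/2 * N\<close>. From below the b-terms contribute \<open>3/4 * N\<close> by 3 and
    4, the path c-terms \<open>1/4 * N\<close> by 5, the star c-terms \<open>1/6 * N\<close> by 6,
    and the a-terms \<open>3/8 * N\<close> by 7 and 8. These add up to
    \<open>37/24 * N\<close>.\<close>
  show False using 1 2 3 4 5 6 7 8 N by linarith
qed

end

theorem theorem6p10:
  shows "\<not> (\<exists>N p. PE_metric 4 N p \<and>
              mm_equivariant 4 (len_metric (MMV 4) (MMle 4) (eucl_sd N p)) \<and>
              CAT0 (real_pts (MMV 4) (MMle 4)) (len_metric (MMV 4) (MMle 4) (eucl_sd N p)))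
       \<and> \<not> (\<exists>N p. PH_metric 4 N p \<and>
              mm_equivariant 4 (len_metric (MMV 4) (MMle 4) (hyp_sd N p)) \<and>
              CATm1 (real_pts (MMV 4) (MMle 4)) (len_metric (MMV 4) (MMle 4) (hyp_sd N p)))"
proof (intro conjI notI; elim exE conjE)
  fix N p
  assume PE: "PE_metric 4 N p" and E: "mm_equivariant 4 (len_metric (MMV 4) (MMle 4) (eucl_sd N p))"
    and C: "CAT0 (real_pts (MMV 4) (MMle 4)) (len_metric (MMV 4) (MMle 4) (eucl_sd N p))"
  interpret angled_metric "MMV 4" "MMle 4" "eucl_sd N p" angE "\<lambda>a. a" "\<lambda>s a. s * a"
    by (rule eucl_angled) (use PE C in \<open>auto simp: PE_metric_def\<close>)
  interpret mm_metric "eucl_sd N p" angE "\<lambda>a. a" "\<lambda>s a. s * a"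
    by unfold_locales (rule E)
  show False by (rule no_equivariant_angles)
next
  fix N p
  assume PH: "PH_metric 4 N p" and E: "mm_equivariant 4 (len_metric (MMV 4) (MMle 4) (hyp_sd N p))"
    and C: "CATm1 (real_pts (MMV 4) (MMle 4)) (len_metric (MMV 4) (MMle 4) (hyp_sd N p))"
  interpret hyp_complex "MMV 4" "MMle 4" N p
    by unfold_locales (use PH in \<open>auto simp: PH_metric_def\<close>)
  interpret angled_metric "MMV 4" "MMle 4" "hyp_sd N p" angH sinh edgeH
    by (rule hyp_angled[OF C])
  interpret mm_metric "hyp_sd N p" angH sinh edgeH
    by unfold_locales (rule E)
  show False by (rule no_equivariant_angles)
qed

end
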